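(* Consider a sequence, indexed by $N\to\infty$, of completely randomized nearly uniform designs with $\min_qN_q\ge2$, satisfying Conditions 1--4, where the constants $\underline c,\overline c,\sigma_F,c,c',\Delta,\nu,\underline S$ do not depend on $N$. Let $\hat V_{\hat\gamma}=F^\top\mathrm{diag}(N_q^{-1}\hat S(q,q))F$, $W_N=V_{\hat\gamma}^{1/2}\{\mathbb E\hat V_{\hat\gamma}\}^{-1}V_{\hat\gamma}^{1/2}\in\mathbb R^{H\times H}$, $\widehat T=(\hat\gamma-\gamma)^\top\hat V_{\hat\gamma}^{-1}(\hat\gamma-\gamma)$, and let $q_\alpha$ denote the upper $\alpha$-quantile of $\chi^2(H)$, $\alpha\in(0,1)$. (i) If $H$ is fixed and $W_N\to W_\infty$, then $\widehat T$ converges in distribution to the law $\mathcal L$ of $\xi_H^\top W_\infty\xi_H$ with $\xi_H\sim\mathcal N(0,I_H)$; $\mathcal L$ is stochastically dominated by $\chi^2(H)$; and $\lim_{N\to\infty}\mathbb P\{\widehat T\le q_\alpha\}\ge1-\alpha$. (ii) If $H\to\infty$ with $H^{19/4}N^{-1/2}\to0$, then $\{\widehat T-\mathrm{tr}(W_N)\}/\sqrt{2\,\mathrm{tr}(W_N^2)}$ converges in distribution to $\mathcal N(0,1)$, and $\liminf_{N\to\infty}\mathbb P\{\widehat T\le q_\alpha\}\ge1-\alpha$.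
   Context: Randomization model: there are $N$ units and $Q$ treatment levels with prescribed group sizes $N_1,\dots,N_Q\ge1$, $\sum_qN_q=N$; unit $i\in[N]$ has fixed real potential outcomes $Y_i(1),\dots,Y_i(Q)$. Under complete randomization the treatment vector $Z$ is uniform over all vectors in $[Q]^N$ with exactly $N_q$ coordinates equal to $q$; observed outcome $Y_i=Y_i(Z_i)$. Write $\overline Y(q)=N^{-1}\sum_iY_i(q)$, $\overline Y=(\overline Y(q))_q$, $S(q,q')=(N-1)^{-1}\sum_i(Y_i(q)-\overline Y(q))(Y_i(q')-\overline Y(q'))$, $S=(S(q,q'))$, $\hat Y_q=N_q^{-1}\sum_{i:Z_i=q}Y_i$, $\hat Y=(\hat Y_q)_q$, $\hat S(q,q)=(N_q-1)^{-1}\sum_{i:Z_i=q}(Y_i-\hat Y_q)^2$, $V_{\hat Y}=\mathrm{diag}(N_q^{-1}S(q,q))-N^{-1}S$. For fixed $F\in\mathbb R^{Q\times H}$: $\gamma=F^\top\overline Y$, $\hat\gamma=F^\top\hat Y$, $V_{\hat\gamma}=F^\top V_{\hat Y}F$ (nonsingular). $\|F\|_\infty$ is the max absolute entry, $\varrho_{\min}$ the smallest eigenvalue. Nearly uniform design: positive integer $N_0$ and constants $0<\underline c\le\overline c$ with $N_q=c_qN_0$, $\underline c\le c_q\le\overline c$. Condition 1: there exists $\sigma_F\ge1$ with $F^\top\mathrm{diag}(N_q^{-1}S(q,q))F\preceq\sigma_F^2F^\top V_{\hat Y}F$. Condition 2: $\|F\|_\infty\le cQ^{-1}$ and $\varrho_{\min}(F^\top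 F)\ge c'Q^{-1}$ for constants $c,c'>0$. Condition 3: $\max_qN^{-1}\sum_i\{Y_i(q)-\overline Y(q)\}^4\le\Delta^4$. Condition 4: $|Y_i(q)-\overline Y(q)|\le\nu$ for all $i,q$, and $S(q,q)\ge\underline S>0$ for all $q$. *)

theory Defs
  imports "HOL-Probability.Probability" "Jordan_Normal_Form.Matrix" "Jordan_Normal_Form.Char_Poly"
    "Jordan_Normal_Form.Gauss_Jordan_Elimination"
begin

definition psd_mat :: "real mat \<Rightarrow> bool" where
  "psd_mat A \<longleftrightarrow> A \<in> carrier_mat (dim_row A) (dim_row A) \<and>
     (\<forall>v \<in> carrier_vec (dim_row A). scalar_prod v (A *\<^sub>v v) \<ge> 0)"

definition loewner_le :: "real mat \<Rightarrow> real mat \<Rightarrow> bool" where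
  "loewner_le A B \<longleftrightarrow> dim_row A = dim_row B \<and> dim_col A = dim_col B \<and> psd_mat (B - A)"

definition mtrace :: "real mat \<Rightarrow> real" where
  "mtrace A = (\<Sum>i<dim_row A. A $$ (i,i))"

text \<open>Matrix inverse (library Gauss-Jordan inverse); convention: zero matrix if singular.\<close>
definition minv :: "real mat \<Rightarrow> real mat" where
  "minv A = (case mat_inverse A of Some B \<Rightarrow> B | None \<Rightarrow> 0\<^sub>m (dim_row A) (dim_row A))"

definition psd_sqrt :: "real mat \<Rightarrow> real mat" where
  "psd_sqrt A = (THE B. B \<in> carrier_mat (dim_row A) (dim_row A) \<and> transpose_mat B = B
                       \<and> psd_mat B \<and> B * B = A)"

text \<open>Units are 0..<N, treatment levels 0..<Q, group sizes Nq q.\<close>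
definition assignments :: "nat \<Rightarrow> nat \<Rightarrow> (nat \<Rightarrow> nat) \<Rightarrow> (nat \<Rightarrow> nat) set" where
  "assignments N Q Nq = {z \<in> {..<N} \<rightarrow>\<^sub>E {..<Q}. \<forall>q<Q. card {i\<in>{..<N}. z i = q} = Nq q}"

definition CR :: "nat \<Rightarrow> nat \<Rightarrow> (nat \<Rightarrow> nat) \<Rightarrow> (nat \<Rightarrow> nat) pmf" where
  "CR N Q Nq = pmf_of_set (assignments N Q Nq)"

definition Ybar :: "nat \<Rightarrow> (nat \<Rightarrow> nat \<Rightarrow> real) \<Rightarrow> nat \<Rightarrow> real" where
  "Ybar N Y q = (\<Sum>i<N. Y i q) / real N"

definition Scov :: "nat \<Rightarrow> (nat \<Rightarrow> nat \<Rightarrow> real) \<Rightarrow> nat \<Rightarrow> nat \<Rightarrow> real" where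
  "Scov N Y q q' = (\<Sum>i<N. (Y i q - Ybar N Y q) * (Y i q' - Ybar N Y q')) / (real N - 1)"

definition Yhat :: "nat \<Rightarrow> (nat \<Rightarrow> nat) \<Rightarrow> (nat \<Rightarrow> nat \<Rightarrow> real) \<Rightarrow> (nat \<Rightarrow> nat) \<Rightarrow> nat \<Rightarrow> real" where
  "Yhat N Nq Y z q = (\<Sum>i\<in>{i\<in>{..<N}. z i = q}. Y i (z i)) / real (Nq q)"

definition Shat :: "nat \<Rightarrow> (nat \<Rightarrow> nat) \<Rightarrow> (nat \<Rightarrow> nat \<Rightarrow> real) \<Rightarrow> (nat \<Rightarrow> nat) \<Rightarrow> nat \<Rightarrow> real" where
  "Shat N Nq Y z q = (\<Sum>i\<in>{i\<in>{..<N}. z i = q}. (Y i (z i) - Yhat N Nq Y z q)\<^sup>2) / (real (Nq q) - 1)"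

definition Dmat :: "nat \<Rightarrow> nat \<Rightarrow> (nat \<Rightarrow> nat) \<Rightarrow> (nat \<Rightarrow> nat \<Rightarrow> real) \<Rightarrow> real mat" where
  "Dmat N Q Nq Y = mat_diag Q (\<lambda>q. Scov N Y q q / real (Nq q))"

definition VYhat :: "nat \<Rightarrow> nat \<Rightarrow> (nat \<Rightarrow> nat) \<Rightarrow> (nat \<Rightarrow> nat \<Rightarrow> real) \<Rightarrow> real mat" where
  "VYhat N Q Nq Y = Dmat N Q Nq Y - Matrix.mat Q Q (\<lambda>(q,q'). Scov N Y q q' / real N)"

definition gamma :: "nat \<Rightarrow> nat \<Rightarrow> (nat \<Rightarrow> nat \<Rightarrow> real) \<Rightarrow> real mat \<Rightarrow> real vec" where
  "gamma N Q Y F = transpose_mat F *\<^sub>v vec Q (Ybar N Y)"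

definition gammahat :: "nat \<Rightarrow> nat \<Rightarrow> (nat \<Rightarrow> nat) \<Rightarrow> (nat \<Rightarrow> nat \<Rightarrow> real) \<Rightarrow> real mat
    \<Rightarrow> (nat \<Rightarrow> nat) \<Rightarrow> real vec" where
  "gammahat N Q Nq Y F z = transpose_mat F *\<^sub>v vec Q (Yhat N Nq Y z)"

definition Vgamma :: "nat \<Rightarrow> nat \<Rightarrow> (nat \<Rightarrow> nat) \<Rightarrow> (nat \<Rightarrow> nat \<Rightarrow> real) \<Rightarrow> real mat \<Rightarrow> real mat" where
  "Vgamma N Q Nq Y F = transpose_mat F * VYhat N Q Nq Y * F"

definition Vhat :: "nat \<Rightarrow> nat \<Rightarrow> (nat \<Rightarrow> nat) \<Rightarrow> (nat \<Rightarrow> nat \<Rightarrow> real) \<Rightarrow> real mat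
    \<Rightarrow> (nat \<Rightarrow> nat) \<Rightarrow> real mat" where
  "Vhat N Q Nq Y F z = transpose_mat F * mat_diag Q (\<lambda>q. Shat N Nq Y z q / real (Nq q)) * F"

definition EVhat :: "nat \<Rightarrow> nat \<Rightarrow> (nat \<Rightarrow> nat) \<Rightarrow> (nat \<Rightarrow> nat \<Rightarrow> real) \<Rightarrow> real mat \<Rightarrow> real mat" where
  "EVhat N Q Nq Y F = Matrix.mat (dim_col F) (dim_col F)
     (\<lambda>(h,k). measure_pmf.expectation (CR N Q Nq) (\<lambda>z. Vhat N Q Nq Y F z $$ (h,k)))"

definition Wmat :: "nat \<Rightarrow> nat \<Rightarrow> (nat \<Rightarrow> nat) \<Rightarrow> (nat \<Rightarrow> nat \<Rightarrow> real) \<Rightarrow> real mat \<Rightarrow> real mat" where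
  "Wmat N Q Nq Y F = psd_sqrt (Vgamma N Q Nq Y F) * minv (EVhat N Q Nq Y F) * psd_sqrt (Vgamma N Q Nq Y F)"

definition That :: "nat \<Rightarrow> nat \<Rightarrow> (nat \<Rightarrow> nat) \<Rightarrow> (nat \<Rightarrow> nat \<Rightarrow> real) \<Rightarrow> real mat
    \<Rightarrow> (nat \<Rightarrow> nat) \<Rightarrow> real" where
  "That N Q Nq Y F z =
     (let d = gammahat N Q Nq Y F z - gamma N Q Y F in scalar_prod d (minv (Vhat N Q Nq Y F z) *\<^sub>v d))"

definition gauss_quad_law :: "nat \<Rightarrow> real mat \<Rightarrow> real measure" where
  "gauss_quad_law H W = distr (PiM {..<H} (\<lambda>_. std_normal_distribution)) borel
     (\<lambda>\<xi>. \<Sum>i<H. \<Sum>j<H. \<xi> i * W $$ (i,j) * \<xi> j)"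

definition chisq :: "nat \<Rightarrow> real measure" where
  "chisq H = distr (PiM {..<H} (\<lambda>_. std_normal_distribution)) borel (\<lambda>\<xi>. \<Sum>i<H. (\<xi> i)\<^sup>2)"

definition chisq_upper_quantile :: "nat \<Rightarrow> real \<Rightarrow> real" where
  "chisq_upper_quantile H \<alpha> = Inf {x. measure (chisq H) {x<..} \<le> \<alpha>}"

end

theory Submission
  imports Defs "HOL-Real_Asymp.Real_Asymp" "HOL-Computational_Algebra.Fundamental_Theorem_Algebra"
begin

text \<open>
  Write \<open>v\<close> for the coordinates of \<open>\<gamma>\<^bsub>hat\<^esub> - \<gamma>\<close> in a basis that makes \<open>V\<close> the identity and
  \<open>E V\<^bsub>hat\<^esub>\<close> diagonal with entries \<open>1 / l\<^sub>k\<close>; the \<open>l\<^sub>k\<close> are the eigenvalues of \<open>W\<close> and lie in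
  \<open>[\<sigma>\<^sub>F\<^bsup>-2\<^esup>, 1]\<close>.  Swapping the labels of two random units gives an exchangeable pair, hence Stein's
  identity for the quadratic form \<open>X = \<Sum> l\<^sub>k v\<^sub>k\<^sup>2\<close> up to an error that tends to zero; the conditional
  covariance of the jumps needs no concentration estimate, because a function of the labels of one
  pair of units is almost uncorrelated with everything else.  Gaussian coordinates satisfy the same
  identity exactly.  For fixed \<open>H\<close> both identities are linear differential equations for the
  characteristic functions, which are therefore close; for \<open>H \<rightarrow> \<infinity>\<close> the identity with weights \<open>l\<close> and
  \<open>l\<^sup>2\<close> becomes \<open>\<psi>' = - t \<psi>\<close> after standardization, for \<open>X\<close> and for its Gaussian counterpart alike.
  Replacing \<open>E V\<^bsub>hat\<^esub>\<close> by \<open>V\<^bsub>hat\<^esub>\<close> perturbs \<open>X\<close> by a relative error that the variance of \<open>V\<^bsub>hat\<^esub>\<close> controls.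
  Coverage follows from \<open>W \<le> 1\<close>, which bounds the Gaussian quadratic form by a chi-square variable.
\<close>

section \<open>Averages over assignments\<close>

text \<open>The number of levels may grow while groups keep as few as two units, so no single group
  obeys a limit theorem and no single \<open>Shat\<close> is consistent; everything rests on the
  smallness of each unit's contribution to \<open>v\<close>. The hypotheses \<open>cond1\<close>,
  \<open>cond2\<close> and \<open>cond4\<close> bound it by \<open>sqrt (\<kappa> * H / N)\<close>,
  where \<open>\<kappa>\<close> depends only on the constants of the sequence. A transposition thus
  moves \<open>v\<close> by order \<open>H / sqrt N\<close>, and the Stein error \<open>K\<close> is
  of order \<open>H ^ 5 / sqrt N\<close>. The spread of the quadratic form is of order
  \<open>sqrt H\<close>, so standardization divides \<open>K\<close> by \<open>H\<close> and leaves
  \<open>H ^ 4 / sqrt N\<close>, which the rate of (ii) absorbs. The relative error of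
  \<open>Vhat\<close> multiplies a mean of order \<open>H\<close> and must therefore be small
  against \<open>1 / sqrt H\<close>. Comparison is by characteristic functions because their
  integrands are bounded by one: on the rare event where \<open>Vhat\<close> is far from its mean,
  or singular, the default value of the inverse does no harm. The quantile in (ii) moves with
  \<open>n\<close>, so coverage compares two sequences of laws with the same normal limit at a
  common point.\<close>

definition fin_mean :: "'b set \<Rightarrow> ('b \<Rightarrow> 'a::real_vector) \<Rightarrow> 'a" where
  "fin_mean S f = (\<Sum>z\<in>S. f z) /\<^sub>R real (card S)"

lemma fin_mean_cong: "(\<And>z. z \<in> S \<Longrightarrow> f z = g z) \<Longrightarrow> fin_mean S f = fin_mean S g"
  by (simp add: fin_mean_def cong: sum.cong)

lemma fin_mean_add: "fin_mean S (\<lambda>z. f z + g z) = fin_mean S f + fin_mean S g"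
  by (simp add: fin_mean_def sum.distrib scaleR_add_right)

lemma fin_mean_diff: "fin_mean S (\<lambda>z. f z - g z) = fin_mean S f - fin_mean S g"
  by (simp add: fin_mean_def sum_subtractf scaleR_diff_right)

lemma fin_mean_minus: "fin_mean S (\<lambda>z. - f z) = - fin_mean S f"
  by (simp add: fin_mean_def sum_negf)

lemma fin_mean_sum: "fin_mean S (\<lambda>z. \<Sum>i\<in>I. f i z) = (\<Sum>i\<in>I. fin_mean S (f i))"
  by (simp add: fin_mean_def sum.swap[of _ I S] scaleR_sum_right)

lemma fin_mean_scaleR: "fin_mean S (\<lambda>z. c *\<^sub>R f z) = c *\<^sub>R fin_mean S f"
  by (simp add: fin_mean_def scaleR_sum_right[symmetric])

lemma fin_mean_mult_left:
  fixes c :: "'a::real_algebra"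
  shows "fin_mean S (\<lambda>z. c * f z) = c * fin_mean S f"
  by (simp add: fin_mean_def sum_distrib_left[symmetric])

lemma fin_mean_mult_right:
  fixes c :: "'a::real_algebra"
  shows "fin_mean S (\<lambda>z. f z * c) = fin_mean S f * c"
  by (simp add: fin_mean_def sum_distrib_right[symmetric])

lemma fin_mean_divide:
  fixes c :: real
  shows "fin_mean S (\<lambda>z. f z / c) = fin_mean S f / c"
  by (simp add: fin_mean_def sum_divide_distrib[symmetric])

lemma fin_mean_const: "finite S \<Longrightarrow> S \<noteq> {} \<Longrightarrow> fin_mean S (\<lambda>z. c) = c"
  by (simp add: fin_mean_def sum_constant_scaleR)

lemma fin_mean_mono:
  fixes f g :: "'b \<Rightarrow> real"
  assumes "\<And>z. z \<in> S \<Longrightarrow> f z \<le> g z"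
  shows "fin_mean S f \<le> fin_mean S g"
  unfolding fin_mean_def real_scaleR_def by (intro mult_left_mono sum_mono assms) auto

lemma fin_mean_nonneg:
  fixes f :: "'b \<Rightarrow> real"
  assumes "\<And>z. z \<in> S \<Longrightarrow> 0 \<le> f z"
  shows "0 \<le> fin_mean S f"
  unfolding fin_mean_def real_scaleR_def by (intro mult_nonneg_nonneg sum_nonneg assms) auto

lemma norm_fin_mean_le:
  fixes f :: "'b \<Rightarrow> 'a::real_normed_vector"
  assumes "\<And>z. z \<in> S \<Longrightarrow> norm (f z) \<le> g z"
  shows "norm (fin_mean S f) \<le> fin_mean S g"
proof -
  have "norm (\<Sum>z\<in>S. f z) \<le> (\<Sum>z\<in>S. g z)"
    by (rule sum_norm_le) (use assms in auto)
  then show ?thesis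
    unfolding fin_mean_def real_scaleR_def norm_scaleR
    by (simp add: mult_left_mono)
qed

section \<open>Transpositions of labels and the space of assignments\<close>

definition swap_at :: "nat \<Rightarrow> nat \<Rightarrow> (nat \<Rightarrow> nat) \<Rightarrow> nat \<Rightarrow> nat" where
  "swap_at i j z = z(i := z j, j := z i)"

lemma swap_at_swap_at [simp]: "swap_at i j (swap_at i j z) = z"
  by (auto simp: swap_at_def fun_eq_iff)

lemma swap_at_apply: "swap_at i j z x = (if x = j then z i else if x = i then z j else z x)"
  by (auto simp: swap_at_def)

lemma swap_at_eq_comp: "swap_at i j z = z \<circ> Transposition.transpose i j"
  by (auto simp: swap_at_def fun_eq_iff Transposition.transpose_def)

text \<open>Greedy choice: reserve \<open>Nq Q\<close> units for the last level and assign the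
  others by induction. It makes the set of assignments nonempty, without which
  \<open>pmf_of_set\<close> in \<open>CR\<close> would be unspecified.\<close>

lemma exists_assignment:
  fixes Nq :: "nat \<Rightarrow> nat"
  assumes "finite I" "card I = (\<Sum>q<Q. Nq q)"
  shows "\<exists>z\<in>I \<rightarrow> {..<Q}. \<forall>q<Q. card {i\<in>I. z i = q} = Nq q"
  using assms
proof (induction Q arbitrary: I)
  case 0
  then show ?case by auto
next
  case (Suc Q)
  have "Nq Q \<le> card I" using Suc.prems by simp
  then obtain B where B: "B \<subseteq> I" "card B = Nq Q"
    using obtain_subset_with_card_n by metis
  have fB: "finite B" using B Suc.prems finite_subset by blast
  have "card (I - B) = (\<Sum>q<Q. Nq q)"
    using Suc.prems B fB by (simp add: card_Diff_subset)
  moreover have "finite (I - B)" using Suc.prems by simp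
  ultimately obtain z where z: "z \<in> (I - B) \<rightarrow> {..<Q}" and cz: "\<forall>q<Q. card {i\<in>I - B. z i = q} = Nq q"
    using Suc.IH[of "I - B"] by blast
  define w where "w i = (if i \<in> B then Q else z i)" for i
  have zQ: "z i < Q" if "i \<in> I" "i \<notin> B" for i using z that by blast
  have 1: "w \<in> I \<rightarrow> {..<Suc Q}"
  proof
    fix i assume "i \<in> I"
    then show "w i \<in> {..<Suc Q}" using zQ[of i] by (cases "i \<in> B") (auto simp: w_def)
  qed
  have "{i\<in>I. w i = q} = {i\<in>I - B. z i = q}" if "q < Q" for q
    using that by (auto simp: w_def)
  moreover have "{i\<in>I. w i = Q} = B"
  proof (intro Set.set_eqI)
    fix i show "i \<in> {i\<in>I. w i = Q} \<longleftrightarrow> i \<in> B"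
      using zQ[of i] B(1) by (cases "i \<in> B") (auto simp: w_def)
  qed
  ultimately have "\<forall>q<Suc Q. card {i\<in>I. w i = q} = Nq q"
    using cz B(2) by (simp add: less_Suc_eq)
  with 1 show ?case by blast
qed

locale assignment_space =
  fixes N Q :: nat and Nq :: "nat \<Rightarrow> nat"
  assumes two_le_N: "2 \<le> N" and sum_Nq: "(\<Sum>q<Q. Nq q) = N"
begin

abbreviation "\<Omega> \<equiv> assignments N Q Nq"
abbreviation E :: "((nat \<Rightarrow> nat) \<Rightarrow> 'a::real_vector) \<Rightarrow> 'a" where "E \<equiv> fin_mean \<Omega>"

lemma finite_assignments [simp]: "finite \<Omega>"
  by (rule finite_subset[of _ "{..<N} \<rightarrow>\<^sub>E {..<Q}"]) (auto simp: assignments_def intro: finite_PiE)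

lemma assignments_nonempty [simp]: "\<Omega> \<noteq> {}"
proof -
  obtain z where z: "z \<in> {..<N} \<rightarrow> {..<Q}" "\<forall>q<Q. card {i\<in>{..<N}. z i = q} = Nq q"
    using exists_assignment[of "{..<N}" Nq Q] sum_Nq by auto
  have "{i\<in>{..<N}. restrict z {..<N} i = q} = {i\<in>{..<N}. z i = q}" for q by auto
  then have "restrict z {..<N} \<in> \<Omega>" using z unfolding assignments_def by simp
  then show ?thesis by blast
qed

lemma assignment_less: "z \<in> \<Omega> \<Longrightarrow> i < N \<Longrightarrow> z i < Q"
  by (auto simp: assignments_def)

lemma card_group: "z \<in> \<Omega> \<Longrightarrow> q < Q \<Longrightarrow> card {i\<in>{..<N}. z i = q} = Nq q"
  by (auto simp: assignments_def)

lemma swap_at_assignment: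
  assumes "z \<in> \<Omega>" "i < N" "j < N"
  shows "swap_at i j z \<in> \<Omega>"
proof -
  have "swap_at i j z \<in> {..<N} \<rightarrow>\<^sub>E {..<Q}"
    using assms by (auto simp: assignments_def swap_at_def PiE_iff extensional_def)
  moreover have "card {x\<in>{..<N}. swap_at i j z x = q} = card {x\<in>{..<N}. z x = q}" for q
  proof -
    have "bij_betw (Transposition.transpose i j) {x\<in>{..<N}. swap_at i j z x = q} {x\<in>{..<N}. z x = q}"
      by (rule bij_betw_byWitness[where f' = "Transposition.transpose i j"])
         (use assms(2,3) in \<open>auto simp: swap_at_eq_comp Transposition.transpose_def\<close>)
    then show ?thesis by (rule bij_betw_same_card)
  qed
  ultimately show ?thesis using assms(1) by (auto simp: assignments_def)
qed

text \<open>\<open>swap_at i j\<close> is an involution of the finite set of assignments, so it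
  permutes the summands. Every later exchangeability argument reduces to this invariance.\<close>

lemma mean_swap_at:
  assumes "i < N" "j < N"
  shows "E (\<lambda>z. g (swap_at i j z)) = E g"
proof -
  have "(\<Sum>z\<in>\<Omega>. g (swap_at i j z)) = (\<Sum>z\<in>\<Omega>. g z)"
    by (rule sum.reindex_bij_witness[of _ "swap_at i j" "swap_at i j"])
       (use assms swap_at_assignment in auto)
  then show ?thesis by (simp add: fin_mean_def)
qed

lemma sum_over_units:
  fixes f :: "nat \<Rightarrow> real"
  assumes "z \<in> \<Omega>"
  shows "(\<Sum>i<N. f (z i)) = (\<Sum>q<Q. real (Nq q) * f q)"
proof -
  have "(\<Sum>i<N. f (z i)) = (\<Sum>q<Q. \<Sum>i\<in>{i\<in>{..<N}. z i = q}. f (z i))"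
    by (rule sum.group[symmetric]) (use assms assignment_less in auto)
  also have "\<dots> = (\<Sum>q<Q. real (Nq q) * f q)"
    using card_group[OF assms] by (intro sum.cong) auto
  finally show ?thesis .
qed

lemma sum_off_diagonal:
  fixes f :: "nat \<Rightarrow> nat \<Rightarrow> 'a::ab_group_add"
  shows "(\<Sum>i<N. \<Sum>j\<in>{..<N}-{i}. f i j) = (\<Sum>i<N. \<Sum>j<N. f i j) - (\<Sum>i<N. f i i)"
  by (simp add: sum_diff1 sum_subtractf)

text \<open>Sum of \<open>G\<close> over ordered pairs of distinct units, read off from the group
  sizes alone. Subtracting the diagonal once per unit leaves the weight
  \<open>Nq q * (Nq q - 1)\<close> for two equal labels.\<close>

definition pair_total :: "(nat \<Rightarrow> nat \<Rightarrow> real) \<Rightarrow> real" where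
  "pair_total G = (\<Sum>q<Q. real (Nq q) * (\<Sum>p<Q. real (Nq p) * G q p)) - (\<Sum>q<Q. real (Nq q) * G q q)"

lemma sum_over_pairs:
  assumes "z \<in> \<Omega>"
  shows "(\<Sum>i<N. \<Sum>j\<in>{..<N}-{i}. G (z i) (z j)) = pair_total G"
  unfolding sum_off_diagonal pair_total_def
  using sum_over_units[OF assms, of "\<lambda>q. G q q"]
    sum_over_units[OF assms, of "\<lambda>q. \<Sum>p<Q. real (Nq p) * G q p"]
    sum_over_units[OF assms, of "G q" for q]
  by simp

lemma sum_pairs_const: "(\<Sum>i<N. \<Sum>j\<in>{..<N}-{i}. c) = (real N * (real N - 1)) *\<^sub>R (c::'a::real_vector)"
proof -
  have "(\<Sum>i<N. \<Sum>j\<in>{..<N}-{i}. c) = (\<Sum>i<N. (real N - 1) *\<^sub>R c)"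
    using two_le_N by (intro sum.cong) (auto simp: sum_constant_scaleR of_nat_diff)
  then show ?thesis by (simp add: sum_constant_scaleR)
qed

text \<open>Two transpositions carry the pair \<open>(i, j)\<close> to \<open>(i', j')\<close>: the
  first exchanges \<open>i\<close> with \<open>i'\<close>; after it the label of \<open>j'\<close>
  sits at \<open>k\<close>, so the second exchanges \<open>j\<close> with \<open>k\<close>. This
  choice of \<open>k\<close> handles all overlaps between the two pairs.\<close>

lemma mean_resample:
  assumes ij: "i < N" "j < N" "i \<noteq> j" and ij': "i' < N" "j' < N" "i' \<noteq> j'"
  defines "k \<equiv> Transposition.transpose i i' j'"
  shows "E (\<lambda>z. \<Phi> (z i) (z j) z) = E (\<lambda>z. \<Phi> (z i') (z j') (swap_at j k (swap_at i i' z)))"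
proof -
  have k: "k < N" using ij ij' by (auto simp: k_def Transposition.transpose_def)
  have *: "swap_at j k (swap_at i i' z) i = z i'" "swap_at j k (swap_at i i' z) j = z j'" for z
    using ij ij' by (auto simp: k_def Transposition.transpose_def swap_at_def)
  have "E (\<lambda>z. \<Phi> (z i) (z j) z) = E (\<lambda>z. \<Phi> (swap_at j k z i) (swap_at j k z j) (swap_at j k z))"
    using mean_swap_at[OF ij(2) k, of "\<lambda>z. \<Phi> (z i) (z j) z"] by simp
  also have "\<dots> = E (\<lambda>z. \<Phi> (swap_at j k (swap_at i i' z) i) (swap_at j k (swap_at i i' z) j)
      (swap_at j k (swap_at i i' z)))"
    using mean_swap_at[OF ij(1) ij'(1), of "\<lambda>z. \<Phi> (swap_at j k z i) (swap_at j k z j) (swap_at j k z)"]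
    by simp
  finally show ?thesis unfolding * .
qed

text \<open>By resampling, all pairs of distinct units share one mean, while their sum is the
  constant \<open>pair_total G\<close> for every assignment.\<close>

lemma mean_pair:
  assumes "i < N" "j < N" "i \<noteq> j"
  shows "E (\<lambda>z. G (z i) (z j)) = pair_total G / (real N * (real N - 1))"
proof -
  have "(real N * (real N - 1)) *\<^sub>R E (\<lambda>z. G (z i) (z j)) =
      (\<Sum>i'<N. \<Sum>j'\<in>{..<N}-{i'}. E (\<lambda>z. G (z i) (z j)))"
    by (rule sum_pairs_const[symmetric])
  also have "\<dots> = (\<Sum>i'<N. \<Sum>j'\<in>{..<N}-{i'}. E (\<lambda>z. G (z i') (z j')))"
    by (intro sum.cong refl mean_resample[of i j _ _ "\<lambda>p q z. G p q"]) (use assms in auto)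
  also have "\<dots> = E (\<lambda>z. \<Sum>i'<N. \<Sum>j'\<in>{..<N}-{i'}. G (z i') (z j'))"
    by (simp add: fin_mean_sum)
  also have "\<dots> = E (\<lambda>z. pair_total G)"
    by (rule fin_mean_cong) (rule sum_over_pairs)
  finally show ?thesis using two_le_N by (simp add: fin_mean_const field_simps)
qed

lemma mean_single:
  assumes "i < N"
  shows "E (\<lambda>z. f (z i)) = (\<Sum>q<Q. real (Nq q) * f q) / real N"
proof -
  have "real N * E (\<lambda>z. f (z i)) = (\<Sum>i'<N. E (\<lambda>z. f (z i')))"
  proof -
    have "E (\<lambda>z. f (z i')) = E (\<lambda>z. f (z i))" if "i' < N" for i'
      using mean_swap_at[OF assms that, of "\<lambda>z. f (z i)"] by (cases "i' = i") (simp_all add: swap_at_def)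
    then show ?thesis by simp
  qed
  also have "\<dots> = E (\<lambda>z. \<Sum>i'<N. f (z i'))"
    by (simp add: fin_mean_sum)
  also have "\<dots> = E (\<lambda>z. (\<Sum>q<Q. real (Nq q) * f q))"
    by (rule fin_mean_cong) (rule sum_over_units)
  finally show ?thesis using two_le_N by (simp add: fin_mean_const field_simps)
qed

text \<open>A function of the labels of two units is nearly uncorrelated with any statistic that is
  insensitive to two transpositions: moving the pair over all pairs makes the former average out.\<close>

lemma mean_decouple:
  fixes \<Phi> :: "nat \<Rightarrow> nat \<Rightarrow> (nat \<Rightarrow> nat) \<Rightarrow> 'a::real_normed_vector"
  assumes ij: "i < N" "j < N" "i \<noteq> j"
    and B: "\<And>p q z a b c d. z \<in> \<Omega> \<Longrightarrow> p < Q \<Longrightarrow> q < Q \<Longrightarrow> a < N \<Longrightarrow> b < N \<Longrightarrow> c < N \<Longrightarrow> d < N \<Longrightarrow>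
      norm (\<Phi> p q (swap_at c d (swap_at a b z)) - \<Phi> p q z) \<le> B p q z"
  shows "norm (E (\<lambda>z. \<Phi> (z i) (z j) z) -
      (\<Sum>i'<N. \<Sum>j'\<in>{..<N}-{i'}. E (\<lambda>z. \<Phi> (z i') (z j') z)) /\<^sub>R (real N * (real N - 1)))
    \<le> (\<Sum>i'<N. \<Sum>j'\<in>{..<N}-{i'}. E (\<lambda>z. B (z i') (z j') z)) / (real N * (real N - 1))"
proof -
  let ?K = "real N * (real N - 1)"
  have K: "?K > 0" using two_le_N by simp
  have "norm (?K *\<^sub>R E (\<lambda>z. \<Phi> (z i) (z j) z) - (\<Sum>i'<N. \<Sum>j'\<in>{..<N}-{i'}. E (\<lambda>z. \<Phi> (z i') (z j') z)))
     = norm (\<Sum>i'<N. \<Sum>j'\<in>{..<N}-{i'}. E (\<lambda>z. \<Phi> (z i) (z j) z) - E (\<lambda>z. \<Phi> (z i') (z j') z))"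
    by (simp only: sum_pairs_const[symmetric] sum_subtractf[symmetric])
  also have "\<dots> \<le> (\<Sum>i'<N. \<Sum>j'\<in>{..<N}-{i'}. E (\<lambda>z. B (z i') (z j') z))"
  proof (intro sum_norm_le)
    fix i' j' assume "i' \<in> {..<N}" "j' \<in> {..<N} - {i'}"
    then have ij': "i' < N" "j' < N" "i' \<noteq> j'" by auto
    let ?k = "Transposition.transpose i i' j'"
    have k: "?k < N" using ij ij' by (auto simp: Transposition.transpose_def)
    \<comment> \<open>Resampling turns the difference between two pairs into the effect of two
      transpositions on the last argument of \<open>\<Phi>\<close> alone, which \<open>B\<close>
      controls.\<close>
    have "E (\<lambda>z. \<Phi> (z i) (z j) z) - E (\<lambda>z. \<Phi> (z i') (z j') z) =
        E (\<lambda>z. \<Phi> (z i') (z j') (swap_at j ?k (swap_at i i' z)) - \<Phi> (z i') (z j') z)"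
      unfolding fin_mean_diff mean_resample[OF ij ij', of \<Phi>] ..
    then show "norm (E (\<lambda>z. \<Phi> (z i) (z j) z) - E (\<lambda>z. \<Phi> (z i') (z j') z)) \<le> E (\<lambda>z. B (z i') (z j') z)"
      using ij ij' k by (auto intro!: norm_fin_mean_le B intro: assignment_less)
  qed
  finally have *: "norm (?K *\<^sub>R E (\<lambda>z. \<Phi> (z i) (z j) z) - (\<Sum>i'<N. \<Sum>j'\<in>{..<N}-{i'}. E (\<lambda>z. \<Phi> (z i') (z j') z)))
     \<le> (\<Sum>i'<N. \<Sum>j'\<in>{..<N}-{i'}. E (\<lambda>z. B (z i') (z j') z))" .
  have scale: "norm (x - y /\<^sub>R t) \<le> b / t" if "norm (t *\<^sub>R x - y) \<le> b" "t > 0" for x y :: 'a and t b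
  proof -
    have "x - y /\<^sub>R t = (t *\<^sub>R x - y) /\<^sub>R t" using that(2) by (simp add: scaleR_diff_right)
    then have "norm (x - y /\<^sub>R t) = norm (t *\<^sub>R x - y) / t" using that(2) by (simp add: divide_inverse_commute)
    then show ?thesis using that by (simp add: divide_right_mono)
  qed
  show ?thesis by (rule scale[OF * K])
qed

end

section \<open>Taylor expansion of the Stein form\<close>

lemma abs_weighted_inner_le:
  assumes "\<And>k. k < H \<Longrightarrow> \<bar>\<mu> k\<bar> \<le> (1::real)"
  shows "\<bar>\<Sum>k<H. \<mu> k * d k * v k\<bar> \<le> L2_set d {..<H} * L2_set v {..<H}"
proof -
  have "\<bar>\<Sum>k<H. \<mu> k * d k * v k\<bar> \<le> (\<Sum>k<H. \<bar>\<mu> k * d k * v k\<bar>)" by (rule sum_abs)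
  also have "\<dots> \<le> (\<Sum>k<H. \<bar>d k\<bar> * \<bar>v k\<bar>)"
    using assms by (intro sum_mono) (auto simp: abs_mult mult.assoc intro!: mult_left_le_one_le)
  also have "\<dots> \<le> L2_set d {..<H} * L2_set v {..<H}" by (rule L2_set_mult_ineq)
  finally show ?thesis .
qed

lemma L2_set_power2: "(L2_set v A)\<^sup>2 = (\<Sum>k\<in>A. (v k)\<^sup>2)"
  by (simp add: L2_set_def sum_nonneg)

lemma weighted_squares_add:
  fixes l :: "nat \<Rightarrow> real"
  shows "(\<Sum>k<H. l k * (v k + d k)\<^sup>2) =
    (\<Sum>k<H. l k * (v k)\<^sup>2) + (2 * (\<Sum>k<H. l k * d k * v k) + (\<Sum>k<H. l k * (d k)\<^sup>2))"
  unfolding sum_distrib_left sum.distrib[symmetric]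
  by (intro sum.cong) (auto simp: power2_sum algebra_simps)

lemma weighted_squares_bounds:
  assumes "\<And>k. k < H \<Longrightarrow> 0 \<le> l k \<and> l k \<le> (1::real)" "L2_set d {..<H} \<le> D"
  shows "0 \<le> (\<Sum>k<H. l k * (d k)\<^sup>2)" "(\<Sum>k<H. l k * (d k)\<^sup>2) \<le> D\<^sup>2"
proof -
  show "0 \<le> (\<Sum>k<H. l k * (d k)\<^sup>2)" using assms by (intro sum_nonneg) auto
  have "(\<Sum>k<H. l k * (d k)\<^sup>2) \<le> (\<Sum>k<H. (d k)\<^sup>2)"
    using assms by (intro sum_mono) (auto intro: mult_left_le_one_le)
  also have "\<dots> \<le> D\<^sup>2"
    using assms(2) by (simp add: L2_set_power2[symmetric] power_mono)
  finally show "(\<Sum>k<H. l k * (d k)\<^sup>2) \<le> D\<^sup>2" .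
qed

lemma iexp_diff_1: "cmod (iexp x - 1) \<le> \<bar>x\<bar>"
  using iexp_approx1[of x 0] by simp

lemma iexp_diff_2: "cmod (iexp x - 1 - \<i> * of_real x) \<le> x\<^sup>2 / 2"
proof -
  have "iexp x - 1 - \<i> * of_real x = iexp x - (\<Sum>k\<le>1. (\<i> * of_real x) ^ k / fact k)" by simp
  then show ?thesis using iexp_approx1[of x 1] by (simp add: power2_eq_square numeral_2_eq_2 fact_numeral diff_diff_eq)
qed

lemma iexp_add: "iexp (x + y) = iexp x * iexp y"
  by (simp add: algebra_simps exp_add)

text \<open>Directional derivative along \<open>d\<close>, at \<open>v\<close>, of
  \<open>\<Sum>k. \<mu> k * d k * v k * iexp (r * X v)\<close>, with the factors \<open>d k\<close>
  in front held fixed and \<open>X v = (\<Sum>k. l k * (v k)\<^sup>2)\<close>. It is the leading,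
  second order part of what a jump \<open>d\<close> contributes to Stein's identity.\<close>

definition stein_form :: "nat \<Rightarrow> (nat \<Rightarrow> real) \<Rightarrow> (nat \<Rightarrow> real) \<Rightarrow> real \<Rightarrow> (nat \<Rightarrow> real) \<Rightarrow> (nat \<Rightarrow> real) \<Rightarrow> complex" where
  "stein_form H \<mu> l r d v =
     (of_real (\<Sum>k<H. \<mu> k * (d k)\<^sup>2) + 2 * \<i> * of_real r *
        of_real (\<Sum>k<H. \<mu> k * d k * v k) * of_real (\<Sum>k<H. l k * d k * v k)) *
     iexp (r * (\<Sum>k<H. l k * (v k)\<^sup>2))"

text \<open>All remainders are reduced to the single majorant \<open>(1 + n) ^ 3\<close>, whose mean
  is bounded by \<open>mean_nrm_cube\<close>.\<close>

lemma cube_bounds: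
  fixes n :: real assumes "0 \<le> n"
  shows "n * (2 * n + 1)\<^sup>2 / 2 \<le> 2 * (1 + n) ^ 3" "3 * n + 1 \<le> 3 * (1 + n) ^ 3"
    "12 * (n + 1) \<le> 12 * (1 + n) ^ 3" "8 * n\<^sup>2 * (n + 1) \<le> 8 * (1 + n) ^ 3"
proof -
  have n: "0 \<le> n * n" "0 \<le> n * n * n" using assms by auto
  show "n * (2 * n + 1)\<^sup>2 / 2 \<le> 2 * (1 + n) ^ 3" "3 * n + 1 \<le> 3 * (1 + n) ^ 3"
    "12 * (n + 1) \<le> 12 * (1 + n) ^ 3" "8 * n\<^sup>2 * (n + 1) \<le> 8 * (1 + n) ^ 3"
    using n assms by (simp_all add: power2_eq_square power3_eq_cube algebra_simps)
qed

text \<open>The jump changes \<open>X\<close> by \<open>\<delta> = 2 * s2 + s4\<close>, with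
  \<open>s4\<close> of second order. Replacing \<open>iexp (r * \<delta>) - 1\<close> by its linear
  part, and dropping \<open>s4\<close> and the product of \<open>s3\<close> with the phase change,
  costs only terms of third order in \<open>D\<close>.\<close>

lemma stein_form_taylor:
  assumes \<mu>: "\<And>k. k < H \<Longrightarrow> 0 \<le> \<mu> k \<and> \<mu> k \<le> (1::real)"
    and l: "\<And>k. k < H \<Longrightarrow> 0 \<le> l k \<and> l k \<le> (1::real)"
    and D: "L2_set d {..<H} \<le> D" "0 \<le> D" "D \<le> 1"
  defines "X \<equiv> \<lambda>v. \<Sum>k<H. l k * (v k)\<^sup>2"
  shows "cmod ((\<Sum>k<H. of_real (\<mu> k * d k) * (of_real (v k + d k) * iexp (r * X (\<lambda>k. v k + d k))
      - of_real (v k) * iexp (r * X v))) - stein_form H \<mu> l r d v)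
    \<le> 3 * D ^ 3 * (\<bar>r\<bar> + r\<^sup>2) * (1 + L2_set v {..<H}) ^ 3"
proof -
  define n where "n = L2_set v {..<H}"
  have n: "0 \<le> n" by (simp add: n_def L2_set_nonneg)
  define s1 s2 s3 s4 where "s1 = (\<Sum>k<H. \<mu> k * d k * v k)" and "s2 = (\<Sum>k<H. l k * d k * v k)"
    and "s3 = (\<Sum>k<H. \<mu> k * (d k)\<^sup>2)" and "s4 = (\<Sum>k<H. l k * (d k)\<^sup>2)"
  define \<delta> where "\<delta> = 2 * s2 + s4"
  define e where "e = iexp (r * X v)"
  define u where "u = iexp (r * \<delta>) - 1"
  have Dn: "L2_set d {..<H} * n \<le> D * n" using D n by (intro mult_right_mono) auto
  have s1: "\<bar>s1\<bar> \<le> D * n"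
    using abs_weighted_inner_le[of H \<mu> d v] \<mu> Dn unfolding s1_def n_def by fastforce
  have s2: "\<bar>s2\<bar> \<le> D * n"
    using abs_weighted_inner_le[of H l d v] l Dn unfolding s2_def n_def by fastforce
  have s3: "0 \<le> s3" "s3 \<le> D\<^sup>2" unfolding s3_def using weighted_squares_bounds[OF \<mu> D(1)] by auto
  have s4: "0 \<le> s4" "s4 \<le> D\<^sup>2" unfolding s4_def using weighted_squares_bounds[OF l D(1)] by auto
  have DD: "D\<^sup>2 \<le> D" using D by (simp add: power2_eq_square mult_left_le)
  have \<delta>: "\<bar>\<delta>\<bar> \<le> D * (2 * n + 1)"
    using s2 s4 DD unfolding \<delta>_def by (simp add: algebra_simps abs_le_iff)
  have X: "X (\<lambda>k. v k + d k) = X v + \<delta>"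
    unfolding X_def weighted_squares_add \<delta>_def s2_def s4_def by simp
  have e': "iexp (r * X (\<lambda>k. v k + d k)) = e * (u + 1)"
    unfolding X e_def u_def distrib_left[of r] iexp_add by simp
  have ne: "cmod e = 1" unfolding e_def by (simp only: norm_exp_i_times)
  have u1: "cmod u \<le> \<bar>r\<bar> * (D * (2 * n + 1))"
  proof -
    have "cmod u \<le> \<bar>r * \<delta>\<bar>" unfolding u_def by (rule iexp_diff_1)
    also have "\<dots> \<le> \<bar>r\<bar> * (D * (2 * n + 1))" unfolding abs_mult using \<delta> by (intro mult_left_mono) auto
    finally show ?thesis .
  qed
  have u2: "cmod (u - \<i> * of_real (r * \<delta>)) \<le> r\<^sup>2 * (D\<^sup>2 * (2 * n + 1)\<^sup>2) / 2"
  proof -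
    have "cmod (u - \<i> * of_real (r * \<delta>)) \<le> (r * \<delta>)\<^sup>2 / 2" unfolding u_def by (rule iexp_diff_2)
    also have "\<delta>\<^sup>2 \<le> (D * (2 * n + 1))\<^sup>2" using \<delta> by (metis abs_ge_zero power2_abs power_mono)
    then have "(r * \<delta>)\<^sup>2 / 2 \<le> r\<^sup>2 * (D\<^sup>2 * (2 * n + 1)\<^sup>2) / 2"
      by (simp add: power_mult_distrib mult_left_mono)
    finally show ?thesis .
  qed
  have sf: "stein_form H \<mu> l r d v = (of_real s3 + 2 * \<i> * of_real r * of_real s1 * of_real s2) * e"
    unfolding stein_form_def e_def X_def s1_def s2_def s3_def ..
  \<comment> \<open>Exact so far: with the new phase written as \<open>e * (u + 1)\<close>, the sum
    depends on the jump only through \<open>s1\<close>, \<open>s3\<close> and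
    \<open>u\<close>.\<close>
  have "(\<Sum>k<H. of_real (\<mu> k * d k) * (of_real (v k + d k) * (e * (u + 1)) - of_real (v k) * e))
      = of_real s1 * (e * u) + of_real s3 * (e * (u + 1))"
    unfolding s1_def s3_def of_real_sum sum_distrib_right sum.distrib[symmetric]
    by (intro sum.cong) (auto simp: algebra_simps power2_eq_square)
  then have "(\<Sum>k<H. of_real (\<mu> k * d k) * (of_real (v k + d k) * iexp (r * X (\<lambda>k. v k + d k))
      - of_real (v k) * iexp (r * X v))) - stein_form H \<mu> l r d v =
     e * (of_real s1 * ((u - \<i> * of_real (r * \<delta>)) + \<i> * of_real (r * s4)) + of_real s3 * u)"
    unfolding e' sf e_def[symmetric] by (simp add: algebra_simps \<delta>_def)
  also have "cmod \<dots> = cmod (of_real s1 * ((u - \<i> * of_real (r * \<delta>)) + \<i> * of_real (r * s4)) + of_real s3 * u)"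
    by (simp add: norm_mult ne)
  also have "\<dots> \<le> \<bar>s1\<bar> * (cmod (u - \<i> * of_real (r * \<delta>)) + \<bar>r\<bar> * s4) + s3 * cmod u"
  proof -
    have "cmod (of_real s1 * ((u - \<i> * of_real (r * \<delta>)) + \<i> * of_real (r * s4)))
        \<le> \<bar>s1\<bar> * (cmod (u - \<i> * of_real (r * \<delta>)) + \<bar>r\<bar> * s4)"
      unfolding norm_mult norm_of_real
      by (intro mult_left_mono order_trans[OF norm_triangle_ineq] add_left_mono)
         (use s4 in \<open>auto simp: norm_mult abs_mult\<close>)
    moreover have "cmod (of_real s3 * u) = s3 * cmod u" using s3 by (simp add: norm_mult)
    ultimately show ?thesis using norm_triangle_ineq[of "of_real s1 * ((u - \<i> * of_real (r * \<delta>)) + \<i> * of_real (r * s4))" "of_real s3 * u"]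
      by linarith
  qed
  also have "\<dots> \<le> (D * n) * (r\<^sup>2 * (D\<^sup>2 * (2 * n + 1)\<^sup>2) / 2 + \<bar>r\<bar> * D\<^sup>2) + D\<^sup>2 * (\<bar>r\<bar> * (D * (2 * n + 1)))"
    using s1 s3 s4 u1 u2 n D by (intro add_mono mult_mono) auto
  also have "\<dots> = D ^ 3 * (r\<^sup>2 * (n * (2 * n + 1)\<^sup>2 / 2) + \<bar>r\<bar> * (3 * n + 1))"
    by (simp add: power2_eq_square power3_eq_cube field_simps)
  also have "\<dots> \<le> D ^ 3 * (r\<^sup>2 * (3 * (1 + n) ^ 3) + \<bar>r\<bar> * (3 * (1 + n) ^ 3))"
  proof -
    have "n * (2 * n + 1)\<^sup>2 / 2 \<le> 3 * (1 + n) ^ 3" using cube_bounds(1)[OF n] n by (smt (verit) zero_le_power)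
    then show ?thesis using cube_bounds(2)[OF n] D by (intro mult_left_mono add_mono) auto
  qed
  also have "\<dots> = 3 * D ^ 3 * (\<bar>r\<bar> + r\<^sup>2) * (1 + n) ^ 3" by (simp add: algebra_simps)
  finally show ?thesis unfolding n_def .
qed

text \<open>The form is quadratic in \<open>d\<close>, hence of size \<open>D\<^sup>2\<close>;
  moving \<open>v\<close> by \<open>w\<close> gains one more factor \<open>D\<close>. The bound
  \<open>2 * D\<close> on \<open>w\<close> stands for the two transpositions in
  \<open>mean_decouple\<close>.\<close>

lemma stein_form_stable:
  assumes \<mu>: "\<And>k. k < H \<Longrightarrow> 0 \<le> \<mu> k \<and> \<mu> k \<le> (1::real)"
    and l: "\<And>k. k < H \<Longrightarrow> 0 \<le> l k \<and> l k \<le> (1::real)"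
    and D: "L2_set d {..<H} \<le> D" "0 \<le> D" "D \<le> 1" and w: "L2_set w {..<H} \<le> 2 * D"
  shows "cmod (stein_form H \<mu> l r d (\<lambda>k. v k + w k) - stein_form H \<mu> l r d v)
    \<le> 12 * D ^ 3 * (\<bar>r\<bar> + r\<^sup>2) * (1 + L2_set v {..<H}) ^ 3"
proof -
  define n where "n = L2_set v {..<H}"
  have n: "0 \<le> n" by (simp add: n_def L2_set_nonneg)
  define s1 s2 s3 where "s1 = (\<Sum>k<H. \<mu> k * d k * v k)" and "s2 = (\<Sum>k<H. l k * d k * v k)"
    and "s3 = (\<Sum>k<H. \<mu> k * (d k)\<^sup>2)"
  define t1 t2 where "t1 = (\<Sum>k<H. \<mu> k * d k * w k)" and "t2 = (\<Sum>k<H. l k * d k * w k)"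
  define \<delta> where "\<delta> = 2 * (\<Sum>k<H. l k * w k * v k) + (\<Sum>k<H. l k * (w k)\<^sup>2)"
  define e where "e = iexp (r * (\<Sum>k<H. l k * (v k)\<^sup>2))"
  define u where "u = iexp (r * \<delta>) - 1"
  have Dn: "L2_set d {..<H} * n \<le> D * n" using D n by (intro mult_right_mono) auto
  have Dw: "L2_set d {..<H} * L2_set w {..<H} \<le> D * (2 * D)"
    using D w by (intro mult_mono) (auto simp: L2_set_nonneg)
  have wn: "L2_set w {..<H} * n \<le> 2 * D * n" using w n by (intro mult_right_mono) auto
  have s1: "\<bar>s1\<bar> \<le> D * n"
    using abs_weighted_inner_le[of H \<mu> d v] \<mu> Dn unfolding s1_def n_def by fastforce
  have s2: "\<bar>s2\<bar> \<le> D * n"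
    using abs_weighted_inner_le[of H l d v] l Dn unfolding s2_def n_def by fastforce
  have t1: "\<bar>t1\<bar> \<le> D * (2 * D)"
    using abs_weighted_inner_le[of H \<mu> d w] \<mu> Dw unfolding t1_def by fastforce
  have t2: "\<bar>t2\<bar> \<le> D * (2 * D)"
    using abs_weighted_inner_le[of H l d w] l Dw unfolding t2_def by fastforce
  have s3: "0 \<le> s3" "s3 \<le> D\<^sup>2" unfolding s3_def using weighted_squares_bounds[OF \<mu> D(1)] by auto
  have DD: "D\<^sup>2 \<le> D" using D by (simp add: power2_eq_square mult_left_le)
  have \<delta>: "\<bar>\<delta>\<bar> \<le> 4 * D * (n + 1)"
  proof -
    have "\<bar>\<Sum>k<H. l k * w k * v k\<bar> \<le> 2 * D * n"
      using abs_weighted_inner_le[of H l w v] l wn unfolding n_def by fastforce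
    moreover have "0 \<le> (\<Sum>k<H. l k * (w k)\<^sup>2)" "(\<Sum>k<H. l k * (w k)\<^sup>2) \<le> (2 * D)\<^sup>2"
      using weighted_squares_bounds[where l = l and H = H, OF l w] by auto
    ultimately show ?thesis using DD unfolding \<delta>_def
      by (simp add: power_mult_distrib algebra_simps abs_le_iff)
  qed
  have e': "iexp (r * (\<Sum>k<H. l k * (v k + w k)\<^sup>2)) = e * (u + 1)"
    unfolding weighted_squares_add e_def u_def \<delta>_def[symmetric] distrib_left[of r] iexp_add by simp
  have ne: "cmod e = 1" "cmod (u + 1) = 1" unfolding e_def u_def by (simp_all only: norm_exp_i_times diff_add_cancel)
  have u1: "cmod u \<le> \<bar>r\<bar> * (4 * D * (n + 1))"
  proof -
    have "cmod u \<le> \<bar>r * \<delta>\<bar>" unfolding u_def by (rule iexp_diff_1)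
    also have "\<dots> \<le> \<bar>r\<bar> * (4 * D * (n + 1))" unfolding abs_mult using \<delta> by (intro mult_left_mono) auto
    finally show ?thesis .
  qed
  have sp: "\<bar>s1 * t2 + t1 * s2 + t1 * t2\<bar> \<le> 4 * D ^ 3 * (n + 1)"
  proof -
    have "\<bar>s1 * t2\<bar> \<le> (D * n) * (D * (2 * D))"
      unfolding abs_mult by (rule mult_mono[OF s1 t2]) (use D n in auto)
    moreover have "\<bar>t1 * s2\<bar> \<le> (D * (2 * D)) * (D * n)"
      unfolding abs_mult by (rule mult_mono[OF t1 s2]) (use D n in auto)
    moreover have "\<bar>t1 * t2\<bar> \<le> (D * (2 * D)) * (D * (2 * D))"
      unfolding abs_mult by (rule mult_mono[OF t1 t2]) (use D n in auto)
    moreover have "D * D * (D * D) \<le> D * D * D"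
      using mult_left_le[of D "D * D * D"] D by (simp add: mult.assoc)
    ultimately show ?thesis by (simp add: power3_eq_cube algebra_simps abs_le_iff)
  qed
  have ss: "\<bar>s1 * s2\<bar> \<le> (D * n) * (D * n)" unfolding abs_mult using s1 s2 by (intro mult_mono) auto
  have dv: "(\<Sum>k<H. \<mu> k * d k * (v k + w k)) = s1 + t1" "(\<Sum>k<H. l k * d k * (v k + w k)) = s2 + t2"
    unfolding s1_def s2_def t1_def t2_def by (simp_all add: sum.distrib[symmetric] distrib_left)
  have "stein_form H \<mu> l r d (\<lambda>k. v k + w k) - stein_form H \<mu> l r d v =
     e * (of_real s3 * u + 2 * \<i> * of_real r * (of_real (s1 * t2 + t1 * s2 + t1 * t2) * (u + 1) + of_real (s1 * s2) * u))"
    unfolding stein_form_def e' dv e_def[symmetric] s1_def[symmetric] s2_def[symmetric] s3_def[symmetric]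
    by (simp add: algebra_simps)
  also have "cmod \<dots> = cmod (of_real s3 * u + 2 * \<i> * of_real r * (of_real (s1 * t2 + t1 * s2 + t1 * t2) * (u + 1) + of_real (s1 * s2) * u))"
    by (simp add: norm_mult ne)
  also have "\<dots> \<le> s3 * cmod u + 2 * \<bar>r\<bar> * (\<bar>s1 * t2 + t1 * s2 + t1 * t2\<bar> + \<bar>s1 * s2\<bar> * cmod u)"
  proof -
    have "cmod (of_real (s1 * t2 + t1 * s2 + t1 * t2) * (u + 1) + of_real (s1 * s2) * u)
      \<le> \<bar>s1 * t2 + t1 * s2 + t1 * t2\<bar> + \<bar>s1 * s2\<bar> * cmod u"
      by (rule order_trans[OF norm_triangle_ineq]) (simp only: norm_mult norm_of_real ne mult_1_right order_refl)
    then have "cmod (2 * \<i> * of_real r * (of_real (s1 * t2 + t1 * s2 + t1 * t2) * (u + 1) + of_real (s1 * s2) * u))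
      \<le> 2 * \<bar>r\<bar> * (\<bar>s1 * t2 + t1 * s2 + t1 * t2\<bar> + \<bar>s1 * s2\<bar> * cmod u)"
      by (subst norm_mult) (auto simp: norm_mult intro!: mult_left_mono)
    moreover have "cmod (of_real s3 * u) = s3 * cmod u" using s3 by (simp add: norm_mult)
    ultimately show ?thesis
      using norm_triangle_ineq[of "of_real s3 * u" "2 * \<i> * of_real r * (of_real (s1 * t2 + t1 * s2 + t1 * t2) * (u + 1) + of_real (s1 * s2) * u)"]
      by linarith
  qed
  also have "\<dots> \<le> D\<^sup>2 * (\<bar>r\<bar> * (4 * D * (n + 1))) + 2 * \<bar>r\<bar> * (4 * D ^ 3 * (n + 1) + (D * n) * (D * n) * (\<bar>r\<bar> * (4 * D * (n + 1))))"
    using s3 u1 sp ss n D by (intro add_mono mult_mono) auto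
  also have "\<dots> = D ^ 3 * (\<bar>r\<bar> * (12 * (n + 1)) + \<bar>r\<bar> * \<bar>r\<bar> * (8 * n\<^sup>2 * (n + 1)))"
    by (simp add: power2_eq_square power3_eq_cube field_simps)
  also have "\<dots> \<le> D ^ 3 * (\<bar>r\<bar> * (12 * (1 + n) ^ 3) + \<bar>r\<bar> * \<bar>r\<bar> * (12 * (1 + n) ^ 3))"
  proof -
    have "8 * n\<^sup>2 * (n + 1) \<le> 12 * (1 + n) ^ 3" using cube_bounds(4)[OF n] n by (smt (verit) zero_le_power)
    then show ?thesis using cube_bounds(3)[OF n] D by (intro mult_left_mono add_mono) auto
  qed
  also have "\<dots> = 12 * D ^ 3 * (\<bar>r\<bar> + r\<^sup>2) * (1 + n) ^ 3" by (simp add: algebra_simps power2_eq_square)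
  finally show ?thesis unfolding n_def .
qed

section \<open>Stein identity for the randomization distribution\<close>

text \<open>Setting of the combinatorial central limit theorem: sums over units of array entries
  selected by the labels, with one array for each coordinate.\<close>

locale linear_statistics = assignment_space +
  fixes H :: nat and a :: "nat \<Rightarrow> nat \<Rightarrow> nat \<Rightarrow> real" and A :: real
  assumes centred: "\<And>k q. k < H \<Longrightarrow> q < Q \<Longrightarrow> (\<Sum>i<N. a k i q) = 0"
    and bounded: "\<And>k i q. k < H \<Longrightarrow> i < N \<Longrightarrow> q < Q \<Longrightarrow> \<bar>a k i q\<bar> \<le> A"
    and A_nonneg: "0 \<le> A"
begin

definition stat :: "nat \<Rightarrow> (nat \<Rightarrow> nat) \<Rightarrow> real" where
  "stat k z = (\<Sum>i<N. a k i (z i))"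

text \<open>The labels \<open>p\<close> of unit \<open>i\<close> and \<open>q\<close> of unit
  \<open>j\<close> are separate arguments, because decoupling feeds the rows \<open>i\<close>,
  \<open>j\<close> of the array with labels taken from other units.\<close>

definition jump :: "nat \<Rightarrow> nat \<Rightarrow> nat \<Rightarrow> nat \<Rightarrow> nat \<Rightarrow> real" where
  "jump i j p q k = a k i q + a k j p - a k i p - a k j q"

text \<open>Each coordinate of a jump consists of four entries bounded by \<open>A\<close>; the
  square root of \<open>H\<close> turns this into a bound for the Euclidean norm.\<close>

definition step :: real where "step = 4 * A * sqrt (real H)"

abbreviation nrm :: "(nat \<Rightarrow> nat) \<Rightarrow> real" where
  "nrm z \<equiv> L2_set (\<lambda>k. stat k z) {..<H}"

lemma step_nonneg: "0 \<le> step" by (simp add: step_def A_nonneg)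

lemma jump_same [simp]: "jump i i p q k = 0" by (simp add: jump_def)

lemma jump_flip: "jump i j q p k = - jump i j p q k" by (simp add: jump_def)

lemma stat_swap_at:
  assumes "i < N" "j < N"
  shows "stat k (swap_at i j z) = stat k z + jump i j (z i) (z j) k"
proof (cases "i = j")
  case True
  then show ?thesis by (simp add: swap_at_def)
next
  case False
  have 1: "(\<Sum>x<N. f x) = f i + f j + (\<Sum>x\<in>{..<N}-{i}-{j}. f x)" for f :: "nat \<Rightarrow> real"
    using assms False by (simp add: sum.remove[of "{..<N}" i] sum.remove[of "{..<N}-{i}" j])
  have "(\<Sum>x\<in>{..<N}-{i}-{j}. a k x (swap_at i j z x)) = (\<Sum>x\<in>{..<N}-{i}-{j}. a k x (z x))"
    by (intro sum.cong) (auto simp: swap_at_apply)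
  then show ?thesis
    unfolding stat_def 1 jump_def using False by (simp add: swap_at_apply)
qed

lemma norm_jump_le:
  assumes "i < N" "j < N" "p < Q" "q < Q"
  shows "L2_set (jump i j p q) {..<H} \<le> step"
proof -
  have "\<bar>jump i j p q k\<bar> \<le> 4 * A" if "k < H" for k
    using bounded[OF that assms(1,3)] bounded[OF that assms(1,4)] bounded[OF that assms(2,3)] bounded[OF that assms(2,4)]
    unfolding jump_def by linarith
  then have "(\<Sum>k<H. (jump i j p q k)\<^sup>2) \<le> (\<Sum>k<H. (4 * A)\<^sup>2)"
    by (intro sum_mono) (metis abs_ge_zero lessThan_iff power2_abs power_mono)
  also have "\<dots> = (4 * A)\<^sup>2 * real H" by simp
  finally show ?thesis
    unfolding L2_set_def step_def using A_nonneg
    by (metis (no_types, lifting) mult_nonneg_nonneg real_sqrt_abs real_sqrt_le_mono real_sqrt_mult abs_of_nonneg zero_le_numeral)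
qed

text \<open>Linear regression property of the exchangeable pair: centring removes the two sums in
  which the label belongs to the other unit, and each of the remaining two contributes
  \<open>N\<close> copies of the statistic.\<close>

lemma sum_jump:
  assumes "z \<in> \<Omega>" "k < H"
  shows "(\<Sum>i<N. \<Sum>j<N. jump i j (z i) (z j) k) = - 2 * real N * stat k z"
proof -
  have c1: "(\<Sum>i<N. \<Sum>j<N. a k i (z j)) = 0"
    by (subst sum.swap) (use assms centred assignment_less in auto)
  have c2: "(\<Sum>i<N. \<Sum>j<N. a k j (z i)) = 0"
    using assms centred assignment_less by simp
  have "(\<Sum>i<N. \<Sum>j<N. jump i j (z i) (z j) k) = (\<Sum>i<N. \<Sum>j<N. a k i (z j)) + (\<Sum>i<N. \<Sum>j<N. a k j (z i))
     - (\<Sum>i<N. \<Sum>j<N. a k i (z i)) - (\<Sum>i<N. \<Sum>j<N. a k j (z j))"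
    by (simp add: jump_def sum.distrib sum_subtractf)
  then show ?thesis unfolding c1 c2 by (simp add: stat_def sum_distrib_left mult.assoc)
qed

text \<open>The swap preserves the mean and reverses the jump, so \<open>f\<close> after the swap
  and \<open>f\<close> before it contribute opposite amounts. Their difference is \<open>- 2\<close>
  times the sum given by \<open>sum_jump\<close>, whence the factor \<open>4 * N\<close>.\<close>

lemma exchange_identity:
  fixes f :: "(nat \<Rightarrow> nat) \<Rightarrow> 'a::real_vector"
  assumes "k < H"
  shows "(4 * real N) *\<^sub>R E (\<lambda>z. stat k z *\<^sub>R f z) =
    (\<Sum>i<N. \<Sum>j<N. E (\<lambda>z. jump i j (z i) (z j) k *\<^sub>R (f (swap_at i j z) - f z)))"
proof -
  let ?S = "\<Sum>i<N. \<Sum>j<N. E (\<lambda>z. jump i j (z i) (z j) k *\<^sub>R f z)"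
  have S: "?S = (- 2 * real N) *\<^sub>R E (\<lambda>z. stat k z *\<^sub>R f z)"
  proof -
    have "?S = E (\<lambda>z. (\<Sum>i<N. \<Sum>j<N. jump i j (z i) (z j) k) *\<^sub>R f z)"
      by (simp add: fin_mean_sum scaleR_sum_left)
    also have "\<dots> = E (\<lambda>z. (- 2 * real N) *\<^sub>R (stat k z *\<^sub>R f z))"
      by (rule fin_mean_cong) (use sum_jump assms in simp)
    finally show ?thesis unfolding fin_mean_scaleR .
  qed
  have "E (\<lambda>z. jump i j (z i) (z j) k *\<^sub>R f (swap_at i j z)) = - E (\<lambda>z. jump i j (z i) (z j) k *\<^sub>R f z)"
    if ij: "i < N" "j < N" for i j
  proof -
    have "jump i j (swap_at i j z i) (swap_at i j z j) k = - jump i j (z i) (z j) k" for z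
      using jump_flip[of i j "z j" "z i" k] by (auto simp: swap_at_apply)
    then show ?thesis
      using mean_swap_at[OF ij, of "\<lambda>z. jump i j (z i) (z j) k *\<^sub>R f (swap_at i j z)"]
      by (simp add: fin_mean_minus)
  qed
  then have "(\<Sum>i<N. \<Sum>j<N. E (\<lambda>z. jump i j (z i) (z j) k *\<^sub>R (f (swap_at i j z) - f z))) = - 2 *\<^sub>R ?S"
    by (simp add: scaleR_diff_right fin_mean_diff scaleR_sum_right scaleR_2)
  then show ?thesis unfolding S by simp
qed

lemma nrm_power2: "(nrm z)\<^sup>2 = (\<Sum>k<H. (stat k z)\<^sup>2)"
  by (rule L2_set_power2)

end

section \<open>Moments and Stein's identity for standardized linear statistics\<close>

locale standardized_statistics = linear_statistics +
  assumes cov: "\<And>k l. k < H \<Longrightarrow> l < H \<Longrightarrow> E (\<lambda>z. stat k z * stat l z) = (if k = l then 1 else 0)"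
    and step_le_1: "step \<le> 1"
begin

lemma mean_nrm_power2: "E (\<lambda>z. (nrm z)\<^sup>2) = real H"
  unfolding nrm_power2 fin_mean_sum using cov by (simp add: power2_eq_square)

text \<open>\<open>exchange_identity\<close> with \<open>f z = stat k z * (nrm z)\<^sup>2\<close>,
  summed over \<open>k\<close>: the jump paired with the increment of this cubic vector is at most
  \<open>step\<^sup>2\<close> times a quadratic in \<open>nrm z\<close>. The fourth moment is
  thereby reduced to the second.\<close>

lemma mean_nrm_power4: "E (\<lambda>z. (nrm z) ^ 4) \<le> real N * step\<^sup>2 * (5 * real H + 3) / 4"
proof -
  have N: "real N > 0" using two_le_N by simp
  define g where "g z = (nrm z)\<^sup>2" for z
  have pt: "(\<Sum>k<H. jump i j (z i) (z j) k * (stat k (swap_at i j z) * g (swap_at i j z) - stat k z * g z))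
      \<le> step\<^sup>2 * (5 * (nrm z)\<^sup>2 + 3)" if z: "z \<in> \<Omega>" and ij: "i < N" "j < N" for z i j
  proof -
    define d where "d = jump i j (z i) (z j)"
    define n where "n = nrm z"
    have n: "0 \<le> n" by (simp add: n_def L2_set_nonneg)
    have d: "L2_set d {..<H} \<le> step"
      unfolding d_def using z ij by (intro norm_jump_le assignment_less) auto
    define s1 where "s1 = (\<Sum>k<H. d k * stat k z)"
    define s3 where "s3 = (\<Sum>k<H. (d k)\<^sup>2)"
    have s1: "\<bar>s1\<bar> \<le> step * n"
      using abs_weighted_inner_le[of H "\<lambda>_. 1" d "\<lambda>k. stat k z"] mult_right_mono[OF d n]
      unfolding s1_def n_def by simp
    have s3: "0 \<le> s3" "s3 \<le> step\<^sup>2"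
      using weighted_squares_bounds[where H = H and l = "\<lambda>_. 1" and d = d and D = step] d unfolding s3_def by auto
    have g': "g (swap_at i j z) = g z + (2 * s1 + s3)"
      unfolding g_def nrm_power2 stat_swap_at[OF ij] s1_def s3_def d_def[symmetric]
      using weighted_squares_add[where H = H and l = "\<lambda>_. 1" and v = "\<lambda>k. stat k z" and d = d]
      by (simp add: L2_set_power2)
    have gn: "g z = n\<^sup>2" by (simp add: g_def n_def)
    have "(\<Sum>k<H. jump i j (z i) (z j) k * (stat k (swap_at i j z) * g (swap_at i j z) - stat k z * g z))
       = s1 * (2 * s1 + s3) + s3 * (n\<^sup>2 + (2 * s1 + s3))"
      unfolding g' gn stat_swap_at[OF ij] d_def[symmetric] s1_def s3_def sum_distrib_right sum.distrib[symmetric]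
      by (intro sum.cong) (auto simp: algebra_simps power2_eq_square)
    also have "\<dots> = 2 * s1\<^sup>2 + 3 * (s1 * s3) + s3 * n\<^sup>2 + s3 * s3" by (simp add: algebra_simps power2_eq_square)
    also have "\<dots> \<le> 2 * (step * n)\<^sup>2 + 3 * (step * n * step) + step\<^sup>2 * n\<^sup>2 + step\<^sup>2 * 1"
    proof -
      have st: "step\<^sup>2 \<le> step" using step_le_1 step_nonneg by (simp add: power2_eq_square mult_left_le)
      have "s1\<^sup>2 \<le> (step * n)\<^sup>2" using s1 by (metis abs_ge_zero power2_abs power_mono)
      moreover have "s1 * s3 \<le> step * n * step" using s1 s3 st by (intro mult_mono) auto
      moreover have "s3 * n\<^sup>2 \<le> step\<^sup>2 * n\<^sup>2" using s3 by (intro mult_right_mono) auto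
      moreover have "s3 * s3 \<le> step\<^sup>2 * 1" using s3 st step_le_1 by (intro mult_mono) auto
      ultimately show ?thesis by linarith
    qed
    also have "\<dots> = step\<^sup>2 * (3 * n\<^sup>2 + 3 * n + 1)" by (simp add: algebra_simps power2_eq_square)
    also have "\<dots> \<le> step\<^sup>2 * (5 * n\<^sup>2 + 3)"
    proof -
      have "0 \<le> (n - 1)\<^sup>2" by simp
      then have "2 * n \<le> n\<^sup>2 + 1" by (simp add: power2_diff)
      then have "3 * n\<^sup>2 + 3 * n + 1 \<le> 5 * n\<^sup>2 + 3" using zero_le_power2[of n] by linarith
      then show ?thesis by (intro mult_left_mono) auto
    qed
    finally show ?thesis unfolding n_def .
  qed
  have "4 * real N * E (\<lambda>z. (nrm z) ^ 4) = (\<Sum>k<H. 4 * real N * E (\<lambda>z. stat k z * (stat k z * g z)))"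
  proof -
    have "(nrm z) ^ 4 = (\<Sum>k<H. stat k z * (stat k z * g z))" for z
    proof -
      have "(nrm z) ^ 4 = (nrm z)\<^sup>2 * g z" by (simp add: g_def power2_eq_square numeral_eq_Suc)
      then show ?thesis unfolding nrm_power2 sum_distrib_right by (simp add: power2_eq_square mult.assoc)
    qed
    then show ?thesis by (simp add: fin_mean_sum sum_distrib_left)
  qed
  also have "\<dots> = (\<Sum>k<H. \<Sum>i<N. \<Sum>j<N. E (\<lambda>z. jump i j (z i) (z j) k * (stat k (swap_at i j z) * g (swap_at i j z) - stat k z * g z)))"
    using exchange_identity[where f = "\<lambda>z. stat _ z * g z"] by (intro sum.cong) auto
  also have "\<dots> = (\<Sum>i<N. \<Sum>j<N. E (\<lambda>z. \<Sum>k<H. jump i j (z i) (z j) k * (stat k (swap_at i j z) * g (swap_at i j z) - stat k z * g z)))"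
    by (simp add: fin_mean_sum sum.swap[of _ "{..<H}"])
  also have "\<dots> \<le> (\<Sum>i<N. \<Sum>j<N. E (\<lambda>z. step\<^sup>2 * (5 * (nrm z)\<^sup>2 + 3)))"
    by (intro sum_mono fin_mean_mono pt) auto
  also have "\<dots> = real N * (real N * (step\<^sup>2 * (5 * real H + 3)))"
    by (simp add: fin_mean_mult_left fin_mean_add mean_nrm_power2 fin_mean_const)
  finally have "4 * real N * E (\<lambda>z. (nrm z) ^ 4) \<le> real N * (real N * (step\<^sup>2 * (5 * real H + 3)))" .
  then have "real N * (4 * E (\<lambda>z. (nrm z) ^ 4)) \<le> real N * (real N * step\<^sup>2 * (5 * real H + 3))"
    by (simp only: ac_simps)
  then have "4 * E (\<lambda>z. (nrm z) ^ 4) \<le> real N * step\<^sup>2 * (5 * real H + 3)"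
    using N by (rule mult_left_le_imp_le)
  then show ?thesis by simp
qed

text \<open>Interpolation between the second and fourth moments. In the design
  \<open>N * step\<^sup>2\<close> is of order \<open>H\<^sup>2\<close>, so with weights
  \<open>H\<close> and \<open>1 / H\<close> both parts have the same order.\<close>

lemma mean_nrm_cube: "E (\<lambda>z. (1 + nrm z) ^ 3) \<le> 4 + 2 * (real H)\<^sup>2 + 4 * (real N * step\<^sup>2)"
proof (cases "H = 0")
  case True
  then show ?thesis by (simp add: fin_mean_const)
next
  case False
  then have H: "1 \<le> real H" by simp
  have "(1 + nrm z) ^ 3 \<le> 4 + 2 * (real H * (nrm z)\<^sup>2 + (nrm z) ^ 4 / real H)" for z
  proof -
    define n where "n = nrm z"
    have n: "0 \<le> n" by (simp add: n_def L2_set_nonneg)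
    have "0 \<le> 3 * ((n - 1)\<^sup>2 * (n + 1))" using n by (intro mult_nonneg_nonneg) auto
    then have "(1 + n) ^ 3 \<le> 4 + 4 * n ^ 3"
      by (simp add: power2_eq_square power3_eq_cube algebra_simps)
    moreover have "0 \<le> n\<^sup>2 * (real H - n)\<^sup>2 / real H" by simp
    then have "2 * n ^ 3 \<le> real H * n\<^sup>2 + n ^ 4 / real H"
      using H by (simp add: power2_eq_square power3_eq_cube field_simps numeral_eq_Suc)
    ultimately have "(1 + n) ^ 3 \<le> 4 + 2 * (2 * n ^ 3)" "2 * (2 * n ^ 3) \<le> 2 * (real H * n\<^sup>2 + n ^ 4 / real H)"
      by simp_all
    then show ?thesis unfolding n_def[symmetric] by (rule order_trans[OF _ add_left_mono])
  qed
  then have "E (\<lambda>z. (1 + nrm z) ^ 3) \<le> E (\<lambda>z. 4 + 2 * (real H * (nrm z)\<^sup>2 + (nrm z) ^ 4 / real H))"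
    by (intro fin_mean_mono)
  also have "\<dots> = 4 + 2 * (real H * real H + E (\<lambda>z. (nrm z) ^ 4) / real H)"
    by (simp add: fin_mean_mult_left fin_mean_add mean_nrm_power2 fin_mean_const fin_mean_divide)
  also have "E (\<lambda>z. (nrm z) ^ 4) / real H \<le> 2 * (real N * step\<^sup>2)"
  proof -
    have "E (\<lambda>z. (nrm z) ^ 4) \<le> real N * step\<^sup>2 * (5 * real H + 3) / 4" by (rule mean_nrm_power4)
    also have "\<dots> \<le> real N * step\<^sup>2 * (8 * real H) / 4"
      using H by (intro divide_right_mono mult_left_mono) auto
    finally show ?thesis using H by (simp add: field_simps)
  qed
  finally show ?thesis by (simp add: power2_eq_square)
qed

text \<open>\<open>exchange_identity\<close> with \<open>f = stat l\<close> evaluates the total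
  second moment of the jumps exactly from the covariance of the statistics, with no computation for
  individual pairs.\<close>

lemma jump_cov:
  assumes "k < H" "l < H"
  shows "(\<Sum>i<N. \<Sum>j\<in>{..<N}-{i}. pair_total (\<lambda>p q. jump i j p q k * jump i j p q l) / (real N * (real N - 1)))
    = (if k = l then 4 * real N else 0)"
proof -
  have "(\<Sum>i<N. \<Sum>j\<in>{..<N}-{i}. pair_total (\<lambda>p q. jump i j p q k * jump i j p q l) / (real N * (real N - 1)))
      = (\<Sum>i<N. \<Sum>j\<in>{..<N}-{i}. E (\<lambda>z. jump i j (z i) (z j) k * jump i j (z i) (z j) l))"
    by (intro sum.cong refl mean_pair[symmetric]) auto
  also have "\<dots> = (\<Sum>i<N. \<Sum>j<N. E (\<lambda>z. jump i j (z i) (z j) k *\<^sub>R (stat l (swap_at i j z) - stat l z)))"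
    unfolding sum_off_diagonal by (simp add: stat_swap_at fin_mean_const)
  also have "\<dots> = 4 * real N * E (\<lambda>z. stat k z * stat l z)"
    using exchange_identity[OF assms(1), of "stat l"] by simp
  finally show ?thesis using cov[OF assms] by simp
qed

text \<open>Stein's identity for a quadratic form, up to third order errors: for a standard Gaussian vector
  the left-hand side vanishes.\<close>

lemma approximate_stein_identity:
  fixes \<mu> l :: "nat \<Rightarrow> real" and r :: real
  assumes \<mu>: "\<And>k. k < H \<Longrightarrow> 0 \<le> \<mu> k \<and> \<mu> k \<le> (1::real)"
    and l: "\<And>k. k < H \<Longrightarrow> 0 \<le> l k \<and> l k \<le> (1::real)"
  defines "e \<equiv> \<lambda>z. iexp (r * (\<Sum>k<H. l k * (stat k z)\<^sup>2))"
  shows "cmod (E (\<lambda>z. of_real (\<Sum>k<H. \<mu> k * (stat k z)\<^sup>2) * e z) - of_real (\<Sum>k<H. \<mu> k) * E e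
      - 2 * \<i> * of_real r * E (\<lambda>z. of_real (\<Sum>k<H. \<mu> k * l k * (stat k z)\<^sup>2) * e z))
    \<le> 4 * real N * step ^ 3 * (\<bar>r\<bar> + r\<^sup>2) * E (\<lambda>z. (1 + nrm z) ^ 3)"
proof -
  have N: "real N > 0" using two_le_N by simp
  define K where "K = real N * (real N - 1)"
  have K: "K > 0" unfolding K_def using two_le_N by simp
  define \<rho> where "\<rho> = \<bar>r\<bar> + r\<^sup>2"
  define M where "M = E (\<lambda>z. (1 + nrm z) ^ 3)"
  define st where "st z = (\<lambda>k. stat k z)" for z
  have \<rho>: "0 \<le> \<rho>" by (simp add: \<rho>_def)
  define \<Psi> where "\<Psi> i j p q z = stein_form H \<mu> l r (jump i j p q) (st z)" for i j p q z
  have e_def': "e z = iexp (r * (\<Sum>k<H. l k * (st z k)\<^sup>2))" for z by (simp add: e_def st_def)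

  have taylor: "cmod ((\<Sum>k<H. of_real (\<mu> k) * (jump i j (z i) (z j) k *\<^sub>R
        (of_real (stat k (swap_at i j z)) * e (swap_at i j z) - of_real (stat k z) * e z))) - \<Psi> i j (z i) (z j) z)
      \<le> 3 * step ^ 3 * \<rho> * (1 + nrm z) ^ 3"
    if z: "z \<in> \<Omega>" and ij: "i < N" "j < N" for z i j
  proof -
    have d: "L2_set (jump i j (z i) (z j)) {..<H} \<le> step"
      using z ij by (intro norm_jump_le assignment_less) auto
    show ?thesis
      using stein_form_taylor[of H \<mu> l "jump i j (z i) (z j)" step "st z" r, OF \<mu> l d step_nonneg step_le_1]
      unfolding \<Psi>_def e_def' st_def stat_swap_at[OF ij] \<rho>_def
      by (simp add: scaleR_conv_of_real mult.assoc)
  qed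

  \<comment> \<open>\<open>exchange_identity\<close> with \<open>f z = stat k z * e z\<close>,
    weighted by \<open>\<mu> k\<close>.\<close>
  have lhs: "(4 * real N) *\<^sub>R E (\<lambda>z. of_real (\<Sum>k<H. \<mu> k * (stat k z)\<^sup>2) * e z) =
     (\<Sum>i<N. \<Sum>j<N. E (\<lambda>z. \<Sum>k<H. of_real (\<mu> k) * (jump i j (z i) (z j) k *\<^sub>R
        (of_real (stat k (swap_at i j z)) * e (swap_at i j z) - of_real (stat k z) * e z))))"
  proof -
    have "(4 * real N) *\<^sub>R E (\<lambda>z. of_real (\<Sum>k<H. \<mu> k * (stat k z)\<^sup>2) * e z)
        = (\<Sum>k<H. of_real (\<mu> k) * ((4 * real N) *\<^sub>R E (\<lambda>z. stat k z *\<^sub>R (of_real (stat k z) * e z))))"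
    proof -
      have eq: "of_real (\<Sum>k<H. \<mu> k * (stat k z)\<^sup>2) * e z =
          (\<Sum>k<H. of_real (\<mu> k) * (stat k z *\<^sub>R (of_real (stat k z) * e z)))" for z
        by (simp add: sum_distrib_right scaleR_conv_of_real power2_eq_square mult.assoc)
      show ?thesis
        unfolding eq fin_mean_sum fin_mean_mult_left scaleR_sum_right by (simp only: mult_scaleR_right)
    qed
    also have "\<dots> = (\<Sum>k<H. of_real (\<mu> k) * (\<Sum>i<N. \<Sum>j<N. E (\<lambda>z. jump i j (z i) (z j) k *\<^sub>R
        (of_real (stat k (swap_at i j z)) * e (swap_at i j z) - of_real (stat k z) * e z))))"
      by (intro sum.cong refl arg_cong2[where f = "(*)"] exchange_identity) auto
    finally show ?thesis
      unfolding fin_mean_sum fin_mean_mult_left sum_distrib_left by (simp only: sum.swap[of _ "{..<H}"])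
  qed
  have step1: "cmod ((4 * real N) *\<^sub>R E (\<lambda>z. of_real (\<Sum>k<H. \<mu> k * (stat k z)\<^sup>2) * e z)
      - (\<Sum>i<N. \<Sum>j<N. E (\<lambda>z. \<Psi> i j (z i) (z j) z))) \<le> (real N)\<^sup>2 * (3 * step ^ 3 * \<rho> * M)"
  proof -
    have "cmod ((\<Sum>i<N. \<Sum>j<N. E (\<lambda>z. \<Sum>k<H. of_real (\<mu> k) * (jump i j (z i) (z j) k *\<^sub>R
        (of_real (stat k (swap_at i j z)) * e (swap_at i j z) - of_real (stat k z) * e z))))
      - (\<Sum>i<N. \<Sum>j<N. E (\<lambda>z. \<Psi> i j (z i) (z j) z))) \<le> (\<Sum>i<N. \<Sum>j<N. E (\<lambda>z. 3 * step ^ 3 * \<rho> * (1 + nrm z) ^ 3))"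
      unfolding sum_subtractf[symmetric] fin_mean_diff[symmetric]
      by (intro sum_norm_le norm_fin_mean_le taylor) auto
    also have "\<dots> = (real N)\<^sup>2 * (3 * step ^ 3 * \<rho> * M)"
      by (simp add: fin_mean_mult_left M_def power2_eq_square)
    finally show ?thesis unfolding lhs .
  qed

  have stable: "cmod (\<Psi> i j p q (swap_at c d (swap_at a' b z)) - \<Psi> i j p q z) \<le> 12 * step ^ 3 * \<rho> * (1 + nrm z) ^ 3"
    if "z \<in> \<Omega>" "i < N" "j < N" "p < Q" "q < Q" "a' < N" "b < N" "c < N" "d < N" for i j p q a' b c d z
  proof -
    define z' where "z' = swap_at a' b z"
    have z': "z' \<in> \<Omega>" unfolding z'_def using that by (intro swap_at_assignment)
    define w where "w k = jump a' b (z a') (z b) k + jump c d (z' c) (z' d) k" for k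
    have w: "L2_set w {..<H} \<le> 2 * step"
    proof -
      have "L2_set w {..<H} \<le> L2_set (jump a' b (z a') (z b)) {..<H} + L2_set (jump c d (z' c) (z' d)) {..<H}"
        unfolding w_def by (rule L2_set_triangle_ineq)
      also have "\<dots> \<le> step + step"
        using that z' by (intro add_mono norm_jump_le assignment_less) auto
      finally show ?thesis by simp
    qed
    have *: "st (swap_at c d z') = (\<lambda>k. st z k + w k)"
      unfolding st_def stat_swap_at[OF that(8,9)] w_def z'_def stat_swap_at[OF that(6,7)] by (simp add: add.assoc)
    have d: "L2_set (jump i j p q) {..<H} \<le> step" using that by (intro norm_jump_le)
    show ?thesis
      unfolding \<Psi>_def z'_def[symmetric] * \<rho>_def
      using stein_form_stable[of H \<mu> l "jump i j p q" step w r "st z", OF \<mu> l d step_nonneg step_le_1 w]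
      by (simp add: st_def)
  qed
  \<comment> \<open>\<open>\<Theta> i j\<close> keeps the rows \<open>i\<close>, \<open>j\<close> of
    the jump but averages its labels over all pairs of units; for every assignment that average is
    the same number, so it factors out of the mean.\<close>
  define \<Theta> where "\<Theta> i j = (\<Sum>i'<N. \<Sum>j'\<in>{..<N}-{i'}. E (\<lambda>z. \<Psi> i j (z i') (z j') z)) /\<^sub>R K" for i j
  have dec: "cmod (E (\<lambda>z. \<Psi> i j (z i) (z j) z) - \<Theta> i j) \<le> 12 * step ^ 3 * \<rho> * M"
    if ij: "i < N" "j < N" "i \<noteq> j" for i j
  proof -
    have "cmod (E (\<lambda>z. \<Psi> i j (z i) (z j) z) - \<Theta> i j)
       \<le> (\<Sum>i'<N. \<Sum>j'\<in>{..<N}-{i'}. E (\<lambda>z. 12 * step ^ 3 * \<rho> * (1 + nrm z) ^ 3)) / K"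
      unfolding \<Theta>_def K_def by (rule mean_decouple[OF ij]) (use stable ij in blast)
    also have "\<dots> = 12 * step ^ 3 * \<rho> * M"
      unfolding sum_pairs_const K_def[symmetric] using K by (simp add: fin_mean_mult_left M_def)
    finally show ?thesis .
  qed
  \<comment> \<open>Decoupling needs distinct units; the pairs \<open>(i, i)\<close> contribute
    nothing to the sum.\<close>
  have Psi0: "\<Psi> i i p q z = 0" for i p q z unfolding \<Psi>_def stein_form_def by simp
  have step2: "cmod ((\<Sum>i<N. \<Sum>j<N. E (\<lambda>z. \<Psi> i j (z i) (z j) z)) - (\<Sum>i<N. \<Sum>j\<in>{..<N}-{i}. \<Theta> i j))
      \<le> (real N)\<^sup>2 * (12 * step ^ 3 * \<rho> * M)"
  proof -
    have M: "0 \<le> M" unfolding M_def by (intro fin_mean_nonneg) (simp add: L2_set_nonneg)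
    have c: "0 \<le> 12 * step ^ 3 * \<rho> * M" using M \<rho> step_nonneg by simp
    have eq: "(\<Sum>i<N. \<Sum>j<N. E (\<lambda>z. \<Psi> i j (z i) (z j) z)) = (\<Sum>i<N. \<Sum>j\<in>{..<N}-{i}. E (\<lambda>z. \<Psi> i j (z i) (z j) z))"
      unfolding sum_off_diagonal by (simp add: Psi0 fin_mean_const)
    have "cmod ((\<Sum>i<N. \<Sum>j<N. E (\<lambda>z. \<Psi> i j (z i) (z j) z)) - (\<Sum>i<N. \<Sum>j\<in>{..<N}-{i}. \<Theta> i j))
        \<le> (\<Sum>i<N. \<Sum>j\<in>{..<N}-{i}. 12 * step ^ 3 * \<rho> * M)"
      unfolding eq sum_subtractf[symmetric] by (intro sum_norm_le dec) auto
    also have "\<dots> = K * (12 * step ^ 3 * \<rho> * M)" unfolding sum_pairs_const K_def by simp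
    also have "\<dots> \<le> (real N)\<^sup>2 * (12 * step ^ 3 * \<rho> * M)"
      using c by (intro mult_right_mono) (auto simp: K_def power2_eq_square algebra_simps)
    finally show ?thesis .
  qed

  \<comment> \<open>Second moments of the jump of the rows \<open>i\<close>, \<open>j\<close> when
    its labels are those of a uniformly chosen pair. Summed over \<open>i\<close> and
    \<open>j\<close> they form \<open>4 * N\<close> times the identity, by
    \<open>jump_cov\<close>.\<close>
  define C where "C i j k m = pair_total (\<lambda>p q. jump i j p q k * jump i j p q m) / K" for i j k m
  have C: "(\<Sum>i<N. \<Sum>j\<in>{..<N}-{i}. C i j k m) = (if k = m then 4 * real N else 0)" if "k < H" "m < H" for k m
    unfolding C_def K_def by (rule jump_cov[OF that])
  have Theta: "\<Theta> i j = (\<Sum>k<H. of_real (\<mu> k * C i j k k) * E e) +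
      (\<Sum>k<H. \<Sum>m<H. of_real (C i j k m) * (2 * \<i> * of_real r * E (\<lambda>z. of_real (\<mu> k * l m * stat k z * stat m z) * e z)))" for i j
  proof -
    have Psi: "\<Psi> i j p q z = (\<Sum>k<H. of_real (jump i j p q k * jump i j p q k) * (of_real (\<mu> k) * e z)) +
        (\<Sum>k<H. \<Sum>m<H. of_real (jump i j p q k * jump i j p q m) * (2 * \<i> * of_real r * (of_real (\<mu> k * l m * stat k z * stat m z) * e z)))"
      for p q z
    proof -
      let ?d = "jump i j p q"
      have "\<Psi> i j p q z = (of_real (\<Sum>k<H. \<mu> k * (?d k)\<^sup>2) + 2 * \<i> * of_real r *
          of_real (\<Sum>k<H. \<mu> k * ?d k * stat k z) * of_real (\<Sum>k<H. l k * ?d k * stat k z)) * e z"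
        unfolding \<Psi>_def stein_form_def e_def st_def ..
      also have "\<dots> = of_real (\<Sum>k<H. \<mu> k * (?d k)\<^sup>2) * e z + 2 * \<i> * of_real r *
          (of_real ((\<Sum>k<H. \<mu> k * ?d k * stat k z) * (\<Sum>k<H. l k * ?d k * stat k z)) * e z)"
        unfolding of_real_mult by (simp only: distrib_right mult.assoc)
      also have "(\<Sum>k<H. \<mu> k * ?d k * stat k z) * (\<Sum>k<H. l k * ?d k * stat k z) =
          (\<Sum>k<H. \<Sum>m<H. (?d k * ?d m) * (\<mu> k * l m * stat k z * stat m z))"
        unfolding sum_product by (intro sum.cong refl) simp
      also have "(\<Sum>k<H. \<mu> k * (?d k)\<^sup>2) = (\<Sum>k<H. (?d k * ?d k) * \<mu> k)"
        by (intro sum.cong refl) (simp add: power2_eq_square)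
      finally show ?thesis
        unfolding of_real_sum sum_distrib_left sum_distrib_right
        by (simp only: of_real_mult mult.assoc mult.left_commute)
    qed
    have tot: "(\<Sum>i'<N. \<Sum>j'\<in>{..<N}-{i'}. of_real (G (z i') (z j'))) = (of_real (pair_total G) :: complex)"
      if "z \<in> \<Omega>" for z G
      using sum_over_pairs[OF that, of G] by (simp only: of_real_sum[symmetric])
    have "(\<Sum>i'<N. \<Sum>j'\<in>{..<N}-{i'}. \<Psi> i j (z i') (z j') z) =
       (\<Sum>k<H. of_real (K * C i j k k) * (of_real (\<mu> k) * e z)) +
        (\<Sum>k<H. \<Sum>m<H. of_real (K * C i j k m) * (2 * \<i> * of_real r * (of_real (\<mu> k * l m * stat k z * stat m z) * e z)))"
      if z: "z \<in> \<Omega>" for z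
    proof -
      have "(\<Sum>i'<N. \<Sum>j'\<in>{..<N}-{i'}. \<Psi> i j (z i') (z j') z) =
        (\<Sum>k<H. (\<Sum>i'<N. \<Sum>j'\<in>{..<N}-{i'}. of_real (jump i j (z i') (z j') k * jump i j (z i') (z j') k)) * (of_real (\<mu> k) * e z)) +
        (\<Sum>k<H. \<Sum>m<H. (\<Sum>i'<N. \<Sum>j'\<in>{..<N}-{i'}. of_real (jump i j (z i') (z j') k * jump i j (z i') (z j') m)) *
            (2 * \<i> * of_real r * (of_real (\<mu> k * l m * stat k z * stat m z) * e z)))"
        unfolding Psi sum.distrib sum_distrib_right
        by (simp only: sum.swap[of _ "{..<H}" "{..<N}"] sum.swap[of _ "{..<H}" "{..<N} - {_}"])
      then show ?thesis
        unfolding tot[OF z, of "\<lambda>p q. jump i j p q _ * jump i j p q _"] C_def using K by simp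
    qed
    then have "\<Theta> i j = E (\<lambda>z. (\<Sum>k<H. of_real (K * C i j k k) * (of_real (\<mu> k) * e z)) +
        (\<Sum>k<H. \<Sum>m<H. of_real (K * C i j k m) * (2 * \<i> * of_real r * (of_real (\<mu> k * l m * stat k z * stat m z) * e z)))) /\<^sub>R K"
      unfolding \<Theta>_def fin_mean_sum[symmetric] by (intro arg_cong2[where f = "(*\<^sub>R)"] refl fin_mean_cong) auto
    moreover have kk: "(of_real (K * c) * x) /\<^sub>R K = of_real c * x" for c and x :: complex
      using K by (simp add: scaleR_conv_of_real)
    ultimately have "\<Theta> i j = (\<Sum>k<H. of_real (C i j k k) * (of_real (\<mu> k) * E e)) +
      (\<Sum>k<H. \<Sum>m<H. of_real (C i j k m) * (2 * \<i> * of_real r * E (\<lambda>z. of_real (\<mu> k * l m * stat k z * stat m z) * e z)))"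
      by (simp only: fin_mean_add fin_mean_sum fin_mean_mult_left scaleR_add_right scaleR_sum_right)
    then show ?thesis by (simp only: of_real_mult ac_simps)
  qed
  have total: "(\<Sum>i<N. \<Sum>j\<in>{..<N}-{i}. \<Theta> i j) = of_real (4 * real N) * (of_real (\<Sum>k<H. \<mu> k) * E e
      + 2 * \<i> * of_real r * E (\<lambda>z. of_real (\<Sum>k<H. \<mu> k * l k * (stat k z)\<^sup>2) * e z))"
  proof -
    define T where "T k m = 2 * \<i> * of_real r * E (\<lambda>z. of_real (\<mu> k * l m * stat k z * stat m z) * e z)" for k m
    have Theta': "\<Theta> i j = (\<Sum>k<H. of_real (\<mu> k * C i j k k) * E e) + (\<Sum>k<H. \<Sum>m<H. of_real (C i j k m) * T k m)" for i j
      unfolding Theta T_def ..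
    have "(\<Sum>i<N. \<Sum>j\<in>{..<N}-{i}. \<Theta> i j) =
       (\<Sum>k<H. of_real (\<mu> k * (\<Sum>i<N. \<Sum>j\<in>{..<N}-{i}. C i j k k)) * E e) +
       (\<Sum>k<H. \<Sum>m<H. of_real (\<Sum>i<N. \<Sum>j\<in>{..<N}-{i}. C i j k m) * T k m)"
      unfolding Theta' sum.distrib of_real_mult of_real_sum sum_distrib_left sum_distrib_right
      by (simp only: sum.swap[of _ "{..<H}" "{..<N}"] sum.swap[of _ "{..<H}" "{..<N} - {_}"])
    also have "\<dots> = (\<Sum>k<H. of_real (\<mu> k * (4 * real N)) * E e) + (\<Sum>k<H. of_real (4 * real N) * T k k)"
    proof (intro arg_cong2[where f = "(+)"] sum.cong refl)
      fix k assume k: "k \<in> {..<H}"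
      then show "of_real (\<mu> k * (\<Sum>i<N. \<Sum>j\<in>{..<N}-{i}. C i j k k)) * E e = of_real (\<mu> k * (4 * real N)) * E e"
        using C by simp
      have "(\<Sum>m<H. of_real (\<Sum>i<N. \<Sum>j\<in>{..<N}-{i}. C i j k m) * T k m) = (\<Sum>m<H. if m = k then of_real (4 * real N) * T k m else 0)"
        using k C by (intro sum.cong) auto
      then show "(\<Sum>m<H. of_real (\<Sum>i<N. \<Sum>j\<in>{..<N}-{i}. C i j k m) * T k m) = of_real (4 * real N) * T k k"
        using k by (simp add: sum.delta)
    qed
    also have "(\<Sum>k<H. of_real (4 * real N) * T k k) =
       of_real (4 * real N) * (2 * \<i> * of_real r * E (\<lambda>z. of_real (\<Sum>k<H. \<mu> k * l k * (stat k z)\<^sup>2) * e z))"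
      unfolding T_def of_real_sum sum_distrib_right fin_mean_sum sum_distrib_left
      by (simp add: power2_eq_square mult.assoc)
    finally show ?thesis by (simp add: sum_distrib_left sum_distrib_right algebra_simps)
  qed
  let ?L = "E (\<lambda>z. of_real (\<Sum>k<H. \<mu> k * (stat k z)\<^sup>2) * e z)"
  let ?R = "of_real (\<Sum>k<H. \<mu> k) * E e + 2 * \<i> * of_real r * E (\<lambda>z. of_real (\<Sum>k<H. \<mu> k * l k * (stat k z)\<^sup>2) * e z)"
  have "4 * real N * cmod (?L - ?R) = cmod ((4 * real N) *\<^sub>R (?L - ?R))" by simp
  also have "(4 * real N) *\<^sub>R (?L - ?R) = (4 * real N) *\<^sub>R ?L - (\<Sum>i<N. \<Sum>j\<in>{..<N}-{i}. \<Theta> i j)"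
    unfolding total scaleR_diff_right by (simp add: scaleR_conv_of_real)
  also have "cmod \<dots> \<le> (real N)\<^sup>2 * (3 * step ^ 3 * \<rho> * M) + (real N)\<^sup>2 * (12 * step ^ 3 * \<rho> * M)"
    by (rule norm_diff_triangle_le[OF step1 step2])
  \<comment> \<open>The Taylor error \<open>3\<close> and the decoupling error \<open>12\<close> add
    up to \<open>15\<close>, rounded up to \<open>16\<close> before dividing by
    \<open>4 * N\<close>.\<close>
  also have "\<dots> \<le> 4 * real N * (4 * real N * step ^ 3 * \<rho> * M)"
  proof -
    have "0 \<le> (real N)\<^sup>2 * (step ^ 3 * \<rho> * M)" unfolding M_def using \<rho> step_nonneg
      by (intro mult_nonneg_nonneg fin_mean_nonneg) (auto simp: L2_set_nonneg)
    then show ?thesis by (simp add: power2_eq_square algebra_simps)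
  qed
  finally have "cmod (?L - ?R) \<le> 4 * real N * step ^ 3 * \<rho> * M"
    by (rule mult_left_le_imp_le) (use N in simp)
  then show ?thesis unfolding \<rho>_def M_def by (simp add: diff_diff_eq)
qed

end

section \<open>From the Stein identity to characteristic functions\<close>

lemma norm_integral_le_integral:
  fixes f :: "'a \<Rightarrow> 'b::{banach,second_countable_topology}"
  assumes "integrable M f" "integrable M g" "\<And>x. x \<in> space M \<Longrightarrow> norm (f x) \<le> g x"
  shows "norm (\<integral>x. f x \<partial>M) \<le> (\<integral>x. g x \<partial>M)"
  by (rule order_trans[OF integral_norm_bound]) (use assms in \<open>auto intro: integral_mono\<close>)

lemma (in prob_space) integrable_iexp [simp]:
  assumes "f \<in> borel_measurable M"
  shows "integrable M (\<lambda>x. iexp (f x))"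
  by (rule integrable_const_bound[of _ 1]) (use assms in \<open>auto simp del: of_real_mult\<close>)

lemma (in prob_space) integrable_mult_iexp:
  fixes g :: "'a \<Rightarrow> real"
  assumes "integrable M g" "f \<in> borel_measurable M"
  shows "integrable M (\<lambda>x. of_real (g x) * iexp (f x))"
  by (rule Bochner_Integration.integrable_bound[OF assms(1)]) (use assms in \<open>auto simp: norm_mult\<close>)

lemma (in prob_space) norm_expectation_iexp_le:
  assumes "f \<in> borel_measurable M"
  shows "cmod (expectation (\<lambda>x. iexp (f x))) \<le> 1"
proof -
  have "cmod (expectation (\<lambda>x. iexp (f x))) \<le> expectation (\<lambda>x. cmod (iexp (f x)))"
    by (rule integral_norm_bound)
  then show ?thesis by (simp add: prob_space)
qed

lemma (in prob_space) norm_expectation_mult_iexp_le: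
  fixes g :: "'a \<Rightarrow> real"
  assumes "\<And>x. 0 \<le> g x"
  shows "cmod (expectation (\<lambda>x. of_real (g x) * iexp (f x))) \<le> expectation g"
proof -
  have "cmod (expectation (\<lambda>x. of_real (g x) * iexp (f x))) \<le> expectation (\<lambda>x. cmod (of_real (g x) * iexp (f x)))"
    by (rule integral_norm_bound)
  also have "\<dots> = expectation g" using assms by (simp add: norm_mult)
  finally show ?thesis .
qed

lemma (in prob_space) integrable_of_square_integrable:
  fixes X :: "'a \<Rightarrow> real"
  assumes X: "X \<in> borel_measurable M" and X2: "integrable M (\<lambda>x. (X x)\<^sup>2)"
  shows "integrable M X"
proof (rule Bochner_Integration.integrable_bound[of M "\<lambda>x. 1 + (X x)\<^sup>2"])
  show "AE x in M. norm (X x) \<le> norm (1 + (X x)\<^sup>2)"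
  proof (rule AE_I2)
    fix x
    have "0 \<le> (\<bar>X x\<bar> - 1)\<^sup>2" by simp
    then show "norm (X x) \<le> norm (1 + (X x)\<^sup>2)" by (simp add: power2_diff)
  qed
qed (use assms in auto)

text \<open>With a second moment, the first order Taylor remainder of \<open>iexp\<close> integrates
  to at most a multiple of \<open>(y - t)\<^sup>2\<close>, which gives the derivative straight from
  its definition.\<close>

lemma (in prob_space) expectation_iexp_has_derivative:
  fixes X :: "'a \<Rightarrow> real"
  assumes X [measurable]: "X \<in> borel_measurable M" and X2: "integrable M (\<lambda>x. (X x)\<^sup>2)"
  shows "((\<lambda>t. expectation (\<lambda>x. iexp (t * X x))) has_vector_derivative
    expectation (\<lambda>x. \<i> * (of_real (X x) * iexp (t * X x)))) (at t)"
  unfolding has_vector_derivative_def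
proof (rule has_derivativeI_sandwich[of 1 _ _ _ _ "\<lambda>y. \<bar>y - t\<bar> * expectation (\<lambda>x. (X x)\<^sup>2)"])
  have X1: "integrable M X" by (rule integrable_of_square_integrable[OF X X2])
  let ?D = "expectation (\<lambda>x. \<i> * (of_real (X x) * iexp (t * X x)))"
  fix y :: real assume y: "y \<noteq> t"
  have int: "integrable M (\<lambda>x. \<i> * (of_real (X x) * iexp (t * X x)))"
    using integrable_mult_iexp[OF X1, of "\<lambda>x. t * X x"] by simp
  have i1: "integrable M (\<lambda>x. iexp (c * X x))" for c by (rule integrable_iexp) simp
  have i3: "integrable M (\<lambda>x. (y - t) *\<^sub>R (\<i> * (of_real (X x) * iexp (t * X x))))"
    by (rule integrable_scaleR_right) (rule int)
  have "expectation (\<lambda>x. iexp (y * X x)) - expectation (\<lambda>x. iexp (t * X x)) - (y - t) *\<^sub>R ?D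
    = expectation (\<lambda>x. iexp (y * X x) - iexp (t * X x) - (y - t) *\<^sub>R (\<i> * (of_real (X x) * iexp (t * X x))))"
  proof -
    show ?thesis
      by (subst Bochner_Integration.integral_diff[OF Bochner_Integration.integrable_diff[OF i1 i1] i3],
          subst Bochner_Integration.integral_diff[OF i1 i1]) (simp only: integral_scaleR_right)
  qed
  also have "cmod \<dots> \<le> expectation (\<lambda>x. (y - t)\<^sup>2 * (X x)\<^sup>2)"
  proof (rule norm_integral_le_integral)
    show "integrable M (\<lambda>x. iexp (y * X x) - iexp (t * X x) - (y - t) *\<^sub>R (\<i> * (of_real (X x) * iexp (t * X x))))"
      by (intro Bochner_Integration.integrable_diff i1 i3)
    show "integrable M (\<lambda>x. (y - t)\<^sup>2 * (X x)\<^sup>2)" using X2 by simp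
    fix x
    have "iexp (y * X x) = iexp (t * X x) * iexp ((y - t) * X x)"
      unfolding iexp_add[symmetric] by (simp add: algebra_simps)
    then have "iexp (y * X x) - iexp (t * X x) - (y - t) *\<^sub>R (\<i> * (of_real (X x) * iexp (t * X x)))
      = iexp (t * X x) * (iexp ((y - t) * X x) - 1 - \<i> * of_real ((y - t) * X x))"
      by (simp add: scaleR_conv_of_real algebra_simps)
    then have "cmod (iexp (y * X x) - iexp (t * X x) - (y - t) *\<^sub>R (\<i> * (of_real (X x) * iexp (t * X x))))
      = cmod (iexp ((y - t) * X x) - 1 - \<i> * of_real ((y - t) * X x))"
      by (simp only: norm_mult norm_exp_i_times mult_1_left)
    also have "\<dots> \<le> ((y - t) * X x)\<^sup>2 / 2" by (rule iexp_diff_2)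
    also have "\<dots> \<le> (y - t)\<^sup>2 * (X x)\<^sup>2" by (simp add: power_mult_distrib)
    finally show "cmod (iexp (y * X x) - iexp (t * X x) - (y - t) *\<^sub>R (\<i> * (of_real (X x) * iexp (t * X x)))) \<le> (y - t)\<^sup>2 * (X x)\<^sup>2" .
  qed
  also have "expectation (\<lambda>x. (y - t)\<^sup>2 * (X x)\<^sup>2) = (y - t)\<^sup>2 * expectation (\<lambda>x. (X x)\<^sup>2)" by simp
  finally have le: "norm (expectation (\<lambda>x. iexp (y * X x)) - expectation (\<lambda>x. iexp (t * X x)) - (y - t) *\<^sub>R ?D)
      \<le> (y - t)\<^sup>2 * expectation (\<lambda>x. (X x)\<^sup>2)" .
  have div: "n / norm d \<le> \<bar>d\<bar> * c" if "n \<le> d\<^sup>2 * c" "d \<noteq> 0" for n c d :: real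
  proof -
    have eq: "d\<^sup>2 * c = \<bar>d\<bar> * c * \<bar>d\<bar>" by (simp add: power2_eq_square)
    have "n \<le> \<bar>d\<bar> * c * \<bar>d\<bar>" using that(1) unfolding eq .
    then show ?thesis using that(2) by (simp add: pos_divide_le_eq)
  qed
  show "norm (expectation (\<lambda>x. iexp (y * X x)) - expectation (\<lambda>x. iexp (t * X x)) - (y - t) *\<^sub>R ?D) / norm (y - t)
      \<le> \<bar>y - t\<bar> * expectation (\<lambda>x. (X x)\<^sup>2)"
    by (rule div[OF le]) (use y in simp)
next
  have "((\<lambda>y. \<bar>y - t\<bar> * expectation (\<lambda>x. (X x)\<^sup>2)) \<longlongrightarrow> \<bar>t - t\<bar> * expectation (\<lambda>x. (X x)\<^sup>2)) (at t)"
    by (intro tendsto_intros)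
  then show "((\<lambda>y. \<bar>y - t\<bar> * expectation (\<lambda>x. (X x)\<^sup>2)) \<longlongrightarrow> 0) (at t)" by simp
qed (auto intro: bounded_linear_scaleR_left)

text \<open>Common interface for the randomization coordinates, with a small \<open>K\<close>, and
  for Gaussian coordinates, with \<open>K = 0\<close>. The weights \<open>\<mu>\<close> are free
  because the comparison for fixed \<open>H\<close> uses indicators of single coordinates, and the
  one for growing \<open>H\<close> uses \<open>l\<close> and \<open>l\<^sup>2\<close>.\<close>

locale stein_quadratic = prob_space +
  fixes H :: nat and l :: "nat \<Rightarrow> real" and v :: "nat \<Rightarrow> 'a \<Rightarrow> real" and K :: real
  assumes l: "\<And>k. k < H \<Longrightarrow> 0 \<le> l k \<and> l k \<le> 1"
    and v_meas [measurable]: "\<And>k. k < H \<Longrightarrow> v k \<in> borel_measurable M"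
    and v_int: "\<And>k. k < H \<Longrightarrow> integrable M (\<lambda>x. (v k x)\<^sup>2)"
    and v_unit: "\<And>k. k < H \<Longrightarrow> expectation (\<lambda>x. (v k x)\<^sup>2) = 1"
    and X2_int: "integrable M (\<lambda>x. (\<Sum>k<H. l k * (v k x)\<^sup>2)\<^sup>2)"
    and K_nonneg: "0 \<le> K"
    and stein: "\<And>\<mu> r. (\<And>k. k < H \<Longrightarrow> 0 \<le> \<mu> k \<and> \<mu> k \<le> 1) \<Longrightarrow>
      cmod (expectation (\<lambda>x. of_real (\<Sum>k<H. \<mu> k * (v k x)\<^sup>2) * iexp (r * (\<Sum>k<H. l k * (v k x)\<^sup>2)))
        - of_real (\<Sum>k<H. \<mu> k) * expectation (\<lambda>x. iexp (r * (\<Sum>k<H. l k * (v k x)\<^sup>2)))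
        - 2 * \<i> * of_real r * expectation (\<lambda>x. of_real (\<Sum>k<H. \<mu> k * l k * (v k x)\<^sup>2) * iexp (r * (\<Sum>k<H. l k * (v k x)\<^sup>2))))
      \<le> K * (\<bar>r\<bar> + r\<^sup>2)"
begin

definition X :: "'a \<Rightarrow> real" where "X x = (\<Sum>k<H. l k * (v k x)\<^sup>2)"

definition \<phi> :: "real \<Rightarrow> complex" where "\<phi> r = expectation (\<lambda>x. iexp (r * X x))"

lemma X_meas [measurable]: "X \<in> borel_measurable M" unfolding X_def by measurable

lemma X_square_int: "integrable M (\<lambda>x. (X x)\<^sup>2)" unfolding X_def by (rule X2_int)

lemma X_int: "integrable M X" by (rule integrable_of_square_integrable[OF X_meas X_square_int])

lemma phi_derivative:
  "(\<phi> has_vector_derivative \<i> * expectation (\<lambda>x. of_real (X x) * iexp (r * X x))) (at r)"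
  unfolding \<phi>_def[abs_def]
  using expectation_iexp_has_derivative[OF X_meas X_square_int, of r] by simp

lemma norm_phi_le: "cmod (\<phi> r) \<le> 1"
  unfolding \<phi>_def by (rule norm_expectation_iexp_le) simp

lemma stein':
  assumes "\<And>k. k < H \<Longrightarrow> 0 \<le> \<mu> k \<and> \<mu> k \<le> 1"
  shows "cmod (expectation (\<lambda>x. of_real (\<Sum>k<H. \<mu> k * (v k x)\<^sup>2) * iexp (r * X x))
        - of_real (\<Sum>k<H. \<mu> k) * \<phi> r
        - 2 * \<i> * of_real r * expectation (\<lambda>x. of_real (\<Sum>k<H. \<mu> k * l k * (v k x)\<^sup>2) * iexp (r * X x)))
      \<le> K * (\<bar>r\<bar> + r\<^sup>2)"
  unfolding \<phi>_def X_def by (rule stein[OF assms])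

text \<open>Stein's identity for the weights \<open>l\<close> and \<open>l\<^sup>2\<close> turns into the differential equation
  \<open>\<psi>' = - t \<psi>\<close> for the standardized characteristic function.\<close>

lemma standardized_char_bound:
  assumes s: "0 < s" "s\<^sup>2 = 2 * (\<Sum>k<H. (l k)\<^sup>2)"
  shows "cmod (expectation (\<lambda>x. iexp (t * ((X x - (\<Sum>k<H. l k)) / s))) - of_real (exp (- (t\<^sup>2) / 2)))
    \<le> \<bar>t\<bar> * ((4 * t\<^sup>2 * real H / s\<^sup>2 + (1 + 2 * \<bar>t\<bar> / s) * (K * (\<bar>t\<bar> / s + t\<^sup>2 / s\<^sup>2))) / s)"
proof -
  define m where "m = (\<Sum>k<H. l k)"
  define Z where "Z x = (X x - m) / s" for x
  define \<psi> where "\<psi> \<tau> = expectation (\<lambda>x. iexp (\<tau> * Z x))" for \<tau>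
  define b where "b = (4 * t\<^sup>2 * real H / s\<^sup>2 + (1 + 2 * \<bar>t\<bar> / s) * (K * (\<bar>t\<bar> / s + t\<^sup>2 / s\<^sup>2))) / s"
  have Z_meas [measurable]: "Z \<in> borel_measurable M" unfolding Z_def by measurable
  have Z2: "integrable M (\<lambda>x. (Z x)\<^sup>2)"
  proof -
    have "(\<lambda>x. (Z x)\<^sup>2) = (\<lambda>x. ((X x)\<^sup>2 - 2 * m * X x + m\<^sup>2) / s\<^sup>2)"
      by (auto simp: Z_def power_divide power2_diff algebra_simps)
    then show ?thesis using X_square_int X_int by simp
  qed
  define D where "D \<tau> = expectation (\<lambda>x. \<i> * (of_real (Z x) * iexp (\<tau> * Z x)))" for \<tau>
  have der: "(\<psi> has_vector_derivative D \<tau>) (at \<tau>)" for \<tau>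
    unfolding \<psi>_def[abs_def] D_def by (rule expectation_iexp_has_derivative[OF Z_meas Z2])
  have iZ: "iexp (\<tau> * Z x) = iexp (- (\<tau> * m / s)) * iexp (\<tau> / s * X x)" for \<tau> x
  proof -
    have "\<tau> * Z x = - (\<tau> * m / s) + \<tau> / s * X x" by (simp add: Z_def diff_divide_distrib algebra_simps)
    then show ?thesis by (simp only: iexp_add)
  qed
  have psi: "\<psi> \<tau> = iexp (- (\<tau> * m / s)) * \<phi> (\<tau> / s)" for \<tau>
    unfolding \<psi>_def \<phi>_def iZ by (rule Bochner_Integration.integral_mult_right_zero)
  \<comment> \<open>The identity with weights \<open>l\<close> expresses the derivative through
    \<open>E2\<close>; with weights \<open>l\<^sup>2\<close> it replaces \<open>E2\<close> by
    \<open>s\<^sup>2 / 2\<close> times \<open>\<phi>\<close>, up to a multiple of \<open>E3\<close>,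
    which is at most \<open>H\<close>.\<close>
  have ode: "cmod (D \<tau> + of_real \<tau> * \<psi> \<tau>) \<le> b" if \<tau>: "\<bar>\<tau>\<bar> \<le> \<bar>t\<bar>" for \<tau>
  proof -
    define r where "r = \<tau> / s"
    define EX1 where "EX1 = expectation (\<lambda>x. of_real (X x) * iexp (r * X x))"
    define E2 where "E2 = expectation (\<lambda>x. of_real (\<Sum>k<H. (l k)\<^sup>2 * (v k x)\<^sup>2) * iexp (r * X x))"
    define E3 where "E3 = expectation (\<lambda>x. of_real (\<Sum>k<H. (l k) ^ 3 * (v k x)\<^sup>2) * iexp (r * X x))"
    have l2: "0 \<le> (l k)\<^sup>2 \<and> (l k)\<^sup>2 \<le> 1" if "k < H" for k using l[OF that] by (auto simp: power_le_one)
    have s1: "cmod (EX1 - of_real m * \<phi> r - 2 * \<i> * of_real r * E2) \<le> K * (\<bar>r\<bar> + r\<^sup>2)"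
      using stein'[of l r, OF l] unfolding EX1_def E2_def m_def X_def[symmetric] by (simp add: power2_eq_square mult.assoc)
    have s2: "cmod (E2 - of_real (s\<^sup>2 / 2) * \<phi> r - 2 * \<i> * of_real r * E3) \<le> K * (\<bar>r\<bar> + r\<^sup>2)"
      using stein'[of "\<lambda>k. (l k)\<^sup>2" r, OF l2] s(2) unfolding E2_def E3_def by (simp add: power2_eq_square power3_eq_cube mult.assoc)
    have e3: "cmod E3 \<le> real H"
    proof -
      have "cmod E3 \<le> expectation (\<lambda>x. \<Sum>k<H. (l k) ^ 3 * (v k x)\<^sup>2)"
        unfolding E3_def using l by (intro norm_expectation_mult_iexp_le sum_nonneg) auto
      also have "\<dots> = (\<Sum>k<H. (l k) ^ 3 * expectation (\<lambda>x. (v k x)\<^sup>2))"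
        using v_int by (subst Bochner_Integration.integral_sum) auto
      also have "\<dots> \<le> (\<Sum>k<H. 1)" using l v_unit by (intro sum_mono) (auto simp: power_le_one)
      finally show ?thesis by simp
    qed
    have D: "D \<tau> = \<i> / of_real s * iexp (- (\<tau> * m / s)) * (EX1 - of_real m * \<phi> r)"
    proof -
      have "(\<lambda>x. \<i> * (of_real (Z x) * iexp (\<tau> * Z x))) =
         (\<lambda>x. \<i> / of_real s * iexp (- (\<tau> * m / s)) * (of_real (X x) * iexp (r * X x) - of_real m * iexp (r * X x)))"
        unfolding iZ r_def[symmetric] by (auto simp: Z_def field_simps)
      then have "D \<tau> = \<i> / of_real s * iexp (- (\<tau> * m / s)) *
         expectation (\<lambda>x. of_real (X x) * iexp (r * X x) - of_real m * iexp (r * X x))"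
        unfolding D_def by simp
      also have "expectation (\<lambda>x. of_real (X x) * iexp (r * X x) - of_real m * iexp (r * X x)) = EX1 - of_real m * \<phi> r"
        unfolding EX1_def \<phi>_def using integrable_mult_iexp[OF X_int, of "\<lambda>x. r * X x"]
        by (subst Bochner_Integration.integral_diff) (auto simp del: of_real_mult)
      finally show ?thesis .
    qed
    define R1 R2 where "R1 = EX1 - of_real m * \<phi> r - 2 * \<i> * of_real r * E2"
      and "R2 = E2 - of_real (s\<^sup>2 / 2) * \<phi> r - 2 * \<i> * of_real r * E3"
    have sr: "of_real \<tau> = of_real s * (of_real r :: complex)" using s(1) by (simp add: r_def)
    have "D \<tau> + of_real \<tau> * \<psi> \<tau> = \<i> / of_real s * iexp (- (\<tau> * m / s)) *
        (R1 + 2 * \<i> * of_real r * R2 + (2 * \<i> * of_real r) * (2 * \<i> * of_real r) * E3)"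
    proof -
      define w where "w = iexp (- (\<tau> * m / s))"
      have EX1: "EX1 - of_real m * \<phi> r = R1 + 2 * \<i> * of_real r * (R2 + of_real (s\<^sup>2 / 2) * \<phi> r + 2 * \<i> * of_real r * E3)"
        by (simp add: R1_def R2_def)
      have sc: "(of_real s :: complex) \<noteq> 0" using s(1) by simp
      have "\<i> / of_real s * w * (2 * \<i> * of_real r * (of_real (s\<^sup>2 / 2) * \<phi> r)) + of_real s * of_real r * (w * \<phi> r) = 0"
        using sc by (simp add: field_simps power2_eq_square)
      then show ?thesis
        unfolding D psi r_def[symmetric] w_def[symmetric] sr EX1 by (simp add: algebra_simps)
    qed
    also have "cmod \<dots> = cmod (R1 + 2 * \<i> * of_real r * R2 + (2 * \<i> * of_real r) * (2 * \<i> * of_real r) * E3) / s"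
      using s(1) by (simp add: norm_mult norm_divide del: of_real_minus of_real_divide of_real_mult)
    also have "\<dots> \<le> (K * (\<bar>r\<bar> + r\<^sup>2) + 2 * \<bar>r\<bar> * (K * (\<bar>r\<bar> + r\<^sup>2)) + 4 * r\<^sup>2 * real H) / s"
    proof (intro divide_right_mono)
      have "cmod (2 * \<i> * of_real r * R2) \<le> 2 * \<bar>r\<bar> * (K * (\<bar>r\<bar> + r\<^sup>2))"
        using s2 unfolding R2_def[symmetric] by (simp add: norm_mult mult_left_mono)
      moreover have "cmod ((2 * \<i> * of_real r) * (2 * \<i> * of_real r) * E3) \<le> 4 * r\<^sup>2 * real H"
        using e3 by (simp add: norm_mult power2_eq_square mult_left_mono)
      moreover have "cmod R1 \<le> K * (\<bar>r\<bar> + r\<^sup>2)" unfolding R1_def by (rule s1)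
      ultimately show "cmod (R1 + 2 * \<i> * of_real r * R2 + (2 * \<i> * of_real r) * (2 * \<i> * of_real r) * E3)
          \<le> K * (\<bar>r\<bar> + r\<^sup>2) + 2 * \<bar>r\<bar> * (K * (\<bar>r\<bar> + r\<^sup>2)) + 4 * r\<^sup>2 * real H"
        by (intro norm_triangle_le add_mono)
    qed (use s in auto)
    also have "\<dots> \<le> b"
    proof -
      define r0 where "r0 = \<bar>t\<bar> / s"
      have r0: "\<bar>r\<bar> \<le> r0" using \<tau> s(1) by (simp add: r_def r0_def divide_right_mono)
      then have r2: "r\<^sup>2 \<le> r0\<^sup>2" by (metis abs_ge_zero power2_abs power_mono)
      have 1: "K * (\<bar>r\<bar> + r\<^sup>2) \<le> K * (r0 + r0\<^sup>2)" using r0 r2 K_nonneg by (intro mult_left_mono) auto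
      have 2: "2 * \<bar>r\<bar> * (K * (\<bar>r\<bar> + r\<^sup>2)) \<le> 2 * r0 * (K * (r0 + r0\<^sup>2))"
        using r0 r2 K_nonneg by (intro mult_mono) auto
      have 3: "4 * r\<^sup>2 * real H \<le> 4 * r0\<^sup>2 * real H" using r2 by (simp add: mult_right_mono)
      have b_eq: "b = (K * (r0 + r0\<^sup>2) + 2 * r0 * (K * (r0 + r0\<^sup>2)) + 4 * r0\<^sup>2 * real H) / s"
      proof -
        have e1: "t\<^sup>2 / s\<^sup>2 = r0\<^sup>2" by (simp add: r0_def power_divide)
        have e2: "2 * \<bar>t\<bar> / s = 2 * r0" by (simp add: r0_def)
        have e3: "4 * t\<^sup>2 * real H / s\<^sup>2 = 4 * r0\<^sup>2 * real H" by (simp add: r0_def power_divide)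
        show ?thesis unfolding b_def e1 e2 e3 r0_def[symmetric] by (simp add: algebra_simps)
      qed
      show ?thesis unfolding b_eq by (intro divide_right_mono add_mono 1 2 3) (use s(1) in simp)
    qed
    finally show ?thesis .
  qed
  have b: "0 \<le> b" using order_trans[OF norm_ge_zero ode[of t]] by simp
  \<comment> \<open>Integrating factor: it turns the perturbed equation for \<open>\<psi>\<close>
    into a bound on the derivative of \<open>h\<close>. Its maximum \<open>c\<close> on the interval
    is cancelled by the Gaussian factor at the end.\<close>
  define h where "h \<tau> = of_real (exp (\<tau>\<^sup>2 / 2)) * \<psi> \<tau>" for \<tau>
  have h_der: "(h has_vector_derivative (of_real (exp (\<tau>\<^sup>2 / 2)) * (D \<tau> + of_real \<tau> * \<psi> \<tau>))) (at \<tau>)" for \<tau>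
  proof -
    have "((\<lambda>\<tau>. exp (\<tau>\<^sup>2 / 2)) has_real_derivative (exp (\<tau>\<^sup>2 / 2) * \<tau>)) (at \<tau>)"
      by (auto intro!: derivative_eq_intros)
    then have "((\<lambda>\<tau>. complex_of_real (exp (\<tau>\<^sup>2 / 2))) has_vector_derivative of_real (exp (\<tau>\<^sup>2 / 2) * \<tau>)) (at \<tau>)"
      by (rule has_vector_derivative_of_real)
    from has_vector_derivative_mult[OF this der] show ?thesis
      unfolding h_def[abs_def] by (simp add: algebra_simps)
  qed
  define c where "c = exp (t\<^sup>2 / 2)"
  have "norm (h t - h 0) \<le> (c * b) * norm (t - 0)"
  proof (rule differentiable_bound[where S = "{- \<bar>t\<bar>..\<bar>t\<bar>}" and f' = "\<lambda>\<tau> y. y *\<^sub>R (of_real (exp (\<tau>\<^sup>2 / 2)) * (D \<tau> + of_real \<tau> * \<psi> \<tau>))"])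
    fix \<tau> assume \<tau>: "\<tau> \<in> {- \<bar>t\<bar>..\<bar>t\<bar>}"
    show "(h has_derivative (\<lambda>y. y *\<^sub>R (of_real (exp (\<tau>\<^sup>2 / 2)) * (D \<tau> + of_real \<tau> * \<psi> \<tau>)))) (at \<tau> within {- \<bar>t\<bar>..\<bar>t\<bar>})"
      using h_der[of \<tau>] unfolding has_vector_derivative_def by (rule has_derivative_at_withinI)
    have "\<bar>\<tau>\<bar> \<le> \<bar>t\<bar>" using \<tau> by auto
    then have "\<tau>\<^sup>2 \<le> t\<^sup>2" by (rule abs_le_square_iff[THEN iffD1])
    then have "exp (\<tau>\<^sup>2 / 2) \<le> c" by (simp add: c_def)
    then have "cmod (of_real (exp (\<tau>\<^sup>2 / 2)) * (D \<tau> + of_real \<tau> * \<psi> \<tau>)) \<le> c * b"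
      unfolding norm_mult using ode[OF \<open>\<bar>\<tau>\<bar> \<le> \<bar>t\<bar>\<close>] by (intro mult_mono) (auto simp: c_def)
    then show "onorm (\<lambda>y. y *\<^sub>R (of_real (exp (\<tau>\<^sup>2 / 2)) * (D \<tau> + of_real \<tau> * \<psi> \<tau>))) \<le> c * b"
      by (intro onorm_le) (simp add: mult.commute mult_left_mono)
  qed auto
  moreover have "h 0 = 1" by (simp add: h_def \<psi>_def prob_space)
  ultimately have hb: "cmod (h t - 1) \<le> c * (\<bar>t\<bar> * b)" by (simp add: ac_simps)
  have "exp (- (t\<^sup>2) / 2) * c = 1" by (simp add: c_def exp_minus[symmetric] mult_exp_exp)
  then have ec: "of_real (exp (- (t\<^sup>2) / 2)) * of_real c = (1::complex)" by (simp only: of_real_mult[symmetric] of_real_1)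
  have "\<psi> t - of_real (exp (- (t\<^sup>2) / 2)) = of_real (exp (- (t\<^sup>2) / 2)) * (h t - 1)"
    unfolding right_diff_distrib h_def c_def[symmetric] mult.assoc[symmetric] ec by simp
  then have "cmod (\<psi> t - of_real (exp (- (t\<^sup>2) / 2))) = exp (- (t\<^sup>2) / 2) * cmod (h t - 1)"
    by (simp add: norm_mult)
  also have "\<dots> \<le> exp (- (t\<^sup>2) / 2) * (c * (\<bar>t\<bar> * b))" using hb by (intro mult_left_mono) auto
  also have "\<dots> = \<bar>t\<bar> * b" using \<open>exp (- (t\<^sup>2) / 2) * c = 1\<close> by (simp only: mult.assoc[symmetric] mult_1_left)
  finally show ?thesis unfolding \<psi>_def Z_def m_def b_def .
qed

text \<open>Logarithmic derivative of the Gaussian characteristic function, which is the product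
  over \<open>k\<close> of the inverse square roots of
  \<open>1 - 2 * \<i> * r * l k\<close>.\<close>

definition \<kappa> :: "real \<Rightarrow> complex" where
  "\<kappa> r = (\<Sum>k<H. \<i> * of_real (l k) / (1 - 2 * \<i> * of_real (r * l k)))"

lemma norm_resolvent_ge: "1 \<le> cmod (1 - 2 * \<i> * of_real x)"
  using complex_Re_le_cmod[of "1 - 2 * \<i> * of_real x"] by simp

lemma resolvent_nonzero: "1 - 2 * \<i> * complex_of_real x \<noteq> 0"
  using norm_resolvent_ge[of x] by (metis norm_zero not_one_le_zero)

text \<open>Stein's identity for a single coordinate reads
  \<open>V k * (1 - 2 * \<i> * r * l k) = \<phi> r + R k\<close>. The factor has modulus at least
  one, so dividing by it does not enlarge the error; the weighted sum over \<open>k\<close> is the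
  derivative of \<open>\<phi>\<close>.\<close>

lemma phi_ode:
  "\<exists>\<eta>. (\<phi> has_vector_derivative \<kappa> r * \<phi> r + \<eta>) (at r) \<and> cmod \<eta> \<le> real H * (K * (\<bar>r\<bar> + r\<^sup>2))"
proof -
  define V where "V k = expectation (\<lambda>x. of_real ((v k x)\<^sup>2) * iexp (r * X x))" for k
  define R where "R k = V k * (1 - 2 * \<i> * of_real (r * l k)) - \<phi> r" for k
  have R: "cmod (R k) \<le> K * (\<bar>r\<bar> + r\<^sup>2)" if k: "k < H" for k
  proof -
    let ?\<mu> = "\<lambda>j. if j = k then 1 else (0::real)"
    have 1: "(\<Sum>j<H. ?\<mu> j * (v j x)\<^sup>2) = (v k x)\<^sup>2" for x
      using k by (simp add: if_distrib[of "\<lambda>y. y * _"] sum.delta cong: if_cong)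
    have 2: "(\<Sum>j<H. ?\<mu> j) = 1" using k by (simp add: sum.delta)
    have 3: "(\<Sum>j<H. ?\<mu> j * l j * (v j x)\<^sup>2) = l k * (v k x)\<^sup>2" for x
      using k by (simp add: if_distrib[of "\<lambda>y. y * _"] sum.delta cong: if_cong)
    have 4: "expectation (\<lambda>x. of_real (l k * (v k x)\<^sup>2) * iexp (r * X x)) = of_real (l k) * V k"
      unfolding V_def of_real_mult mult.assoc by (rule Bochner_Integration.integral_mult_right_zero)
    show ?thesis using stein'[of ?\<mu> r] unfolding 1 2 3 4 V_def[symmetric] R_def by (simp add: algebra_simps)
  qed
  have "expectation (\<lambda>x. of_real (X x) * iexp (r * X x)) = (\<Sum>k<H. of_real (l k) * V k)"
  proof -
    have "of_real (X x) * iexp (r * X x) = (\<Sum>k<H. of_real (l k) * (of_real ((v k x)\<^sup>2) * iexp (r * X x)))" for x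
    proof -
      have "of_real (X x) = (\<Sum>k<H. complex_of_real (l k) * of_real ((v k x)\<^sup>2))" by (simp add: X_def)
      then show ?thesis by (simp only: sum_distrib_right mult.assoc)
    qed
    moreover have "integrable M (\<lambda>x. of_real ((v k x)\<^sup>2) * iexp (r * X x))" if "k < H" for k
      using v_int[OF that] by (intro integrable_mult_iexp) auto
    ultimately show ?thesis unfolding V_def
      by (subst Bochner_Integration.integral_mult_right_zero[symmetric]) (simp only: , subst Bochner_Integration.integral_sum, auto simp del: of_real_power)
  qed
  then have "\<i> * expectation (\<lambda>x. of_real (X x) * iexp (r * X x)) = \<kappa> r * \<phi> r + (\<Sum>k<H. \<i> * of_real (l k) / (1 - 2 * \<i> * of_real (r * l k)) * R k)"
  proof -
    have "\<i> * (of_real (l k) * V k) = \<i> * of_real (l k) / (1 - 2 * \<i> * of_real (r * l k)) * \<phi> r + \<i> * of_real (l k) / (1 - 2 * \<i> * of_real (r * l k)) * R k" for k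
      using resolvent_nonzero[of "r * l k"] unfolding distrib_left[symmetric] R_def by (simp del: of_real_mult)
    then show ?thesis using \<open>_ = (\<Sum>k<H. of_real (l k) * V k)\<close>
      by (simp only: \<kappa>_def sum_distrib_left sum_distrib_right sum.distrib)
  qed
  moreover have "cmod (\<Sum>k<H. \<i> * of_real (l k) / (1 - 2 * \<i> * of_real (r * l k)) * R k) \<le> (\<Sum>k<H. K * (\<bar>r\<bar> + r\<^sup>2))"
  proof (rule sum_norm_le)
    fix k assume "k \<in> {..<H}" then have k: "k < H" by simp
    have "cmod (\<i> * of_real (l k) / (1 - 2 * \<i> * of_real (r * l k))) = l k / cmod (1 - 2 * \<i> * of_real (r * l k))"
      using l[OF k] by (simp add: norm_divide norm_mult)
    also have "\<dots> \<le> 1" using l[OF k] norm_resolvent_ge[of "r * l k"] by (simp add: divide_le_eq del: of_real_mult)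
    finally show "cmod (\<i> * of_real (l k) / (1 - 2 * \<i> * of_real (r * l k)) * R k) \<le> K * (\<bar>r\<bar> + r\<^sup>2)"
      unfolding norm_mult using mult_mono[OF _ R[OF k], of _ 1] by simp
  qed
  ultimately show ?thesis using phi_derivative[of r] by auto
qed

end

text \<open>The product solves \<open>P' = - 2 * \<kappa> * P\<close>, so it compensates the square
  of any solution of \<open>\<phi>' = \<kappa> * \<phi>\<close>.\<close>

lemma resolvent_product_derivative:
  fixes l :: "nat \<Rightarrow> real"
  shows "((\<lambda>r. \<Prod>k<n. 1 - 2 * \<i> * complex_of_real (r * l k)) has_vector_derivative
    - 2 * (\<Sum>k<n. \<i> * of_real (l k) / (1 - 2 * \<i> * of_real (r * l k))) * (\<Prod>k<n. 1 - 2 * \<i> * of_real (r * l k))) (at r)"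
proof (induction n)
  case 0
  then show ?case by (simp add: has_vector_derivative_const)
next
  case (Suc n)
  let ?z = "1 - 2 * \<i> * complex_of_real (r * l n)"
  have z: "?z \<noteq> 0" by (simp add: complex_eq_iff)
  have "((\<lambda>r. complex_of_real (r * l n)) has_vector_derivative of_real (l n)) (at r)"
    by (rule has_vector_derivative_of_real) (auto intro!: derivative_eq_intros)
  then have "((\<lambda>r. 1 - 2 * \<i> * complex_of_real (r * l n)) has_vector_derivative (0 - 2 * \<i> * of_real (l n))) (at r)"
    by (intro has_vector_derivative_diff has_vector_derivative_const has_vector_derivative_mult_right)
  note der = has_vector_derivative_mult[OF Suc.IH this]
  have eq: "a * (0 - 2 * \<i> * b) + (- 2 * d * a) * w = - 2 * (d + \<i> * b / w) * (a * w)" if "w \<noteq> 0" for a b d w :: complex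
  proof -
    define q where "q = \<i> * b / w"
    have "\<i> * b = q * w" using that by (simp add: q_def)
    then have qw: "2 * \<i> * b = 2 * (q * w)" by (simp only: mult.assoc)
    show ?thesis unfolding q_def[symmetric] qw by (simp add: algebra_simps)
  qed
  show ?case unfolding prod.lessThan_Suc sum.lessThan_Suc
    by (rule has_vector_derivative_eq_rhs[OF der]) (rule eq[OF z])
qed

text \<open>If \<open>f\<close> is the difference of the two characteristic functions and \<open>P(r) = \<Prod>(1 - 2 i r l\<^sub>k)\<close>,
  then \<open>f\<^sup>2 P\<close> has a small derivative.\<close>

lemma char_compare:
  assumes "stein_quadratic M1 H l v1 K" "stein_quadratic M2 H l v2 0"
  shows "(cmod (stein_quadratic.\<phi> M1 H l v1 r - stein_quadratic.\<phi> M2 H l v2 r))\<^sup>2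
    \<le> 4 * real H * (K * (\<bar>r\<bar> + r\<^sup>2)) * (1 + 2 * \<bar>r\<bar>) ^ H * \<bar>r\<bar>"
proof -
  interpret A: stein_quadratic M1 H l v1 K by fact
  interpret B: stein_quadratic M2 H l v2 0 by fact
  define f where "f \<tau> = A.\<phi> \<tau> - B.\<phi> \<tau>" for \<tau>
  \<comment> \<open>Squaring the difference lets the polynomial \<open>P\<close> serve as
    integrating factor; for \<open>f\<close> itself one would need a complex square root of
    \<open>P\<close> and a choice of branch.\<close>
  define P where "P \<tau> = (\<Prod>k<H. 1 - 2 * \<i> * complex_of_real (\<tau> * l k))" for \<tau>
  define e where "e = real H * (K * (\<bar>r\<bar> + r\<^sup>2))"
  define c where "c = (1 + 2 * \<bar>r\<bar>) ^ H"
  have e: "0 \<le> e" using A.K_nonneg by (simp add: e_def)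
  have f2: "cmod (f \<tau>) \<le> 2" for \<tau>
    unfolding f_def using norm_triangle_ineq4[of "A.\<phi> \<tau>" "B.\<phi> \<tau>"] A.norm_phi_le[of \<tau>] B.norm_phi_le[of \<tau>] by linarith
  have Pder: "(P has_vector_derivative - 2 * A.\<kappa> \<tau> * P \<tau>) (at \<tau>)" for \<tau>
    unfolding P_def[abs_def] A.\<kappa>_def by (rule resolvent_product_derivative)
  have ex: "\<exists>d. ((\<lambda>\<tau>. (f \<tau>)\<^sup>2 * P \<tau>) has_vector_derivative d) (at \<tau>) \<and> cmod d \<le> 4 * e * c"
    if \<tau>: "\<bar>\<tau>\<bar> \<le> \<bar>r\<bar>" for \<tau>
  proof -
    obtain \<eta>1 where 1: "(A.\<phi> has_vector_derivative A.\<kappa> \<tau> * A.\<phi> \<tau> + \<eta>1) (at \<tau>)" "cmod \<eta>1 \<le> real H * (K * (\<bar>\<tau>\<bar> + \<tau>\<^sup>2))"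
      using A.phi_ode[of \<tau>] by blast
    obtain \<eta>2 where 2: "(B.\<phi> has_vector_derivative A.\<kappa> \<tau> * B.\<phi> \<tau> + \<eta>2) (at \<tau>)" "cmod \<eta>2 \<le> 0"
      using B.phi_ode[of \<tau>] by auto
    have f': "(f has_vector_derivative A.\<kappa> \<tau> * f \<tau> + \<eta>1) (at \<tau>)"
      using has_vector_derivative_diff[OF 1(1) 2(1)] 2(2) unfolding f_def[abs_def] by (simp add: algebra_simps)
    have "((\<lambda>\<tau>. f \<tau> * f \<tau> * P \<tau>) has_vector_derivative 2 * (f \<tau> * \<eta>1 * P \<tau>)) (at \<tau>)"
      using has_vector_derivative_mult[OF has_vector_derivative_mult[OF f' f'] Pder[of \<tau>]] by (simp add: algebra_simps)
    moreover have "cmod (2 * (f \<tau> * \<eta>1 * P \<tau>)) \<le> 4 * e * c"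
    proof -
      have "\<tau>\<^sup>2 \<le> r\<^sup>2" using \<tau> by (rule abs_le_square_iff[THEN iffD1])
      then have \<eta>: "cmod \<eta>1 \<le> e"
        unfolding e_def using \<tau> A.K_nonneg by (intro order_trans[OF 1(2)] mult_left_mono) auto
      have "cmod (P \<tau>) = (\<Prod>k<H. cmod (1 - 2 * \<i> * complex_of_real (\<tau> * l k)))"
        unfolding P_def by (rule prod_norm[symmetric])
      also have "\<dots> \<le> (\<Prod>k<H. 1 + 2 * \<bar>r\<bar>)"
      proof (intro prod_mono conjI)
        fix k assume "k \<in> {..<H}"
        then have lk: "0 \<le> l k" "l k \<le> 1" using A.l[of k] by auto
        have "cmod (1 - 2 * \<i> * complex_of_real (\<tau> * l k)) \<le> 1 + 2 * (\<bar>\<tau>\<bar> * l k)"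
          using norm_triangle_ineq4[of 1 "2 * \<i> * complex_of_real (\<tau> * l k)"] lk by (simp add: norm_mult abs_mult)
        also have "\<bar>\<tau>\<bar> * l k \<le> \<bar>r\<bar> * 1" using \<tau> lk by (intro mult_mono) auto
        finally show "cmod (1 - 2 * \<i> * complex_of_real (\<tau> * l k)) \<le> 1 + 2 * \<bar>r\<bar>" by simp
      qed simp
      finally have P: "cmod (P \<tau>) \<le> c" by (simp add: c_def)
      have "cmod (f \<tau>) * cmod \<eta>1 * cmod (P \<tau>) \<le> 2 * e * c"
        using f2 \<eta> P e by (intro mult_mono) auto
      moreover have "cmod (2 * (f \<tau> * \<eta>1 * P \<tau>)) = 2 * (cmod (f \<tau>) * cmod \<eta>1 * cmod (P \<tau>))" by (simp add: norm_mult)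
      ultimately show ?thesis by linarith
    qed
    ultimately show ?thesis unfolding power2_eq_square by blast
  qed
  \<comment> \<open>\<open>phi_ode\<close> provides the error only existentially at each point; the
    choice makes the derivative a function of \<open>\<tau>\<close>, as
    \<open>differentiable_bound\<close> expects.\<close>
  define d where "d \<tau> = (SOME d. ((\<lambda>\<tau>. (f \<tau>)\<^sup>2 * P \<tau>) has_vector_derivative d) (at \<tau>) \<and> cmod d \<le> 4 * e * c)" for \<tau>
  have d: "((\<lambda>\<tau>. (f \<tau>)\<^sup>2 * P \<tau>) has_vector_derivative d \<tau>) (at \<tau>)" "cmod (d \<tau>) \<le> 4 * e * c"
    if "\<bar>\<tau>\<bar> \<le> \<bar>r\<bar>" for \<tau>
    using someI_ex[OF ex[OF that]] unfolding d_def by auto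
  have "norm ((f r)\<^sup>2 * P r - (f 0)\<^sup>2 * P 0) \<le> (4 * e * c) * norm (r - 0)"
  proof (rule differentiable_bound[where S = "{- \<bar>r\<bar>..\<bar>r\<bar>}" and f' = "\<lambda>\<tau> y. y *\<^sub>R d \<tau>"])
    fix \<tau> assume "\<tau> \<in> {- \<bar>r\<bar>..\<bar>r\<bar>}"
    then have \<tau>: "\<bar>\<tau>\<bar> \<le> \<bar>r\<bar>" by auto
    show "((\<lambda>\<tau>. (f \<tau>)\<^sup>2 * P \<tau>) has_derivative (\<lambda>y. y *\<^sub>R d \<tau>)) (at \<tau> within {- \<bar>r\<bar>..\<bar>r\<bar>})"
      using d(1)[OF \<tau>] unfolding has_vector_derivative_def by (rule has_derivative_at_withinI)
    show "onorm (\<lambda>y. y *\<^sub>R d \<tau>) \<le> 4 * e * c"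
      using d(2)[OF \<tau>] by (intro onorm_le) (simp add: mult.commute mult_left_mono)
  qed auto
  moreover have "f 0 = 0" by (simp add: f_def A.\<phi>_def B.\<phi>_def A.prob_space B.prob_space)
  ultimately have "(cmod (f r))\<^sup>2 * cmod (P r) \<le> 4 * e * c * \<bar>r\<bar>" by (simp add: norm_mult norm_power)
  moreover have "1 \<le> cmod (P r)"
    unfolding P_def prod_norm[symmetric] by (intro prod_ge_1 A.norm_resolvent_ge)
  then have "(cmod (f r))\<^sup>2 * 1 \<le> (cmod (f r))\<^sup>2 * cmod (P r)" by (intro mult_left_mono) auto
  ultimately show ?thesis unfolding f_def e_def c_def by (simp add: mult.assoc)
qed

section \<open>Gaussian quadratic forms\<close>

lemma std_normal_density_derivative:
  "(std_normal_density has_real_derivative - (y * std_normal_density y)) (at y)"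
proof -
  have "((\<lambda>x::real. exp (- x\<^sup>2 / 2)) has_real_derivative - (y * exp (- y\<^sup>2 / 2))) (at y)"
    by (auto intro!: derivative_eq_intros)
  from DERIV_cmult[OF this, of "1 / sqrt (2 * pi)"] show ?thesis
    unfolding std_normal_density_def[abs_def] by (simp add: ac_simps)
qed

lemma integrable_std_normal_bounded:
  fixes g :: "real \<Rightarrow> complex"
  assumes [measurable]: "g \<in> borel_measurable borel" and b: "\<And>y. norm (g y) \<le> C * (1 + \<bar>y\<bar> ^ n)"
  shows "integrable lborel (\<lambda>y. std_normal_density y *\<^sub>R g y)"
proof (rule Bochner_Integration.integrable_bound)
  show "integrable lborel (\<lambda>y. C * (std_normal_density y * \<bar>y\<bar> ^ 0 + std_normal_density y * \<bar>y\<bar> ^ n))"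
    by (intro integrable_mult_right Bochner_Integration.integrable_add integrable_std_normal_moment_abs)
  show "AE y in lborel. norm (std_normal_density y *\<^sub>R g y) \<le> norm (C * (std_normal_density y * \<bar>y\<bar> ^ 0 + std_normal_density y * \<bar>y\<bar> ^ n))"
  proof (rule AE_I2)
    fix y :: real
    have "norm (std_normal_density y *\<^sub>R g y) \<le> std_normal_density y * (C * (1 + \<bar>y\<bar> ^ n))"
      using b[of y] by (simp add: mult_left_mono)
    also have "\<dots> = C * (std_normal_density y * \<bar>y\<bar> ^ 0 + std_normal_density y * \<bar>y\<bar> ^ n)"
      by (simp add: algebra_simps)
    finally show "norm (std_normal_density y *\<^sub>R g y) \<le> norm (C * (std_normal_density y * \<bar>y\<bar> ^ 0 + std_normal_density y * \<bar>y\<bar> ^ n))"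
      by simp
  qed
qed simp

text \<open>Gaussian integration by parts for \<open>g y = (a + b * y) * e y\<close>. Along a line
  parallel to an axis the quadratic form is a quadratic polynomial and every coordinate is affine,
  so this shape covers the use in \<open>ibp_coord\<close>.\<close>

lemma std_normal_ibp:
  fixes a b r A B C :: real
  defines "e \<equiv> \<lambda>y. iexp (r * (A + B * y + C * y\<^sup>2))"
  shows "(\<integral>y. of_real (y * (a + b * y)) * e y \<partial>std_normal_distribution) =
    (\<integral>y. (of_real b + \<i> * of_real (r * (a + b * y) * (B + 2 * C * y))) * e y \<partial>std_normal_distribution)"
proof -
  have e_meas [measurable]: "e \<in> borel_measurable borel" unfolding e_def by measurable
  have ne: "cmod (e y) = 1" for y unfolding e_def by (simp only: norm_exp_i_times)
  have e_cont: "isCont e y" for y unfolding e_def by (intro continuous_intros)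
  define g where "g y = of_real (a + b * y) * e y" for y
  define g' where "g' y = (of_real b + \<i> * of_real (r * (a + b * y) * (B + 2 * C * y))) * e y" for y
  have g_meas [measurable]: "g \<in> borel_measurable borel" "g' \<in> borel_measurable borel"
    unfolding g_def g'_def by measurable
  have e_der: "(e has_vector_derivative (\<i> * of_real (r * (B + 2 * C * y)) * e y)) (at y)" for y
  proof -
    have "((\<lambda>y. r * (A + B * y + C * y\<^sup>2)) has_real_derivative r * (B + 2 * C * y)) (at y)"
      by (auto intro!: derivative_eq_intros simp: algebra_simps)
    then have "((\<lambda>y. \<i> * complex_of_real (r * (A + B * y + C * y\<^sup>2))) has_vector_derivative \<i> * of_real (r * (B + 2 * C * y))) (at y)"
      by (intro has_vector_derivative_mult_right has_vector_derivative_of_real)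
    moreover have "(exp has_field_derivative exp (\<i> * complex_of_real (r * (A + B * y + C * y\<^sup>2)))) (at (\<i> * complex_of_real (r * (A + B * y + C * y\<^sup>2))))"
      by (rule DERIV_exp)
    ultimately have "((exp \<circ> (\<lambda>y. \<i> * complex_of_real (r * (A + B * y + C * y\<^sup>2)))) has_vector_derivative
        (\<i> * of_real (r * (B + 2 * C * y))) * exp (\<i> * complex_of_real (r * (A + B * y + C * y\<^sup>2)))) (at y)"
      by (rule field_vector_diff_chain_at)
    then show ?thesis unfolding e_def comp_def .
  qed
  have g_der: "(g has_vector_derivative g' y) (at y)" for y
  proof -
    have "((\<lambda>y. a + b * y) has_real_derivative b) (at y)" by (auto intro!: derivative_eq_intros)
    then have "((\<lambda>y. complex_of_real (a + b * y)) has_vector_derivative of_real b) (at y)"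
      by (rule has_vector_derivative_of_real)
    from has_vector_derivative_mult[OF this e_der[of y]] show ?thesis
      unfolding g_def[abs_def] g'_def by (simp add: algebra_simps)
  qed
  \<comment> \<open>One constant that dominates both \<open>g\<close> and \<open>g'\<close> by a
    quadratic, so that integrability follows from Gaussian moments.\<close>
  define c where "c = 4 * (\<bar>a\<bar> + \<bar>b\<bar>) * (1 + \<bar>r\<bar> * (\<bar>B\<bar> + 2 * \<bar>C\<bar>))"
  have c0: "0 \<le> c" by (simp add: c_def)
  have aff: "\<bar>u + w * y\<bar> \<le> (\<bar>u\<bar> + \<bar>w\<bar>) * (1 + \<bar>y\<bar>)" for u w y :: real
  proof -
    have "\<bar>u + w * y\<bar> \<le> \<bar>u\<bar> + \<bar>w\<bar> * \<bar>y\<bar>" using abs_triangle_ineq[of u "w * y"] by (simp add: abs_mult)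
    moreover have "0 \<le> \<bar>u\<bar> * \<bar>y\<bar> + \<bar>w\<bar>" by simp
    moreover have "(\<bar>u\<bar> + \<bar>w\<bar>) * (1 + \<bar>y\<bar>) = \<bar>u\<bar> + \<bar>w\<bar> * \<bar>y\<bar> + (\<bar>u\<bar> * \<bar>y\<bar> + \<bar>w\<bar>)" by (simp add: algebra_simps)
    ultimately show ?thesis by linarith
  qed
  have sq: "(1 + \<bar>y\<bar>) * (1 + \<bar>y\<bar>) \<le> 2 * (1 + \<bar>y\<bar>\<^sup>2)" "1 + \<bar>y\<bar> \<le> 2 * (1 + \<bar>y\<bar>\<^sup>2)" for y :: real
  proof -
    have "0 \<le> (\<bar>y\<bar> - 1)\<^sup>2" by simp
    then show "(1 + \<bar>y\<bar>) * (1 + \<bar>y\<bar>) \<le> 2 * (1 + \<bar>y\<bar>\<^sup>2)" by (simp add: power2_eq_square algebra_simps)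
    then show "1 + \<bar>y\<bar> \<le> 2 * (1 + \<bar>y\<bar>\<^sup>2)" using mult_left_mono[of 1 "1 + \<bar>y\<bar>" "1 + \<bar>y\<bar>"] by simp
  qed
  let ?ab = "\<bar>a\<bar> + \<bar>b\<bar>" and ?rB = "\<bar>r\<bar> * (\<bar>B\<bar> + 2 * \<bar>C\<bar>)"
  have c_ge: "?ab * 2 + ?ab * ?rB * 2 \<le> c" "?ab * 2 \<le> c"
  proof -
    have "0 \<le> ?ab * ?rB" "0 \<le> ?ab" by simp_all
    then show "?ab * 2 + ?ab * ?rB * 2 \<le> c" "?ab * 2 \<le> c" unfolding c_def by (simp_all add: algebra_simps)
  qed
  have gb: "norm (g y) \<le> c * (1 + \<bar>y\<bar>\<^sup>2)" for y
  proof -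
    have "norm (g y) = \<bar>a + b * y\<bar>" unfolding g_def norm_mult ne norm_of_real by simp
    also have "\<dots> \<le> ?ab * (1 + \<bar>y\<bar>)" by (rule aff)
    also have "\<dots> \<le> ?ab * (2 * (1 + \<bar>y\<bar>\<^sup>2))" using sq by (intro mult_left_mono) auto
    also have "\<dots> \<le> c * (1 + \<bar>y\<bar>\<^sup>2)" unfolding mult.assoc[symmetric] using c_ge by (intro mult_right_mono) auto
    finally show ?thesis .
  qed
  have gb': "norm (g' y) \<le> c * (1 + \<bar>y\<bar> ^ 2)" for y
  proof -
    have "norm (g' y) = cmod (of_real b + \<i> * of_real (r * (a + b * y) * (B + 2 * C * y)))"
      unfolding g'_def norm_mult ne by simp
    also have "\<dots> \<le> \<bar>b\<bar> + \<bar>r * (a + b * y) * (B + 2 * C * y)\<bar>"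
      by (rule order_trans[OF norm_triangle_ineq]) (simp only: norm_mult norm_of_real norm_ii mult_1_left order_refl)
    also have "\<bar>r * (a + b * y) * (B + 2 * C * y)\<bar> \<le> \<bar>r\<bar> * (?ab * (1 + \<bar>y\<bar>)) * ((\<bar>B\<bar> + 2 * \<bar>C\<bar>) * (1 + \<bar>y\<bar>))"
      unfolding abs_mult using aff[of a b y] aff[of B "2 * C" y] by (intro mult_mono) (auto simp: abs_mult)
    also have "\<dots> = ?ab * ?rB * ((1 + \<bar>y\<bar>) * (1 + \<bar>y\<bar>))" by (simp add: ac_simps)
    also have "\<dots> \<le> ?ab * ?rB * (2 * (1 + \<bar>y\<bar>\<^sup>2))" using sq by (intro mult_left_mono) auto
    also have "\<bar>b\<bar> + ?ab * ?rB * (2 * (1 + \<bar>y\<bar>\<^sup>2)) \<le> ?ab * (2 * (1 + \<bar>y\<bar>\<^sup>2)) + ?ab * ?rB * (2 * (1 + \<bar>y\<bar>\<^sup>2))"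
    proof (rule add_right_mono)
      have "\<bar>b\<bar> * 1 \<le> ?ab * (2 * (1 + \<bar>y\<bar>\<^sup>2))" by (intro mult_mono) auto
      then show "\<bar>b\<bar> \<le> ?ab * (2 * (1 + \<bar>y\<bar>\<^sup>2))" by simp
    qed
    also have "?ab * (2 * (1 + \<bar>y\<bar>\<^sup>2)) + ?ab * ?rB * (2 * (1 + \<bar>y\<bar>\<^sup>2)) = (?ab * 2 + ?ab * ?rB * 2) * (1 + \<bar>y\<bar>\<^sup>2)"
    proof -
      have "p * (2 * q) + t * (2 * q) = (p * 2 + t * 2) * q" for p q t :: real by (simp add: algebra_simps)
      then show ?thesis .
    qed
    also have "\<dots> \<le> c * (1 + \<bar>y\<bar>\<^sup>2)" using c_ge by (intro mult_right_mono) auto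
    finally show ?thesis by simp
  qed
  have yg: "norm (of_real y * g y) \<le> 2 * c * (1 + \<bar>y\<bar> ^ 3)" for y
  proof -
    have "norm (of_real y * g y) \<le> \<bar>y\<bar> * (c * (1 + \<bar>y\<bar>\<^sup>2))" using gb[of y] by (simp add: norm_mult mult_left_mono)
    also have "\<dots> = c * (\<bar>y\<bar> + \<bar>y\<bar> ^ 3)" by (simp add: power2_eq_square power3_eq_cube algebra_simps)
    also have "\<bar>y\<bar> \<le> 1 + \<bar>y\<bar> ^ 3"
    proof (cases "\<bar>y\<bar> \<le> 1")
      case True then show ?thesis using zero_le_power[of "\<bar>y\<bar>" 3] by linarith
    next
      case False
      then have "\<bar>y\<bar> ^ 1 \<le> \<bar>y\<bar> ^ 3" by (intro power_increasing) auto
      then show ?thesis by simp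
    qed
    then have "c * (\<bar>y\<bar> + \<bar>y\<bar> ^ 3) \<le> c * (2 * (1 + \<bar>y\<bar> ^ 3))"
      using c0 by (intro mult_left_mono) (auto intro: order_trans)
    finally show ?thesis by (simp only: ac_simps)
  qed
  have i1: "integrable lborel (\<lambda>y. std_normal_density y *\<^sub>R g' y)"
    by (rule integrable_std_normal_bounded[OF _ gb']) simp
  have i2: "integrable lborel (\<lambda>y. std_normal_density y *\<^sub>R (of_real y * g y))"
    by (rule integrable_std_normal_bounded[OF _ yg]) simp
  \<comment> \<open>\<open>F\<close> is the density times \<open>g\<close>. Its derivative is the
    difference of the two integrands and it vanishes at both ends, so the integral of
    \<open>F'\<close> is zero.\<close>
  define F where "F y = std_normal_density y *\<^sub>R g y" for y
  define F' where "F' y = std_normal_density y *\<^sub>R g' y - std_normal_density y *\<^sub>R (of_real y * g y)" for y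
  have F_der: "(F has_vector_derivative F' y) (at y)" for y
    using has_vector_derivative_scaleR[OF std_normal_density_derivative g_der[of y]]
    unfolding F_def[abs_def] F'_def by (simp add: scaleR_conv_of_real algebra_simps)
  have lim: "(F \<longlongrightarrow> 0) at_top" "(F \<longlongrightarrow> 0) at_bot"
  proof -
    have nF: "norm (F y) \<le> std_normal_density y * (c * (1 + \<bar>y\<bar>\<^sup>2))" for y
      unfolding F_def using gb[of y] by (simp add: mult_left_mono)
    have 1: "((\<lambda>y::real. std_normal_density y * (c * (1 + \<bar>y\<bar>\<^sup>2))) \<longlongrightarrow> 0) at_top"
      unfolding std_normal_density_def power2_abs by real_asymp
    have 2: "((\<lambda>y::real. std_normal_density y * (c * (1 + \<bar>y\<bar>\<^sup>2))) \<longlongrightarrow> 0) at_bot"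
      unfolding std_normal_density_def power2_abs by real_asymp
    show "(F \<longlongrightarrow> 0) at_top" by (rule Lim_null_comparison[OF always_eventually[OF allI[OF nF]] 1])
    show "(F \<longlongrightarrow> 0) at_bot" by (rule Lim_null_comparison[OF always_eventually[OF allI[OF nF]] 2])
  qed
  have cont: "isCont F' y" for y
    unfolding F'_def g'_def g_def std_normal_density_def using e_cont
    by (intro continuous_intros) auto
  have iF': "integrable lborel F'" unfolding F'_def using i1 i2 by (rule Bochner_Integration.integrable_diff)
  have "(LBINT y=-\<infinity>..\<infinity>. F' y) = 0 - 0"
    by (rule interval_integral_FTC_integrable[where F = F])
       (use F_der cont iF' lim in \<open>auto simp: set_integrable_def ereal_tendsto_simps1\<close>)
  then have "integral\<^sup>L lborel F' = 0"
    by (simp add: interval_lebesgue_integral_def set_lebesgue_integral_def)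
  then have lb: "(\<integral>y. std_normal_density y *\<^sub>R g' y \<partial>lborel) = (\<integral>y. std_normal_density y *\<^sub>R (of_real y * g y) \<partial>lborel)"
    unfolding F'_def using i1 i2 by (subst (asm) Bochner_Integration.integral_diff) auto
  have yg_eq: "of_real (y * (a + b * y)) * e y = of_real y * g y" for y by (simp add: g_def)
  have dens: "(\<integral>y. h y \<partial>std_normal_distribution) = (\<integral>y. std_normal_density y *\<^sub>R h y \<partial>lborel)"
    if "h \<in> borel_measurable borel" for h :: "real \<Rightarrow> complex"
    by (rule integral_density) (use that in \<open>auto simp: normal_density_nonneg\<close>)
  have "(\<integral>y. of_real y * g y \<partial>std_normal_distribution) = (\<integral>y. g' y \<partial>std_normal_distribution)"
    by (subst (1 2) dens) (simp_all only: lb g_meas, measurable)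
  then show ?thesis unfolding yg_eq g'_def .
qed

locale gauss_space =
  fixes H :: nat
begin

abbreviation G :: "(nat \<Rightarrow> real) measure" where
  "G \<equiv> PiM {..<H} (\<lambda>_. std_normal_distribution)"

sublocale product_prob_space "\<lambda>_::nat. std_normal_distribution" "{..<H}"
  by (intro product_prob_spaceI prob_space_normal_density) simp

sublocale P: prob_space G
  by (intro prob_space_PiM prob_space_normal_density) simp

lemma coord_measurable [measurable]: "j < H \<Longrightarrow> (\<lambda>\<xi>. \<xi> j) \<in> borel_measurable G"
  using measurable_component_singleton[of j "{..<H}" "\<lambda>_. std_normal_distribution"] by simp

lemma coord_integrable:
  fixes h :: "real \<Rightarrow> real"
  assumes j: "j < H" and h: "integrable std_normal_distribution h"
  shows "integrable G (\<lambda>\<xi>. h (\<xi> j))"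
proof -
  have "distr G std_normal_distribution (\<lambda>\<xi>. \<xi> j) = std_normal_distribution"
    using PiM_component[of j] j by simp
  then have "integrable (distr G std_normal_distribution (\<lambda>\<xi>. \<xi> j)) h" using h by simp
  then show ?thesis
    by (subst (asm) integrable_distr_eq) (use h j in auto)
qed

lemma coord_power_integrable: "j < H \<Longrightarrow> integrable G (\<lambda>\<xi>. (\<xi> j) ^ n)"
  using coord_integrable[of j "\<lambda>x. x ^ n"] integrable_std_normal_moment[of n]
  by (simp add: integrable_density normal_density_nonneg)

lemma coord_mult_integrable:
  assumes "i < H" "j < H"
  shows "integrable G (\<lambda>\<xi>. \<xi> i * \<xi> j)"
proof (rule Bochner_Integration.integrable_bound[of G "\<lambda>\<xi>. (\<xi> i)\<^sup>2 + (\<xi> j)\<^sup>2"])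
  show "integrable G (\<lambda>\<xi>. (\<xi> i)\<^sup>2 + (\<xi> j)\<^sup>2)"
    using assms by (intro Bochner_Integration.integrable_add coord_power_integrable)
  show "AE \<xi> in G. norm (\<xi> i * \<xi> j) \<le> norm ((\<xi> i)\<^sup>2 + (\<xi> j)\<^sup>2)"
  proof (rule AE_I2)
    fix \<xi> :: "nat \<Rightarrow> real"
    have "0 \<le> (\<bar>\<xi> i\<bar> - \<bar>\<xi> j\<bar>)\<^sup>2" by simp
    then have "2 * (\<bar>\<xi> i\<bar> * \<bar>\<xi> j\<bar>) \<le> (\<xi> i)\<^sup>2 + (\<xi> j)\<^sup>2" by (simp add: power2_diff)
    moreover have "0 \<le> \<bar>\<xi> i\<bar> * \<bar>\<xi> j\<bar>" by simp
    ultimately have "\<bar>\<xi> i\<bar> * \<bar>\<xi> j\<bar> \<le> (\<xi> i)\<^sup>2 + (\<xi> j)\<^sup>2" by linarith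
    then show "norm (\<xi> i * \<xi> j) \<le> norm ((\<xi> i)\<^sup>2 + (\<xi> j)\<^sup>2)" by (simp add: abs_mult)
  qed
qed (use assms in measurable)

end

text \<open>The rotation \<open>B\<close> is kept explicit, so that \<open>X\<close> is the form of
  \<open>spectral_mat H B l\<close> in the original Gaussian coordinates. Stein's identity is proved
  for the rotated coordinates directly instead of through rotation invariance of the
  measure.\<close>

locale gauss_frame = gauss_space +
  fixes B :: "nat \<Rightarrow> nat \<Rightarrow> real" and l :: "nat \<Rightarrow> real"
  assumes orth: "\<And>k m. k < H \<Longrightarrow> m < H \<Longrightarrow> (\<Sum>j<H. B k j * B m j) = (if k = m then 1 else 0)"
    and l: "\<And>k. k < H \<Longrightarrow> 0 \<le> l k \<and> l k \<le> 1"
begin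

definition v :: "nat \<Rightarrow> (nat \<Rightarrow> real) \<Rightarrow> real" where "v k \<xi> = (\<Sum>j<H. B k j * \<xi> j)"

definition X :: "(nat \<Rightarrow> real) \<Rightarrow> real" where "X \<xi> = (\<Sum>k<H. l k * (v k \<xi>)\<^sup>2)"

definition dX :: "nat \<Rightarrow> (nat \<Rightarrow> real) \<Rightarrow> real" where "dX j \<xi> = 2 * (\<Sum>k<H. l k * v k \<xi> * B k j)"

lemma v_measurable [measurable]: "v k \<in> borel_measurable G" unfolding v_def by measurable
lemma X_measurable [measurable]: "X \<in> borel_measurable G" unfolding X_def by measurable
lemma dX_measurable [measurable]: "dX j \<in> borel_measurable G" unfolding dX_def by measurable

lemma coord_v_integrable: "i < H \<Longrightarrow> integrable G (\<lambda>\<xi>. \<xi> i * v k \<xi>)"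
proof -
  assume i: "i < H"
  have eq: "(\<lambda>\<xi>. \<xi> i * v k \<xi>) = (\<lambda>\<xi>. \<Sum>j<H. B k j * (\<xi> i * \<xi> j))"
    by (auto simp: v_def sum_distrib_left ac_simps)
  show ?thesis unfolding eq
    by (intro Bochner_Integration.integrable_sum integrable_mult_right coord_mult_integrable i) simp
qed

lemma v_v_integrable: "integrable G (\<lambda>\<xi>. v k \<xi> * v m \<xi>)"
  unfolding v_def[of k] sum_distrib_right mult.assoc
  using coord_v_integrable[of _ m] by (intro Bochner_Integration.integrable_sum) auto

lemma coord_dX_integrable: "i < H \<Longrightarrow> integrable G (\<lambda>\<xi>. \<xi> i * dX j \<xi>)"
proof -
  assume i: "i < H"
  have eq: "(\<lambda>\<xi>. \<xi> i * dX j \<xi>) = (\<lambda>\<xi>. \<Sum>k<H. (2 * l k * B k j) * (\<xi> i * v k \<xi>))"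
    by (auto simp: dX_def sum_distrib_left ac_simps)
  show ?thesis unfolding eq
    by (intro Bochner_Integration.integrable_sum integrable_mult_right coord_v_integrable i)
qed

text \<open>Fubini with coordinate \<open>j\<close> integrated first, and
  \<open>std_normal_ibp\<close> on each line parallel to that axis.\<close>

lemma ibp_coord:
  assumes ij: "i < H" "j < H"
  shows "(\<integral>\<xi>. of_real (\<xi> j * \<xi> i) * iexp (r * X \<xi>) \<partial>G) =
    (\<integral>\<xi>. of_real (if i = j then 1 else 0) * iexp (r * X \<xi>) \<partial>G) +
    \<i> * of_real r * (\<integral>\<xi>. of_real (\<xi> i * dX j \<xi>) * iexp (r * X \<xi>) \<partial>G)"
proof -
  define f where "f \<xi> = of_real (\<xi> j * \<xi> i) * iexp (r * X \<xi>)" for \<xi>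
  define f' where "f' \<xi> = (of_real (if i = j then 1 else 0) + \<i> * of_real (r * \<xi> i * dX j \<xi>)) * iexp (r * X \<xi>)" for \<xi>
  have int: "integrable G f" unfolding f_def
    by (rule P.integrable_mult_iexp) (use coord_mult_integrable ij in auto)
  have int1: "integrable G (\<lambda>\<xi>. of_real (if i = j then 1 else 0) * iexp (r * X \<xi>))"
    by (rule P.integrable_mult_iexp) auto
  have int2: "integrable G (\<lambda>\<xi>. of_real (\<xi> i * dX j \<xi>) * iexp (r * X \<xi>))"
    by (rule P.integrable_mult_iexp) (use coord_dX_integrable ij in auto)
  have int3: "integrable G (\<lambda>\<xi>. \<i> * of_real r * (of_real (\<xi> i * dX j \<xi>) * iexp (r * X \<xi>)))"
    by (intro integrable_mult_right int2)
  have f'_eq: "f' = (\<lambda>\<xi>. of_real (if i = j then 1 else 0) * iexp (r * X \<xi>) + \<i> * of_real r * (of_real (\<xi> i * dX j \<xi>) * iexp (r * X \<xi>)))"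
    unfolding f'_def by (auto simp: algebra_simps)
  have int': "integrable G f'" unfolding f'_eq using int1 int3 by (rule Bochner_Integration.integrable_add)
  define J where "J = {..<H} - {j}"
  have J: "finite J" "j \<notin> J" "insert j J = {..<H}" using ij by (auto simp: J_def)
  have inner: "(\<integral>y. f (x(j := y)) \<partial>std_normal_distribution) = (\<integral>y. f' (x(j := y)) \<partial>std_normal_distribution)" for x
  proof -
    define \<alpha> where "\<alpha> k = (\<Sum>i\<in>J. B k i * x i)" for k
    have v: "v k (x(j := y)) = \<alpha> k + B k j * y" for k y
    proof -
      have "v k (x(j := y)) = (\<Sum>i\<in>insert j J. B k i * (x(j := y)) i)" unfolding v_def J(3) ..
      also have "\<dots> = B k j * y + (\<Sum>i\<in>J. B k i * (x(j := y)) i)" using J(1,2) by simp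
      also have "(\<Sum>i\<in>J. B k i * (x(j := y)) i) = \<alpha> k" unfolding \<alpha>_def using J(2) by (intro sum.cong) auto
      finally show ?thesis by (simp only: add.commute)
    qed
    define A0 B0 C0 where "A0 = (\<Sum>k<H. l k * (\<alpha> k)\<^sup>2)" and "B0 = (\<Sum>k<H. 2 * l k * \<alpha> k * B k j)" and "C0 = (\<Sum>k<H. l k * (B k j)\<^sup>2)"
    have X: "X (x(j := y)) = A0 + B0 * y + C0 * y\<^sup>2" for y
      unfolding X_def v A0_def B0_def C0_def sum_distrib_right sum.distrib[symmetric]
      by (intro sum.cong refl) (simp add: power2_eq_square algebra_simps)
    have dX: "dX j (x(j := y)) = B0 + 2 * C0 * y" for y
      unfolding dX_def v B0_def C0_def sum_distrib_left sum_distrib_right sum.distrib[symmetric]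
      by (intro sum.cong refl) (simp add: power2_eq_square algebra_simps)
    define a b where "a = (if i = j then 0 else x i)" and "b = (if i = j then 1 else (0::real))"
    have xi: "(x(j := y)) i = a + b * y" for y by (simp add: a_def b_def)
    have b: "of_real (if i = j then 1 else 0) = complex_of_real b" by (simp add: b_def)
    show ?thesis
      unfolding f_def f'_def X dX xi b using std_normal_ibp[of a b r A0 B0 C0] by simp
  qed
  have "integral\<^sup>L G f = integral\<^sup>L G f'"
    using product_integral_insert[OF J(1,2), of f] product_integral_insert[OF J(1,2), of f'] int int' inner
    unfolding J(3) by simp
  then show ?thesis
    unfolding f'_eq f_def Bochner_Integration.integral_add[OF int1 int3]
    by (simp only: Bochner_Integration.integral_mult_right_zero)
qed

text \<open>After expanding \<open>(v k)\<^sup>2\<close> and integrating by parts in each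
  coordinate, orthonormality gives
  \<open>(\<Sum>j. B k j * dX j \<xi>) = 2 * l k * v k \<xi>\<close>: differentiation in the
  direction \<open>B k\<close> sees only its own square in \<open>X\<close>.\<close>

lemma stein_v:
  assumes k: "k < H"
  shows "(\<integral>\<xi>. of_real ((v k \<xi>)\<^sup>2) * iexp (r * X \<xi>) \<partial>G) =
    (\<integral>\<xi>. iexp (r * X \<xi>) \<partial>G) + 2 * \<i> * of_real (r * l k) * (\<integral>\<xi>. of_real ((v k \<xi>)\<^sup>2) * iexp (r * X \<xi>) \<partial>G)"
proof -
  define e where "e \<xi> = iexp (r * X \<xi>)" for \<xi>
  have e_int: "integrable G (\<lambda>\<xi>. of_real (h \<xi>) * e \<xi>)" if "integrable G h" for h
    unfolding e_def by (rule P.integrable_mult_iexp[OF that]) simp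
  have vv: "(v k \<xi>)\<^sup>2 = (\<Sum>j<H. \<Sum>i<H. B k j * B k i * (\<xi> j * \<xi> i))" for \<xi>
    unfolding v_def power2_eq_square sum_product by (intro sum.cong refl) simp
  have "(\<integral>\<xi>. of_real ((v k \<xi>)\<^sup>2) * e \<xi> \<partial>G) = (\<Sum>j<H. \<Sum>i<H. of_real (B k j * B k i) * (\<integral>\<xi>. of_real (\<xi> j * \<xi> i) * e \<xi> \<partial>G))"
  proof -
    have "of_real ((v k \<xi>)\<^sup>2) * e \<xi> = (\<Sum>j<H. \<Sum>i<H. of_real (B k j * B k i) * (of_real (\<xi> j * \<xi> i) * e \<xi>))" for \<xi>
      unfolding vv of_real_sum sum_distrib_right by (simp only: of_real_mult mult.assoc)
    moreover have "integrable G (\<lambda>\<xi>. of_real (B k j * B k i) * (of_real (\<xi> j * \<xi> i) * e \<xi>))" if "i < H" "j < H" for i j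
      using e_int[OF coord_mult_integrable[OF that(2,1)]] by (rule integrable_mult_right)
    ultimately show ?thesis
      by (simp only: ) (subst Bochner_Integration.integral_sum, auto simp del: of_real_mult intro!: sum.cong)
  qed
  also have "\<dots> = (\<Sum>j<H. \<Sum>i<H. of_real (B k j * B k i) * ((if i = j then integral\<^sup>L G e else 0) + \<i> * of_real r * (\<integral>\<xi>. of_real (\<xi> i * dX j \<xi>) * e \<xi> \<partial>G)))"
    unfolding e_def by (intro sum.cong refl arg_cong2[where f = "(*)"]) (subst ibp_coord, auto simp del: of_real_mult)
  also have "\<dots> = (\<Sum>j<H. of_real (B k j * B k j) * integral\<^sup>L G e) +
      (\<Sum>j<H. \<Sum>i<H. of_real (B k j * B k i) * (\<i> * of_real r * (\<integral>\<xi>. of_real (\<xi> i * dX j \<xi>) * e \<xi> \<partial>G)))"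
    unfolding distrib_left sum.distrib
    by (intro arg_cong2[where f = "(+)"] sum.cong refl) (simp add: if_distrib[of "\<lambda>z. _ * z"] sum.delta cong: if_cong)
  also have "(\<Sum>j<H. of_real (B k j * B k j) * integral\<^sup>L G e) = integral\<^sup>L G e"
    unfolding sum_distrib_right[symmetric] of_real_sum[symmetric] orth[OF k k] by simp
  also have "(\<Sum>j<H. \<Sum>i<H. of_real (B k j * B k i) * (\<i> * of_real r * (\<integral>\<xi>. of_real (\<xi> i * dX j \<xi>) * e \<xi> \<partial>G))) =
     \<i> * of_real r * (\<integral>\<xi>. of_real (2 * l k * (v k \<xi>)\<^sup>2) * e \<xi> \<partial>G)"
  proof -
    have key: "(\<Sum>j<H. \<Sum>i<H. B k j * B k i * (\<xi> i * dX j \<xi>)) = 2 * l k * (v k \<xi>)\<^sup>2" for \<xi>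
    proof -
      have "(\<Sum>j<H. \<Sum>i<H. B k j * B k i * (\<xi> i * dX j \<xi>)) = (\<Sum>j<H. v k \<xi> * (B k j * dX j \<xi>))"
        unfolding v_def sum_distrib_right by (intro sum.cong refl) (simp add: ac_simps)
      also have "\<dots> = v k \<xi> * (\<Sum>j<H. B k j * dX j \<xi>)" by (simp add: sum_distrib_left)
      also have "(\<Sum>j<H. B k j * dX j \<xi>) = (\<Sum>m<H. 2 * l m * v m \<xi> * (\<Sum>j<H. B k j * B m j))"
        unfolding dX_def sum_distrib_left by (subst sum.swap) (intro sum.cong refl, simp add: ac_simps)
      also have "\<dots> = (\<Sum>m<H. if m = k then 2 * l m * v m \<xi> else 0)"
        using orth[OF k] by (intro sum.cong refl) auto
      also have "\<dots> = 2 * l k * v k \<xi>" using k by (simp add: sum.delta)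
      finally show ?thesis by (simp add: power2_eq_square)
    qed
    have "of_real (2 * l k * (v k \<xi>)\<^sup>2) * e \<xi> = (\<Sum>j<H. \<Sum>i<H. of_real (B k j * B k i) * (of_real (\<xi> i * dX j \<xi>) * e \<xi>))" for \<xi>
      unfolding key[symmetric] of_real_sum sum_distrib_right by (simp only: of_real_mult mult.assoc)
    moreover have "integrable G (\<lambda>\<xi>. of_real (B k j * B k i) * (of_real (\<xi> i * dX j \<xi>) * e \<xi>))" if "i < H" for i j
      using e_int[OF coord_dX_integrable[OF that]] by (rule integrable_mult_right)
    ultimately have "(\<integral>\<xi>. of_real (2 * l k * (v k \<xi>)\<^sup>2) * e \<xi> \<partial>G) = (\<Sum>j<H. \<Sum>i<H. of_real (B k j * B k i) * (\<integral>\<xi>. of_real (\<xi> i * dX j \<xi>) * e \<xi> \<partial>G))"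
      by (simp only: ) (subst Bochner_Integration.integral_sum, auto simp del: of_real_mult intro!: sum.cong)
    then show ?thesis by (simp only: sum_distrib_left) (simp only: ac_simps)
  qed
  also have "(\<integral>\<xi>. of_real (2 * l k * (v k \<xi>)\<^sup>2) * e \<xi> \<partial>G) = of_real (2 * l k) * (\<integral>\<xi>. of_real ((v k \<xi>)\<^sup>2) * e \<xi> \<partial>G)"
  proof -
    have "of_real (2 * l k * (v k \<xi>)\<^sup>2) * e \<xi> = of_real (2 * l k) * (of_real ((v k \<xi>)\<^sup>2) * e \<xi>)" for \<xi>
      by (simp only: of_real_mult mult.assoc)
    then show ?thesis by (simp only: Bochner_Integration.integral_mult_right_zero)
  qed
  finally show ?thesis unfolding e_def by (simp add: ac_simps)
qed

text \<open>Bessel's inequality: the squared distance of \<open>\<xi>\<close> from its projection on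
  the rows of \<open>B\<close> is nonnegative.\<close>

lemma sum_v_squares_le: "(\<Sum>k<H. (v k \<xi>)\<^sup>2) \<le> (\<Sum>j<H. (\<xi> j)\<^sup>2)"
proof -
  have "0 \<le> (\<Sum>j<H. (\<xi> j - (\<Sum>k<H. v k \<xi> * B k j))\<^sup>2)" by (intro sum_nonneg) auto
  also have "\<dots> = (\<Sum>j<H. (\<xi> j)\<^sup>2) - 2 * (\<Sum>j<H. \<xi> j * (\<Sum>k<H. v k \<xi> * B k j)) + (\<Sum>j<H. (\<Sum>k<H. v k \<xi> * B k j)\<^sup>2)"
    by (simp add: power2_diff sum.distrib sum_subtractf sum_distrib_left mult.assoc)
  also have "(\<Sum>j<H. \<xi> j * (\<Sum>k<H. v k \<xi> * B k j)) = (\<Sum>k<H. (v k \<xi>)\<^sup>2)"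
  proof -
    have "(\<Sum>j<H. \<xi> j * (\<Sum>k<H. v k \<xi> * B k j)) = (\<Sum>k<H. v k \<xi> * (\<Sum>j<H. B k j * \<xi> j))"
      unfolding sum_distrib_left by (subst sum.swap) (intro sum.cong refl, simp add: ac_simps)
    then show ?thesis by (simp add: v_def[symmetric] power2_eq_square)
  qed
  also have "(\<Sum>j<H. (\<Sum>k<H. v k \<xi> * B k j)\<^sup>2) = (\<Sum>k<H. (v k \<xi>)\<^sup>2)"
  proof -
    have "(\<Sum>j<H. (\<Sum>k<H. v k \<xi> * B k j)\<^sup>2) = (\<Sum>j<H. \<Sum>k<H. \<Sum>m<H. v k \<xi> * v m \<xi> * (B k j * B m j))"
      unfolding power2_eq_square sum_product by (intro sum.cong refl) (simp add: ac_simps)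
    also have "\<dots> = (\<Sum>k<H. \<Sum>m<H. \<Sum>j<H. v k \<xi> * v m \<xi> * (B k j * B m j))"
      by (rule trans[OF sum.swap]) (intro sum.cong refl sum.swap)
    also have "\<dots> = (\<Sum>k<H. \<Sum>m<H. if m = k then v k \<xi> * v m \<xi> else 0)"
      unfolding sum_distrib_left[symmetric] using orth by (intro sum.cong refl) auto
    also have "\<dots> = (\<Sum>k<H. (v k \<xi>)\<^sup>2)" by (simp add: sum.delta power2_eq_square)
    finally show ?thesis .
  qed
  finally show ?thesis by simp
qed

lemma X_le: "0 \<le> X \<xi>" "X \<xi> \<le> (\<Sum>j<H. (\<xi> j)\<^sup>2)"
proof -
  show "0 \<le> X \<xi>" unfolding X_def using l by (intro sum_nonneg) auto
  have "X \<xi> \<le> (\<Sum>k<H. (v k \<xi>)\<^sup>2)"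
    unfolding X_def using l by (intro sum_mono) (auto intro: mult_left_le_one_le)
  then show "X \<xi> \<le> (\<Sum>j<H. (\<xi> j)\<^sup>2)" using sum_v_squares_le by (rule order_trans)
qed

lemma X_square_integrable: "integrable G (\<lambda>\<xi>. (X \<xi>)\<^sup>2)"
proof (rule Bochner_Integration.integrable_bound[of G "\<lambda>\<xi>. real H * (\<Sum>j<H. (\<xi> j) ^ 4)"])
  show "integrable G (\<lambda>\<xi>. real H * (\<Sum>j<H. (\<xi> j) ^ 4))"
    by (intro integrable_mult_right Bochner_Integration.integrable_sum coord_power_integrable) simp
  show "AE \<xi> in G. norm ((X \<xi>)\<^sup>2) \<le> norm (real H * (\<Sum>j<H. (\<xi> j) ^ 4))"
  proof (rule AE_I2)
    fix \<xi> :: "nat \<Rightarrow> real"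
    have "(X \<xi>)\<^sup>2 \<le> (\<Sum>j<H. (\<xi> j)\<^sup>2)\<^sup>2" using X_le by (intro power_mono) auto
    also have "\<dots> \<le> (\<Sum>j<H. 1\<^sup>2) * (\<Sum>j<H. ((\<xi> j)\<^sup>2)\<^sup>2)"
      using Cauchy_Schwarz_ineq_sum[of "\<lambda>_. 1" "\<lambda>j. (\<xi> j)\<^sup>2" "{..<H}"] by simp
    also have "\<dots> = real H * (\<Sum>j<H. (\<xi> j) ^ 4)" by (simp add: power_mult[symmetric])
    finally show "norm ((X \<xi>)\<^sup>2) \<le> norm (real H * (\<Sum>j<H. (\<xi> j) ^ 4))" by simp
  qed
qed simp

lemma stein_quadratic_gauss: "stein_quadratic G H l v 0"
proof (unfold_locales)
  show "integrable G (\<lambda>x. (v k x)\<^sup>2)" for k using v_v_integrable[of k k] by (simp add: power2_eq_square)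
  show "P.expectation (\<lambda>x. (v k x)\<^sup>2) = 1" if "k < H" for k
  proof -
    \<comment> \<open>At \<open>r = 0\<close> the phase is one and \<open>stein_v\<close> reduces to
      the second moment.\<close>
    have "complex_of_real (P.expectation (\<lambda>x. (v k x)\<^sup>2)) = 1"
      using stein_v[OF that, of 0] by (simp add: P.prob_space integral_complex_of_real[symmetric] del: integral_complex_of_real)
    then show ?thesis by simp
  qed
  show "integrable G (\<lambda>x. (\<Sum>k<H. l k * (v k x)\<^sup>2)\<^sup>2)" using X_square_integrable unfolding X_def .
  fix \<mu> :: "nat \<Rightarrow> real" and r :: real
  define V where "V k = (\<integral>\<xi>. of_real ((v k \<xi>)\<^sup>2) * iexp (r * X \<xi>) \<partial>G)" for k
  have gen: "P.expectation (\<lambda>x. of_real (\<Sum>k<H. w k * (v k x)\<^sup>2) * iexp (r * X x)) = (\<Sum>k<H. of_real (w k) * V k)" for w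
  proof -
    have "of_real (\<Sum>k<H. w k * (v k x)\<^sup>2) * iexp (r * X x) = (\<Sum>k<H. of_real (w k) * (of_real ((v k x)\<^sup>2) * iexp (r * X x)))" for x
      unfolding of_real_sum sum_distrib_right of_real_mult[of "w _"] mult.assoc ..
    moreover have "integrable G (\<lambda>x. of_real (w k) * (of_real ((v k x)\<^sup>2) * iexp (r * X x)))" for k
      using v_v_integrable[of k k] by (intro integrable_mult_right P.integrable_mult_iexp) (auto simp: power2_eq_square)
    ultimately show ?thesis
      unfolding V_def by (simp only: ) (subst Bochner_Integration.integral_sum, auto simp del: of_real_mult of_real_power intro!: sum.cong)
  qed
  have "(\<Sum>k<H. of_real (\<mu> k) * V k) = of_real (\<Sum>k<H. \<mu> k) * P.expectation (\<lambda>x. iexp (r * X x))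
      + 2 * \<i> * of_real r * (\<Sum>k<H. of_real (\<mu> k * l k) * V k)"
  proof -
    have "of_real (\<mu> k) * V k = of_real (\<mu> k) * P.expectation (\<lambda>x. iexp (r * X x)) + 2 * \<i> * of_real r * (of_real (\<mu> k * l k) * V k)" if "k < H" for k
      using arg_cong[OF stein_v[OF that, of r], of "\<lambda>z. of_real (\<mu> k) * z"] unfolding V_def[symmetric]
      by (simp add: distrib_left ac_simps)
    then have "(\<Sum>k<H. of_real (\<mu> k) * V k) = (\<Sum>k<H. of_real (\<mu> k) * P.expectation (\<lambda>x. iexp (r * X x)) + 2 * \<i> * of_real r * (of_real (\<mu> k * l k) * V k))"
      by (intro sum.cong) auto
    then show ?thesis unfolding sum.distrib by (simp only: sum_distrib_left sum_distrib_right of_real_sum)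
  qed
  then show "cmod (P.expectation (\<lambda>x. of_real (\<Sum>k<H. \<mu> k * (v k x)\<^sup>2) * iexp (r * (\<Sum>k<H. l k * (v k x)\<^sup>2)))
        - of_real (\<Sum>k<H. \<mu> k) * P.expectation (\<lambda>x. iexp (r * (\<Sum>k<H. l k * (v k x)\<^sup>2)))
        - 2 * \<i> * of_real r * P.expectation (\<lambda>x. of_real (\<Sum>k<H. \<mu> k * l k * (v k x)\<^sup>2) * iexp (r * (\<Sum>k<H. l k * (v k x)\<^sup>2))))
      \<le> 0 * (\<bar>r\<bar> + r\<^sup>2)"
    unfolding X_def[symmetric] gen by simp
qed (use l in auto)

end

section \<open>The real spectral theorem\<close>

text \<open>Row and column relations are both demanded, so that \<open>B\<close> can be used in
  either direction without an inverse matrix argument. Index functions instead of matrices keep the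
  sums of the induction easy to rearrange.\<close>

definition orthonormal :: "nat \<Rightarrow> (nat \<Rightarrow> nat \<Rightarrow> real) \<Rightarrow> bool" where
  "orthonormal n B \<longleftrightarrow>
     (\<forall>k<n. \<forall>m<n. (\<Sum>j<n. B k j * B m j) = (if k = m then 1 else 0)) \<and>
     (\<forall>i<n. \<forall>j<n. (\<Sum>k<n. B k i * B k j) = (if i = j then 1 else 0))"

lemma orthonormalD:
  assumes "orthonormal n B"
  shows "k < n \<Longrightarrow> m < n \<Longrightarrow> (\<Sum>j<n. B k j * B m j) = (if k = m then 1 else 0)"
    and "i < n \<Longrightarrow> j < n \<Longrightarrow> (\<Sum>k<n. B k i * B k j) = (if i = j then 1 else 0)"
  using assms by (auto simp: orthonormal_def)

text \<open>A complex eigenvalue exists by the fundamental theorem of algebra. The Hermitian form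
  \<open>q\<close> equals \<open>k\<close> times a positive number and is its own conjugate, so
  \<open>k\<close> is real; as a real root of the real characteristic polynomial it has a real
  eigenvector, which is then normalized.\<close>

lemma symmetric_real_eigenvector:
  fixes S :: "nat \<Rightarrow> nat \<Rightarrow> real"
  assumes n: "0 < n" and sym: "\<And>i j. i < n \<Longrightarrow> j < n \<Longrightarrow> S i j = S j i"
  shows "\<exists>x u. (\<Sum>i<n. (u i)\<^sup>2) = 1 \<and> (\<forall>i<n. (\<Sum>j<n. S i j * u j) = x * u i)"
proof -
  define A where "A = Matrix.mat n n (\<lambda>(i, j). S i j)"
  have A: "A \<in> carrier_mat n n" by (simp add: A_def)
  define C where "C = map_mat complex_of_real A"
  have C: "C \<in> carrier_mat n n" using A by (simp add: C_def)
  have "\<not> constant (poly (char_poly C))"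
    using degree_monic_char_poly[OF C] n by (simp add: constant_degree)
  then obtain k where k: "eigenvalue C k"
    using fundamental_theorem_of_algebra eigenvalue_root_char_poly[OF C] by blast
  then obtain w where w: "w \<in> carrier_vec n" "w \<noteq> 0\<^sub>v n" "C *\<^sub>v w = k \<cdot>\<^sub>v w"
    unfolding eigenvalue_def eigenvector_def using C by auto
  define w' where "w' i = w $ i" for i
  have eq: "(\<Sum>j<n. of_real (S i j) * w' j) = k * w' i" if "i < n" for i
  proof -
    have "(C *\<^sub>v w) $ i = (k \<cdot>\<^sub>v w) $ i" using w(3) by simp
    then show ?thesis using that w(1) C
      by (simp add: C_def A_def scalar_prod_def w'_def atLeast0LessThan)
  qed
  define q where "q = (\<Sum>i<n. \<Sum>j<n. cnj (w' i) * (of_real (S i j) * w' j))"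
  have q1: "q = k * of_real (\<Sum>i<n. (cmod (w' i))\<^sup>2)"
  proof -
    have "q = (\<Sum>i<n. cnj (w' i) * (k * w' i))"
      unfolding q_def by (intro sum.cong refl) (simp add: sum_distrib_left[symmetric] eq)
    also have "\<dots> = (\<Sum>i<n. k * of_real ((cmod (w' i))\<^sup>2))"
      by (intro sum.cong refl) (simp only: complex_norm_square ac_simps)
    finally show ?thesis by (simp add: sum_distrib_left)
  qed
  have q2: "cnj q = q"
  proof -
    have "cnj q = (\<Sum>i<n. \<Sum>j<n. w' i * (of_real (S i j) * cnj (w' j)))"
      unfolding q_def by simp
    also have "\<dots> = (\<Sum>j<n. \<Sum>i<n. w' i * (of_real (S i j) * cnj (w' j)))" by (rule sum.swap)
    also have "\<dots> = q" unfolding q_def using sym by (intro sum.cong refl) (simp add: ac_simps)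
    finally show ?thesis .
  qed
  have pos: "(\<Sum>i<n. (cmod (w' i))\<^sup>2) \<noteq> 0"
  proof
    assume "(\<Sum>i<n. (cmod (w' i))\<^sup>2) = 0"
    then have "\<forall>i\<in>{..<n}. (cmod (w' i))\<^sup>2 = 0" by (subst (asm) sum_nonneg_eq_0_iff) auto
    then have "w = 0\<^sub>v n" using w(1) by (intro eq_vecI) (auto simp: w'_def)
    then show False using w(2) by simp
  qed
  have "cnj k = k" using q2 pos unfolding q1 by (simp del: of_real_sum)
  then have kr: "k = of_real (Re k)" by (simp add: complex_eq_iff)
  have "poly (char_poly C) k = 0" using k eigenvalue_root_char_poly[OF C] by simp
  moreover have "char_poly C = map_poly complex_of_real (char_poly A)"
    unfolding C_def by (rule of_real_hom.char_poly_hom[OF A])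
  ultimately have "poly (map_poly complex_of_real (char_poly A)) (of_real (Re k)) = 0" using kr by simp
  then have "poly (char_poly A) (Re k) = 0" by simp
  then have "eigenvalue A (Re k)" using eigenvalue_root_char_poly[OF A] by simp
  then obtain v where v: "v \<in> carrier_vec n" "v \<noteq> 0\<^sub>v n" "A *\<^sub>v v = Re k \<cdot>\<^sub>v v"
    unfolding eigenvalue_def eigenvector_def using A by auto
  have veq: "(\<Sum>j<n. S i j * v $ j) = Re k * v $ i" if "i < n" for i
  proof -
    have "(A *\<^sub>v v) $ i = (Re k \<cdot>\<^sub>v v) $ i" using v(3) by simp
    then show ?thesis using that v(1) A
      by (simp add: A_def scalar_prod_def atLeast0LessThan)
  qed
  define s where "s = (\<Sum>i<n. (v $ i)\<^sup>2)"
  have "s \<noteq> 0"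
  proof
    assume "s = 0"
    then have "\<forall>i\<in>{..<n}. (v $ i)\<^sup>2 = 0" unfolding s_def by (subst (asm) sum_nonneg_eq_0_iff) auto
    then have "v = 0\<^sub>v n" using v(1) by (intro eq_vecI) auto
    then show False using v(2) by simp
  qed
  moreover have "0 \<le> s" unfolding s_def by (intro sum_nonneg) auto
  ultimately have s: "0 < s" by simp
  show ?thesis
  proof (intro exI conjI allI impI)
    show "(\<Sum>i<n. (v $ i / sqrt s)\<^sup>2) = 1"
      using s by (simp add: power_divide sum_divide_distrib[symmetric] s_def[symmetric])
    show "(\<Sum>j<n. S i j * (v $ j / sqrt s)) = Re k * (v $ i / sqrt s)" if "i < n" for i
      using veq[OF that] by (simp add: sum_divide_distrib[symmetric])
  qed
qed

text \<open>Reflection exchanging the first unit vector and \<open>u\<close>; it completes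
  \<open>u\<close> to a symmetric orthogonal matrix without Gram-Schmidt.\<close>

lemma householder:
  fixes u :: "nat \<Rightarrow> real"
  assumes n: "0 < n" and u: "(\<Sum>i<n. (u i)\<^sup>2) = 1"
  shows "\<exists>U. (\<forall>i<n. \<forall>j<n. U i j = U j i) \<and> (\<forall>i<n. U 0 i = u i) \<and>
    (\<forall>i<n. \<forall>j<n. (\<Sum>k<n. U i k * U k j) = (if i = j then 1 else 0))"
proof -
  define d where "d i j = (if i = j then 1 else (0::real))" for i j :: nat
  define w where "w i = u i - d 0 i" for i
  define s where "s = (\<Sum>i<n. (w i)\<^sup>2)"
  have dsum: "(\<Sum>k<n. d i k * f k) = f i" "(\<Sum>k<n. f k * d k i) = f i" if "i < n" for i and f :: "nat \<Rightarrow> real"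
    using that by (simp_all add: d_def if_distrib[of "\<lambda>x. x * _"] if_distrib[of "\<lambda>x. _ * x"] sum.delta sum.delta' cong: if_cong)
  have s_w0: "s = - 2 * w 0"
  proof -
    have "(w i)\<^sup>2 = (u i)\<^sup>2 - 2 * (d 0 i * u i) + d 0 i * 1" for i
      by (simp add: w_def power2_diff d_def)
    then have "s = (\<Sum>i<n. (u i)\<^sup>2) - 2 * (\<Sum>i<n. d 0 i * u i) + (\<Sum>i<n. d 0 i * 1)"
      unfolding s_def by (simp add: sum.distrib sum_subtractf sum_distrib_left)
    also have "\<dots> = 1 - 2 * u 0 + 1" unfolding dsum[OF n] u by simp
    finally show ?thesis by (simp add: w_def d_def)
  qed
  \<comment> \<open>If \<open>u\<close> is the first unit vector, then \<open>s = 0\<close> and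
    \<open>2 / s = 0\<close>, so \<open>U\<close> is the identity, as it should be.\<close>
  define U where "U i j = d i j - 2 / s * (w i * w j)" for i j
  show ?thesis
  proof (intro exI[of _ U] conjI allI impI)
    show "U i j = U j i" for i j by (auto simp: U_def d_def)
    show "U 0 i = u i" if "i < n" for i
    proof (cases "s = 0")
      case True
      then have "\<forall>i\<in>{..<n}. (w i)\<^sup>2 = 0" unfolding s_def by (subst (asm) sum_nonneg_eq_0_iff) auto
      then show ?thesis using that True by (simp add: U_def w_def)
    next
      case False
      then have "2 / s * w 0 = -1" using s_w0 by (simp add: field_simps)
      then have "2 / s * (w 0 * w i) = - w i" by (simp add: mult.assoc[symmetric])
      then show ?thesis unfolding U_def by (simp add: w_def)
    qed
    fix i j assume ij: "i < n" "j < n"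
    define c where "c = 2 / s"
    have cs: "c * c * s = 2 * c" by (simp add: c_def)
    have "(\<Sum>k<n. U i k * U k j) = (\<Sum>k<n. d i k * d k j) - c * (\<Sum>k<n. d i k * (w k * w j)) - c * (\<Sum>k<n. (w i * w k) * d k j)
       + c * c * (w i * w j) * (\<Sum>k<n. (w k)\<^sup>2)"
      unfolding U_def c_def[symmetric] sum_distrib_left sum_subtractf[symmetric] sum.distrib[symmetric]
      by (intro sum.cong refl) (simp add: power2_eq_square algebra_simps)
    also have "\<dots> = d i j - c * (w i * w j) - c * (w i * w j) + (c * c * s) * (w i * w j)"
      unfolding dsum[OF ij(1)] dsum[OF ij(2)] s_def[symmetric] by simp
    also have "\<dots> = d i j" unfolding cs by simp
    finally show "(\<Sum>k<n. U i k * U k j) = (if i = j then 1 else 0)" by (simp add: d_def)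
  qed
qed

text \<open>Deflation: in the Householder basis, whose first vector is an eigenvector, the first row
  and column of the matrix vanish off the diagonal, and the induction hypothesis applies to the
  remaining block.\<close>

theorem real_spectral:
  fixes S :: "nat \<Rightarrow> nat \<Rightarrow> real"
  assumes "\<And>i j. i < n \<Longrightarrow> j < n \<Longrightarrow> S i j = S j i"
  shows "\<exists>B x. orthonormal n B \<and> (\<forall>i<n. \<forall>j<n. S i j = (\<Sum>k<n. x k * B k i * B k j))"
  using assms
proof (induction n arbitrary: S)
  case 0
  then show ?case by (auto simp: orthonormal_def)
next
  case (Suc n)
  note sym = Suc.prems
  obtain x0 u where u: "(\<Sum>i<Suc n. (u i)\<^sup>2) = 1" "\<And>i. i < Suc n \<Longrightarrow> (\<Sum>j<Suc n. S i j * u j) = x0 * u i"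
    using symmetric_real_eigenvector[of "Suc n" S] sym by auto
  from householder[OF zero_less_Suc u(1)] obtain U
    where U: "\<forall>i<Suc n. \<forall>j<Suc n. U i j = U j i" "\<forall>i<Suc n. U 0 i = u i"
      "\<forall>i<Suc n. \<forall>j<Suc n. (\<Sum>k<Suc n. U i k * U k j) = (if i = j then 1 else 0)"
    by (elim exE conjE)
  have Usym: "U i j = U j i" if "i < Suc n" "j < Suc n" for i j using U(1) that by blast
  have U0: "U 0 i = u i" if "i < Suc n" for i using U(2) that by blast
  have UU: "(\<Sum>k<Suc n. U i k * U k j) = (if i = j then 1 else 0)" if "i < Suc n" "j < Suc n" for i j
    using U(3) that by blast
  define A where "A p q = (\<Sum>i<Suc n. \<Sum>j<Suc n. U p i * S i j * U j q)" for p q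
  have Asym: "A p q = A q p" if "p < Suc n" "q < Suc n" for p q
    unfolding A_def by (subst sum.swap) (intro sum.cong refl, use that Usym sym in \<open>simp add: ac_simps\<close>)
  have A0: "A p 0 = (if p = 0 then x0 else 0)" if p: "p < Suc n" for p
  proof -
    have "A p 0 = (\<Sum>i<Suc n. U p i * (\<Sum>j<Suc n. S i j * u j))"
      unfolding A_def sum_distrib_left using Usym U0 by (intro sum.cong refl) (simp add: mult.assoc)
    also have "\<dots> = x0 * (\<Sum>i<Suc n. U p i * U i 0)"
      unfolding sum_distrib_left[of x0] using u(2) Usym U0 by (intro sum.cong refl) (simp del: sum.lessThan_Suc)
    finally show ?thesis using UU[OF p] by (simp del: sum.lessThan_Suc)
  qed
  have SA: "S i j = (\<Sum>p<Suc n. \<Sum>q<Suc n. U i p * A p q * U q j)" if ij: "i < Suc n" "j < Suc n" for i j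
  proof -
    let ?N = "{..<Suc n}"
    have delta: "(\<Sum>a\<in>?N. (if i = a then 1 else 0) * f a) = f i" "(\<Sum>a\<in>?N. f a * (if a = j then 1 else 0)) = f j" for f :: "nat \<Rightarrow> real"
      using ij by (simp_all add: if_distrib[of "\<lambda>x. x * _"] if_distrib[of "\<lambda>x. _ * x"] sum.delta sum.delta' cong: if_cong del: sum.lessThan_Suc)
    have "(\<Sum>p\<in>?N. \<Sum>q\<in>?N. U i p * A p q * U q j) = (\<Sum>p\<in>?N. \<Sum>q\<in>?N. \<Sum>a\<in>?N. \<Sum>b\<in>?N. (U i p * U p a) * (S a b * (U b q * U q j)))"
      unfolding A_def sum_distrib_left sum_distrib_right by (intro sum.cong refl) (simp add: ac_simps)
    also have "\<dots> = (\<Sum>a\<in>?N. \<Sum>b\<in>?N. \<Sum>p\<in>?N. \<Sum>q\<in>?N. (U i p * U p a) * (S a b * (U b q * U q j)))"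
    proof -
      have rot: "(\<Sum>p\<in>?N. \<Sum>q\<in>?N. \<Sum>a\<in>?N. f p q a) = (\<Sum>a\<in>?N. \<Sum>p\<in>?N. \<Sum>q\<in>?N. f p q a)"
        for f :: "nat \<Rightarrow> nat \<Rightarrow> nat \<Rightarrow> real"
      proof -
        have "(\<Sum>p\<in>?N. \<Sum>q\<in>?N. \<Sum>a\<in>?N. f p q a) = (\<Sum>p\<in>?N. \<Sum>a\<in>?N. \<Sum>q\<in>?N. f p q a)"
          by (rule sum.cong[OF refl sum.swap])
        also have "\<dots> = (\<Sum>a\<in>?N. \<Sum>p\<in>?N. \<Sum>q\<in>?N. f p q a)" by (rule sum.swap)
        finally show ?thesis .
      qed
      show ?thesis unfolding rot[of "\<lambda>p q a. \<Sum>b\<in>?N. (U i p * U p a) * (S a b * (U b q * U q j))"]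
        by (rule sum.cong[OF refl rot])
    qed
    also have "\<dots> = (\<Sum>a\<in>?N. \<Sum>b\<in>?N. (\<Sum>p\<in>?N. U i p * U p a) * (S a b * (\<Sum>q\<in>?N. U b q * U q j)))"
      unfolding sum_distrib_left[of "S _ _"] sum_product ..
    also have "\<dots> = (\<Sum>a\<in>?N. (if i = a then 1 else 0) * (\<Sum>b\<in>?N. S a b * (if b = j then 1 else 0)))"
      unfolding sum_distrib_left[of "if i = _ then 1 else 0"] using UU ij by (intro sum.cong refl) (simp del: sum.lessThan_Suc)
    also have "\<dots> = S i j" unfolding delta ..
    finally show ?thesis by simp
  qed
  have "A (Suc i) (Suc j) = A (Suc j) (Suc i)" if "i < n" "j < n" for i j using Asym that by simp
  from Suc.IH[of "\<lambda>p q. A (Suc p) (Suc q)", OF this]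
  obtain B x where B: "orthonormal n B" and x: "\<And>i j. i < n \<Longrightarrow> j < n \<Longrightarrow> A (Suc i) (Suc j) = (\<Sum>k<n. x k * B k i * B k j)"
    by auto
  \<comment> \<open>Eigenvectors of the block, extended by a zero first component and rotated back
    by \<open>U\<close>; row zero is the eigenvector \<open>u\<close> itself.\<close>
  define B' where "B' k j = (case k of 0 \<Rightarrow> U 0 j | Suc m \<Rightarrow> (\<Sum>p<n. B m p * U (Suc p) j))" for k j
  define x' where "x' k = (case k of 0 \<Rightarrow> x0 | Suc m \<Rightarrow> x m)" for k
  have UUt: "(\<Sum>j<Suc n. U p j * U q j) = (if p = q then 1 else 0)" if "p < Suc n" "q < Suc n" for p q
  proof -
    have "(\<Sum>j<Suc n. U p j * U q j) = (\<Sum>j<Suc n. U p j * U j q)"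
      by (intro sum.cong refl arg_cong2[where f = "(*)"] Usym that) auto
    then show ?thesis using UU[OF that] by (simp del: sum.lessThan_Suc)
  qed
  have deltan: "(\<Sum>q<n. (if p = q then 1 else 0) * f q) = f p" if "p < n" for p and f :: "nat \<Rightarrow> real"
    using that by (simp add: if_distrib[of "\<lambda>x. x * _"] sum.delta cong: if_cong)
  have row0: "(\<Sum>j<Suc n. B' 0 j * B' (Suc m) j) = 0" for m
  proof -
    have "(\<Sum>j<Suc n. B' 0 j * B' (Suc m) j) = (\<Sum>p<n. B m p * (\<Sum>j<Suc n. U 0 j * U (Suc p) j))"
      unfolding B'_def nat.case sum_distrib_left by (subst sum.swap) (intro sum.cong refl, simp)
    also have "\<dots> = 0" using UUt by (intro sum.neutral) (simp del: sum.lessThan_Suc)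
    finally show ?thesis .
  qed
  have rows: "(\<Sum>j<Suc n. B' (Suc k) j * B' (Suc m) j) = (if k = m then 1 else 0)" if km: "k < n" "m < n" for k m
  proof -
    have "(\<Sum>j<Suc n. B' (Suc k) j * B' (Suc m) j) = (\<Sum>p<n. \<Sum>q<n. B k p * B m q * (\<Sum>j<Suc n. U (Suc p) j * U (Suc q) j))"
    proof -
      have "(\<Sum>j<Suc n. B' (Suc k) j * B' (Suc m) j) = (\<Sum>j<Suc n. \<Sum>p<n. \<Sum>q<n. B k p * B m q * (U (Suc p) j * U (Suc q) j))"
        unfolding B'_def nat.case sum_product by (intro sum.cong refl) simp
      also have "\<dots> = (\<Sum>p<n. \<Sum>q<n. \<Sum>j<Suc n. B k p * B m q * (U (Suc p) j * U (Suc q) j))"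
        by (rule trans[OF sum.swap]) (rule sum.cong[OF refl sum.swap])
      finally show ?thesis by (simp only: sum_distrib_left)
    qed
    also have "\<dots> = (\<Sum>p<n. \<Sum>q<n. (if p = q then 1 else 0) * (B k p * B m q))"
      using UUt by (intro sum.cong refl) (simp del: sum.lessThan_Suc)
    also have "\<dots> = (\<Sum>p<n. B k p * B m p)" by (intro sum.cong refl) (use deltan in simp)
    finally show ?thesis using orthonormalD(1)[OF B km] by simp
  qed
  have cols_gen: "(\<Sum>k<n. y k * B' (Suc k) i * B' (Suc k) j) = (\<Sum>p<n. \<Sum>q<n. U (Suc p) i * (\<Sum>k<n. y k * B k p * B k q) * U (Suc q) j)" for y i j
  proof -
    have e: "B' (Suc k) i * B' (Suc k) j = (\<Sum>p<n. \<Sum>q<n. (B k p * U (Suc p) i) * (B k q * U (Suc q) j))" for k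
      unfolding B'_def nat.case sum_product ..
    have "(\<Sum>k<n. y k * B' (Suc k) i * B' (Suc k) j) = (\<Sum>k<n. \<Sum>p<n. \<Sum>q<n. U (Suc p) i * (y k * B k p * B k q) * U (Suc q) j)"
      unfolding mult.assoc[of "y _" "B' _ _"] e sum_distrib_left by (intro sum.cong refl) simp
    also have "\<dots> = (\<Sum>p<n. \<Sum>q<n. \<Sum>k<n. U (Suc p) i * (y k * B k p * B k q) * U (Suc q) j)"
      by (rule trans[OF sum.swap]) (rule sum.cong[OF refl sum.swap])
    finally show ?thesis by (simp only: sum_distrib_left sum_distrib_right)
  qed
  have "orthonormal (Suc n) B'"
    unfolding orthonormal_def
  proof (intro conjI allI impI)
    fix k m assume km: "k < Suc n" "m < Suc n"
    show "(\<Sum>j<Suc n. B' k j * B' m j) = (if k = m then 1 else 0)"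
    proof (cases k)
      case 0
      show ?thesis
      proof (cases m)
        case 0
        then show ?thesis using \<open>k = 0\<close> UUt[of 0 0] by (simp add: B'_def del: sum.lessThan_Suc)
      next
        case (Suc m')
        then show ?thesis using \<open>k = 0\<close> row0[of m'] by (simp del: sum.lessThan_Suc)
      qed
    next
      case (Suc k')
      show ?thesis
      proof (cases m)
        case 0
        have "(\<Sum>j<Suc n. B' (Suc k') j * B' 0 j) = (\<Sum>j<Suc n. B' 0 j * B' (Suc k') j)"
          by (intro sum.cong refl) simp
        then show ?thesis using 0 \<open>k = Suc k'\<close> row0[of k'] by (simp del: sum.lessThan_Suc)
      next
        case (Suc m')
        then show ?thesis using \<open>k = Suc k'\<close> rows[of k' m'] km by (simp del: sum.lessThan_Suc)
      qed
    qed
  next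
    fix i j assume ij: "i < Suc n" "j < Suc n"
    have "(\<Sum>k<Suc n. B' k i * B' k j) = U 0 i * U 0 j + (\<Sum>k<n. 1 * B' (Suc k) i * B' (Suc k) j)"
      unfolding sum.lessThan_Suc_shift by (simp add: B'_def)
    also have "\<dots> = U 0 i * U 0 j + (\<Sum>p<n. \<Sum>q<n. (if p = q then 1 else 0) * (U (Suc p) i * U (Suc q) j))"
      unfolding cols_gen using orthonormalD(2)[OF B] by (intro arg_cong2[where f = "(+)"] sum.cong refl) simp
    also have "\<dots> = U 0 i * U 0 j + (\<Sum>p<n. U (Suc p) i * U (Suc p) j)"
      by (intro arg_cong2[where f = "(+)"] sum.cong refl) (use deltan in simp)
    also have "\<dots> = (\<Sum>p<Suc n. U i p * U p j)"
      unfolding sum.lessThan_Suc_shift using Usym ij by (intro arg_cong2[where f = "(+)"] sum.cong refl) auto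
    finally show "(\<Sum>k<Suc n. B' k i * B' k j) = (if i = j then 1 else 0)" using UU[OF ij] by (simp del: sum.lessThan_Suc)
  qed
  moreover have "S i j = (\<Sum>k<Suc n. x' k * B' k i * B' k j)" if ij: "i < Suc n" "j < Suc n" for i j
  proof -
    have "(\<Sum>k<Suc n. x' k * B' k i * B' k j) = x0 * U 0 i * U 0 j + (\<Sum>p<n. \<Sum>q<n. U (Suc p) i * A (Suc p) (Suc q) * U (Suc q) j)"
    proof -
      have "(\<Sum>k<Suc n. x' k * B' k i * B' k j) = x0 * U 0 i * U 0 j + (\<Sum>k<n. x k * B' (Suc k) i * B' (Suc k) j)"
        unfolding sum.lessThan_Suc_shift by (simp add: x'_def B'_def[of 0])
      also have "(\<Sum>k<n. x k * B' (Suc k) i * B' (Suc k) j) = (\<Sum>p<n. \<Sum>q<n. U (Suc p) i * A (Suc p) (Suc q) * U (Suc q) j)"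
        unfolding cols_gen by (intro sum.cong refl) (simp add: x)
      finally show ?thesis .
    qed
    also have "\<dots> = (\<Sum>p<Suc n. \<Sum>q<Suc n. U i p * A p q * U q j)"
    proof -
      have A0': "A 0 (Suc q) = 0" if "q < n" for q using Asym[of 0 "Suc q"] A0[of "Suc q"] that by simp
      have 1: "(\<Sum>q<Suc n. U i 0 * A 0 q * U q j) = x0 * U 0 i * U 0 j"
        unfolding sum.lessThan_Suc_shift using A0[of 0] A0' Usym[of i 0] ij by simp
      have 2: "(\<Sum>q<Suc n. U i (Suc p) * A (Suc p) q * U q j) = (\<Sum>q<n. U (Suc p) i * A (Suc p) (Suc q) * U (Suc q) j)" if "p < n" for p
        unfolding sum.lessThan_Suc_shift using A0[of "Suc p"] Usym[of i "Suc p"] ij that by simp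
      show ?thesis unfolding sum.lessThan_Suc_shift[of "\<lambda>p. \<Sum>q<Suc n. U i p * A p q * U q j"] 1 using 2 by simp
    qed
    finally show ?thesis using SA[OF ij] by (simp del: sum.lessThan_Suc)
  qed
  ultimately show ?case by blast
qed

section \<open>Positive definite matrices and square roots\<close>

text \<open>Vectors are index functions of which only the values below \<open>n\<close> matter; sums
  can then be rearranged without carrier conditions.\<close>

definition form :: "nat \<Rightarrow> real mat \<Rightarrow> (nat \<Rightarrow> real) \<Rightarrow> (nat \<Rightarrow> real) \<Rightarrow> real" where
  "form n M x y = (\<Sum>i<n. \<Sum>j<n. x i * M $$ (i,j) * y j)"

lemma mult_mat_entry:
  assumes "A \<in> carrier_mat n m" "B \<in> carrier_mat m p" "i < n" "j < p"
  shows "(A * B) $$ (i,j) = (\<Sum>k<m. A $$ (i,k) * B $$ (k,j))"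
  using assms by (auto simp: scalar_prod_def atLeast0LessThan)

lemma mult_vec_entry:
  assumes "A \<in> carrier_mat n m" "v \<in> carrier_vec m" "i < n"
  shows "(A *\<^sub>v v) $ i = (\<Sum>k<m. A $$ (i,k) * v $ k)"
  using assms by (auto simp: scalar_prod_def atLeast0LessThan)

lemma form_eq_scalar_prod:
  assumes "M \<in> carrier_mat n n" "x \<in> carrier_vec n" "y \<in> carrier_vec n"
  shows "scalar_prod x (M *\<^sub>v y) = form n M (($) x) (($) y)"
  using assms by (simp add: form_def scalar_prod_def atLeast0LessThan sum_distrib_left mult.assoc)

lemma form_cong:
  assumes "\<And>i j. i < n \<Longrightarrow> j < n \<Longrightarrow> M $$ (i,j) = M' $$ (i,j)"
    "\<And>i. i < n \<Longrightarrow> x i = x' i" "\<And>i. i < n \<Longrightarrow> y i = y' i"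
  shows "form n M x y = form n M' x' y'"
  unfolding form_def using assms by (intro sum.cong refl) auto

lemma form_vec: "form n M (($) (vec n x)) (($) (vec n y)) = form n M x y"
  by (rule form_cong) auto

lemma form_commute:
  assumes "\<And>i j. i < n \<Longrightarrow> j < n \<Longrightarrow> M $$ (i,j) = M $$ (j,i)"
  shows "form n M x y = form n M y x"
  unfolding form_def by (subst sum.swap) (use assms in \<open>auto intro!: sum.cong simp: ac_simps\<close>)

lemma form_sandwich_entry:
  assumes "A \<in> carrier_mat n n" "M \<in> carrier_mat n n" "k < n" "m < n"
  shows "(A * M * transpose_mat A) $$ (k,m) = form n M (\<lambda>h. A $$ (k,h)) (\<lambda>h. A $$ (m,h))"
proof -
  have "(A * M * transpose_mat A) $$ (k,m) = (\<Sum>j<n. (A * M) $$ (k,j) * transpose_mat A $$ (j,m))"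
    using assms by (intro mult_mat_entry) auto
  also have "\<dots> = (\<Sum>j<n. \<Sum>i<n. A $$ (k,i) * M $$ (i,j) * A $$ (m,j))"
    using assms by (intro sum.cong refl) (simp add: mult_mat_entry[OF assms(1,2)] sum_distrib_right del: index_mult_mat(1))
  also have "\<dots> = form n M (\<lambda>h. A $$ (k,h)) (\<lambda>h. A $$ (m,h))"
    unfolding form_def by (rule sum.swap)
  finally show ?thesis .
qed

lemma form_cauchy_schwarz:
  assumes sym: "\<And>i j. i < n \<Longrightarrow> j < n \<Longrightarrow> M $$ (i,j) = M $$ (j,i)"
    and psd: "\<And>x. 0 \<le> form n M x x"
  shows "(form n M x y)\<^sup>2 \<le> form n M x x * form n M y y"
proof -
  define a b c where "a = form n M x x" and "b = form n M x y" and "c = form n M y y"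
  have expand: "form n M (\<lambda>i. s * x i + t * y i) (\<lambda>i. s * x i + t * y i) = s\<^sup>2 * a + 2 * (s * t) * b + t\<^sup>2 * c" for s t
  proof -
    have "form n M (\<lambda>i. s * x i + t * y i) (\<lambda>i. s * x i + t * y i)
      = s\<^sup>2 * form n M x x + s * t * form n M x y + s * t * form n M y x + t\<^sup>2 * form n M y y"
      unfolding form_def sum_distrib_left sum.distrib[symmetric]
      by (intro sum.cong refl) (simp add: power2_eq_square algebra_simps)
    moreover have comm: "form n M y x = form n M x y" by (rule form_commute) (rule sym)
    ultimately show ?thesis unfolding a_def b_def c_def by simp
  qed
  have nn: "0 \<le> s\<^sup>2 * a + 2 * (s * t) * b + t\<^sup>2 * c" for s t
    unfolding expand[symmetric] by (rule psd)
  have c0: "0 \<le> c" unfolding c_def by (rule psd)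
  show ?thesis unfolding a_def[symmetric] b_def[symmetric] c_def[symmetric]
  proof (cases "c = 0")
    case True
    have "b = 0"
    proof (rule ccontr)
      assume b: "b \<noteq> 0"
      \<comment> \<open>Here \<open>c = 0\<close>, and this choice of \<open>t\<close> would make
        the form equal to \<open>a - (a + 1) = - 1\<close>.\<close>
      have "0 \<le> 1\<^sup>2 * a + 2 * (1 * (- (a + 1) / (2 * b))) * b + (- (a + 1) / (2 * b))\<^sup>2 * c" by (rule nn)
      then show False using b True by (simp add: field_simps)
    qed
    then show "b\<^sup>2 \<le> a * c" using True by simp
  next
    case False
    then have c: "0 < c" using c0 by simp
    \<comment> \<open>With \<open>s = c\<close> and \<open>t = - b\<close> the form becomes
      \<open>c\<close> times the discriminant \<open>c * a - b\<^sup>2\<close>.\<close>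
    have "0 \<le> c\<^sup>2 * a + 2 * (c * (- b)) * b + (- b)\<^sup>2 * c" by (rule nn)
    then have "0 \<le> c * (c * a - b\<^sup>2)" by (simp add: power2_eq_square algebra_simps)
    then show "b\<^sup>2 \<le> a * c" using c by (simp add: zero_le_mult_iff mult.commute)
  qed
qed

text \<open>Symmetry is part of this notion, in contrast to \<open>psd_mat\<close>; nonzero means
  nonzero at some index below \<open>n\<close>.\<close>

definition pd_mat :: "nat \<Rightarrow> real mat \<Rightarrow> bool" where
  "pd_mat n M \<longleftrightarrow> M \<in> carrier_mat n n \<and> (\<forall>i<n. \<forall>j<n. M $$ (i,j) = M $$ (j,i)) \<and>
     (\<forall>x. (\<exists>i<n. x i \<noteq> 0) \<longrightarrow> 0 < form n M x x)"

lemma pd_matD: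
  assumes "pd_mat n M"
  shows "M \<in> carrier_mat n n" "i < n \<Longrightarrow> j < n \<Longrightarrow> M $$ (i,j) = M $$ (j,i)"
    "i < n \<Longrightarrow> x i \<noteq> 0 \<Longrightarrow> 0 < form n M x x" "0 \<le> form n M x x"
proof -
  show "M \<in> carrier_mat n n" "i < n \<Longrightarrow> j < n \<Longrightarrow> M $$ (i,j) = M $$ (j,i)"
    "i < n \<Longrightarrow> x i \<noteq> 0 \<Longrightarrow> 0 < form n M x x" using assms by (auto simp: pd_mat_def)
  show "0 \<le> form n M x x"
  proof (cases "\<exists>i<n. x i \<noteq> 0")
    case True
    then show ?thesis using assms by (force simp: pd_mat_def)
  next
    case False
    then have "form n M x x = 0" unfolding form_def by (intro sum.neutral ballI) auto
    then show ?thesis by simp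
  qed
qed

text \<open>A nonzero kernel vector would annihilate the form, so the determinant does not vanish
  and \<open>minv\<close> does not take its default value.\<close>

lemma pd_mat_minv:
  assumes "pd_mat n M"
  shows "minv M \<in> carrier_mat n n" "M * minv M = 1\<^sub>m n" "minv M * M = 1\<^sub>m n"
proof -
  have M: "M \<in> carrier_mat n n" by (rule pd_matD[OF assms])
  have "det M \<noteq> 0"
  proof
    assume "det M = 0"
    then obtain v where v: "v \<in> carrier_vec n" "v \<noteq> 0\<^sub>v n" "M *\<^sub>v v = 0\<^sub>v n"
      using det_0_iff_vec_prod_zero_field[OF M] by auto
    then obtain i where "i < n" "v $ i \<noteq> 0" by (metis carrier_vecD eq_vecI index_zero_vec(1) index_zero_vec(2))
    then have "0 < form n M (($) v) (($) v)" by (rule pd_matD(3)[OF assms])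
    moreover have "form n M (($) v) (($) v) = 0"
      using form_eq_scalar_prod[OF M v(1) v(1)] v by simp
    ultimately show False by simp
  qed
  then obtain B where "B \<in> carrier_mat n n" "B * M = 1\<^sub>m n" "M * B = 1\<^sub>m n"
    using det_non_zero_imp_unit[OF M] by (auto simp: Units_def ring_mat_def)
  then have "mat_inverse M \<noteq> None" using mat_inverse(1)[OF M] M by (auto simp: Units_def ring_mat_def)
  then obtain B' where B': "mat_inverse M = Some B'" by auto
  show "minv M \<in> carrier_mat n n" "M * minv M = 1\<^sub>m n" "minv M * M = 1\<^sub>m n"
    using mat_inverse(2)[OF M B'] B' by (auto simp: minv_def)
qed

lemma symmetric_transpose:
  assumes "M \<in> carrier_mat n n" "\<And>i j. i < n \<Longrightarrow> j < n \<Longrightarrow> M $$ (i,j) = M $$ (j,i)"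
  shows "transpose_mat M = M"
  using assms by (intro eq_matI) auto

text \<open>Functional calculus: for orthonormal \<open>B\<close> the map from \<open>f\<close> to
  matrices is multiplicative. It is also applied to the oblique basis \<open>\<beta>\<close>, where
  only the formula for the quadratic form is used.\<close>

definition spectral_mat :: "nat \<Rightarrow> (nat \<Rightarrow> nat \<Rightarrow> real) \<Rightarrow> (nat \<Rightarrow> real) \<Rightarrow> real mat" where
  "spectral_mat n B f = Matrix.mat n n (\<lambda>(i,j). \<Sum>k<n. f k * B k i * B k j)"

lemma spectral_mat_carrier [simp]: "spectral_mat n B f \<in> carrier_mat n n"
  by (simp add: spectral_mat_def)

lemma spectral_mat_dim [simp]: "dim_row (spectral_mat n B f) = n" "dim_col (spectral_mat n B f) = n"
  by (simp_all add: spectral_mat_def)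

lemma spectral_mat_entry: "i < n \<Longrightarrow> j < n \<Longrightarrow> spectral_mat n B f $$ (i,j) = (\<Sum>k<n. f k * B k i * B k j)"
  by (simp add: spectral_mat_def)

lemma spectral_mat_sym: "i < n \<Longrightarrow> j < n \<Longrightarrow> spectral_mat n B f $$ (i,j) = spectral_mat n B f $$ (j,i)"
  by (simp add: spectral_mat_entry ac_simps)

lemma spectral_mat_transpose [simp]: "transpose_mat (spectral_mat n B f) = spectral_mat n B f"
  by (rule symmetric_transpose) (auto simp: spectral_mat_sym)

lemma spectral_mat_mult:
  assumes "orthonormal n B"
  shows "spectral_mat n B f * spectral_mat n B g = spectral_mat n B (\<lambda>k. f k * g k)"
proof (rule eq_matI)
  fix i j assume "i < dim_row (spectral_mat n B (\<lambda>k. f k * g k))" "j < dim_col (spectral_mat n B (\<lambda>k. f k * g k))"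
  then have ij: "i < n" "j < n" by auto
  have "(spectral_mat n B f * spectral_mat n B g) $$ (i,j) = (\<Sum>p<n. spectral_mat n B f $$ (i,p) * spectral_mat n B g $$ (p,j))"
    using ij by (intro mult_mat_entry) auto
  also have "\<dots> = (\<Sum>p<n. \<Sum>k<n. \<Sum>m<n. (f k * B k i) * (g m * B m j) * (B k p * B m p))"
    using ij by (intro sum.cong refl) (simp add: spectral_mat_entry sum_product ac_simps)
  also have "\<dots> = (\<Sum>k<n. \<Sum>m<n. \<Sum>p<n. (f k * B k i) * (g m * B m j) * (B k p * B m p))"
    by (rule trans[OF sum.swap]) (rule sum.cong[OF refl sum.swap])
  also have "\<dots> = (\<Sum>k<n. \<Sum>m<n. if m = k then (f k * B k i) * (g m * B m j) else 0)"
    unfolding sum_distrib_left[symmetric] using orthonormalD(1)[OF assms] by (intro sum.cong refl) auto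
  also have "\<dots> = (\<Sum>k<n. f k * g k * B k i * B k j)"
    by (simp add: sum.delta ac_simps)
  finally show "(spectral_mat n B f * spectral_mat n B g) $$ (i,j) = spectral_mat n B (\<lambda>k. f k * g k) $$ (i,j)"
    using ij by (simp add: spectral_mat_entry)
qed auto

lemma spectral_mat_cong: "(\<And>k. k < n \<Longrightarrow> f k = g k) \<Longrightarrow> spectral_mat n B f = spectral_mat n B g"
  unfolding spectral_mat_def by (rule eq_matI) (auto intro!: sum.cong)

lemma spectral_mat_one: "orthonormal n B \<Longrightarrow> spectral_mat n B (\<lambda>_. 1) = 1\<^sub>m n"
  by (rule eq_matI) (auto simp: spectral_mat_entry orthonormalD(2))

lemma form_spectral_mat: "form n (spectral_mat n B f) x y = (\<Sum>k<n. f k * (\<Sum>i<n. B k i * x i) * (\<Sum>j<n. B k j * y j))"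
proof -
  have "form n (spectral_mat n B f) x y = (\<Sum>i<n. \<Sum>j<n. \<Sum>k<n. f k * ((B k i * x i) * (B k j * y j)))"
    unfolding form_def by (intro sum.cong refl) (simp add: spectral_mat_entry sum_distrib_left sum_distrib_right ac_simps)
  also have "\<dots> = (\<Sum>k<n. \<Sum>i<n. \<Sum>j<n. f k * ((B k i * x i) * (B k j * y j)))"
    by (rule trans[OF sum.cong[OF refl sum.swap] sum.swap])
  also have "\<dots> = (\<Sum>k<n. f k * ((\<Sum>i<n. B k i * x i) * (\<Sum>j<n. B k j * y j)))"
    unfolding sum_product by (simp only: sum_distrib_left)
  finally show ?thesis by (simp only: mult.assoc)
qed

text \<open>The column relations recover \<open>x\<close> from its coordinates.\<close>

lemma orthonormal_coords_zero:
  assumes "orthonormal n B" "\<And>k. k < n \<Longrightarrow> (\<Sum>j<n. B k j * x j) = 0" "i < n"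
  shows "x i = 0"
proof -
  have "(\<Sum>k<n. B k i * (\<Sum>j<n. B k j * x j)) = (\<Sum>j<n. (\<Sum>k<n. B k i * B k j) * x j)"
    unfolding sum_distrib_left sum_distrib_right by (subst sum.swap) (intro sum.cong refl, simp add: mult.assoc)
  also have "\<dots> = (\<Sum>j<n. if j = i then x j else 0)"
    using orthonormalD(2)[OF assms(1) assms(3)] by (intro sum.cong refl) auto
  also have "\<dots> = x i" using assms(3) by (simp add: sum.delta)
  finally show ?thesis using assms(2) by simp
qed

lemma spectral_mat_pd:
  assumes B: "orthonormal n B" and f: "\<And>k. k < n \<Longrightarrow> 0 < f k"
  shows "pd_mat n (spectral_mat n B f)"
  unfolding pd_mat_def
proof (intro conjI allI impI)
  fix x :: "nat \<Rightarrow> real" assume "\<exists>i<n. x i \<noteq> 0"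
  then obtain i where i: "i < n" "x i \<noteq> 0" by auto
  have "\<exists>k<n. (\<Sum>j<n. B k j * x j) \<noteq> 0" using orthonormal_coords_zero[OF B, of x i] i by auto
  then obtain k where k: "k < n" "(\<Sum>j<n. B k j * x j) \<noteq> 0" by auto
  have "0 < (\<Sum>k<n. f k * ((\<Sum>j<n. B k j * x j) * (\<Sum>j<n. B k j * x j)))"
  proof (rule sum_pos2[of _ k])
    show "0 < f k * ((\<Sum>j<n. B k j * x j) * (\<Sum>j<n. B k j * x j))"
      unfolding power2_eq_square[symmetric] using f[OF k(1)] k(2) by (intro mult_pos_pos) auto
    show "0 \<le> f m * ((\<Sum>j<n. B m j * x j) * (\<Sum>j<n. B m j * x j))" if "m \<in> {..<n}" for m
      unfolding power2_eq_square[symmetric] using f[of m] that by (intro mult_nonneg_nonneg) auto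
  qed (use k in auto)
  then show "0 < form n (spectral_mat n B f) x x" unfolding form_spectral_mat by (simp only: mult.assoc)
qed (auto simp: spectral_mat_sym)

lemma spectral_decomposition:
  assumes "M \<in> carrier_mat n n" "\<And>i j. i < n \<Longrightarrow> j < n \<Longrightarrow> M $$ (i,j) = M $$ (j,i)"
  obtains B f where "orthonormal n B" "M = spectral_mat n B f"
proof -
  obtain B f where "orthonormal n B" "\<forall>i<n. \<forall>j<n. M $$ (i,j) = (\<Sum>k<n. f k * B k i * B k j)"
    using real_spectral[of n "\<lambda>i j. M $$ (i,j)"] assms(2) by blast
  then show ?thesis using assms(1) that[of B f] by (force intro!: eq_matI simp: spectral_mat_entry)
qed

lemma form_spectral_eigen:
  assumes B: "orthonormal n B" and k: "k < n"
  shows "form n (spectral_mat n B f) (B k) (B k) = f k"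
proof -
  have "form n (spectral_mat n B f) (B k) (B k) = (\<Sum>m<n. if m = k then f m else 0)"
    unfolding form_spectral_mat using orthonormalD(1)[OF B _ k] by (intro sum.cong refl) auto
  then show ?thesis using k by (simp add: sum.delta)
qed

lemma psd_mat_iff_form:
  assumes "M \<in> carrier_mat n n"
  shows "psd_mat M \<longleftrightarrow> (\<forall>x. 0 \<le> form n M x x)"
proof
  assume p: "psd_mat M"
  show "\<forall>x. 0 \<le> form n M x x"
  proof
    fix x
    have "0 \<le> scalar_prod (vec n x) (M *\<^sub>v vec n x)" using p assms by (auto simp: psd_mat_def)
    then show "0 \<le> form n M x x" using form_eq_scalar_prod[OF assms, of "vec n x" "vec n x"] by (simp add: form_vec)
  qed
next
  assume "\<forall>x. 0 \<le> form n M x x"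
  then show "psd_mat M" using assms form_eq_scalar_prod[OF assms] by (auto simp: psd_mat_def)
qed

text \<open>Two square roots agree on the eigenvectors \<open>u\<close> of the second one: if \<open>C u = m u\<close>, then
  \<open>y = R u - m u\<close> satisfies \<open>R y = - m y\<close>, which forces \<open>y = 0\<close> because \<open>R\<close> is positive definite.\<close>

lemma pd_sqrt_unique:
  assumes R: "pd_mat n R" and C: "C \<in> carrier_mat n n" "transpose_mat C = C" "psd_mat C"
    and eq: "C * C = R * R"
  shows "C = R"
proof -
  have Rc: "R \<in> carrier_mat n n" by (rule pd_matD[OF R])
  have Csym: "C $$ (i,j) = C $$ (j,i)" if "i < n" "j < n" for i j
    using C(1,2) that by (metis carrier_matD(1) carrier_matD(2) index_transpose_mat(1))
  obtain B m where B: "orthonormal n B" and Cm: "C = spectral_mat n B m"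
    using spectral_decomposition[OF C(1) Csym] by blast
  have m: "0 \<le> m k" if "k < n" for k
    using form_spectral_eigen[OF B that, of m] C(3) psd_mat_iff_form[OF C(1)] unfolding Cm by metis
  have agree: "(\<Sum>j<n. R $$ (i,j) * B k j) = m k * B k i" if i: "i < n" and k: "k < n" for i k
  proof -
    define y where "y i = (\<Sum>j<n. R $$ (i,j) * B k j) - m k * B k i" for i
    have RR: "(\<Sum>p<n. R $$ (i,p) * (\<Sum>j<n. R $$ (p,j) * B k j)) = m k * m k * B k i" if "i < n" for i
    proof -
      have "(\<Sum>p<n. R $$ (i,p) * (\<Sum>j<n. R $$ (p,j) * B k j)) = (\<Sum>j<n. (\<Sum>p<n. R $$ (i,p) * R $$ (p,j)) * B k j)"
        unfolding sum_distrib_left sum_distrib_right by (subst sum.swap) (intro sum.cong refl, simp add: mult.assoc)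
      also have "\<dots> = (\<Sum>j<n. (R * R) $$ (i,j) * B k j)"
        using that by (intro sum.cong refl) (simp add: mult_mat_entry[OF Rc Rc] del: index_mult_mat(1))
      also have "R * R = spectral_mat n B (\<lambda>k. m k * m k)" unfolding eq[symmetric] Cm by (rule spectral_mat_mult[OF B])
      also have "(\<Sum>j<n. spectral_mat n B (\<lambda>k. m k * m k) $$ (i,j) * B k j) = (\<Sum>q<n. m q * m q * B q i * (\<Sum>j<n. B q j * B k j))"
        unfolding sum_distrib_left using that
        by (subst sum.swap) (intro sum.cong refl, simp add: spectral_mat_entry sum_distrib_right mult.assoc)
      also have "\<dots> = (\<Sum>q<n. if q = k then m q * m q * B q i else 0)"
        using orthonormalD(1)[OF B _ k] by (intro sum.cong refl) auto
      finally show ?thesis using k by (simp add: sum.delta)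
    qed
    have Ry: "(\<Sum>p<n. R $$ (i,p) * y p) = - (m k * y i)" if "i < n" for i
    proof -
      have "(\<Sum>p<n. R $$ (i,p) * y p) = (\<Sum>p<n. R $$ (i,p) * (\<Sum>j<n. R $$ (p,j) * B k j)) - m k * (\<Sum>p<n. R $$ (i,p) * B k p)"
        unfolding y_def right_diff_distrib sum_subtractf by (simp add: sum_distrib_left mult.left_commute)
      then show ?thesis unfolding RR[OF that] y_def by (simp add: algebra_simps)
    qed
    have "form n R y y = (\<Sum>i<n. y i * (\<Sum>p<n. R $$ (i,p) * y p))"
      unfolding form_def by (simp add: sum_distrib_left mult.assoc)
    also have "\<dots> = - m k * (\<Sum>i<n. (y i)\<^sup>2)"
      unfolding sum_distrib_left[of "- m k"] by (intro sum.cong refl) (simp add: Ry power2_eq_square)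
    also have "\<dots> \<le> 0" using m[OF k] by (simp add: sum_nonneg)
    finally have "y i = 0" using pd_matD(3)[OF R i, of y] by force
    then show ?thesis by (simp add: y_def)
  qed
  show ?thesis
  proof (rule eq_matI)
    fix i j assume "i < dim_row R" "j < dim_col R"
    then have ij: "i < n" "j < n" using Rc by auto
    have "R $$ (i,j) - C $$ (i,j) = 0"
    proof (rule orthonormal_coords_zero[OF B, where x = "\<lambda>j. R $$ (i,j) - C $$ (i,j)"])
      fix k assume k: "k < n"
      have "(\<Sum>j<n. C $$ (i,j) * B k j) = (\<Sum>q<n. m q * B q i * (\<Sum>j<n. B q j * B k j))"
        unfolding sum_distrib_left Cm using ij
        by (subst sum.swap) (intro sum.cong refl, simp add: spectral_mat_entry sum_distrib_right mult.assoc)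
      also have "\<dots> = (\<Sum>q<n. if q = k then m q * B q i else 0)"
        using orthonormalD(1)[OF B _ k] by (intro sum.cong refl) auto
      also have "\<dots> = m k * B k i" using k by (simp add: sum.delta)
      finally have "(\<Sum>j<n. C $$ (i,j) * B k j) = m k * B k i" .
      then show "(\<Sum>j<n. B k j * (R $$ (i,j) - C $$ (i,j))) = 0"
        using agree[OF ij(1) k] by (simp add: right_diff_distrib sum_subtractf mult.commute)
    qed (rule ij)
    then show "C $$ (i,j) = R $$ (i,j)" by simp
  qed (use C Rc in auto)
qed

text \<open>\<open>psd_sqrt\<close> is a definite description: the spectral matrix of the roots
  supplies existence and \<open>pd_sqrt_unique\<close> uniqueness.\<close>

lemma psd_sqrt_spectral:
  assumes B: "orthonormal n B" and f: "\<And>k. k < n \<Longrightarrow> 0 < f k"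
  shows "psd_sqrt (spectral_mat n B f) = spectral_mat n B (\<lambda>k. sqrt (f k))"
proof -
  let ?R = "spectral_mat n B (\<lambda>k. sqrt (f k))"
  have pd: "pd_mat n ?R" by (rule spectral_mat_pd[OF B]) (simp add: f)
  have RR: "?R * ?R = spectral_mat n B f"
    unfolding spectral_mat_mult[OF B]
    by (rule spectral_mat_cong) (use f in \<open>simp add: less_imp_le abs_of_pos\<close>)
  show ?thesis
    unfolding psd_sqrt_def
  proof (rule the_equality)
    show "?R \<in> carrier_mat (dim_row (spectral_mat n B f)) (dim_row (spectral_mat n B f)) \<and> transpose_mat ?R = ?R \<and> psd_mat ?R \<and> ?R * ?R = spectral_mat n B f"
      using RR pd_matD(4)[OF pd] by (auto simp: psd_mat_iff_form[OF spectral_mat_carrier])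
    fix C assume "C \<in> carrier_mat (dim_row (spectral_mat n B f)) (dim_row (spectral_mat n B f)) \<and> transpose_mat C = C \<and> psd_mat C \<and> C * C = spectral_mat n B f"
    then show "C = ?R" using RR by (intro pd_sqrt_unique[OF pd]) auto
  qed
qed

text \<open>With \<open>R = psd_sqrt V\<close>, diagonalize \<open>R * minv M * R\<close> by an
  orthogonal \<open>O'\<close> and put \<open>b = O' * Ri\<close>, where \<open>Ri\<close> inverts
  \<open>R\<close>. The rows \<open>\<beta>\<close> of \<open>b\<close> are orthonormal for
  \<open>V\<close>, and the same \<open>b\<close> carries the diagonal matrix of \<open>l\<close> to
  \<open>minv M\<close>; so the eigenvalues of \<open>W\<close> are the weights of the quadratic
  statistic.\<close>

lemma simultaneous_diagonalization:
  fixes V M :: "real mat" and n :: nat and \<sigma> :: real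
  assumes V: "pd_mat n V" and M: "pd_mat n M"
    and VM: "\<And>x. form n V x x \<le> form n M x x" and MV: "\<And>x. form n M x x \<le> \<sigma>\<^sup>2 * form n V x x"
  obtains \<beta> B :: "nat \<Rightarrow> nat \<Rightarrow> real" and l :: "nat \<Rightarrow> real" where
    "orthonormal n B"
    "psd_sqrt V * minv M * psd_sqrt V = spectral_mat n B l"
    "\<And>k. k < n \<Longrightarrow> 0 < l k" "\<And>k. k < n \<Longrightarrow> l k \<le> 1" "\<And>k. k < n \<Longrightarrow> 1 \<le> \<sigma>\<^sup>2 * l k"
    "\<And>k m. k < n \<Longrightarrow> m < n \<Longrightarrow> form n V (\<beta> k) (\<beta> m) = (if k = m then 1 else 0)"
    "\<And>k m. k < n \<Longrightarrow> m < n \<Longrightarrow> l k * form n M (\<beta> k) (\<beta> m) = (if k = m then 1 else 0)"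
    "\<And>d. form n (minv M) d d = (\<Sum>k<n. l k * (\<Sum>h<n. \<beta> k h * d h)\<^sup>2)"
    "\<And>x. \<exists>\<alpha>. \<forall>h<n. x h = (\<Sum>k<n. \<alpha> k * \<beta> k h)"
proof -
  note Vc = pd_matD(1)[OF V] and Mc = pd_matD(1)[OF M]
  obtain B0 f where B0: "orthonormal n B0" and Vf: "V = spectral_mat n B0 f"
    using spectral_decomposition[OF Vc pd_matD(2)[OF V]] by blast
  have f: "0 < f k" if k: "k < n" for k
  proof -
    have "\<exists>i<n. B0 k i \<noteq> 0"
    proof (rule ccontr)
      assume "\<not> ?thesis"
      then have "(\<Sum>j<n. B0 k j * B0 k j) = 0" by (intro sum.neutral) auto
      then show False using orthonormalD(1)[OF B0 k k] by simp
    qed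
    then obtain i where "i < n" "B0 k i \<noteq> 0" by auto
    then have "0 < form n V (B0 k) (B0 k)" by (rule pd_matD(3)[OF V])
    then show ?thesis unfolding Vf form_spectral_eigen[OF B0 k] .
  qed
  define R Ri where "R = spectral_mat n B0 (\<lambda>k. sqrt (f k))" and "Ri = spectral_mat n B0 (\<lambda>k. 1 / sqrt (f k))"
  have Rsq: "psd_sqrt V = R" unfolding Vf R_def by (rule psd_sqrt_spectral[OF B0 f])
  have Rc [simp]: "R \<in> carrier_mat n n" "Ri \<in> carrier_mat n n" by (simp_all add: R_def Ri_def)
  have one: "spectral_mat n B0 g = 1\<^sub>m n" if "\<And>k. k < n \<Longrightarrow> g k = 1" for g
    unfolding spectral_mat_one[OF B0, symmetric] using that by (rule spectral_mat_cong)
  have sf: "f k \<noteq> 0" if "k < n" for k using f[OF that] by simp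
  have RRi: "R * Ri = 1\<^sub>m n" unfolding R_def Ri_def spectral_mat_mult[OF B0] by (rule one) (simp add: sf)
  have RiR: "Ri * R = 1\<^sub>m n" unfolding R_def Ri_def spectral_mat_mult[OF B0] by (rule one) (simp add: sf)
  have RR: "R * R = V" unfolding R_def Vf spectral_mat_mult[OF B0]
    by (rule spectral_mat_cong) (use f in \<open>simp add: less_imp_le abs_of_pos\<close>)
  have Rt [simp]: "transpose_mat R = R" "transpose_mat Ri = Ri" by (simp_all add: R_def Ri_def)
  define Ei where "Ei = minv M"
  have Ei: "Ei \<in> carrier_mat n n" "M * Ei = 1\<^sub>m n" "Ei * M = 1\<^sub>m n"
    unfolding Ei_def using pd_mat_minv[OF M] by auto
  have Mt: "transpose_mat M = M" by (rule symmetric_transpose[OF Mc pd_matD(2)[OF M]])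
  have Eit: "transpose_mat Ei = Ei"
  proof -
    have "transpose_mat Ei * M = 1\<^sub>m n"
      using arg_cong[OF Ei(2), of transpose_mat] transpose_mult[OF Mc Ei(1)] Mt by simp
    then have "transpose_mat Ei * M * Ei = Ei" using Ei(1) by simp
    moreover have "transpose_mat Ei * M * Ei = transpose_mat Ei * (M * Ei)"
      using Ei(1) Mc by (intro assoc_mult_mat[of _ n n _ n _ n]) auto
    ultimately show ?thesis using Ei by simp
  qed
  define W where "W = R * Ei * R"
  have Wc: "W \<in> carrier_mat n n" unfolding W_def using Ei(1) by (intro mult_carrier_mat[of _ n n]) auto
  have Wt: "transpose_mat W = W"
  proof -
    have "transpose_mat W = R * (Ei * R)"
      unfolding W_def using Ei(1) transpose_mult[of "R * Ei" n n R n] transpose_mult[of R n n Ei n] Eit by simp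
    then show ?thesis unfolding W_def using Ei(1) by (simp add: assoc_mult_mat[of R n n Ei n R n])
  qed
  have Wsym: "W $$ (i,j) = W $$ (j,i)" if "i < n" "j < n" for i j
    using Wt Wc that by (metis carrier_matD(1) carrier_matD(2) index_transpose_mat(1))
  obtain B l where B: "orthonormal n B" and Wl: "W = spectral_mat n B l"
    using spectral_decomposition[OF Wc Wsym] by blast
  define O' where "O' = Matrix.mat n n (\<lambda>(k,j). B k j)"
  have Oc [simp]: "O' \<in> carrier_mat n n" "transpose_mat O' \<in> carrier_mat n n" by (simp_all add: O'_def)
  have OOt: "O' * transpose_mat O' = 1\<^sub>m n"
    by (rule eq_matI) (auto simp: O'_def scalar_prod_def atLeast0LessThan orthonormalD(1)[OF B])
  have OtO: "transpose_mat O' * O' = 1\<^sub>m n"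
    by (rule eq_matI) (auto simp: O'_def scalar_prod_def atLeast0LessThan orthonormalD(2)[OF B])
  define L where "L = mat_diag n l"
  have Lc [simp]: "L \<in> carrier_mat n n" by (simp add: L_def)
  have WO: "W = transpose_mat O' * L * O'"
  proof (rule eq_matI)
    fix i j assume "i < dim_row (transpose_mat O' * L * O')" "j < dim_col (transpose_mat O' * L * O')"
    then have ij: "i < n" "j < n" by (auto simp: O'_def)
    have LO: "L * O' = Matrix.mat n n (\<lambda>(k,j). l k * B k j)"
      unfolding L_def O'_def by (rule eq_matI) (auto simp: mat_diag_mult_left[of _ n n])
    have "transpose_mat O' * L * O' = transpose_mat O' * (L * O')" by (rule assoc_mult_mat[of _ n n _ n _ n]) auto
    then have "(transpose_mat O' * L * O') $$ (i,j) = (\<Sum>k<n. B k i * (l k * B k j))"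
      unfolding LO using ij by (simp add: O'_def scalar_prod_def atLeast0LessThan)
    then show "W $$ (i,j) = (transpose_mat O' * L * O') $$ (i,j)"
      unfolding Wl using ij by (simp add: spectral_mat_entry ac_simps)
  qed (use Wc in \<open>auto simp: O'_def\<close>)
  define b where "b = O' * Ri"
  define \<Gamma> where "\<Gamma> = R * transpose_mat O'"
  have bc [simp]: "b \<in> carrier_mat n n" "\<Gamma> \<in> carrier_mat n n" unfolding b_def \<Gamma>_def by (auto intro!: mult_carrier_mat[of _ n n])
  have bt: "transpose_mat b = Ri * transpose_mat O'"
    unfolding b_def by (subst transpose_mult[of _ n n _ n]) auto
  note assoc = assoc_mult_mat[of _ n n _ n _ n]
  note ones = left_mult_one_mat[of _ n n] right_mult_one_mat[of _ n n]
  have carr: "X * Y' \<in> carrier_mat n n" if "X \<in> carrier_mat n n" "Y' \<in> carrier_mat n n" for X Y' :: "real mat"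
    using that by (rule mult_carrier_mat)
  have b\<Gamma>: "b * \<Gamma> = 1\<^sub>m n"
  proof -
    have "b * \<Gamma> = O' * ((Ri * R) * transpose_mat O')" unfolding b_def \<Gamma>_def by (simp add: assoc carr)
    then show ?thesis unfolding RiR by (simp add: OOt ones)
  qed
  have \<Gamma>b: "\<Gamma> * b = 1\<^sub>m n" by (rule mat_mult_left_right_inverse[OF bc b\<Gamma>])
  have bVb: "b * V * transpose_mat b = 1\<^sub>m n"
  proof -
    have "b * V * transpose_mat b = O' * ((Ri * R) * ((R * Ri) * transpose_mat O'))"
      unfolding bt RR[symmetric] unfolding b_def by (simp add: assoc carr)
    then show ?thesis unfolding RiR RRi by (simp add: OOt ones)
  qed
  have bLb: "transpose_mat b * L * b = Ei"
  proof -
    have "transpose_mat b * L * b = Ri * (transpose_mat O' * L * O') * Ri"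
      unfolding bt unfolding b_def by (simp add: assoc carr)
    also have "\<dots> = (Ri * R) * (Ei * (R * Ri))" unfolding WO[symmetric] W_def using Ei(1) by (simp add: assoc carr)
    finally show ?thesis unfolding RiR RRi using Ei(1) by (simp add: ones)
  qed
  \<comment> \<open>Inverting \<open>transpose_mat b * L * b = Ei\<close> shows that
    \<open>b * M * transpose_mat b\<close> is the inverse of \<open>L\<close>, so
    \<open>\<beta>\<close> diagonalizes \<open>M\<close> as well.\<close>
  have LbMb: "L * (b * M * transpose_mat b) = 1\<^sub>m n"
  proof -
    have "transpose_mat b * (L * b * M) = transpose_mat b * L * b * M" using Mc by (simp add: assoc carr)
    then have "transpose_mat b * (L * b * M) = 1\<^sub>m n" unfolding bLb using Ei by simp
    then have "(L * b * M) * transpose_mat b = 1\<^sub>m n"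
      using Mc by (intro mat_mult_left_right_inverse[of "transpose_mat b" n]) (auto intro!: mult_carrier_mat[of _ n n])
    then show ?thesis using Mc by (simp add: assoc carr)
  qed
  define \<beta> where "\<beta> k h = b $$ (k,h)" for k h
  have P1: "form n V (\<beta> k) (\<beta> m) = (if k = m then 1 else 0)" if "k < n" "m < n" for k m
    using form_sandwich_entry[OF bc(1) Vc that] that unfolding bVb \<beta>_def by simp
  have P2: "l k * form n M (\<beta> k) (\<beta> m) = (if k = m then 1 else 0)" if km: "k < n" "m < n" for k m
  proof -
    have bM: "b * M * transpose_mat b \<in> carrier_mat n n" using Mc by (intro mult_carrier_mat[of _ n n]) auto
    have "(L * (b * M * transpose_mat b)) $$ (k,m) = l k * (b * M * transpose_mat b) $$ (k,m)"
      unfolding L_def using km bM by (subst mat_diag_mult_left[OF bM]) auto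
    then show ?thesis unfolding LbMb \<beta>_def form_sandwich_entry[OF bc(1) Mc km] using km by simp
  qed
  \<comment> \<open>\<open>l k\<close> is the reciprocal of the \<open>M\<close>-form at
    \<open>\<beta> k\<close>, where the \<open>V\<close>-form is one; the two comparisons of forms
    put that value between \<open>1\<close> and \<open>\<sigma>\<^sup>2\<close>.\<close>
  have lb: "0 < l k \<and> l k \<le> 1 \<and> 1 \<le> \<sigma>\<^sup>2 * l k" if k: "k < n" for k
  proof -
    define t where "t = form n M (\<beta> k) (\<beta> k)"
    have t: "1 \<le> t" "t \<le> \<sigma>\<^sup>2" using VM[of "\<beta> k"] MV[of "\<beta> k"] P1[OF k k] by (auto simp: t_def)
    have lt: "l k * t = 1" using P2[OF k k] by (simp add: t_def)
    then have lk: "l k = 1 / t" using t by (simp add: field_simps)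
    show ?thesis using t unfolding lk by (simp add: divide_le_eq le_divide_eq)
  qed
  have P3: "form n (minv M) d d = (\<Sum>k<n. l k * (\<Sum>h<n. \<beta> k h * d h)\<^sup>2)" for d
  proof -
    have "minv M $$ (i,j) = (\<Sum>k<n. l k * \<beta> k i * \<beta> k j)" if ij: "i < n" "j < n" for i j
    proof -
      have Lb: "L * b \<in> carrier_mat n n" by (intro mult_carrier_mat[of _ n n]) auto
      have "minv M = transpose_mat b * (L * b)" unfolding Ei_def[symmetric] bLb[symmetric] by (simp add: assoc carr)
      then have "minv M $$ (i,j) = (\<Sum>k<n. transpose_mat b $$ (i,k) * (L * b) $$ (k,j))"
        using ij mult_mat_entry[OF _ Lb, of "transpose_mat b" n i j] by simp
      also have "\<dots> = (\<Sum>k<n. l k * \<beta> k i * \<beta> k j)"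
        unfolding L_def mat_diag_mult_left[OF bc(1)] \<beta>_def using ij carrier_matD[OF bc(1)] by (intro sum.cong refl) auto
      finally show ?thesis .
    qed
    then have "form n (minv M) d d = form n (spectral_mat n \<beta> l) d d" by (intro form_cong) (auto simp: spectral_mat_entry)
    then show ?thesis unfolding form_spectral_mat by (simp add: power2_eq_square mult.assoc)
  qed
  have P4: "\<exists>\<alpha>. \<forall>h<n. x h = (\<Sum>k<n. \<alpha> k * \<beta> k h)" for x
  proof (intro exI allI impI)
    fix h assume h: "h < n"
    let ?\<alpha> = "\<lambda>k. \<Sum>i<n. x i * \<Gamma> $$ (i,k)"
    have "(\<Sum>k<n. ?\<alpha> k * \<beta> k h) = (\<Sum>i<n. x i * (\<Sum>k<n. \<Gamma> $$ (i,k) * b $$ (k,h)))"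
      unfolding \<beta>_def sum_distrib_left sum_distrib_right by (subst sum.swap) (intro sum.cong refl, simp add: mult.assoc)
    also have "\<dots> = (\<Sum>i<n. x i * (\<Gamma> * b) $$ (i,h))"
      using h by (intro sum.cong refl) (simp add: mult_mat_entry[OF bc(2,1)] del: index_mult_mat(1))
    also have "\<dots> = (\<Sum>i<n. if i = h then x i else 0)" unfolding \<Gamma>b using h by (intro sum.cong refl) auto
    finally show "x h = (\<Sum>k<n. ?\<alpha> k * \<beta> k h)" using h by (simp add: sum.delta)
  qed
  show ?thesis
    by (rule that[of B l \<beta>]) (use B Wl W_def Rsq Ei_def lb P1 P2 P3 P4 in auto)
qed

section \<open>Variance of pair statistics and perturbation of inverses\<close>

context assignment_space
begin

text \<open>Decoupling takes the place of independence. A transposition changes \<open>U\<close> by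
  at most \<open>K = 8 * \<rho>\<close>, so by \<open>mean_decouple\<close> each summand has
  covariance with \<open>U\<close> at most \<open>2 * K\<close> times its absolute mean; these
  covariances add up to the variance.\<close>

lemma pair_statistic_variance:
  fixes G :: "nat \<Rightarrow> nat \<Rightarrow> nat \<Rightarrow> nat \<Rightarrow> real"
  assumes sym: "\<And>i j p q. G i j p q = G j i q p"
    and row: "\<And>z i. z \<in> \<Omega> \<Longrightarrow> i < N \<Longrightarrow> (\<Sum>j\<in>{..<N}-{i}. \<bar>G i j (z i) (z j)\<bar>) \<le> \<rho>"
  defines "U \<equiv> \<lambda>z. \<Sum>i<N. \<Sum>j\<in>{..<N}-{i}. G i j (z i) (z j)"
  shows "E (\<lambda>z. (U z - E U)\<^sup>2) \<le> 16 * real N * \<rho>\<^sup>2"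
proof -
  obtain z0 where z0: "z0 \<in> \<Omega>" using assignments_nonempty by blast
  have \<rho>: "0 \<le> \<rho>"
  proof -
    have "0 \<le> (\<Sum>j\<in>{..<N}-{0}. \<bar>G 0 j (z0 0) (z0 j)\<bar>)" by (intro sum_nonneg) auto
    also have "\<dots> \<le> \<rho>" using row[OF z0, of 0] two_le_N by simp
    finally show ?thesis .
  qed
  define K where "K = 8 * \<rho>"
  have swap1: "\<bar>U (swap_at a b z) - U z\<bar> \<le> K" if z: "z \<in> \<Omega>" and ab: "a < N" "b < N" for z a b
  proof -
    define z' where "z' = swap_at a b z"
    have z': "z' \<in> \<Omega>" unfolding z'_def by (rule swap_at_assignment[OF z ab])
    define ind where "ind i = (if i = a \<or> i = b then 1 else (0::real))" for i
    have card: "(\<Sum>i<N. ind i) \<le> 2"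
    proof -
      have "(\<Sum>i<N. ind i) \<le> (\<Sum>i<N. (if i = a then 1 else 0) + (if i = b then 1 else 0))"
        by (intro sum_mono) (auto simp: ind_def)
      also have "\<dots> = 2" using ab by (simp add: sum.distrib sum.delta)
      finally show ?thesis .
    qed
    have rows: "(\<Sum>i<N. \<Sum>j\<in>{..<N}-{i}. ind i * \<bar>G i j (w i) (w j)\<bar>) \<le> 2 * \<rho>" if w: "w \<in> \<Omega>" for w
    proof -
      have "(\<Sum>i<N. \<Sum>j\<in>{..<N}-{i}. ind i * \<bar>G i j (w i) (w j)\<bar>) \<le> (\<Sum>i<N. ind i * \<rho>)"
        unfolding sum_distrib_left[symmetric] using row[OF w] by (intro sum_mono mult_left_mono) (auto simp: ind_def)
      also have "\<dots> \<le> 2 * \<rho>" unfolding sum_distrib_right[symmetric] using card \<rho> by (intro mult_right_mono) auto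
      finally show ?thesis .
    qed
    have offswap: "(\<Sum>i<N. \<Sum>j\<in>{..<N}-{i}. f i j) = (\<Sum>i<N. \<Sum>j\<in>{..<N}-{i}. f j i)" for f :: "nat \<Rightarrow> nat \<Rightarrow> real"
      unfolding sum_off_diagonal by (subst sum.swap) simp
    have cols: "(\<Sum>i<N. \<Sum>j\<in>{..<N}-{i}. ind j * \<bar>G i j (w i) (w j)\<bar>) \<le> 2 * \<rho>" if w: "w \<in> \<Omega>" for w
    proof -
      have "(\<Sum>i<N. \<Sum>j\<in>{..<N}-{i}. ind j * \<bar>G i j (w i) (w j)\<bar>) = (\<Sum>i<N. \<Sum>j\<in>{..<N}-{i}. ind i * \<bar>G i j (w i) (w j)\<bar>)"
        unfolding offswap[of "\<lambda>i j. ind j * \<bar>G i j (w i) (w j)\<bar>"]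
        by (intro sum.cong refl arg_cong2[where f = "(*)"] arg_cong[where f = abs] sym)
      then show ?thesis using rows[OF w] by simp
    qed
    have "\<bar>U z' - U z\<bar> \<le> (\<Sum>i<N. \<Sum>j\<in>{..<N}-{i}. \<bar>G i j (z' i) (z' j) - G i j (z i) (z j)\<bar>)"
      unfolding U_def sum_subtractf[symmetric] by (rule order_trans[OF sum_abs]) (rule sum_mono, rule sum_abs)
    \<comment> \<open>Only pairs that meet \<open>{a, b}\<close> change. Two rows and two columns,
      once for \<open>z\<close> and once for \<open>z'\<close>, make eight sums bounded by
      \<open>\<rho>\<close>.\<close>
    also have "\<dots> \<le> (\<Sum>i<N. \<Sum>j\<in>{..<N}-{i}. (ind i * \<bar>G i j (z' i) (z' j)\<bar> + ind j * \<bar>G i j (z' i) (z' j)\<bar>)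
        + (ind i * \<bar>G i j (z i) (z j)\<bar> + ind j * \<bar>G i j (z i) (z j)\<bar>))"
    proof (intro sum_mono)
      fix i j
      show "\<bar>G i j (z' i) (z' j) - G i j (z i) (z j)\<bar> \<le> (ind i * \<bar>G i j (z' i) (z' j)\<bar> + ind j * \<bar>G i j (z' i) (z' j)\<bar>)
        + (ind i * \<bar>G i j (z i) (z j)\<bar> + ind j * \<bar>G i j (z i) (z j)\<bar>)"
        by (auto simp: ind_def z'_def swap_at_apply)
    qed
    also have "\<dots> \<le> (2 * \<rho> + 2 * \<rho>) + (2 * \<rho> + 2 * \<rho>)"
      unfolding sum.distrib by (intro add_mono rows cols z z')
    finally show ?thesis by (simp add: z'_def K_def)
  qed
  have dec: "\<bar>E (\<lambda>z. G i j (z i) (z j) * U z) - E (\<lambda>z. G i j (z i) (z j)) * E U\<bar> \<le> 2 * K * E (\<lambda>z. \<bar>G i j (z i) (z j)\<bar>)"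
    if ij: "i < N" "j < N" "i \<noteq> j" for i j
  proof -
    let ?C = "real N * (real N - 1)"
    have pairE: "(\<Sum>i'<N. \<Sum>j'\<in>{..<N}-{i'}. E (\<lambda>z. g (z i') (z j') * h z)) = pair_total g * E h" for g :: "nat \<Rightarrow> nat \<Rightarrow> real" and h
    proof -
      have "(\<Sum>i'<N. \<Sum>j'\<in>{..<N}-{i'}. E (\<lambda>z. g (z i') (z j') * h z)) = E (\<lambda>z. (\<Sum>i'<N. \<Sum>j'\<in>{..<N}-{i'}. g (z i') (z j')) * h z)"
        by (simp add: fin_mean_sum sum_distrib_right)
      also have "\<dots> = E (\<lambda>z. pair_total g * h z)" by (rule fin_mean_cong) (simp only: sum_over_pairs)
      finally show ?thesis by (simp add: fin_mean_mult_left)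
    qed
    have "norm (E (\<lambda>z. G i j (z i) (z j) * U z) - (\<Sum>i'<N. \<Sum>j'\<in>{..<N}-{i'}. E (\<lambda>z. G i j (z i') (z j') * U z)) /\<^sub>R ?C)
       \<le> (\<Sum>i'<N. \<Sum>j'\<in>{..<N}-{i'}. E (\<lambda>z. \<bar>G i j (z i') (z j')\<bar> * (2 * K))) / ?C"
    proof (rule mean_decouple[OF ij, where \<Phi> = "\<lambda>p q z. G i j p q * U z" and B = "\<lambda>p q z. \<bar>G i j p q\<bar> * (2 * K)"])
      fix p q z a b c d assume z: "z \<in> \<Omega>" and l: "a < N" "b < N" "c < N" "d < N"
      have "\<bar>U (swap_at c d (swap_at a b z)) - U z\<bar> \<le> 2 * K"
        using swap1[OF swap_at_assignment[OF z l(1,2)] l(3,4)] swap1[OF z l(1,2)] by linarith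
      then show "norm (G i j p q * U (swap_at c d (swap_at a b z)) - G i j p q * U z) \<le> \<bar>G i j p q\<bar> * (2 * K)"
        by (simp add: right_diff_distrib[symmetric] abs_mult mult_left_mono)
    qed
    then show ?thesis
      unfolding pairE[of "G i j" U] pairE[of "\<lambda>p q. \<bar>G i j p q\<bar>" "\<lambda>_. 2 * K"]
        mean_pair[OF ij, of "G i j"] mean_pair[OF ij, of "\<lambda>p q. \<bar>G i j p q\<bar>"]
      by (simp add: fin_mean_const divide_inverse ac_simps)
  qed
  have UU: "E (\<lambda>z. U z * U z) = (\<Sum>i<N. \<Sum>j\<in>{..<N}-{i}. E (\<lambda>z. G i j (z i) (z j) * U z))"
  proof -
    have "U z * U z = (\<Sum>i<N. \<Sum>j\<in>{..<N}-{i}. G i j (z i) (z j) * U z)" for z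
    proof -
      have "U z = (\<Sum>i<N. \<Sum>j\<in>{..<N}-{i}. G i j (z i) (z j))" by (simp add: U_def)
      then have "U z * U z = (\<Sum>i<N. \<Sum>j\<in>{..<N}-{i}. G i j (z i) (z j)) * U z" by (rule arg_cong[of _ _ "\<lambda>t. t * U z"])
      then show ?thesis by (simp only: sum_distrib_right)
    qed
    then show ?thesis by (simp add: fin_mean_sum)
  qed
  have EU: "E U = (\<Sum>i<N. \<Sum>j\<in>{..<N}-{i}. E (\<lambda>z. G i j (z i) (z j)))"
    unfolding U_def by (simp add: fin_mean_sum)
  have "E (\<lambda>z. (U z - E U)\<^sup>2) = E (\<lambda>z. U z * U z) - E U * E U"
    by (simp add: power2_eq_square algebra_simps fin_mean_diff fin_mean_add fin_mean_mult_left fin_mean_mult_right fin_mean_const)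
  also have "\<dots> = (\<Sum>i<N. \<Sum>j\<in>{..<N}-{i}. E (\<lambda>z. G i j (z i) (z j) * U z) - E (\<lambda>z. G i j (z i) (z j)) * E U)"
    unfolding UU sum_subtractf sum_distrib_right[symmetric] EU[symmetric] ..
  also have "\<dots> \<le> (\<Sum>i<N. \<Sum>j\<in>{..<N}-{i}. 2 * K * E (\<lambda>z. \<bar>G i j (z i) (z j)\<bar>))"
    by (intro sum_mono) (rule order_trans[OF abs_ge_self dec]; simp)
  also have "\<dots> = 2 * K * E (\<lambda>z. \<Sum>i<N. \<Sum>j\<in>{..<N}-{i}. \<bar>G i j (z i) (z j)\<bar>)"
    by (simp add: fin_mean_sum sum_distrib_left)
  also have "\<dots> \<le> 2 * K * E (\<lambda>z. \<Sum>i<N. \<rho>)"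
    using \<rho> row by (intro mult_left_mono fin_mean_mono sum_mono) (auto simp: K_def)
  also have "\<dots> = 16 * real N * \<rho>\<^sup>2" by (simp add: fin_mean_const K_def power2_eq_square)
  finally show ?thesis .
qed

end

text \<open>Neyman's variance formula for a general array. Distinct units are handled by
  \<open>mean_pair\<close>, and centring makes the full double sums vanish, so that only their
  diagonals survive.\<close>

lemma (in linear_statistics) covariance:
  assumes k: "k < H" and m: "m < H"
  shows "E (\<lambda>z. stat k z * stat m z) =
    (\<Sum>q<Q. real (Nq q) * (\<Sum>i<N. a k i q * a m i q)) / (real N - 1) -
    (\<Sum>i<N. (\<Sum>q<Q. real (Nq q) * a k i q) * (\<Sum>q<Q. real (Nq q) * a m i q)) / (real N * (real N - 1))"
proof -
  define r where "r k i = (\<Sum>q<Q. real (Nq q) * a k i q)" for k i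
  define P where "P = (\<Sum>q<Q. real (Nq q) * (\<Sum>i<N. a k i q * a m i q))"
  define R where "R = (\<Sum>i<N. r k i * r m i)"
  let ?C = "real N * (real N - 1)"
  have P': "(\<Sum>i<N. \<Sum>q<Q. real (Nq q) * (a k i q * a m i q)) = P"
    unfolding P_def sum_distrib_left by (rule sum.swap)
  have r0: "(\<Sum>j<N. r m j) = 0"
    unfolding r_def by (subst sum.swap) (simp add: sum_distrib_left[symmetric] centred m)
  have "E (\<lambda>z. stat k z * stat m z) = (\<Sum>i<N. \<Sum>j<N. E (\<lambda>z. a k i (z i) * a m j (z j)))"
    unfolding stat_def sum_product by (simp add: fin_mean_sum)
  also have "\<dots> = (\<Sum>i<N. \<Sum>j\<in>{..<N}-{i}. E (\<lambda>z. a k i (z i) * a m j (z j))) + (\<Sum>i<N. E (\<lambda>z. a k i (z i) * a m i (z i)))"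
    unfolding sum_off_diagonal by simp
  also have "(\<Sum>i<N. E (\<lambda>z. a k i (z i) * a m i (z i))) = P / real N"
  proof -
    have "(\<Sum>i<N. E (\<lambda>z. a k i (z i) * a m i (z i))) = (\<Sum>i<N. (\<Sum>q<Q. real (Nq q) * (a k i q * a m i q)) / real N)"
      by (intro sum.cong refl mean_single) auto
    then show ?thesis unfolding sum_divide_distrib[symmetric] P' .
  qed
  also have "(\<Sum>i<N. \<Sum>j\<in>{..<N}-{i}. E (\<lambda>z. a k i (z i) * a m j (z j))) = (P - R) / ?C"
  proof -
    have pt: "pair_total (\<lambda>p q. a k i p * a m j q) = r k i * r m j - (\<Sum>q<Q. real (Nq q) * (a k i q * a m j q))" for i j
    proof -
      have "r k i * r m j = (\<Sum>q<Q. real (Nq q) * (\<Sum>p<Q. real (Nq p) * (a k i q * a m j p)))"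
        unfolding r_def sum_product by (simp add: sum_distrib_left ac_simps)
      then show ?thesis unfolding pair_total_def by simp
    qed
    have "(\<Sum>i<N. \<Sum>j\<in>{..<N}-{i}. E (\<lambda>z. a k i (z i) * a m j (z j))) = (\<Sum>i<N. \<Sum>j\<in>{..<N}-{i}. pair_total (\<lambda>p q. a k i p * a m j q) / ?C)"
      by (intro sum.cong refl mean_pair) auto
    also have "\<dots> = (\<Sum>i<N. \<Sum>j\<in>{..<N}-{i}. r k i * r m j - (\<Sum>q<Q. real (Nq q) * (a k i q * a m j q))) / ?C"
      unfolding pt sum_divide_distrib ..
    also have "(\<Sum>i<N. \<Sum>j\<in>{..<N}-{i}. r k i * r m j - (\<Sum>q<Q. real (Nq q) * (a k i q * a m j q))) = P - R"
    proof -
      have "(\<Sum>i<N. \<Sum>j<N. r k i * r m j) = 0" unfolding sum_distrib_left[symmetric] r0 by simp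
      moreover have "(\<Sum>i<N. \<Sum>j<N. \<Sum>q<Q. real (Nq q) * (a k i q * a m j q)) = 0"
      proof -
        have "(\<Sum>j<N. \<Sum>q<Q. real (Nq q) * (a k i q * a m j q)) = 0" for i
        proof -
          have "(\<Sum>j<N. \<Sum>q<Q. real (Nq q) * (a k i q * a m j q)) = (\<Sum>q<Q. real (Nq q) * a k i q * (\<Sum>j<N. a m j q))"
            unfolding sum_distrib_left by (subst sum.swap) (simp add: mult.assoc)
          then show ?thesis using centred[OF m] by simp
        qed
        then show ?thesis by simp
      qed
      ultimately show ?thesis unfolding sum_off_diagonal sum_subtractf P' R_def by simp
    qed
    finally show ?thesis .
  qed
  also have "(P - R) / ?C + P / real N = P / (real N - 1) - R / ?C"
  proof -
    have split: "P / ((e + 1) * e) + P / (e + 1) = P / e" if "e > 0" for e :: real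
    proof -
      have "P / (e + 1) = P * e / ((e + 1) * e)" using that by simp
      then have "P / ((e + 1) * e) + P / (e + 1) = (P + P * e) / ((e + 1) * e)" by (simp only: add_divide_distrib)
      also have "P + P * e = (e + 1) * P" by (simp add: algebra_simps)
      also have "(e + 1) * P / ((e + 1) * e) = P / e" using that by (intro mult_divide_mult_cancel_left) simp
      finally show ?thesis .
    qed
    show ?thesis using split[of "real N - 1"] two_le_N unfolding diff_divide_distrib by simp
  qed
  finally show ?thesis unfolding P_def R_def r_def .
qed

text \<open>Replaces the sample mean by a double sum of differences, so that a sample variance
  becomes a statistic of pairs of labels.\<close>

lemma sum_squared_deviations:
  fixes x :: "nat \<Rightarrow> real"
  assumes "finite G" "G \<noteq> {}"
  shows "(\<Sum>i\<in>G. (x i - (\<Sum>j\<in>G. x j) / real (card G))\<^sup>2) = (\<Sum>i\<in>G. \<Sum>j\<in>G. (x i - x j)\<^sup>2) / (2 * real (card G))"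
proof -
  define n where "n = real (card G)"
  have n: "n \<noteq> 0" using assms by (simp add: n_def)
  define s t where "s = (\<Sum>i\<in>G. x i)" and "t = (\<Sum>i\<in>G. (x i)\<^sup>2)"
  have "(\<Sum>i\<in>G. (x i - s / n)\<^sup>2) = t - 2 * (s / n) * s + n * (s / n)\<^sup>2"
  proof -
    have lin: "(\<Sum>i\<in>G. 2 * x i * c) = 2 * c * s" for c
      unfolding s_def sum_distrib_left by (intro sum.cong refl) simp
    show ?thesis unfolding power2_diff sum.distrib sum_subtractf t_def[symmetric] lin by (simp add: n_def)
  qed
  moreover have "(\<Sum>i\<in>G. \<Sum>j\<in>G. (x i - x j)\<^sup>2) = 2 * n * t - 2 * s * s"
  proof -
    have "(\<Sum>i\<in>G. \<Sum>j\<in>G. (x i - x j)\<^sup>2) = (\<Sum>i\<in>G. \<Sum>j\<in>G. (x i)\<^sup>2) + (\<Sum>i\<in>G. \<Sum>j\<in>G. (x j)\<^sup>2) - 2 * (\<Sum>i\<in>G. \<Sum>j\<in>G. x i * x j)"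
      unfolding power2_diff by (simp add: sum.distrib sum_subtractf sum_distrib_left mult.assoc)
    moreover have "(\<Sum>i\<in>G. \<Sum>j\<in>G. (x i)\<^sup>2) = n * t" "(\<Sum>i\<in>G. \<Sum>j\<in>G. (x j)\<^sup>2) = n * t"
      by (simp_all add: t_def n_def sum_distrib_left)
    moreover have "(\<Sum>i\<in>G. \<Sum>j\<in>G. x i * x j) = s * s" unfolding s_def sum_product ..
    ultimately show ?thesis by simp
  qed
  ultimately show ?thesis unfolding s_def[symmetric] n_def[symmetric] using n by (simp add: field_simps power2_eq_square)
qed

section \<open>Congruences by \<open>F\<close> as quadratic forms, and the effect of a relative
  perturbation on inverses\<close>

lemma congruence_carrier:
  assumes "F \<in> carrier_mat Q H" "A \<in> carrier_mat Q Q"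
  shows "transpose_mat F * A * F \<in> carrier_mat H H"
  using assms by auto

lemma congruence_entry:
  assumes F: "F \<in> carrier_mat Q H" and A: "A \<in> carrier_mat Q Q" and hk: "h < H" "k < H"
  shows "(transpose_mat F * A * F) $$ (h,k) = form Q A (\<lambda>q. F $$ (q,h)) (\<lambda>q. F $$ (q,k))"
proof -
  have FA: "transpose_mat F * A \<in> carrier_mat H Q" using F A by auto
  have "(transpose_mat F * A * F) $$ (h,k) = (\<Sum>j<Q. (\<Sum>i<Q. F $$ (i,h) * A $$ (i,j)) * F $$ (j,k))"
    unfolding mult_mat_entry[OF FA F hk] using F A hk
    by (intro sum.cong refl) (simp add: mult_mat_entry[OF _ A, of "transpose_mat F" H] del: index_mult_mat(1))
  also have "\<dots> = form Q A (\<lambda>q. F $$ (q,h)) (\<lambda>q. F $$ (q,k))"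
    unfolding form_def sum_distrib_right by (rule sum.swap)
  finally show ?thesis .
qed

lemma form_congruence:
  assumes F: "F \<in> carrier_mat Q H" and A: "A \<in> carrier_mat Q Q"
  shows "form H (transpose_mat F * A * F) x y = form Q A (\<lambda>q. \<Sum>h<H. F $$ (q,h) * x h) (\<lambda>q. \<Sum>h<H. F $$ (q,h) * y h)"
proof -
  have "form H (transpose_mat F * A * F) x y = (\<Sum>h<H. \<Sum>k<H. \<Sum>i<Q. \<Sum>j<Q. (F $$ (i,h) * x h) * A $$ (i,j) * (F $$ (j,k) * y k))"
    unfolding form_def[of H] using congruence_entry[OF F A]
    by (intro sum.cong refl) (simp add: form_def sum_distrib_left sum_distrib_right ac_simps)
  also have "\<dots> = (\<Sum>i<Q. \<Sum>j<Q. \<Sum>h<H. \<Sum>k<H. (F $$ (i,h) * x h) * A $$ (i,j) * (F $$ (j,k) * y k))"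
  proof -
    have rot: "(\<Sum>h<H. \<Sum>k<H. \<Sum>i<Q. f h k i) = (\<Sum>i<Q. \<Sum>h<H. \<Sum>k<H. f h k i)" for f :: "nat \<Rightarrow> nat \<Rightarrow> nat \<Rightarrow> real"
      by (rule trans[OF sum.cong[OF refl sum.swap] sum.swap])
    show ?thesis unfolding rot[of "\<lambda>h k i. \<Sum>j<Q. (F $$ (i,h) * x h) * A $$ (i,j) * (F $$ (j,k) * y k)"]
      by (rule sum.cong[OF refl rot])
  qed
  also have "\<dots> = form Q A (\<lambda>q. \<Sum>h<H. F $$ (q,h) * x h) (\<lambda>q. \<Sum>h<H. F $$ (q,h) * y h)"
    unfolding form_def sum_distrib_right[of _ _ "A $$ _"] sum_product ..
  finally show ?thesis .
qed

lemma form_mat_diag: "form Q (mat_diag Q d) u w = (\<Sum>q<Q. d q * u q * w q)"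
proof -
  have "form Q (mat_diag Q d) u w = (\<Sum>q<Q. \<Sum>p<Q. if p = q then d q * u q * w p else 0)"
    unfolding form_def by (intro sum.cong refl) (auto simp: mat_diag_def)
  then show ?thesis by (simp add: sum.delta)
qed

lemma form_sum_expand:
  fixes m :: nat
  shows "form n M (\<lambda>h. \<Sum>k<m. \<alpha> k * \<beta> k h) (\<lambda>h. \<Sum>k<m. \<alpha> k * \<beta> k h) = (\<Sum>k<m. \<Sum>l<m. \<alpha> k * \<alpha> l * form n M (\<beta> k) (\<beta> l))"
proof -
  have "form n M (\<lambda>h. \<Sum>k<m. \<alpha> k * \<beta> k h) (\<lambda>h. \<Sum>k<m. \<alpha> k * \<beta> k h) =
     (\<Sum>i<n. \<Sum>j<n. \<Sum>k<m. \<Sum>l<m. \<alpha> k * \<alpha> l * (\<beta> k i * M $$ (i,j) * \<beta> l j))"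
    unfolding form_def sum_distrib_right[of _ _ "M $$ _"] sum_product by (intro sum.cong refl) simp
  also have "\<dots> = (\<Sum>k<m. \<Sum>l<m. \<Sum>i<n. \<Sum>j<n. \<alpha> k * \<alpha> l * (\<beta> k i * M $$ (i,j) * \<beta> l j))"
  proof -
    have rot: "(\<Sum>i<n. \<Sum>j<n. \<Sum>k<m. f i j k) = (\<Sum>k<m. \<Sum>i<n. \<Sum>j<n. f i j k)" for f :: "nat \<Rightarrow> nat \<Rightarrow> nat \<Rightarrow> real"
      by (rule trans[OF sum.cong[OF refl sum.swap] sum.swap])
    show ?thesis unfolding rot[of "\<lambda>i j k. \<Sum>l<m. \<alpha> k * \<alpha> l * (\<beta> k i * M $$ (i,j) * \<beta> l j)"]
      by (rule sum.cong[OF refl rot])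
  qed
  finally show ?thesis unfolding form_def sum_distrib_left .
qed

text \<open>Let \<open>x\<close> and \<open>y\<close> solve the systems of \<open>M\<close> and
  \<open>V\<close> with right-hand side \<open>d\<close>. Then \<open>t\<close> is both the
  \<open>V\<close>-form at \<open>y\<close> and the \<open>M\<close>-pairing of \<open>y\<close>
  with \<open>x\<close>, and \<open>s\<close> is likewise both the \<open>M\<close>-form at
  \<open>x\<close> and a \<open>V\<close>-pairing. Cauchy-Schwarz in each form, combined with
  closeness, gives \<open>(1 - \<epsilon>) * t \<le> s\<close> and
  \<open>s \<le> (1 + \<epsilon>) * t\<close>.\<close>

lemma inverse_forms_close:
  assumes M: "pd_mat n M" and Vc: "V \<in> carrier_mat n n" and Vsym: "\<And>i j. i < n \<Longrightarrow> j < n \<Longrightarrow> V $$ (i,j) = V $$ (j,i)"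
    and close: "\<And>x. \<bar>form n V x x - form n M x x\<bar> \<le> \<epsilon> * form n M x x" and \<epsilon>: "0 \<le> \<epsilon>" "\<epsilon> \<le> 1 / 2"
    and d: "d \<in> carrier_vec n"
  shows "\<bar>scalar_prod d (minv V *\<^sub>v d) - scalar_prod d (minv M *\<^sub>v d)\<bar> \<le> 2 * \<epsilon> * scalar_prod d (minv M *\<^sub>v d)"
proof -
  have V: "pd_mat n V"
    unfolding pd_mat_def
  proof (intro conjI allI impI)
    fix x :: "nat \<Rightarrow> real" assume "\<exists>i<n. x i \<noteq> 0"
    then have p: "0 < form n M x x" using pd_matD(3)[OF M] by blast
    have "form n M x x * (1 / 2) \<le> form n M x x * (1 - \<epsilon>)" using p \<epsilon> by (intro mult_left_mono) auto
    then show "0 < form n V x x" using close[of x] p by (simp add: algebra_simps abs_le_iff)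
  qed (use Vc Vsym in auto)
  note Mc = pd_matD(1)[OF M]
  have nrm: "\<exists>x. x \<in> carrier_vec n \<and> A *\<^sub>v x = d \<and> x = minv A *\<^sub>v d" if A: "pd_mat n A" for A
  proof -
    have Ac: "A \<in> carrier_mat n n" by (rule pd_matD[OF A])
    note mi = pd_mat_minv[OF A]
    have "A *\<^sub>v (minv A *\<^sub>v d) = (A * minv A) *\<^sub>v d" by (rule assoc_mult_mat_vec[OF Ac mi(1) d, symmetric])
    then show ?thesis using mi d by (intro exI[of _ "minv A *\<^sub>v d"]) (auto intro!: mult_mat_vec_carrier)
  qed
  obtain x where x: "x \<in> carrier_vec n" "M *\<^sub>v x = d" "x = minv M *\<^sub>v d" using nrm[OF M] by blast
  obtain y where y: "y \<in> carrier_vec n" "V *\<^sub>v y = d" "y = minv V *\<^sub>v d" using nrm[OF V] by blast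
  define s t where "s = scalar_prod d x" and "t = scalar_prod d y"
  have comm: "scalar_prod u w = scalar_prod w u" if "u \<in> carrier_vec n" "w \<in> carrier_vec n" for u w :: "real vec"
    using that by (rule comm_scalar_prod)
  have s1: "s = form n M (($) x) (($) x)"
    unfolding s_def comm[OF d x(1)] form_eq_scalar_prod[OF Mc x(1) x(1), symmetric] x(2) ..
  have t1: "t = form n V (($) y) (($) y)"
    unfolding t_def comm[OF d y(1)] form_eq_scalar_prod[OF Vc y(1) y(1), symmetric] y(2) ..
  have t2: "t = form n M (($) y) (($) x)"
    unfolding t_def comm[OF d y(1)] form_eq_scalar_prod[OF Mc y(1) x(1), symmetric] x(2) ..
  have s2: "s = form n V (($) x) (($) y)"
    unfolding s_def comm[OF d x(1)] form_eq_scalar_prod[OF Vc x(1) y(1), symmetric] y(2) ..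
  have s0: "0 \<le> s" and t0: "0 \<le> t" unfolding s1 t1 by (rule pd_matD(4)[OF M], rule pd_matD(4)[OF V])
  have cs1: "t\<^sup>2 \<le> form n M (($) y) (($) y) * s"
    unfolding t2 s1 by (rule form_cauchy_schwarz) (use pd_matD(2,4)[OF M] in auto)
  have cs2: "s\<^sup>2 \<le> form n V (($) x) (($) x) * t"
    unfolding s2 t1 by (rule form_cauchy_schwarz) (use pd_matD(2,4)[OF V] in auto)
  have My: "(1 - \<epsilon>) * form n M (($) y) (($) y) \<le> t"
    using close[of "($) y"] unfolding t1 by (simp add: algebra_simps abs_le_iff)
  have Vx: "form n V (($) x) (($) x) \<le> (1 + \<epsilon>) * s"
    using close[of "($) x"] unfolding s1 by (simp add: algebra_simps abs_le_iff)
  have le1: "(1 - \<epsilon>) * t \<le> s"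
  proof (cases "t = 0")
    case False
    have "t * ((1 - \<epsilon>) * t) = (1 - \<epsilon>) * t\<^sup>2" by (simp add: power2_eq_square)
    also have "\<dots> \<le> (1 - \<epsilon>) * (form n M (($) y) (($) y) * s)" using cs1 \<epsilon> by (intro mult_left_mono) auto
    also have "\<dots> = ((1 - \<epsilon>) * form n M (($) y) (($) y)) * s" by simp
    also have "\<dots> \<le> t * s" using My s0 by (rule mult_right_mono)
    finally show ?thesis using False t0 by simp
  qed (use s0 in simp)
  have le2: "s \<le> (1 + \<epsilon>) * t"
  proof (cases "s = 0")
    case False
    have "s * s \<le> form n V (($) x) (($) x) * t" using cs2 by (simp add: power2_eq_square)
    also have "\<dots> \<le> (1 + \<epsilon>) * s * t" using Vx t0 by (rule mult_right_mono)
    also have "\<dots> = s * ((1 + \<epsilon>) * t)" by simp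
    finally show ?thesis using False s0 by simp
  qed (use t0 \<epsilon> in simp)
  have "(1 / 2) * t \<le> (1 - \<epsilon>) * t" using \<epsilon> t0 by (intro mult_right_mono) auto
  then have t_s: "t \<le> 2 * s" using le1 by simp
  have "\<epsilon> * t \<le> \<epsilon> * (2 * s)" using t_s \<epsilon> by (intro mult_left_mono) auto
  then have "\<bar>t - s\<bar> \<le> 2 * \<epsilon> * s" using le1 le2 by (simp add: algebra_simps abs_le_iff)
  then show ?thesis unfolding s_def t_def x(3) y(3) .
qed

section \<open>The design\<close>

lemma (in assignment_space) expectation_CR:
  fixes f :: "(nat \<Rightarrow> nat) \<Rightarrow> 'a::{banach,second_countable_topology}"
  shows "measure_pmf.expectation (CR N Q Nq) f = E f"
proof -
  have "measure_pmf.expectation (CR N Q Nq) f = (\<Sum>z\<in>\<Omega>. pmf (CR N Q Nq) z *\<^sub>R f z)"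
    by (rule integral_measure_pmf) (auto simp: CR_def)
  also have "\<dots> = E f"
    unfolding fin_mean_def scaleR_sum_right by (intro sum.cong refl) (simp add: CR_def pmf_of_set divide_inverse)
  finally show ?thesis .
qed

lemma (in assignment_space) integrable_CR:
  fixes f :: "(nat \<Rightarrow> nat) \<Rightarrow> 'a::{banach,second_countable_topology}"
  shows "integrable (measure_pmf (CR N Q Nq)) f"
  by (rule integrable_measure_pmf_finite) (simp add: CR_def)

text \<open>One member of the sequence, with the constants as parameters, so that every bound proved
  here is uniform along the sequence.\<close>

locale design = assignment_space N Q Nq for N Q Nq +
  fixes H N0 :: nat and Y :: "nat \<Rightarrow> nat \<Rightarrow> real" and F :: "real mat"
    and c_lo c_hi \<sigma> c c' \<nu> S_lo :: real
  assumes sizes_ge2: "\<And>q. q < Q \<Longrightarrow> 2 \<le> Nq q"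
    and c_lo: "0 < c_lo" and N0: "0 < N0"
    and near: "\<And>q. q < Q \<Longrightarrow> c_lo * real N0 \<le> real (Nq q) \<and> real (Nq q) \<le> c_hi * real N0"
    and F: "F \<in> carrier_mat Q H"
    and cond1: "loewner_le (transpose_mat F * Dmat N Q Nq Y * F) (\<sigma>\<^sup>2 \<cdot>\<^sub>m Vgamma N Q Nq Y F)"
    and cc: "0 < c" "0 < c'"
    and F_bound: "\<And>q h. q < Q \<Longrightarrow> h < H \<Longrightarrow> \<bar>F $$ (q,h)\<bar> \<le> c / real Q"
    and F_eig: "\<And>k. eigenvalue (transpose_mat F * F) k \<Longrightarrow> c' / real Q \<le> k"
    and S_lo: "0 < S_lo"
    and Y_bound: "\<And>i q. i < N \<Longrightarrow> q < Q \<Longrightarrow> \<bar>Y i q - Ybar N Y q\<bar> \<le> \<nu>"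
    and S_bound: "\<And>q. q < Q \<Longrightarrow> S_lo \<le> Scov N Y q q"
begin

abbreviation "M \<equiv> transpose_mat F * Dmat N Q Nq Y * F"
abbreviation "V \<equiv> Vgamma N Q Nq Y F"

definition y :: "nat \<Rightarrow> nat \<Rightarrow> real" where "y i q = Y i q - Ybar N Y q"

definition g :: "(nat \<Rightarrow> real) \<Rightarrow> nat \<Rightarrow> real" where "g x q = (\<Sum>h<H. F $$ (q,h) * x h)"

lemma Q_pos: "0 < Q"
proof (rule ccontr)
  assume "\<not> 0 < Q" then show False using sum_Nq two_le_N by simp
qed

lemma Nq_pos: "q < Q \<Longrightarrow> 0 < real (Nq q)" using sizes_ge2[of q] by simp

lemma c_hi: "0 < c_hi"
proof -
  have "0 < c_lo * real N0" using c_lo N0 by simp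
  then have "0 < c_hi * real N0" using near[OF Q_pos] by linarith
  then show ?thesis using N0 by (simp add: zero_less_mult_iff)
qed

lemma N_le: "real N \<le> real Q * c_hi * real N0"
proof -
  have "real N = (\<Sum>q<Q. real (Nq q))" using sum_Nq by (simp flip: of_nat_sum)
  also have "\<dots> \<le> (\<Sum>q<Q. c_hi * real N0)" using near by (intro sum_mono) auto
  finally show ?thesis by simp
qed

lemma \<nu>_nonneg: "0 \<le> \<nu>"
  using Y_bound[of 0 0] Q_pos two_le_N by (smt (verit) not_numeral_le_zero gr0I)

lemma sum_y: "(\<Sum>i<N. y i q) = 0"
  using two_le_N by (simp add: y_def sum_subtractf Ybar_def)

lemma Scov_y: "Scov N Y q p = (\<Sum>i<N. y i q * y i p) / (real N - 1)"
  by (simp add: Scov_def y_def)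

lemma D_carrier: "Dmat N Q Nq Y \<in> carrier_mat Q Q" by (simp add: Dmat_def)

lemma VY_carrier: "VYhat N Q Nq Y \<in> carrier_mat Q Q"
  unfolding VYhat_def by (rule minus_carrier_mat) simp

lemma M_carrier: "M \<in> carrier_mat H H" by (rule congruence_carrier[OF F D_carrier])

lemma V_carrier: "V \<in> carrier_mat H H" unfolding Vgamma_def by (rule congruence_carrier[OF F VY_carrier])

lemma form_M: "form H M x x' = (\<Sum>q<Q. Scov N Y q q / real (Nq q) * g x q * g x' q)"
  unfolding form_congruence[OF F D_carrier] g_def[symmetric] unfolding Dmat_def form_mat_diag ..

lemma form_V: "form H V x x' = form H M x x' - (\<Sum>q<Q. \<Sum>p<Q. g x q * Scov N Y q p * g x' p) / real N"
proof -
  have "form H V x x' = form Q (VYhat N Q Nq Y) (g x) (g x')"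
    unfolding Vgamma_def form_congruence[OF F VY_carrier] g_def[symmetric] ..
  also have "\<dots> = form Q (Dmat N Q Nq Y) (g x) (g x') - (\<Sum>q<Q. \<Sum>p<Q. g x q * Scov N Y q p * g x' p) / real N"
    unfolding form_def sum_divide_distrib sum_subtractf[symmetric]
    by (intro sum.cong refl) (simp add: VYhat_def Dmat_def algebra_simps)
  finally show ?thesis unfolding form_congruence[OF F D_carrier] g_def[symmetric] .
qed

lemma S_form: "(\<Sum>q<Q. \<Sum>p<Q. g x q * Scov N Y q p * g x' p) = (\<Sum>i<N. (\<Sum>q<Q. g x q * y i q) * (\<Sum>q<Q. g x' q * y i q)) / (real N - 1)"
proof -
  have "(\<Sum>q<Q. \<Sum>p<Q. g x q * Scov N Y q p * g x' p) = (\<Sum>q<Q. \<Sum>p<Q. \<Sum>i<N. (g x q * y i q) * (g x' p * y i p)) / (real N - 1)"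
    unfolding sum_divide_distrib[of _ _ "real N - 1"] Scov_y
    by (intro sum.cong refl) (simp add: sum_divide_distrib sum_distrib_left sum_distrib_right ac_simps)
  also have "(\<Sum>q<Q. \<Sum>p<Q. \<Sum>i<N. (g x q * y i q) * (g x' p * y i p)) = (\<Sum>i<N. \<Sum>q<Q. \<Sum>p<Q. (g x q * y i q) * (g x' p * y i p))"
    by (rule trans[OF sum.cong[OF refl sum.swap] sum.swap])
  finally show ?thesis unfolding sum_product .
qed

text \<open>The gap is the form of \<open>S / N\<close>, and \<open>S\<close> is a Gram matrix of
  centred outcomes. This conservativeness of the variance estimator yields
  \<open>l k \<le> 1\<close> and thereby the coverage bounds.\<close>

lemma V_le_M: "form H V x x \<le> form H M x x"
proof -
  have "0 \<le> (\<Sum>i<N. (\<Sum>q<Q. g x q * y i q) * (\<Sum>q<Q. g x q * y i q)) / (real N - 1)"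
    using two_le_N by (intro divide_nonneg_nonneg sum_nonneg) auto
  then have "0 \<le> (\<Sum>q<Q. \<Sum>p<Q. g x q * Scov N Y q p * g x p) / real N"
    unfolding S_form by (rule divide_nonneg_nonneg) simp
  then show ?thesis unfolding form_V by simp
qed

lemma M_le_V: "form H M x x \<le> \<sigma>\<^sup>2 * form H V x x"
proof -
  have c: "\<sigma>\<^sup>2 \<cdot>\<^sub>m V - M \<in> carrier_mat H H" using M_carrier by (rule minus_carrier_mat)
  have "psd_mat (\<sigma>\<^sup>2 \<cdot>\<^sub>m V - M)" using cond1 by (simp add: loewner_le_def)
  then have "0 \<le> form H (\<sigma>\<^sup>2 \<cdot>\<^sub>m V - M) x x" using psd_mat_iff_form[OF c] by blast
  also have "form H (\<sigma>\<^sup>2 \<cdot>\<^sub>m V - M) x x = \<sigma>\<^sup>2 * form H V x x - form H M x x"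
  proof -
    have ent: "(\<sigma>\<^sup>2 \<cdot>\<^sub>m V - M) $$ (i,j) = \<sigma>\<^sup>2 * V $$ (i,j) - M $$ (i,j)" if "i < H" "j < H" for i j
      using that carrier_matD[OF M_carrier] carrier_matD[OF V_carrier]
      by (subst index_minus_mat) (auto simp del: index_mult_mat)
    show ?thesis
      unfolding form_def sum_distrib_left sum_subtractf[symmetric]
      by (intro sum.cong refl) (simp add: ent right_diff_distrib left_diff_distrib del: index_mult_mat)
  qed
  finally show ?thesis by simp
qed

text \<open>The eigenvalue hypothesis becomes a Rayleigh bound through the spectral decomposition of
  the Gram matrix of \<open>F\<close>, since every spectral value \<open>f k\<close> is a genuine
  eigenvalue with eigenvector \<open>B k\<close>.\<close>

lemma gram_lower: "c' / real Q * (\<Sum>h<H. (x h)\<^sup>2) \<le> (\<Sum>q<Q. (g x q)\<^sup>2)"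
proof -
  define A where "A = transpose_mat F * F"
  have A: "A \<in> carrier_mat H H" using F by (auto simp: A_def)
  have entry: "A $$ (h,k) = (\<Sum>q<Q. F $$ (q,h) * F $$ (q,k))" if "h < H" "k < H" for h k
    unfolding A_def using F that by (subst mult_mat_entry[of _ H Q _ H]) auto
  have sym: "A $$ (h,k) = A $$ (k,h)" if "h < H" "k < H" for h k
    using that by (simp add: entry mult.commute)
  obtain B f where B: "orthonormal H B" and Af: "A = spectral_mat H B f"
    using spectral_decomposition[OF A sym] by blast
  have f: "c' / real Q \<le> f k" if k: "k < H" for k
  proof (rule F_eig)
    have "eigenvector A (vec H (B k)) (f k)"
      unfolding eigenvector_def
    proof (intro conjI)
      show "vec H (B k) \<in> carrier_vec (dim_row A)" using A by auto
      show "vec H (B k) \<noteq> 0\<^sub>v (dim_row A)"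
      proof
        assume "vec H (B k) = 0\<^sub>v (dim_row A)"
        then have z: "B k j = 0" if "j < H" for j using that A by (metis carrier_matD(1) index_vec index_zero_vec(1))
        then have "(\<Sum>j<H. B k j * B k j) = 0" by simp
        then show False using orthonormalD(1)[OF B k k] by simp
      qed
      show "A *\<^sub>v vec H (B k) = f k \<cdot>\<^sub>v vec H (B k)"
      proof (rule eq_vecI)
        fix i assume "i < dim_vec (f k \<cdot>\<^sub>v vec H (B k))"
        then have i: "i < H" by simp
        have "(A *\<^sub>v vec H (B k)) $ i = (\<Sum>j<H. A $$ (i,j) * B k j)"
          using mult_vec_entry[OF A, of "vec H (B k)" i] i by simp
        also have "\<dots> = (\<Sum>q<H. f q * B q i * (\<Sum>j<H. B q j * B k j))"
          unfolding sum_distrib_left Af using i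
          by (subst sum.swap) (intro sum.cong refl, simp add: spectral_mat_entry sum_distrib_right mult.assoc)
        also have "\<dots> = (\<Sum>q<H. if q = k then f q * B q i else 0)"
          using orthonormalD(1)[OF B _ k] by (intro sum.cong refl) auto
        also have "\<dots> = f k * B k i" using k by (simp add: sum.delta)
        finally show "(A *\<^sub>v vec H (B k)) $ i = (f k \<cdot>\<^sub>v vec H (B k)) $ i" using i by simp
      qed (use A in auto)
    qed
    then show "eigenvalue (transpose_mat F * F) (f k)" unfolding eigenvalue_def A_def by blast
  qed
  have "(\<Sum>h<H. (x h)\<^sup>2) = (\<Sum>k<H. (\<Sum>j<H. B k j * x j)\<^sup>2)"
  proof -
    have "form H (spectral_mat H B (\<lambda>_. 1)) x x = (\<Sum>i<H. \<Sum>j<H. if j = i then x i * x j else 0)"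
      unfolding spectral_mat_one[OF B] form_def by (intro sum.cong refl) auto
    then show ?thesis unfolding form_spectral_mat by (simp add: power2_eq_square sum.delta)
  qed
  then have "c' / real Q * (\<Sum>h<H. (x h)\<^sup>2) = (\<Sum>k<H. c' / real Q * (\<Sum>j<H. B k j * x j)\<^sup>2)"
    by (simp add: sum_distrib_left)
  also have "\<dots> \<le> (\<Sum>k<H. f k * (\<Sum>j<H. B k j * x j)\<^sup>2)"
    using f by (intro sum_mono mult_right_mono) auto
  also have "\<dots> = form H A x x" unfolding Af form_spectral_mat by (simp add: power2_eq_square mult.assoc)
  also have "\<dots> = (\<Sum>q<Q. (g x q)\<^sup>2)"
  proof -
    have "form H A x x = (\<Sum>h<H. \<Sum>k<H. \<Sum>q<Q. (F $$ (q,h) * x h) * (F $$ (q,k) * x k))"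
      unfolding form_def by (intro sum.cong refl) (simp add: entry sum_distrib_left sum_distrib_right ac_simps)
    also have "\<dots> = (\<Sum>q<Q. \<Sum>h<H. \<Sum>k<H. (F $$ (q,h) * x h) * (F $$ (q,k) * x k))"
      by (rule trans[OF sum.cong[OF refl sum.swap] sum.swap])
    finally show ?thesis unfolding g_def power2_eq_square sum_product .
  qed
  finally show ?thesis .
qed

lemma M_lower: "S_lo / (c_hi * real N0) * (\<Sum>q<Q. (g x q)\<^sup>2) \<le> form H M x x"
  unfolding form_M sum_distrib_left
proof (intro sum_mono)
  fix q assume "q \<in> {..<Q}" then have q: "q < Q" by simp
  have "S_lo / (c_hi * real N0) \<le> Scov N Y q q / real (Nq q)"
    using S_bound[OF q] S_lo Nq_pos[OF q] near[OF q] by (intro frac_le) auto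
  then have "S_lo / (c_hi * real N0) * (g x q)\<^sup>2 \<le> Scov N Y q q / real (Nq q) * (g x q)\<^sup>2"
    by (rule mult_right_mono) simp
  then show "S_lo / (c_hi * real N0) * (g x q)\<^sup>2 \<le> Scov N Y q q / real (Nq q) * g x q * g x q"
    by (simp add: power2_eq_square mult.assoc)
qed

lemma M_pos:
  assumes "i < H" "x i \<noteq> 0"
  shows "0 < form H M x x"
proof -
  have "0 < (x i)\<^sup>2" using assms by simp
  also have "(x i)\<^sup>2 \<le> (\<Sum>h<H. (x h)\<^sup>2)" using assms by (intro member_le_sum) auto
  finally have "0 < c' / real Q * (\<Sum>h<H. (x h)\<^sup>2)" using cc Q_pos by simp
  then have "0 < (\<Sum>q<Q. (g x q)\<^sup>2)" using gram_lower[of x] by linarith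
  then have "0 < S_lo / (c_hi * real N0) * (\<Sum>q<Q. (g x q)\<^sup>2)" using S_lo c_hi N0 by simp
  then show ?thesis using M_lower[of x] by linarith
qed

lemma form_unit: "h < H \<Longrightarrow> k < H \<Longrightarrow> form H A (\<lambda>i. if i = h then 1 else 0) (\<lambda>i. if i = k then 1 else 0) = A $$ (h,k)"
proof -
  assume hk: "h < H" "k < H"
  have 1: "(\<Sum>j<H. f j * (if j = k then 1 else 0)) = f k" for f :: "nat \<Rightarrow> real"
    using hk by (simp add: if_distrib[of "\<lambda>x. _ * x"] sum.delta cong: if_cong)
  have 2: "(\<Sum>i<H. (if i = h then 1 else 0) * f i) = f h" for f :: "nat \<Rightarrow> real"
    using hk by (simp add: if_distrib[of "\<lambda>x. x * _"] sum.delta cong: if_cong)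
  show ?thesis unfolding form_def 1 2 ..
qed

lemma sym_entry: "h < H \<Longrightarrow> k < H \<Longrightarrow> M $$ (h,k) = M $$ (k,h)" "h < H \<Longrightarrow> k < H \<Longrightarrow> V $$ (h,k) = V $$ (k,h)"
proof -
  assume hk: "h < H" "k < H"
  have m: "form H M x x' = form H M x' x" for x x' unfolding form_M by (simp add: mult.assoc mult.commute[of "g x _"])
  have s: "(\<Sum>q<Q. \<Sum>p<Q. g x q * Scov N Y q p * g x' p) = (\<Sum>q<Q. \<Sum>p<Q. g x' q * Scov N Y q p * g x p)" for x x'
    unfolding S_form by (simp add: mult.commute)
  show "M $$ (h,k) = M $$ (k,h)"
    using form_unit[OF hk, of M] form_unit[OF hk(2,1), of M] m by metis
  have v: "form H V x x' = form H V x' x" for x x'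
    unfolding form_V m[of x x'] s[of x x'] ..
  show "V $$ (h,k) = V $$ (k,h)"
    using form_unit[OF hk, of V] form_unit[OF hk(2,1), of V] v by metis
qed

lemma M_pd: "pd_mat H M"
  unfolding pd_mat_def using M_carrier sym_entry(1) M_pos by blast

text \<open>\<open>cond1\<close> bounds the form of \<open>M\<close>, which is positive definite, by
  a multiple of the form of \<open>V\<close>.\<close>

lemma V_pd: "pd_mat H V"
  unfolding pd_mat_def
proof (intro conjI allI impI)
  fix x :: "nat \<Rightarrow> real" assume "\<exists>i<H. x i \<noteq> 0"
  then have "0 < form H M x x" using M_pos by blast
  then have "0 < \<sigma>\<^sup>2 * form H V x x" using M_le_V[of x] by linarith
  then show "0 < form H V x x" by (simp add: zero_less_mult_iff)
qed (use V_carrier sym_entry(2) in auto)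

section \<open>Unbiasedness and concentration of the variance estimator\<close>

lemma Shat_pairs:
  assumes z: "z \<in> \<Omega>" and q: "q < Q"
  shows "Shat N Nq Y z q = (\<Sum>i<N. \<Sum>j\<in>{..<N}-{i}. if z i = q \<and> z j = q then (Y i q - Y j q)\<^sup>2 / (2 * real (Nq q) * (real (Nq q) - 1)) else 0)"
proof -
  define G where "G = {i\<in>{..<N}. z i = q}"
  have cG: "card G = Nq q" unfolding G_def by (rule card_group[OF z q])
  have "0 < card G" using cG sizes_ge2[OF q] by simp
  then have G: "finite G" "G \<noteq> {}" by (auto simp: card_gt_0_iff)
  have "Shat N Nq Y z q = (\<Sum>i\<in>G. (Y i q - (\<Sum>j\<in>G. Y j q) / real (card G))\<^sup>2) / (real (Nq q) - 1)"
    unfolding Shat_def Yhat_def G_def[symmetric] cG by (intro arg_cong2[where f = "(/)"] refl sum.cong) (auto simp: G_def intro!: sum.cong arg_cong2[where f = "(/)"])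
  also have "\<dots> = (\<Sum>i\<in>G. \<Sum>j\<in>G. (Y i q - Y j q)\<^sup>2 / (2 * real (Nq q) * (real (Nq q) - 1)))"
    unfolding sum_squared_deviations[OF G, of "\<lambda>i. Y i q"] by (simp add: sum_divide_distrib cG)
  also have "\<dots> = (\<Sum>i<N. \<Sum>j<N. if z i = q \<and> z j = q then (Y i q - Y j q)\<^sup>2 / (2 * real (Nq q) * (real (Nq q) - 1)) else 0)"
  proof -
    have "(\<Sum>i\<in>G. \<Sum>j\<in>G. f i j) = (\<Sum>i<N. \<Sum>j<N. if z i = q \<and> z j = q then f i j else 0)" for f :: "nat \<Rightarrow> nat \<Rightarrow> real"
    proof -
      have "(\<Sum>i\<in>G. \<Sum>j\<in>G. f i j) = (\<Sum>i<N. if z i = q then (\<Sum>j\<in>G. f i j) else 0)"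
        unfolding G_def by (rule sum.inter_filter) simp
      also have "\<dots> = (\<Sum>i<N. if z i = q then (\<Sum>j<N. if z j = q then f i j else 0) else 0)"
        unfolding G_def by (intro sum.cong refl if_cong sum.inter_filter) simp
      also have "\<dots> = (\<Sum>i<N. \<Sum>j<N. if z i = q \<and> z j = q then f i j else 0)"
        by (intro sum.cong refl) auto
      finally show ?thesis .
    qed
    then show ?thesis .
  qed
  finally show ?thesis unfolding sum_off_diagonal by (simp add: sum.neutral)
qed

text \<open>Two given units share the level \<open>q\<close> with probability
  \<open>Nq q * (Nq q - 1) / (N * (N - 1))\<close>, by \<open>mean_pair\<close> for the indicator
  \<open>ind\<close>. This cancels the normalization in the pair form of \<open>Shat\<close> and
  leaves the pair form of \<open>Scov\<close>.\<close>

lemma mean_Shat: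
  assumes q: "q < Q"
  shows "E (\<lambda>z. Shat N Nq Y z q) = Scov N Y q q"
proof -
  let ?m = "real (Nq q)" and ?C = "real N * (real N - 1)"
  have m: "0 < ?m" "0 < ?m - 1" using sizes_ge2[OF q] by auto
  have C: "0 < ?C" using two_le_N by simp
  define ind where "ind p p' = (if p = q \<and> p' = q then 1 else (0::real))" for p p'
  have pt: "pair_total ind = ?m * (?m - 1)"
  proof -
    have "(\<Sum>p'<Q. real (Nq p') * ind p p') = (if p = q then ?m else 0)" for p
      using q by (simp add: ind_def if_distrib[of "\<lambda>x. _ * x"] sum.delta cong: if_cong)
    moreover have "(\<Sum>p<Q. real (Nq p) * ind p p) = ?m"
      using q by (simp add: ind_def if_distrib[of "\<lambda>x. _ * x"] sum.delta cong: if_cong)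
    ultimately show ?thesis unfolding pair_total_def
      using q by (simp add: if_distrib[of "\<lambda>x. _ * x"] sum.delta algebra_simps cong: if_cong)
  qed
  have "E (\<lambda>z. Shat N Nq Y z q) = E (\<lambda>z. \<Sum>i<N. \<Sum>j\<in>{..<N}-{i}. (Y i q - Y j q)\<^sup>2 / (2 * ?m * (?m - 1)) * ind (z i) (z j))"
    by (rule fin_mean_cong) (simp add: Shat_pairs[OF _ q] ind_def if_distrib[of "\<lambda>x. _ * x"] cong: if_cong)
  also have "\<dots> = (\<Sum>i<N. \<Sum>j\<in>{..<N}-{i}. (Y i q - Y j q)\<^sup>2 / (2 * ?m * (?m - 1)) * E (\<lambda>z. ind (z i) (z j)))"
    by (simp only: fin_mean_sum fin_mean_mult_left)
  also have "\<dots> = (\<Sum>i<N. \<Sum>j\<in>{..<N}-{i}. (Y i q - Y j q)\<^sup>2 / (2 * ?C))"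
  proof (intro sum.cong refl)
    fix i j assume "i \<in> {..<N}" "j \<in> {..<N} - {i}"
    then have "E (\<lambda>z. ind (z i) (z j)) = ?m * (?m - 1) / ?C" using mean_pair[of i j ind] pt by auto
    moreover have cancel: "a / (2 * p * r) * (p * r / t) = a / (2 * t)" if "0 < p" "0 < r" for a p r t :: real
      using that by simp
    ultimately show "(Y i q - Y j q)\<^sup>2 / (2 * ?m * (?m - 1)) * E (\<lambda>z. ind (z i) (z j)) = (Y i q - Y j q)\<^sup>2 / (2 * ?C)"
      using cancel[OF m] by (simp only:)
  qed
  also have "\<dots> = (\<Sum>i<N. \<Sum>j<N. (Y i q - Y j q)\<^sup>2) / (2 * ?C)"
    unfolding sum_off_diagonal by (simp add: sum_divide_distrib)
  also have "\<dots> = (\<Sum>i<N. (Y i q - (\<Sum>j<N. Y j q) / real (card {..<N}))\<^sup>2) / (real N - 1)"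
    using two_le_N by (subst sum_squared_deviations) (auto simp: lessThan_empty_iff)
  finally show ?thesis by (simp add: Scov_def Ybar_def power2_eq_square)
qed

lemma Vhat_entry: "h < H \<Longrightarrow> k < H \<Longrightarrow> Vhat N Q Nq Y F z $$ (h,k) = (\<Sum>q<Q. Shat N Nq Y z q / real (Nq q) * F $$ (q,h) * F $$ (q,k))"
  unfolding Vhat_def by (subst congruence_entry[OF F]) (auto simp: form_mat_diag)

lemma Vhat_carrier: "Vhat N Q Nq Y F z \<in> carrier_mat H H"
  unfolding Vhat_def by (rule congruence_carrier[OF F]) simp

lemma form_Vhat: "form H (Vhat N Q Nq Y F z) x x' = (\<Sum>q<Q. Shat N Nq Y z q / real (Nq q) * g x q * g x' q)"
  unfolding Vhat_def by (subst form_congruence[OF F]) (auto simp: form_mat_diag g_def)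

text \<open>Unbiasedness of each \<open>Shat\<close> passes to the entries of \<open>Vhat\<close> by
  linearity; \<open>Wmat\<close> thus compares the true variance \<open>V\<close> with
  \<open>M\<close>.\<close>

lemma EVhat_eq: "EVhat N Q Nq Y F = M"
proof (rule eq_matI)
  fix h k assume "h < dim_row M" "k < dim_col M"
  then have hk: "h < H" "k < H" using M_carrier by auto
  have "EVhat N Q Nq Y F $$ (h,k) = E (\<lambda>z. Vhat N Q Nq Y F z $$ (h,k))"
    using hk F unfolding EVhat_def by (simp add: expectation_CR)
  also have "\<dots> = (\<Sum>q<Q. E (\<lambda>z. Shat N Nq Y z q) / real (Nq q) * F $$ (q,h) * F $$ (q,k))"
    unfolding Vhat_entry[OF hk] by (simp add: fin_mean_sum fin_mean_mult_right fin_mean_divide)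
  also have "\<dots> = (\<Sum>q<Q. Scov N Y q q / real (Nq q) * F $$ (q,h) * F $$ (q,k))"
    by (intro sum.cong refl) (simp add: mean_Shat)
  also have "\<dots> = M $$ (h,k)"
    by (subst congruence_entry[OF F D_carrier hk]) (simp add: Dmat_def form_mat_diag)
  finally show "EVhat N Q Nq Y F $$ (h,k) = M $$ (h,k)" .
qed (use M_carrier F in \<open>auto simp: EVhat_def\<close>)

definition dev :: "(nat \<Rightarrow> nat) \<Rightarrow> real vec" where
  "dev z = gammahat N Q Nq Y F z - gamma N Q Y F"

lemma dev_carrier: "dev z \<in> carrier_vec H" using F by (simp add: dev_def gammahat_def gamma_def)

lemma dev_entry: "h < H \<Longrightarrow> dev z $ h = (\<Sum>q<Q. F $$ (q,h) * (Yhat N Nq Y z q - Ybar N Y q))"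
  using F unfolding dev_def gammahat_def gamma_def
  by (simp add: scalar_prod_def atLeast0LessThan sum_subtractf right_diff_distrib)

lemma That_eq: "That N Q Nq Y F z = scalar_prod (dev z) (minv (Vhat N Q Nq Y F z) *\<^sub>v dev z)"
  by (simp add: That_def dev_def Let_def)

text \<open>Chosen such that \<open>\<kappa> * H / N\<close> bounds the square of every entry of the
  array \<open>a\<close> below; it contains only constants of the sequence.\<close>

definition \<kappa> :: real where "\<kappa> = c\<^sup>2 * \<sigma>\<^sup>2 * c_hi\<^sup>2 * \<nu>\<^sup>2 / (c' * S_lo * c_lo\<^sup>2)"

lemma \<kappa>_nonneg: "0 \<le> \<kappa>" using cc S_lo c_lo by (simp add: \<kappa>_def)

text \<open>The weighted sum is a pair statistic. In the row of unit \<open>i\<close> only the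
  \<open>Nq q - 1\<close> other members of its group count, which cancels the factor
  \<open>1 / (Nq q - 1)\<close> of the sample variance; the bound is therefore uniform even for
  groups of two units.\<close>

lemma weighted_Shat_variance:
  assumes w: "\<And>q. q < Q \<Longrightarrow> \<bar>w q\<bar> \<le> \<omega>"
  shows "E (\<lambda>z. (\<Sum>q<Q. w q * (Shat N Nq Y z q - Scov N Y q q))\<^sup>2) \<le> 16 * real N * (2 * \<omega> * \<nu>\<^sup>2 / (c_lo * real N0))\<^sup>2"
proof -
  define G where "G i j p q = (if p = q \<and> p < Q then w p * ((Y i p - Y j p)\<^sup>2 / (2 * real (Nq p) * (real (Nq p) - 1))) else 0)" for i j p q
  define U where "U z = (\<Sum>i<N. \<Sum>j\<in>{..<N}-{i}. G i j (z i) (z j))" for z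
  have \<omega>: "0 \<le> \<omega>" using w[OF Q_pos] by linarith
  have U: "(\<Sum>q<Q. w q * Shat N Nq Y z q) = U z" if z: "z \<in> \<Omega>" for z
  proof -
    have "(\<Sum>q<Q. w q * Shat N Nq Y z q) = (\<Sum>q<Q. \<Sum>i<N. \<Sum>j\<in>{..<N}-{i}. if z i = q \<and> z j = q then G i j q q else 0)"
    proof (rule sum.cong[OF refl])
      fix q assume "q \<in> {..<Q}" then have q: "q < Q" by simp
      show "w q * Shat N Nq Y z q = (\<Sum>i<N. \<Sum>j\<in>{..<N}-{i}. if z i = q \<and> z j = q then G i j q q else 0)"
        unfolding Shat_pairs[OF z q] sum_distrib_left using q by (intro sum.cong refl) (simp add: G_def)
    qed
    also have "\<dots> = (\<Sum>i<N. \<Sum>j\<in>{..<N}-{i}. \<Sum>q<Q. if z i = q \<and> z j = q then G i j q q else 0)"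
      by (rule trans[OF sum.swap]) (rule sum.cong[OF refl sum.swap])
    also have "\<dots> = U z" unfolding U_def
    proof (intro sum.cong refl)
      fix i j assume "i \<in> {..<N}"
      then have zi: "z i < Q" using assignment_less[OF z] by simp
      have "(\<Sum>q<Q. if z i = q \<and> z j = q then G i j q q else 0) = (\<Sum>q<Q. if q = z i then (if z i = z j then G i j q q else 0) else 0)"
        by (intro sum.cong refl) auto
      also have "\<dots> = (if z i = z j then G i j (z i) (z i) else 0)" using zi by (simp add: sum.delta)
      finally show "(\<Sum>q<Q. if z i = q \<and> z j = q then G i j q q else 0) = G i j (z i) (z j)" by (auto simp: G_def)
    qed
    finally show ?thesis .
  qed
  have EU: "E U = (\<Sum>q<Q. w q * Scov N Y q q)"
  proof -
    have "E U = E (\<lambda>z. \<Sum>q<Q. w q * Shat N Nq Y z q)" by (rule fin_mean_cong) (simp add: U)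
    then show ?thesis by (simp add: fin_mean_sum fin_mean_mult_left mean_Shat)
  qed
  have row: "(\<Sum>j\<in>{..<N}-{i}. \<bar>G i j (z i) (z j)\<bar>) \<le> 2 * \<omega> * \<nu>\<^sup>2 / (c_lo * real N0)" if z: "z \<in> \<Omega>" and i: "i < N" for z i
  proof -
    define q where "q = z i"
    have q: "q < Q" unfolding q_def by (rule assignment_less[OF z i])
    let ?m = "real (Nq q)"
    have m: "0 < ?m" "0 < ?m - 1" using sizes_ge2[OF q] by auto
    define b where "b = \<omega> * ((2 * \<nu>)\<^sup>2 / (2 * ?m * (?m - 1)))"
    have b: "\<bar>G i j (z i) (z j)\<bar> \<le> (if z j = q then b else 0)" if "j < N" for j
    proof (cases "z j = q")
      case True
      have "\<bar>Y i q - Y j q\<bar> \<le> 2 * \<nu>" using Y_bound[OF i q] Y_bound[OF that q] by linarith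
      then have "\<bar>Y i q - Y j q\<bar>\<^sup>2 \<le> (2 * \<nu>)\<^sup>2" by (intro power_mono) auto
      then have "(Y i q - Y j q)\<^sup>2 / (2 * ?m * (?m - 1)) \<le> (2 * \<nu>)\<^sup>2 / (2 * ?m * (?m - 1))"
        using m by (intro divide_right_mono) auto
      then have "\<bar>w q\<bar> * ((Y i q - Y j q)\<^sup>2 / (2 * ?m * (?m - 1))) \<le> b"
        unfolding b_def using w[OF q] \<omega> m by (intro mult_mono) auto
      moreover have "\<bar>G i j (z i) (z j)\<bar> = \<bar>w q\<bar> * ((Y i q - Y j q)\<^sup>2 / (2 * ?m * (?m - 1)))"
        using True q m by (simp add: G_def q_def abs_mult)
      ultimately show ?thesis using True by simp
    next
      case False
      then show ?thesis by (auto simp: G_def q_def)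
    qed
    have "(\<Sum>j\<in>{..<N}-{i}. \<bar>G i j (z i) (z j)\<bar>) \<le> (\<Sum>j\<in>{..<N}-{i}. if z j = q then b else 0)"
      using b by (intro sum_mono) auto
    also have "\<dots> = (?m - 1) * b"
    proof -
      have "(\<Sum>j<N. if z j = q then b else 0) = (\<Sum>p<Q. real (Nq p) * (if p = q then b else 0))"
        by (rule sum_over_units[OF z])
      also have "\<dots> = ?m * b" using q by (simp add: if_distrib[of "\<lambda>x. _ * x"] sum.delta cong: if_cong)
      finally show ?thesis using i by (simp add: sum_diff1 q_def algebra_simps)
    qed
    also have "\<dots> = 2 * \<omega> * \<nu>\<^sup>2 / ?m" unfolding b_def using m by (simp add: power2_eq_square)
    also have "\<dots> \<le> 2 * \<omega> * \<nu>\<^sup>2 / (c_lo * real N0)"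
      using near[OF q] \<omega> c_lo N0 m(1) by (intro divide_left_mono mult_pos_pos) auto
    finally show ?thesis .
  qed
  have "E (\<lambda>z. (U z - E U)\<^sup>2) \<le> 16 * real N * (2 * \<omega> * \<nu>\<^sup>2 / (c_lo * real N0))\<^sup>2"
  proof -
    have sym: "G i j p q = G j i q p" for i j p q by (auto simp: G_def power2_commute)
    show ?thesis unfolding U_def by (rule pair_statistic_variance[OF sym row])
  qed
  moreover have "E (\<lambda>z. (\<Sum>q<Q. w q * (Shat N Nq Y z q - Scov N Y q q))\<^sup>2) = E (\<lambda>z. (U z - E U)\<^sup>2)"
    by (rule fin_mean_cong) (simp add: right_diff_distrib sum_subtractf U EU)
  ultimately show ?thesis by simp
qed

end

section \<open>The diagonalized statistic\<close>

text \<open>The output of \<open>simultaneous_diagonalization\<close> for \<open>V\<close> and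
  \<open>M\<close>, turned into assumptions so that \<open>\<beta>\<close>, \<open>B\<close> and
  \<open>l\<close> stay fixed; \<open>diagonalized_design_exists\<close> provides them.\<close>

locale diagonalized_design = design +
  fixes \<beta> B :: "nat \<Rightarrow> nat \<Rightarrow> real" and l :: "nat \<Rightarrow> real"
  assumes B: "orthonormal H B"
    and W: "psd_sqrt V * minv M * psd_sqrt V = spectral_mat H B l"
    and l_pos: "\<And>k. k < H \<Longrightarrow> 0 < l k" and l_le: "\<And>k. k < H \<Longrightarrow> l k \<le> 1"
    and l_ge: "\<And>k. k < H \<Longrightarrow> 1 \<le> \<sigma>\<^sup>2 * l k"
    and V_diag: "\<And>k m. k < H \<Longrightarrow> m < H \<Longrightarrow> form H V (\<beta> k) (\<beta> m) = (if k = m then 1 else 0)"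
    and M_diag: "\<And>k m. k < H \<Longrightarrow> m < H \<Longrightarrow> l k * form H M (\<beta> k) (\<beta> m) = (if k = m then 1 else 0)"
    and M_inv: "\<And>d. form H (minv M) d d = (\<Sum>k<H. l k * (\<Sum>h<H. \<beta> k h * d h)\<^sup>2)"
    and span: "\<And>x. \<exists>\<alpha>. \<forall>h<H. x h = (\<Sum>k<H. \<alpha> k * \<beta> k h)"
begin

lemma Wmat_eq: "Wmat N Q Nq Y F = spectral_mat H B l"
  unfolding Wmat_def EVhat_eq by (rule W)

definition gk :: "nat \<Rightarrow> nat \<Rightarrow> real" where "gk k q = g (\<beta> k) q"

definition a :: "nat \<Rightarrow> nat \<Rightarrow> nat \<Rightarrow> real" where "a k i q = gk k q * y i q / real (Nq q)"

definition A :: real where "A = sqrt (\<kappa> * real H / real N)"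

definition g_max :: real where "g_max = c\<^sup>2 * \<sigma>\<^sup>2 * c_hi * real H * real N0 / (c' * S_lo * real Q)"

lemma g_max_nonneg: "0 \<le> g_max" using cc S_lo c_hi by (simp add: g_max_def)

text \<open>The \<open>M\<close>-form at \<open>\<beta> k\<close> is at most
  \<open>\<sigma>\<^sup>2\<close>; by \<open>M_lower\<close> this bounds the sum of
  \<open>g\<^sup>2\<close> over the levels, hence by \<open>gram_lower\<close> the length of
  \<open>\<beta> k\<close>. The sup bound on \<open>F\<close> and Cauchy-Schwarz then control each
  single level, and \<open>g_max\<close> collects the constants.\<close>

lemma gk_bound:
  assumes k: "k < H" and q: "q < Q"
  shows "(gk k q)\<^sup>2 \<le> g_max"
proof -
  have Mk: "form H M (\<beta> k) (\<beta> k) \<le> \<sigma>\<^sup>2" using M_le_V[of "\<beta> k"] V_diag[OF k k] by simp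
  define s where "s = (\<Sum>q<Q. (g (\<beta> k) q)\<^sup>2)"
  define t where "t = (\<Sum>h<H. (\<beta> k h)\<^sup>2)"
  have pos: "0 < c_hi * real N0" "0 < real Q" using c_hi N0 Q_pos by auto
  have "S_lo / (c_hi * real N0) * s \<le> \<sigma>\<^sup>2" using M_lower[of "\<beta> k"] Mk unfolding s_def by linarith
  then have s: "s \<le> \<sigma>\<^sup>2 * (c_hi * real N0) / S_lo" using S_lo pos by (simp add: field_simps)
  have "c' / real Q * t \<le> s" unfolding s_def t_def by (rule gram_lower)
  then have "t \<le> s * real Q / c'" using cc pos by (simp add: field_simps)
  also have "\<dots> \<le> \<sigma>\<^sup>2 * (c_hi * real N0) / S_lo * real Q / c'"
    using s cc pos by (intro divide_right_mono mult_right_mono) auto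
  finally have t: "t \<le> \<sigma>\<^sup>2 * (c_hi * real N0) / S_lo * real Q / c'" .
  have "(gk k q)\<^sup>2 \<le> (\<Sum>h<H. (F $$ (q,h))\<^sup>2) * t"
    unfolding gk_def g_def t_def by (rule Cauchy_Schwarz_ineq_sum)
  also have "(\<Sum>h<H. (F $$ (q,h))\<^sup>2) \<le> (\<Sum>h<H. (c / real Q)\<^sup>2)"
  proof (intro sum_mono)
    fix h assume "h \<in> {..<H}"
    then have "\<bar>F $$ (q,h)\<bar> \<le> c / real Q" using F_bound[OF q] by simp
    then have "\<bar>F $$ (q,h)\<bar>\<^sup>2 \<le> (c / real Q)\<^sup>2" by (intro power_mono) auto
    then show "(F $$ (q,h))\<^sup>2 \<le> (c / real Q)\<^sup>2" by simp
  qed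
  then have "(\<Sum>h<H. (F $$ (q,h))\<^sup>2) * t \<le> (\<Sum>h<H. (c / real Q)\<^sup>2) * (\<sigma>\<^sup>2 * (c_hi * real N0) / S_lo * real Q / c')"
    using t by (intro mult_mono) (auto simp: t_def sum_nonneg)
  also have "\<dots> = g_max" unfolding g_max_def using pos by (simp add: power2_eq_square field_simps)
  finally show ?thesis .
qed

text \<open>No unit dominates: \<open>g_max\<close> is of order \<open>H * N0 / Q\<close>, division
  by the squared group size leaves \<open>H / (N0 * Q)\<close>, and \<open>N0 * Q\<close> is at
  least of order \<open>N\<close>.\<close>

lemma a_bound:
  assumes "k < H" "i < N" "q < Q"
  shows "\<bar>a k i q\<bar> \<le> A"
proof -
  have N: "0 < real N" using two_le_N by simp
  have pos: "0 < c_hi * real N0" "0 < real Q" "0 < c_lo * real N0" using c_hi N0 Q_pos c_lo by auto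
  have "(a k i q)\<^sup>2 = (gk k q)\<^sup>2 * (y i q)\<^sup>2 / (real (Nq q))\<^sup>2" by (simp add: a_def power_mult_distrib power_divide)
  also have "\<dots> \<le> g_max * \<nu>\<^sup>2 / (c_lo * real N0)\<^sup>2"
  proof (intro frac_le mult_mono)
    show "(gk k q)\<^sup>2 \<le> g_max" using assms by (intro gk_bound)
    have "\<bar>y i q\<bar>\<^sup>2 \<le> \<nu>\<^sup>2" using Y_bound[OF assms(2,3)] by (intro power_mono) (auto simp: y_def)
    then show "(y i q)\<^sup>2 \<le> \<nu>\<^sup>2" by simp
    show "(c_lo * real N0)\<^sup>2 \<le> (real (Nq q))\<^sup>2" using near[OF assms(3)] pos by (intro power_mono) auto
  qed (use g_max_nonneg c_lo N0 in auto)
  also have "\<dots> = \<kappa> * real H / (c_hi * real N0 * real Q)"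
    unfolding g_max_def \<kappa>_def using pos c_lo N0 by (simp add: power2_eq_square field_simps)
  also have "\<dots> \<le> \<kappa> * real H / real N"
    using N_le \<kappa>_nonneg N pos c_hi N0 by (intro divide_left_mono mult_nonneg_nonneg mult_pos_pos) (auto simp: ac_simps)
  finally have "sqrt ((a k i q)\<^sup>2) \<le> A" unfolding A_def by (rule real_sqrt_le_mono)
  then show ?thesis by simp
qed

sublocale L: linear_statistics N Q Nq H a A
proof unfold_locales
  show "(\<Sum>i<N. a k i q) = 0" for k q
    unfolding a_def sum_divide_distrib[symmetric] sum_distrib_left[symmetric] sum_y by simp
  show "0 \<le> A" unfolding A_def using \<kappa>_nonneg by simp
qed (rule a_bound)

text \<open>The general covariance formula for the array \<open>a\<close> is exactly the form of
  \<open>V\<close> at \<open>\<beta> k\<close> and \<open>\<beta> m\<close>, and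
  \<open>\<beta>\<close> is orthonormal for \<open>V\<close>.\<close>

lemma cov: 
  assumes "k < H" "m < H"
  shows "E (\<lambda>z. L.stat k z * L.stat m z) = (if k = m then 1 else 0)"
proof -
  have na: "real (Nq q) * a k i q = gk k q * y i q" if "q < Q" for k i q
    using Nq_pos[OF that] by (simp add: a_def)
  have "(\<Sum>q<Q. real (Nq q) * (\<Sum>i<N. a k i q * a m i q)) / (real N - 1) = form H M (\<beta> k) (\<beta> m)"
    unfolding form_M sum_divide_distrib
  proof (intro sum.cong refl)
    fix q assume "q \<in> {..<Q}" then have q: "q < Q" by simp
    have "real (Nq q) * (\<Sum>i<N. a k i q * a m i q) = (\<Sum>i<N. gk k q * gk m q / real (Nq q) * (y i q * y i q))"
      unfolding sum_distrib_left using Nq_pos[OF q] by (intro sum.cong refl) (simp add: a_def)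
    also have "\<dots> = gk k q * gk m q / real (Nq q) * (\<Sum>i<N. y i q * y i q)" by (simp add: sum_distrib_left)
    finally show "real (Nq q) * (\<Sum>i<N. a k i q * a m i q) / (real N - 1) = Scov N Y q q / real (Nq q) * g (\<beta> k) q * g (\<beta> m) q"
      by (simp add: Scov_y gk_def ac_simps)
  qed
  moreover have "(\<Sum>i<N. (\<Sum>q<Q. real (Nq q) * a k i q) * (\<Sum>q<Q. real (Nq q) * a m i q)) / (real N * (real N - 1))
      = (\<Sum>q<Q. \<Sum>p<Q. g (\<beta> k) q * Scov N Y q p * g (\<beta> m) p) / real N"
  proof -
    have "(\<Sum>q<Q. real (Nq q) * a k i q) = (\<Sum>q<Q. g (\<beta> k) q * y i q)" for k i
      by (intro sum.cong refl) (simp add: na gk_def)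
    then show ?thesis unfolding S_form by (simp add: mult.commute)
  qed
  ultimately have "E (\<lambda>z. L.stat k z * L.stat m z) = form H V (\<beta> k) (\<beta> m)"
    unfolding L.covariance[OF assms] form_V by simp
  then show ?thesis using V_diag[OF assms] by simp
qed

lemma stat_eq:
  assumes z: "z \<in> \<Omega>"
  shows "L.stat k z = (\<Sum>h<H. \<beta> k h * dev z $ h)"
proof -
  have yh: "Yhat N Nq Y z q - Ybar N Y q = (\<Sum>i\<in>{i\<in>{..<N}. z i = q}. y i q) / real (Nq q)" if q: "q < Q" for q
  proof -
    let ?G = "{i\<in>{..<N}. z i = q}"
    have "(\<Sum>i\<in>?G. y i q) = (\<Sum>i\<in>?G. Y i (z i)) - real (Nq q) * Ybar N Y q"
      using card_group[OF z q] by (simp add: y_def sum_subtractf)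
    then show ?thesis using Nq_pos[OF q] by (simp add: Yhat_def diff_divide_distrib)
  qed
  have "L.stat k z = (\<Sum>q<Q. \<Sum>i\<in>{i\<in>{..<N}. z i = q}. a k i (z i))"
    unfolding L.stat_def by (rule sum.group[symmetric]) (use z assignment_less in auto)
  also have "\<dots> = (\<Sum>q<Q. gk k q * (Yhat N Nq Y z q - Ybar N Y q))"
  proof (intro sum.cong refl)
    fix q assume "q \<in> {..<Q}" then have q: "q < Q" by simp
    have "(\<Sum>i\<in>{i\<in>{..<N}. z i = q}. a k i (z i)) = (\<Sum>i\<in>{i\<in>{..<N}. z i = q}. gk k q / real (Nq q) * y i q)"
      by (intro sum.cong refl) (auto simp: a_def)
    then have "(\<Sum>i\<in>{i\<in>{..<N}. z i = q}. a k i (z i)) = gk k q / real (Nq q) * (\<Sum>i\<in>{i\<in>{..<N}. z i = q}. y i q)"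
      by (simp only: sum_distrib_left[symmetric])
    then show "(\<Sum>i\<in>{i\<in>{..<N}. z i = q}. a k i (z i)) = gk k q * (Yhat N Nq Y z q - Ybar N Y q)"
      unfolding yh[OF q] by simp
  qed
  also have "\<dots> = (\<Sum>h<H. \<beta> k h * (\<Sum>q<Q. F $$ (q,h) * (Yhat N Nq Y z q - Ybar N Y q)))"
    unfolding gk_def g_def sum_distrib_left sum_distrib_right by (subst sum.swap) (simp add: ac_simps)
  finally show ?thesis by (simp add: dev_entry)
qed

definition X :: "(nat \<Rightarrow> nat) \<Rightarrow> real" where "X z = (\<Sum>k<H. l k * (L.stat k z)\<^sup>2)"

lemma X_eq:
  assumes "z \<in> \<Omega>"
  shows "X z = scalar_prod (dev z) (minv M *\<^sub>v dev z)"
  using form_eq_scalar_prod[OF pd_mat_minv(1)[OF M_pd] dev_carrier dev_carrier, of z z] M_inv[of "($) (dev z)"]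
  by (simp add: X_def stat_eq[OF assms])

text \<open>Entry of \<open>Vhat - M\<close> in the basis \<open>\<beta>\<close>.\<close>

definition err :: "nat \<Rightarrow> nat \<Rightarrow> (nat \<Rightarrow> nat) \<Rightarrow> real" where
  "err k m z = (\<Sum>q<Q. gk k q * gk m q / real (Nq q) * (Shat N Nq Y z q - Scov N Y q q))"

text \<open>The weights are at most \<open>g_max / (c_lo * N0)\<close>; with this
  \<open>\<omega>\<close> the row bound of \<open>weighted_Shat_variance\<close> is at most
  \<open>2 * \<kappa> * H / N\<close>.\<close>

lemma mean_err: 
  assumes "k < H" "m < H"
  shows "E (\<lambda>z. (err k m z)\<^sup>2) \<le> 64 * \<kappa>\<^sup>2 * (real H)\<^sup>2 / real N"
proof -
  have N: "0 < real N" using two_le_N by simp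
  have pos: "0 < c_hi * real N0" "0 < real Q" "0 < c_lo * real N0" using c_hi N0 Q_pos c_lo by auto
  define \<omega> where "\<omega> = g_max / (c_lo * real N0)"
  have "\<bar>gk k q * gk m q / real (Nq q)\<bar> \<le> \<omega>" if q: "q < Q" for q
  proof -
    have "0 \<le> (\<bar>gk k q\<bar> - \<bar>gk m q\<bar>)\<^sup>2" by simp
    then have "2 * (\<bar>gk k q\<bar> * \<bar>gk m q\<bar>) \<le> (gk k q)\<^sup>2 + (gk m q)\<^sup>2" by (simp add: power2_diff)
    then have "\<bar>gk k q * gk m q\<bar> \<le> g_max" using gk_bound[OF assms(1) q] gk_bound[OF assms(2) q] by (simp add: abs_mult)
    then show ?thesis unfolding \<omega>_def using near[OF q] pos g_max_nonneg by (simp add: abs_divide) (intro frac_le, auto)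
  qed
  then have "E (\<lambda>z. (err k m z)\<^sup>2) \<le> 16 * real N * (2 * \<omega> * \<nu>\<^sup>2 / (c_lo * real N0))\<^sup>2"
    unfolding err_def by (rule weighted_Shat_variance)
  also have "2 * \<omega> * \<nu>\<^sup>2 / (c_lo * real N0) \<le> 2 * \<kappa> * real H / real N"
  proof -
    have "2 * \<omega> * \<nu>\<^sup>2 / (c_lo * real N0) = 2 * (\<kappa> * real H / (c_hi * real N0 * real Q))"
      unfolding \<omega>_def g_max_def \<kappa>_def using pos c_lo N0 by (simp add: power2_eq_square field_simps)
    also have "\<dots> \<le> 2 * (\<kappa> * real H / real N)"
      using N_le \<kappa>_nonneg N pos c_hi N0 by (intro mult_left_mono divide_left_mono mult_nonneg_nonneg mult_pos_pos) (auto simp: ac_simps)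
    finally show ?thesis by simp
  qed
  then have "16 * real N * (2 * \<omega> * \<nu>\<^sup>2 / (c_lo * real N0))\<^sup>2 \<le> 16 * real N * (2 * \<kappa> * real H / real N)\<^sup>2"
    using pos g_max_nonneg by (intro mult_left_mono power_mono) (auto simp: \<omega>_def)
  also have "\<dots> = 64 * \<kappa>\<^sup>2 * (real H)\<^sup>2 / real N" using N by (simp add: power2_eq_square field_simps)
  finally show ?thesis .
qed

text \<open>In the basis \<open>\<beta>\<close> the matrix \<open>M\<close> is diagonal with entries
  \<open>1 / l k \<ge> 1\<close>, so a Frobenius bound on \<open>err\<close> is at once a bound
  relative to \<open>M\<close>, and \<open>inverse_forms_close\<close> applies.\<close>

lemma close_on_good_event:
  assumes z: "z \<in> \<Omega>" and \<epsilon>: "0 \<le> \<epsilon>" "\<epsilon> \<le> 1 / 2" and good: "(\<Sum>k<H. \<Sum>m<H. (err k m z)\<^sup>2) \<le> \<epsilon>\<^sup>2"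
  shows "\<bar>That N Q Nq Y F z - X z\<bar> \<le> 2 * \<epsilon> * X z"
  unfolding That_eq X_eq[OF z]
proof (rule inverse_forms_close[OF M_pd Vhat_carrier])
  show "Vhat N Q Nq Y F z $$ (i,j) = Vhat N Q Nq Y F z $$ (j,i)" if "i < H" "j < H" for i j
    using that by (simp add: Vhat_entry ac_simps)
  fix x
  obtain \<alpha> where \<alpha>: "\<And>h. h < H \<Longrightarrow> x h = (\<Sum>k<H. \<alpha> k * \<beta> k h)" using span[of x] by blast
  define s where "s = (\<Sum>k<H. (\<alpha> k)\<^sup>2)"
  have expand: "form H A' x x = (\<Sum>k<H. \<Sum>m<H. \<alpha> k * \<alpha> m * form H A' (\<beta> k) (\<beta> m))" for A'
  proof -
    have "form H A' x x = form H A' (\<lambda>h. \<Sum>k<H. \<alpha> k * \<beta> k h) (\<lambda>h. \<Sum>k<H. \<alpha> k * \<beta> k h)" using \<alpha> by (intro form_cong) auto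
    then show ?thesis by (simp only: form_sum_expand)
  qed
  have diff: "form H (Vhat N Q Nq Y F z) (\<beta> k) (\<beta> m) - form H M (\<beta> k) (\<beta> m) = err k m z" for k m
    unfolding form_Vhat form_M err_def gk_def sum_subtractf[symmetric]
    by (intro sum.cong refl) (simp add: algebra_simps diff_divide_distrib)
  have "form H (Vhat N Q Nq Y F z) x x - form H M x x = (\<Sum>k<H. \<Sum>m<H. \<alpha> k * \<alpha> m * err k m z)"
    unfolding expand sum_subtractf[symmetric] right_diff_distrib[symmetric] diff ..
  also have "\<bar>\<dots>\<bar> \<le> \<epsilon> * s"
  proof -
    have "(\<Sum>k<H. \<Sum>m<H. \<alpha> k * \<alpha> m * err k m z)\<^sup>2 \<le> (\<Sum>p\<in>{..<H}\<times>{..<H}. (\<alpha> (fst p) * \<alpha> (snd p))\<^sup>2) * (\<Sum>p\<in>{..<H}\<times>{..<H}. (err (fst p) (snd p) z)\<^sup>2)"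
      unfolding sum.cartesian_product using Cauchy_Schwarz_ineq_sum[of "\<lambda>p. \<alpha> (fst p) * \<alpha> (snd p)" "\<lambda>p. err (fst p) (snd p) z" "{..<H}\<times>{..<H}"]
      by (simp add: case_prod_beta)
    also have "(\<Sum>p\<in>{..<H}\<times>{..<H}. (\<alpha> (fst p) * \<alpha> (snd p))\<^sup>2) = s * s"
      unfolding s_def sum_product sum.cartesian_product by (simp add: case_prod_beta power_mult_distrib)
    also have "(\<Sum>p\<in>{..<H}\<times>{..<H}. (err (fst p) (snd p) z)\<^sup>2) = (\<Sum>k<H. \<Sum>m<H. (err k m z)\<^sup>2)"
      unfolding sum.cartesian_product by (simp add: case_prod_beta)
    also have "s * s * (\<Sum>k<H. \<Sum>m<H. (err k m z)\<^sup>2) \<le> s * s * \<epsilon>\<^sup>2" using good by (intro mult_left_mono) auto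
    also have "\<dots> = (\<epsilon> * s)\<^sup>2" by (simp add: power2_eq_square)
    finally have "\<bar>\<Sum>k<H. \<Sum>m<H. \<alpha> k * \<alpha> m * err k m z\<bar> \<le> \<bar>\<epsilon> * s\<bar>" by (simp only: abs_le_square_iff)
    moreover have "0 \<le> \<epsilon> * s" using \<epsilon> by (simp add: s_def sum_nonneg)
    ultimately show ?thesis by simp
  qed
  also have "\<epsilon> * s \<le> \<epsilon> * form H M x x"
  proof (intro mult_left_mono \<epsilon>)
    have "form H M x x = (\<Sum>k<H. \<Sum>m<H. if m = k then (\<alpha> k)\<^sup>2 * (1 / l k) else 0)"
      unfolding expand
    proof (intro sum.cong refl)
      fix k m assume "k \<in> {..<H}" "m \<in> {..<H}"
      then have km: "k < H" "m < H" by auto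
      have "form H M (\<beta> k) (\<beta> m) = (if k = m then 1 else 0) / l k"
        using M_diag[OF km] l_pos[OF km(1)] by (simp add: field_simps)
      then show "\<alpha> k * \<alpha> m * form H M (\<beta> k) (\<beta> m) = (if m = k then (\<alpha> k)\<^sup>2 * (1 / l k) else 0)"
        by (simp add: power2_eq_square)
    qed
    also have "\<dots> = (\<Sum>k<H. (\<alpha> k)\<^sup>2 * (1 / l k))" by (simp add: sum.delta)
    also have "s \<le> \<dots>" unfolding s_def
    proof (intro sum_mono)
      fix k assume "k \<in> {..<H}"
      then have "1 \<le> 1 / l k" using l_pos[of k] l_le[of k] by simp
      then have "(\<alpha> k)\<^sup>2 * 1 \<le> (\<alpha> k)\<^sup>2 * (1 / l k)" by (intro mult_left_mono) auto
      then show "(\<alpha> k)\<^sup>2 \<le> (\<alpha> k)\<^sup>2 * (1 / l k)" by simp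
    qed
    finally show "s \<le> form H M x x" .
  qed
  finally show "\<bar>form H (Vhat N Q Nq Y F z) x x - form H M x x\<bar> \<le> \<epsilon> * form H M x x" .
qed (use \<epsilon> dev_carrier in auto)

text \<open>On the good event the phases differ by at most
  \<open>\<bar>t\<bar> * 2 * \<epsilon> * X z\<close>, and \<open>X\<close> has mean at most
  \<open>H\<close>. Off it the exponentials differ by at most two, charged to
  \<open>S z / \<epsilon>\<^sup>2 > 1\<close>; there \<open>Vhat\<close> may be singular and
  \<open>minv\<close> a default value, without effect on the bound. The power \<open>H ^ 4\<close>
  comes from \<open>H\<^sup>2\<close> entries with second moments of order
  \<open>H\<^sup>2 / N\<close>.\<close>

lemma T_close_in_char:
  assumes \<epsilon>: "0 < \<epsilon>" "\<epsilon> \<le> 1 / 2"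
  shows "cmod (E (\<lambda>z. iexp (t * That N Q Nq Y F z)) - E (\<lambda>z. iexp (t * X z)))
    \<le> 2 * \<bar>t\<bar> * \<epsilon> * real H + 128 * \<kappa>\<^sup>2 * (real H) ^ 4 / (real N * \<epsilon>\<^sup>2)"
proof -
  let ?T = "That N Q Nq Y F"
  define S where "S z = (\<Sum>k<H. \<Sum>m<H. (err k m z)\<^sup>2)" for z
  have S0: "0 \<le> S z" for z by (auto simp: S_def intro!: sum_nonneg)
  have X0: "0 \<le> X z" for z unfolding X_def using l_pos by (intro sum_nonneg mult_nonneg_nonneg) (auto simp: less_imp_le)
  have pt: "cmod (iexp (t * ?T z) - iexp (t * X z)) \<le> \<bar>t\<bar> * (2 * \<epsilon> * X z) + 2 * (S z / \<epsilon>\<^sup>2)" if z: "z \<in> \<Omega>" for z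
  proof (cases "S z \<le> \<epsilon>\<^sup>2")
    case True
    have "iexp (t * ?T z) - iexp (t * X z) = iexp (t * X z) * (iexp (t * (?T z - X z)) - 1)"
      unfolding right_diff_distrib iexp_add[symmetric] mult_1_right
      by (simp add: right_diff_distrib)
    then have "cmod (iexp (t * ?T z) - iexp (t * X z)) = cmod (iexp (t * (?T z - X z)) - 1)"
      by (simp only: norm_mult norm_exp_i_times mult_1_left)
    also have "\<dots> \<le> \<bar>t * (?T z - X z)\<bar>" by (rule iexp_diff_1)
    also have "\<dots> \<le> \<bar>t\<bar> * (2 * \<epsilon> * X z)"
      unfolding abs_mult using close_on_good_event[OF z _ \<epsilon>(2)] \<epsilon> True by (intro mult_left_mono) (auto simp: S_def)
    also have "\<dots> \<le> \<bar>t\<bar> * (2 * \<epsilon> * X z) + 2 * (S z / \<epsilon>\<^sup>2)" using S0 by simp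
    finally show ?thesis .
  next
    case False
    have "cmod (iexp (t * ?T z) - iexp (t * X z)) \<le> cmod (iexp (t * ?T z)) + cmod (iexp (t * X z))" by (rule norm_triangle_ineq4)
    also have "\<dots> = 2" by (simp only: norm_exp_i_times)
    also have "2 \<le> 2 * (S z / \<epsilon>\<^sup>2)" using False \<epsilon> by (simp add: le_divide_eq)
    also have "\<dots> \<le> \<bar>t\<bar> * (2 * \<epsilon> * X z) + 2 * (S z / \<epsilon>\<^sup>2)" using X0[of z] \<epsilon> by simp
    finally show ?thesis .
  qed
  have "cmod (E (\<lambda>z. iexp (t * ?T z)) - E (\<lambda>z. iexp (t * X z))) \<le> E (\<lambda>z. \<bar>t\<bar> * (2 * \<epsilon> * X z) + 2 * (S z / \<epsilon>\<^sup>2))"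
    unfolding fin_mean_diff[symmetric] by (rule norm_fin_mean_le) (rule pt)
  also have "\<dots> = \<bar>t\<bar> * (2 * \<epsilon> * E X) + 2 * (E S / \<epsilon>\<^sup>2)"
    by (simp add: fin_mean_add fin_mean_mult_left fin_mean_divide)
  also have "\<dots> \<le> \<bar>t\<bar> * (2 * \<epsilon> * real H) + 2 * (64 * \<kappa>\<^sup>2 * (real H) ^ 4 / real N / \<epsilon>\<^sup>2)"
  proof -
    have "E X = (\<Sum>k<H. l k * E (\<lambda>z. L.stat k z * L.stat k z))"
      unfolding X_def by (simp add: fin_mean_sum fin_mean_mult_left power2_eq_square)
    also have "\<dots> \<le> (\<Sum>k<H. 1)" using cov l_le by (intro sum_mono) auto
    finally have 1: "E X \<le> real H" by simp
    have "E S = (\<Sum>k<H. \<Sum>m<H. E (\<lambda>z. (err k m z)\<^sup>2))" unfolding S_def by (simp add: fin_mean_sum)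
    also have "\<dots> \<le> (\<Sum>k<H. \<Sum>m<H. 64 * \<kappa>\<^sup>2 * (real H)\<^sup>2 / real N)" by (intro sum_mono mean_err) auto
    also have "\<dots> = 64 * \<kappa>\<^sup>2 * (real H) ^ 4 / real N" by (simp add: power2_eq_square numeral_eq_Suc)
    finally have 2: "E S \<le> 64 * \<kappa>\<^sup>2 * (real H) ^ 4 / real N" .
    show ?thesis using 1 2 \<epsilon> by (intro add_mono mult_left_mono divide_right_mono) auto
  qed
  finally show ?thesis by (simp add: ac_simps)
qed

text \<open>Constant of the approximate Stein identity, with the third moment replaced by its bound
  from \<open>mean_nrm_cube\<close>.\<close>

definition K :: real where
  "K = 4 * real N * L.step ^ 3 * (4 + 2 * (real H)\<^sup>2 + 4 * (real N * L.step\<^sup>2))"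

lemma stein_quadratic_design:
  assumes "L.step \<le> 1"
  shows "stein_quadratic (measure_pmf (CR N Q Nq)) H l L.stat K"
proof -
  interpret SS: standardized_statistics N Q Nq H a A
    by unfold_locales (use cov assms in auto)
  show ?thesis
  proof unfold_locales
    show "0 \<le> l k \<and> l k \<le> 1" if "k < H" for k using l_pos[OF that] l_le[OF that] by simp
    show "measure_pmf.expectation (CR N Q Nq) (\<lambda>x. (L.stat k x)\<^sup>2) = 1" if "k < H" for k
      using cov[OF that that] by (simp add: expectation_CR power2_eq_square)
    show "0 \<le> K" using L.step_nonneg by (simp add: K_def)
    fix \<mu> :: "nat \<Rightarrow> real" and r :: real
    assume \<mu>: "\<And>k. k < H \<Longrightarrow> 0 \<le> \<mu> k \<and> \<mu> k \<le> 1"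
    have l: "0 \<le> l k \<and> l k \<le> 1" if "k < H" for k using l_pos[OF that] l_le[OF that] by simp
    have "4 * real N * L.step ^ 3 * (\<bar>r\<bar> + r\<^sup>2) * E (\<lambda>z. (1 + L.nrm z) ^ 3) \<le>
      4 * real N * L.step ^ 3 * (\<bar>r\<bar> + r\<^sup>2) * (4 + 2 * (real H)\<^sup>2 + 4 * (real N * L.step\<^sup>2))"
      using L.step_nonneg SS.mean_nrm_cube by (intro mult_left_mono) auto
    also have "\<dots> = K * (\<bar>r\<bar> + r\<^sup>2)" by (simp add: K_def ac_simps)
    finally show "cmod (measure_pmf.expectation (CR N Q Nq) (\<lambda>x. of_real (\<Sum>k<H. \<mu> k * (L.stat k x)\<^sup>2) * iexp (r * (\<Sum>k<H. l k * (L.stat k x)\<^sup>2)))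
        - of_real (\<Sum>k<H. \<mu> k) * measure_pmf.expectation (CR N Q Nq) (\<lambda>x. iexp (r * (\<Sum>k<H. l k * (L.stat k x)\<^sup>2)))
        - 2 * \<i> * of_real r * measure_pmf.expectation (CR N Q Nq) (\<lambda>x. of_real (\<Sum>k<H. \<mu> k * l k * (L.stat k x)\<^sup>2) * iexp (r * (\<Sum>k<H. l k * (L.stat k x)\<^sup>2))))
      \<le> K * (\<bar>r\<bar> + r\<^sup>2)"
      unfolding expectation_CR using SS.approximate_stein_identity[of \<mu> l r, OF \<mu> l] by linarith
  qed (auto intro: integrable_CR)
qed

lemma gauss_frame_design: "gauss_frame H B l"
  by unfold_locales (use orthonormalD(1)[OF B] l_pos l_le in \<open>auto simp: less_imp_le\<close>)

lemma step_eq: "L.step = 4 * sqrt \<kappa> * real H / sqrt (real N)"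
  unfolding L.step_def unfolding A_def by (simp add: real_sqrt_mult real_sqrt_divide mult.assoc)

end

lemma (in design) diagonalized_design_exists:
  "\<exists>\<beta> B l. diagonalized_design N Q Nq H N0 Y F c_lo c_hi \<sigma> c c' \<nu> S_lo \<beta> B l"
proof (rule simultaneous_diagonalization[OF V_pd M_pd V_le_M M_le_V])
  fix \<beta> B :: "nat \<Rightarrow> nat \<Rightarrow> real" and l :: "nat \<Rightarrow> real"
  assume "orthonormal H B"
    "psd_sqrt V * minv M * psd_sqrt V = spectral_mat H B l"
    "\<And>k. k < H \<Longrightarrow> 0 < l k" "\<And>k. k < H \<Longrightarrow> l k \<le> 1" "\<And>k. k < H \<Longrightarrow> 1 \<le> \<sigma>\<^sup>2 * l k"
    "\<And>k m. k < H \<Longrightarrow> m < H \<Longrightarrow> form H V (\<beta> k) (\<beta> m) = (if k = m then 1 else 0)"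
    "\<And>k m. k < H \<Longrightarrow> m < H \<Longrightarrow> l k * form H M (\<beta> k) (\<beta> m) = (if k = m then 1 else 0)"
    "\<And>d. form H (minv M) d d = (\<Sum>k<H. l k * (\<Sum>h<H. \<beta> k h * d h)\<^sup>2)"
    "\<And>x. \<exists>\<alpha>. \<forall>h<H. x h = (\<Sum>k<H. \<alpha> k * \<beta> k h)"
  then have "diagonalized_design N Q Nq H N0 Y F c_lo c_hi \<sigma> c c' \<nu> S_lo \<beta> B l"
    by unfold_locales
  then show ?thesis by blast
qed

section \<open>Limit laws\<close>

lemma (in gauss_space) gauss_quad_law_eq: "gauss_quad_law H W = distr G borel (\<lambda>\<xi>. form H W \<xi> \<xi>)"
  by (simp add: gauss_quad_law_def form_def)

lemma (in gauss_space) form_measurable [measurable]: "(\<lambda>\<xi>. form H W \<xi> \<xi>) \<in> borel_measurable G"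
  unfolding form_def by measurable

lemma (in gauss_space) real_distribution_gauss: "real_distribution (gauss_quad_law H W)"
  unfolding gauss_quad_law_eq by (rule P.real_distribution_distr) simp

lemma (in gauss_space) real_distribution_chisq: "real_distribution (chisq H)"
  unfolding chisq_def by (rule P.real_distribution_distr) simp

lemma (in gauss_space) char_gauss: "char (gauss_quad_law H W) t = P.expectation (\<lambda>\<xi>. iexp (t * form H W \<xi> \<xi>))"
  unfolding gauss_quad_law_eq char_def by (subst integral_distr) auto

lemma (in gauss_frame) X_eq_form: "X \<xi> = form H (spectral_mat H B l) \<xi> \<xi>"
  unfolding X_def v_def form_spectral_mat by (simp add: power2_eq_square mult.assoc)

text \<open>Both laws are images of the same Gaussian vector, so a pointwise inequality of the forms
  acts as a coupling.\<close>

lemma (in gauss_space) gauss_tail_le: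
  assumes "\<And>\<xi>. form H W \<xi> \<xi> \<le> (\<Sum>i<H. (\<xi> i)\<^sup>2)"
  shows "measure (gauss_quad_law H W) {x<..} \<le> measure (chisq H) {x<..}"
proof -
  have "measure (gauss_quad_law H W) {x<..} = measure G ((\<lambda>\<xi>. form H W \<xi> \<xi>) -` {x<..} \<inter> space G)"
    unfolding gauss_quad_law_eq by (rule measure_distr) auto
  also have "\<dots> \<le> measure G ((\<lambda>\<xi>. \<Sum>i<H. (\<xi> i)\<^sup>2) -` {x<..} \<inter> space G)"
    by (rule P.finite_measure_mono) (use assms in \<open>auto intro: less_le_trans\<close>)
  also have "\<dots> = measure (chisq H) {x<..}"
    unfolding chisq_def by (rule measure_distr[symmetric]) auto
  finally show ?thesis .
qed

lemma (in real_distribution) tail_eq: "measure M {x<..} = 1 - cdf M x"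
proof -
  have "measure M (UNIV - {..x}) = measure M (space M) - measure M {..x}"
    using finite_measure_compl[of "{..x}"] by simp
  moreover have "UNIV - {..x} = {x<..}" by auto
  ultimately show ?thesis using prob_space by (simp add: cdf_def)
qed

text \<open>The set under the infimum is nonempty because the distribution function tends to one,
  and bounded below by zero because the chi-square law lives on the nonnegative axis. Right
  continuity carries the inequality from points above the infimum to the infimum itself.\<close>

lemma (in gauss_space) chisq_quantile:
  assumes \<alpha>: "0 < \<alpha>" "\<alpha> < 1"
  shows "0 \<le> chisq_upper_quantile H \<alpha>" "1 - \<alpha> \<le> cdf (chisq H) (chisq_upper_quantile H \<alpha>)"
proof -
  interpret C: real_distribution "chisq H" by (rule real_distribution_chisq)
  define S where "S = {x. measure (chisq H) {x<..} \<le> \<alpha>}"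
  have S: "S = {x. 1 - \<alpha> \<le> cdf (chisq H) x}" unfolding S_def C.tail_eq by auto
  have "\<forall>\<^sub>F x in at_top. 1 - \<alpha> < cdf (chisq H) x"
    by (rule order_tendstoD(1)[OF C.cdf_lim_at_top_prob]) (use \<alpha> in simp)
  then obtain x0 where "1 - \<alpha> < cdf (chisq H) x0" by (meson eventually_at_top_linorder order_refl)
  then have ne: "x0 \<in> S" unfolding S by simp
  have low: "0 \<le> x" if "x \<in> S" for x
  proof (rule ccontr)
    assume x: "\<not> 0 \<le> x"
    have "measure (chisq H) {x<..} = measure G ((\<lambda>\<xi>. \<Sum>i<H. (\<xi> i)\<^sup>2) -` {x<..} \<inter> space G)"
      unfolding chisq_def by (rule measure_distr) auto
    also have "(\<lambda>\<xi>. \<Sum>i<H. (\<xi> i)\<^sup>2) -` {x<..} \<inter> space G = space G"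
    proof -
      have "x < (\<Sum>i<H. (\<xi> i)\<^sup>2)" for \<xi> :: "nat \<Rightarrow> real"
        using x sum_nonneg[of "{..<H}" "\<lambda>i. (\<xi> i)\<^sup>2"] by fastforce
      then show ?thesis by auto
    qed
    finally have "measure (chisq H) {x<..} = 1" using P.prob_space by simp
    then show False using that \<alpha> unfolding S_def by simp
  qed
  define q where "q = chisq_upper_quantile H \<alpha>"
  have q: "q = Inf S" by (simp add: q_def S_def chisq_upper_quantile_def)
  show "0 \<le> chisq_upper_quantile H \<alpha>"
    unfolding q_def[symmetric] q using ne low by (intro cInf_greatest) auto
  have above: "1 - \<alpha> \<le> cdf (chisq H) x" if qx: "q < x" for x
  proof -
    obtain s where s: "s \<in> S" "s < x"
      using cInf_lessD[of S x] qx ne unfolding q by auto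
    have "1 - \<alpha> \<le> cdf (chisq H) s" using s unfolding S by simp
    also have "\<dots> \<le> cdf (chisq H) x" using s by (intro C.cdf_nondecreasing) simp
    finally show ?thesis .
  qed
  have "(cdf (chisq H) \<longlongrightarrow> cdf (chisq H) q) (at_right q)"
    using C.cdf_is_right_cont[of q] by (simp add: continuous_within)
  moreover have "\<forall>\<^sub>F x in at_right q. 1 - \<alpha> \<le> cdf (chisq H) x"
    using above by (auto simp: eventually_at_filter intro!: always_eventually)
  ultimately show "1 - \<alpha> \<le> cdf (chisq H) (chisq_upper_quantile H \<alpha>)"
    unfolding q_def[symmetric] by (rule tendsto_lowerbound) simp
qed

text \<open>Fixing all coordinates but the first one, the quadratic form is a polynomial of degree two,
  whose level sets are finite.\<close>

lemma (in gauss_space) gauss_no_atoms: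
  assumes H: "0 < H" and W: "W $$ (0,0) \<noteq> 0"
  shows "measure (gauss_quad_law H W) {x} = 0"
proof -
  define J where "J = {..<H} - {0}"
  have J: "finite J" "0 \<notin> J" "insert 0 J = {..<H}" using H by (auto simp: J_def)
  define S where "S = (\<lambda>\<xi>. form H W \<xi> \<xi>) -` {x} \<inter> space G"
  have S [measurable]: "S \<in> sets G" unfolding S_def by measurable
  have "measure (gauss_quad_law H W) {x} = measure G S"
    unfolding gauss_quad_law_eq S_def by (rule measure_distr) auto
  also have "\<dots> = (\<integral>\<xi>. indicat_real S \<xi> \<partial>G)" using S by simp
  also have "\<dots> = (\<integral>u. (\<integral>y. indicat_real S (u(0 := y)) \<partial>std_normal_distribution) \<partial>PiM J (\<lambda>_. std_normal_distribution))"
    using product_integral_insert[OF J(1,2), of "indicat_real S"] S unfolding J(3)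
    by (simp add: integrable_indicator_iff P.emeasure_finite less_top[symmetric])
  also have "\<dots> = (\<integral>u. 0 \<partial>PiM J (\<lambda>_. std_normal_distribution))"
  proof (rule Bochner_Integration.integral_cong[OF refl])
    fix u :: "nat \<Rightarrow> real"
    define b0 b1 where "b0 = (\<Sum>i\<in>J. \<Sum>j\<in>J. u i * W $$ (i,j) * u j)"
      and "b1 = (\<Sum>j\<in>J. W $$ (0,j) * u j) + (\<Sum>i\<in>J. u i * W $$ (i,0))"
    have q: "form H W (u(0 := y)) (u(0 := y)) = b0 + b1 * y + W $$ (0,0) * y\<^sup>2" for y
    proof -
      let ?u = "u(0 := y)"
      have u: "(\<Sum>i\<in>J. f (?u i) i) = (\<Sum>i\<in>J. f (u i) i)" for f :: "real \<Rightarrow> nat \<Rightarrow> real"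
        using J(2) by (intro sum.cong) auto
      have "form H W ?u ?u = (\<Sum>i\<in>insert 0 J. \<Sum>j\<in>insert 0 J. ?u i * W $$ (i,j) * ?u j)"
        unfolding form_def J(3) ..
      also have "\<dots> = (y * W $$ (0,0) * y + (\<Sum>j\<in>J. y * W $$ (0,j) * ?u j)) + (\<Sum>i\<in>J. ?u i * W $$ (i,0) * y + (\<Sum>j\<in>J. ?u i * W $$ (i,j) * ?u j))"
        using J(1,2) by simp
      also have "(\<Sum>j\<in>J. y * W $$ (0,j) * ?u j) = (\<Sum>j\<in>J. W $$ (0,j) * u j) * y"
        unfolding u[of "\<lambda>a j. y * W $$ (0,j) * a"] sum_distrib_right by (intro sum.cong refl) simp
      also have "(\<Sum>i\<in>J. ?u i * W $$ (i,0) * y + (\<Sum>j\<in>J. ?u i * W $$ (i,j) * ?u j)) = (\<Sum>i\<in>J. u i * W $$ (i,0)) * y + b0"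
      proof -
        have "(\<Sum>j\<in>J. a * W $$ (i,j) * ?u j) = (\<Sum>j\<in>J. a * W $$ (i,j) * u j)" for a i
          by (rule u[of "\<lambda>t j. a * W $$ (i,j) * t"])
        then have "(\<Sum>i\<in>J. ?u i * W $$ (i,0) * y + (\<Sum>j\<in>J. ?u i * W $$ (i,j) * ?u j)) = (\<Sum>i\<in>J. ?u i * W $$ (i,0) * y + (\<Sum>j\<in>J. ?u i * W $$ (i,j) * u j))"
          by (simp only:)
        also have "\<dots> = (\<Sum>i\<in>J. u i * W $$ (i,0) * y + (\<Sum>j\<in>J. u i * W $$ (i,j) * u j))"
          by (rule u[of "\<lambda>t i. t * W $$ (i,0) * y + (\<Sum>j\<in>J. t * W $$ (i,j) * u j)"])
        finally show ?thesis by (simp add: sum.distrib sum_distrib_right b0_def)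
      qed
      finally have "form H W ?u ?u = (y * W $$ (0,0) * y + (\<Sum>j\<in>J. W $$ (0,j) * u j) * y) + ((\<Sum>i\<in>J. u i * W $$ (i,0)) * y + b0)" .
      moreover have "(y * w * y + p * y) + (r * y + b0) = b0 + (p + r) * y + w * y\<^sup>2" for p r w
        by (simp add: power2_eq_square algebra_simps)
      ultimately show ?thesis unfolding b1_def by (simp only:)
    qed
    define R where "R = {y. poly [:b0 - x, b1, W $$ (0,0):] y = 0}"
    have R: "finite R" unfolding R_def using W by (intro poly_roots_finite) auto
    have sub: "indicat_real S (u(0 := y)) = 0" if "y \<notin> R" for y
    proof -
      have "form H W (u(0 := y)) (u(0 := y)) \<noteq> x"
        using that unfolding q R_def by (simp add: algebra_simps power2_eq_square)
      then show ?thesis unfolding S_def by (simp add: indicator_def)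
    qed
    have "AE y in lborel. y \<notin> R"
      using R by (intro AE_not_in) (simp add: finite_imp_null_set_lborel)
    then have "AE y in std_normal_distribution. indicat_real S (u(0 := y)) = 0"
      by (subst AE_density) (auto elim!: eventually_mono intro: sub)
    then show "(\<integral>y. indicat_real S (u(0 := y)) \<partial>std_normal_distribution) = 0" by (rule integral_eq_zero_AE)
  qed
  finally show ?thesis by simp
qed

lemma mtrace_spectral_mat:
  assumes "orthonormal n B"
  shows "mtrace (spectral_mat n B f) = (\<Sum>k<n. f k)"
proof -
  have "mtrace (spectral_mat n B f) = (\<Sum>i<n. \<Sum>k<n. f k * (B k i * B k i))"
    by (simp add: mtrace_def spectral_mat_entry mult.assoc)
  also have "\<dots> = (\<Sum>k<n. \<Sum>i<n. f k * (B k i * B k i))" by (rule sum.swap)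
  also have "\<dots> = (\<Sum>k<n. f k)"
    unfolding sum_distrib_left[symmetric] using orthonormalD(1)[OF assms] by simp
  finally show ?thesis .
qed

lemma (in assignment_space) char_CR:
  "char (distr (measure_pmf (CR N Q Nq)) borel f) t = E (\<lambda>z. iexp (t * f z))"
  unfolding char_def by (subst integral_distr) (auto simp: expectation_CR)

section \<open>Comparison of one design with its Gaussian counterpart\<close>

context diagonalized_design
begin

abbreviation "Wm \<equiv> Wmat N Q Nq Y F"

interpretation GF: gauss_frame H B l by (rule gauss_frame_design)
interpretation GQ: stein_quadratic GF.G H l GF.v 0 by (rule GF.stein_quadratic_gauss)

lemma form_W: "form H Wm \<xi> \<xi> = GF.X \<xi>" "GQ.X = GF.X"
  unfolding Wmat_eq by (rule GF.X_eq_form[symmetric]) (simp add: GQ.X_def[abs_def] GF.X_def[abs_def])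

lemma form_W_le: "form H Wm \<xi> \<xi> \<le> (\<Sum>i<H. (\<xi> i)\<^sup>2)"
  unfolding form_W by (rule GF.X_le)

text \<open>All eigenvalues of \<open>W\<close> are at least \<open>1 / \<sigma>\<^sup>2\<close>.
  The bound survives the limit, so the limiting form is not degenerate and its law has no
  atoms.\<close>

lemma W00: "0 < H \<Longrightarrow> 1 \<le> \<sigma>\<^sup>2 * Wm $$ (0,0)"
proof -
  assume H: "0 < H"
  have "1 = (\<Sum>k<H. B k 0 * B k 0)" using orthonormalD(2)[OF B H H] by simp
  also have "\<dots> \<le> (\<Sum>k<H. \<sigma>\<^sup>2 * l k * (B k 0 * B k 0))"
  proof (intro sum_mono)
    fix k assume "k \<in> {..<H}"
    then have "1 * (B k 0 * B k 0) \<le> \<sigma>\<^sup>2 * l k * (B k 0 * B k 0)" using l_ge[of k] by (intro mult_right_mono) auto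
    then show "B k 0 * B k 0 \<le> \<sigma>\<^sup>2 * l k * (B k 0 * B k 0)" by simp
  qed
  also have "\<dots> = \<sigma>\<^sup>2 * Wm $$ (0,0)"
    unfolding Wmat_eq using H by (simp add: spectral_mat_entry sum_distrib_left mult.assoc)
  finally show ?thesis .
qed

lemma trace_W: "mtrace Wm = (\<Sum>k<H. l k)" "mtrace (Wm * Wm) = (\<Sum>k<H. (l k)\<^sup>2)"
  unfolding Wmat_eq spectral_mat_mult[OF B] mtrace_spectral_mat[OF B] by (simp_all add: power2_eq_square)

lemma trace_sq_lower: "real H \<le> \<sigma> ^ 4 * mtrace (Wm * Wm)"
proof -
  have "(\<Sum>k<H. 1) \<le> (\<Sum>k<H. \<sigma> ^ 4 * (l k)\<^sup>2)"
  proof (intro sum_mono)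
    fix k assume "k \<in> {..<H}"
    then have "1 \<le> (\<sigma>\<^sup>2 * l k)\<^sup>2" using l_ge[of k] by (simp add: one_le_power)
    also have "\<dots> = \<sigma> ^ 4 * (l k)\<^sup>2" by (simp add: power_mult_distrib power_mult[symmetric])
    finally show "1 \<le> \<sigma> ^ 4 * (l k)\<^sup>2" .
  qed
  then show ?thesis unfolding trace_W by (simp add: sum_distrib_left)
qed

text \<open>Needed for the degenerate case of (i): without contrasts the chi-square law is a point
  mass at zero, and the quantile is a point of discontinuity.\<close>

lemma That_zero:
  assumes H: "H = 0" and z: "z \<in> \<Omega>"
  shows "That N Q Nq Y F z = 0"
proof -
  have "X z = 0" unfolding X_def by (simp add: H)
  moreover have "(\<Sum>k<H. \<Sum>m<H. (err k m z)\<^sup>2) \<le> 0\<^sup>2" by (simp add: H)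
  ultimately show ?thesis using close_on_good_event[OF z, of 0] by simp
qed

text \<open>\<open>N * step\<^sup>2\<close> is free of \<open>N\<close>, and
  \<open>N * step ^ 3\<close> carries exactly one factor \<open>1 / sqrt N\<close>; so
  \<open>K\<close> is a polynomial in \<open>H\<close> of degree at most five, divided by
  \<open>sqrt N\<close>.\<close>

lemma K_eq: "K = 256 * sqrt \<kappa> ^ 3 * (real H) ^ 3 * (4 + 2 * (real H)\<^sup>2 + 64 * \<kappa> * (real H)\<^sup>2) / sqrt (real N)"
proof -
  have N: "0 < sqrt (real N)" "real N = sqrt (real N) * sqrt (real N)" using two_le_N by auto
  have 1: "real N * L.step\<^sup>2 = 16 * \<kappa> * (real H)\<^sup>2"
    unfolding step_eq power_mult_distrib power_divide using \<kappa>_nonneg two_le_N by simp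
  have 2: "real N * L.step ^ 3 = 64 * sqrt \<kappa> ^ 3 * (real H) ^ 3 / sqrt (real N)"
  proof -
    have "L.step ^ 3 = 64 * sqrt \<kappa> ^ 3 * (real H) ^ 3 / (sqrt (real N)) ^ 3"
      unfolding step_eq power_mult_distrib power_divide by simp
    also have "(sqrt (real N)) ^ 3 = real N * sqrt (real N)" by (simp add: power3_eq_cube)
    finally show ?thesis using two_le_N by simp
  qed
  have "K = 4 * (real N * L.step ^ 3) * (4 + 2 * (real H)\<^sup>2 + 4 * (real N * L.step\<^sup>2))" by (simp add: K_def)
  then show ?thesis unfolding 1 2 by simp
qed

text \<open>\<open>\<epsilon>\<close> is a free threshold for the good event. The last term is a
  square root because \<open>char_compare\<close> controls a squared difference; it is exponential
  in \<open>H\<close> and hence serves fixed \<open>H\<close> only.\<close>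

lemma char_T_close_gauss:
  assumes step: "L.step \<le> 1" and \<epsilon>: "0 < \<epsilon>" "\<epsilon> \<le> 1 / 2"
  shows "cmod (char (distr (measure_pmf (CR N Q Nq)) borel (That N Q Nq Y F)) t - char (gauss_quad_law H Wm) t)
    \<le> 2 * \<bar>t\<bar> * \<epsilon> * real H + 128 * \<kappa>\<^sup>2 * (real H) ^ 4 / (real N * \<epsilon>\<^sup>2)
      + sqrt (4 * real H * (K * (\<bar>t\<bar> + t\<^sup>2)) * (1 + 2 * \<bar>t\<bar>) ^ H * \<bar>t\<bar>)"
proof -
  have sq: "stein_quadratic (measure_pmf (CR N Q Nq)) H l L.stat K" by (rule stein_quadratic_design[OF step])
  interpret SQ: stein_quadratic "measure_pmf (CR N Q Nq)" H l L.stat K by (rule sq)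
  have X: "SQ.X = X" by (simp add: SQ.X_def[abs_def] X_def[abs_def])
  have "(cmod (SQ.\<phi> t - GQ.\<phi> t))\<^sup>2 \<le> 4 * real H * (K * (\<bar>t\<bar> + t\<^sup>2)) * (1 + 2 * \<bar>t\<bar>) ^ H * \<bar>t\<bar>"
    by (rule char_compare[OF sq GF.stein_quadratic_gauss])
  then have "cmod (SQ.\<phi> t - GQ.\<phi> t) \<le> sqrt (4 * real H * (K * (\<bar>t\<bar> + t\<^sup>2)) * (1 + 2 * \<bar>t\<bar>) ^ H * \<bar>t\<bar>)"
    by (rule real_le_rsqrt)
  moreover have "SQ.\<phi> t = E (\<lambda>z. iexp (t * X z))" unfolding SQ.\<phi>_def X by (rule expectation_CR)
  moreover have "GQ.\<phi> t = char (gauss_quad_law H Wm) t" unfolding GQ.\<phi>_def GF.char_gauss form_W ..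
  ultimately have "cmod (E (\<lambda>z. iexp (t * X z)) - char (gauss_quad_law H Wm) t) \<le> sqrt (4 * real H * (K * (\<bar>t\<bar> + t\<^sup>2)) * (1 + 2 * \<bar>t\<bar>) ^ H * \<bar>t\<bar>)"
    by simp
  with T_close_in_char[OF \<epsilon>, of t] show ?thesis
    unfolding char_CR by (rule norm_diff_triangle_le)
qed

definition m :: real where "m = mtrace Wm"
definition s :: real where "s = sqrt (2 * mtrace (Wm * Wm))"

lemma s_pos: "0 < H \<Longrightarrow> 0 < s"
proof -
  assume "0 < H"
  then have "0 < \<sigma> ^ 4 * mtrace (Wm * Wm)" using trace_sq_lower by simp
  then have "0 < mtrace (Wm * Wm)" by (metis zero_less_mult_pos zero_le_even_power even_numeral mult_zero_left order_less_le)
  then show ?thesis by (simp add: s_def)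
qed

lemma s_square: "s\<^sup>2 = 2 * (\<Sum>k<H. (l k)\<^sup>2)"
  unfolding s_def trace_W by (simp add: sum_nonneg)

text \<open>Each \<open>l k\<close> is at least \<open>1 / \<sigma>\<^sup>2\<close>, so the spread
  grows at least like \<open>sqrt H\<close>.\<close>

lemma s_lower: "sqrt (real H) \<le> \<sigma>\<^sup>2 * s"
proof -
  have "real H \<le> \<sigma> ^ 4 * s\<^sup>2"
  proof -
    have "real H \<le> \<sigma> ^ 4 * mtrace (Wm * Wm)" by (rule trace_sq_lower)
    also have "\<dots> \<le> \<sigma> ^ 4 * s\<^sup>2" unfolding s_square trace_W by (intro mult_left_mono) (auto simp: sum_nonneg)
    finally show ?thesis .
  qed
  also have "\<dots> = (\<sigma>\<^sup>2 * s)\<^sup>2" by (simp add: power_mult_distrib power_mult[symmetric])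
  finally have "sqrt (real H) \<le> sqrt ((\<sigma>\<^sup>2 * s)\<^sup>2)" by (rule real_sqrt_le_mono)
  then have "sqrt (real H) \<le> \<bar>\<sigma>\<^sup>2 * s\<bar>" by (simp only: real_sqrt_abs)
  moreover have "0 \<le> \<sigma>\<^sup>2 * s" by (simp add: s_def trace_W sum_nonneg)
  ultimately show ?thesis by simp
qed

text \<open>Bound of \<open>standardized_char_bound\<close> with \<open>k\<close> in place of the
  Stein error, so that \<open>k = K\<close> serves the randomization law and \<open>k = 0\<close>
  the Gaussian one.\<close>

definition clt_error :: "real \<Rightarrow> real \<Rightarrow> real" where
  "clt_error k t = \<bar>t\<bar> * ((4 * t\<^sup>2 * real H / s\<^sup>2 + (1 + 2 * \<bar>t\<bar> / s) * (k * (\<bar>t\<bar> / s + t\<^sup>2 / s\<^sup>2))) / s)"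

lemma char_T_standardized:
  assumes step: "L.step \<le> 1" and \<epsilon>: "0 < \<epsilon>" "\<epsilon> \<le> 1 / 2" and H: "0 < H"
  shows "cmod (char (distr (measure_pmf (CR N Q Nq)) borel (\<lambda>z. (That N Q Nq Y F z - m) / s)) t - of_real (exp (- (t\<^sup>2) / 2)))
    \<le> 2 * \<bar>t\<bar> / s * \<epsilon> * real H + 128 * \<kappa>\<^sup>2 * (real H) ^ 4 / (real N * \<epsilon>\<^sup>2) + clt_error K t"
proof -
  interpret SQ: stein_quadratic "measure_pmf (CR N Q Nq)" H l L.stat K by (rule stein_quadratic_design[OF step])
  have X: "SQ.X = X" by (simp add: SQ.X_def[abs_def] X_def[abs_def])
  have s: "0 < s" by (rule s_pos[OF H])
  have shift: "E (\<lambda>z. iexp (t * ((f z - m) / s))) = iexp (- (t * m / s)) * E (\<lambda>z. iexp (t / s * f z))" for f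
  proof -
    have "iexp (t * ((f z - m) / s)) = iexp (- (t * m / s)) * iexp (t / s * f z)" for z
    proof -
      have "t * ((f z - m) / s) = - (t * m / s) + t / s * f z" by (simp add: diff_divide_distrib right_diff_distrib)
      then show ?thesis by (simp only: iexp_add)
    qed
    then show ?thesis by (simp only: fin_mean_mult_left)
  qed
  have "cmod (E (\<lambda>z. iexp (t * ((That N Q Nq Y F z - m) / s))) - E (\<lambda>z. iexp (t * ((X z - m) / s))))
     = cmod (E (\<lambda>z. iexp (t / s * That N Q Nq Y F z)) - E (\<lambda>z. iexp (t / s * X z)))"
    unfolding shift right_diff_distrib[symmetric] norm_mult norm_exp_i_times by simp
  also have "\<dots> \<le> 2 * \<bar>t / s\<bar> * \<epsilon> * real H + 128 * \<kappa>\<^sup>2 * (real H) ^ 4 / (real N * \<epsilon>\<^sup>2)"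
    by (rule T_close_in_char[OF \<epsilon>])
  also have "2 * \<bar>t / s\<bar> = 2 * \<bar>t\<bar> / s" using s by simp
  finally have 1: "cmod (E (\<lambda>z. iexp (t * ((That N Q Nq Y F z - m) / s))) - E (\<lambda>z. iexp (t * ((X z - m) / s))))
     \<le> 2 * \<bar>t\<bar> / s * \<epsilon> * real H + 128 * \<kappa>\<^sup>2 * (real H) ^ 4 / (real N * \<epsilon>\<^sup>2)" .
  have 2: "cmod (E (\<lambda>z. iexp (t * ((X z - m) / s))) - of_real (exp (- (t\<^sup>2) / 2))) \<le> clt_error K t"
    using SQ.standardized_char_bound[OF s s_square, of t]
    unfolding X expectation_CR clt_error_def m_def trace_W .
  show ?thesis unfolding char_CR by (rule norm_diff_triangle_le[OF 1 2])
qed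

text \<open>Gaussian coordinates satisfy Stein's identity with error zero, so the same differential
  inequality gives the normal approximation of the Gaussian form.\<close>

lemma char_gauss_standardized:
  assumes H: "0 < H"
  shows "cmod (char (distr (gauss_quad_law H Wm) borel (\<lambda>x. (x - m) / s)) t - of_real (exp (- (t\<^sup>2) / 2))) \<le> clt_error 0 t"
proof -
  have s: "0 < s" by (rule s_pos[OF H])
  have "char (distr (gauss_quad_law H Wm) borel (\<lambda>x. (x - m) / s)) t = GF.P.expectation (\<lambda>\<xi>. iexp (t * ((GF.X \<xi> - m) / s)))"
    unfolding char_def GF.gauss_quad_law_eq form_W
    by (subst distr_distr) (auto simp: integral_distr comp_def)
  then show ?thesis
    using GQ.standardized_char_bound[OF s s_square, of t] unfolding form_W clt_error_def m_def trace_W by simp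
qed

text \<open>By \<open>s_lower\<close>, three factors \<open>1 / s\<close> against \<open>H\<close>
  leave \<open>1 / sqrt H\<close>, two against \<open>k\<close> leave \<open>k / H\<close>, and
  every further \<open>1 / s\<close> is at most \<open>\<sigma>\<^sup>2\<close>.\<close>

lemma clt_error_le:
  assumes H: "0 < H" and k: "0 \<le> k"
  shows "clt_error k t \<le> \<bar>t\<bar> * (4 * t\<^sup>2 * \<sigma> ^ 6 / sqrt (real H) + (1 + 2 * \<bar>t\<bar> * \<sigma>\<^sup>2) * (\<bar>t\<bar> + t\<^sup>2 * \<sigma>\<^sup>2) * \<sigma> ^ 4 * (k / real H))"
proof -
  have s: "0 < s" by (rule s_pos[OF H])
  have Hp: "0 < sqrt (real H)" "1 \<le> sqrt (real H)" using H by auto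
  have si: "1 / s \<le> \<sigma>\<^sup>2 / sqrt (real H)" using s_lower s Hp by (simp add: field_simps)
  have si1: "1 / s \<le> \<sigma>\<^sup>2"
  proof -
    have "\<sigma>\<^sup>2 / sqrt (real H) \<le> \<sigma>\<^sup>2 / 1" using Hp by (intro divide_left_mono) auto
    then show ?thesis using si by simp
  qed
  have si0: "0 \<le> 1 / s" using s by simp
  have si2: "1 / s\<^sup>2 \<le> \<sigma> ^ 4 / real H"
  proof -
    have "(1 / s)\<^sup>2 \<le> (\<sigma>\<^sup>2 / sqrt (real H))\<^sup>2" using si si0 by (rule power_mono)
    then show ?thesis by (simp add: power_divide power_mult[symmetric])
  qed
  have A: "4 * t\<^sup>2 * real H / s\<^sup>2 / s \<le> 4 * t\<^sup>2 * \<sigma> ^ 6 / sqrt (real H)"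
  proof -
    have "4 * t\<^sup>2 * real H / s\<^sup>2 / s = (4 * t\<^sup>2 * real H) * (1 / s\<^sup>2) * (1 / s)" by simp
    also have "\<dots> \<le> (4 * t\<^sup>2 * real H) * (\<sigma> ^ 4 / real H) * (\<sigma>\<^sup>2 / sqrt (real H))"
      using si si2 si0 by (intro mult_mono) auto
    also have "\<dots> = 4 * t\<^sup>2 * (\<sigma> ^ 4 * \<sigma>\<^sup>2) / sqrt (real H)" using H by simp
    also have "\<sigma> ^ 4 * \<sigma>\<^sup>2 = \<sigma> ^ 6" by (simp flip: power_add)
    finally show ?thesis .
  qed
  have Bd: "(1 + 2 * \<bar>t\<bar> / s) * (k * (\<bar>t\<bar> / s + t\<^sup>2 / s\<^sup>2)) / s \<le> (1 + 2 * \<bar>t\<bar> * \<sigma>\<^sup>2) * (\<bar>t\<bar> + t\<^sup>2 * \<sigma>\<^sup>2) * \<sigma> ^ 4 * (k / real H)"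
  proof -
    have "(1 + 2 * \<bar>t\<bar> / s) * (k * (\<bar>t\<bar> / s + t\<^sup>2 / s\<^sup>2)) / s = (1 + 2 * \<bar>t\<bar> * (1 / s)) * (\<bar>t\<bar> + t\<^sup>2 * (1 / s)) * (1 / s\<^sup>2) * k"
      using s by (simp add: field_simps power2_eq_square)
    also have "\<dots> \<le> (1 + 2 * \<bar>t\<bar> * \<sigma>\<^sup>2) * (\<bar>t\<bar> + t\<^sup>2 * \<sigma>\<^sup>2) * (\<sigma> ^ 4 / real H) * k"
      using si1 si2 si0 k by (intro mult_mono add_mono order_refl mult_nonneg_nonneg add_nonneg_nonneg) auto
    finally show ?thesis by simp
  qed
  have "clt_error k t = \<bar>t\<bar> * (4 * t\<^sup>2 * real H / s\<^sup>2 / s + (1 + 2 * \<bar>t\<bar> / s) * (k * (\<bar>t\<bar> / s + t\<^sup>2 / s\<^sup>2)) / s)"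
    unfolding clt_error_def by (simp add: add_divide_distrib)
  also have "\<dots> \<le> \<bar>t\<bar> * (4 * t\<^sup>2 * \<sigma> ^ 6 / sqrt (real H) + (1 + 2 * \<bar>t\<bar> * \<sigma>\<^sup>2) * (\<bar>t\<bar> + t\<^sup>2 * \<sigma>\<^sup>2) * \<sigma> ^ 4 * (k / real H))"
    using A Bd by (intro mult_left_mono add_mono) auto
  finally show ?thesis .
qed

lemma gauss_cdf_at_quantile:
  assumes "0 < \<alpha>" "\<alpha> < 1"
  shows "1 - \<alpha> \<le> cdf (gauss_quad_law H Wm) (chisq_upper_quantile H \<alpha>)"
proof -
  let ?q = "chisq_upper_quantile H \<alpha>"
  interpret C: real_distribution "chisq H" by (rule GF.real_distribution_chisq)
  interpret Gl: real_distribution "gauss_quad_law H Wm" by (rule GF.real_distribution_gauss)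
  have "measure (gauss_quad_law H Wm) {?q<..} \<le> measure (chisq H) {?q<..}"
    by (rule GF.gauss_tail_le) (rule form_W_le)
  then show ?thesis using GF.chisq_quantile(2)[OF assms] unfolding C.tail_eq Gl.tail_eq by simp
qed

end

section \<open>Convergence\<close>

text \<open>Limit in two stages: \<open>\<eta>\<close> is fixed while \<open>n\<close> grows and
  only then made small. This spares choosing a threshold that shrinks with \<open>n\<close>.\<close>

lemma tendsto_zero_two_scale:
  fixes x :: "nat \<Rightarrow> 'a::real_normed_vector"
  assumes "\<And>\<eta>. 0 < \<eta> \<Longrightarrow> \<eta> \<le> 1 / 2 \<Longrightarrow> \<exists>e. e \<longlonglongrightarrow> 0 \<and> (\<forall>\<^sub>F n in sequentially. norm (x n) \<le> C * \<eta> + e n)"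
  shows "x \<longlonglongrightarrow> 0"
proof (rule tendstoI)
  fix \<delta> :: real assume \<delta>: "0 < \<delta>"
  define \<eta> where "\<eta> = min (1 / 2) (\<delta> / (2 * (\<bar>C\<bar> + 1)))"
  have "0 < \<bar>C\<bar> + 1" by linarith
  then have "0 < \<delta> / (2 * (\<bar>C\<bar> + 1))" using \<delta> by simp
  then have \<eta>: "0 < \<eta>" "\<eta> \<le> 1 / 2" "\<eta> \<le> \<delta> / (2 * (\<bar>C\<bar> + 1))"
    unfolding \<eta>_def by (simp_all only: min.cobounded1 min.cobounded2 min_less_iff_conj zero_less_divide_1_iff zero_less_numeral simp_thms)
  obtain e where e: "e \<longlonglongrightarrow> 0" "\<forall>\<^sub>F n in sequentially. norm (x n) \<le> C * \<eta> + e n"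
    using assms[OF \<eta>(1,2)] by blast
  have C: "C * \<eta> \<le> \<delta> / 2"
  proof -
    have "C * \<eta> \<le> (\<bar>C\<bar> + 1) * \<eta>" using \<eta> by (intro mult_right_mono) auto
    also have "\<dots> \<le> (\<bar>C\<bar> + 1) * (\<delta> / (2 * (\<bar>C\<bar> + 1)))" using \<eta> by (intro mult_left_mono) auto
    also have "\<dots> = \<delta> / 2"
    proof -
      have "\<bar>C\<bar> + 1 \<noteq> 0" by linarith
      then show ?thesis by (metis (no_types, opaque_lifting) mult.commute nonzero_mult_divide_mult_cancel_left times_divide_eq_right)
    qed
    finally show ?thesis .
  qed
  have "\<forall>\<^sub>F n in sequentially. e n < \<delta> / 2" using order_tendstoD(2)[OF e(1), of "\<delta> / 2"] \<delta> by simp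
  with e(2) show "\<forall>\<^sub>F n in sequentially. dist (x n) 0 < \<delta>"
    by eventually_elim (use C in auto)
qed

lemma cdf_standardized:
  fixes f :: "'a \<Rightarrow> real"
  assumes s: "0 < s" and f: "f \<in> borel_measurable M"
  shows "cdf (distr M borel (\<lambda>x. (f x - m) / s)) ((q - m) / s) = measure M {x \<in> space M. f x \<le> q}"
proof -
  have "cdf (distr M borel (\<lambda>x. (f x - m) / s)) ((q - m) / s) = measure M ((\<lambda>x. (f x - m) / s) -` {..(q - m) / s} \<inter> space M)"
    unfolding cdf_def using f by (intro measure_distr) auto
  also have "(\<lambda>x. (f x - m) / s) -` {..(q - m) / s} \<inter> space M = {x \<in> space M. f x \<le> q}"
    using s by (auto simp: divide_le_cancel)
  finally show ?thesis .
qed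

lemma std_normal_no_atoms: "measure std_normal_distribution {x} = 0"
proof -
  have "emeasure std_normal_distribution {x} = 0"
    by (subst emeasure_density) (auto simp: nn_integral_indicator_singleton)
  then show ?thesis by (simp add: measure_def)
qed

text \<open>The points \<open>x n\<close> need not converge. Take \<open>z\<close> at which the
  normal distribution function has a value \<open>w\<close> strictly between \<open>v\<close> and
  \<open>p\<close>: there the laws \<open>G n\<close> are eventually below \<open>p\<close>, so
  \<open>z \<le> x n\<close> by monotonicity, and the laws \<open>M n\<close> are eventually above
  \<open>v\<close>.\<close>

lemma eventually_cdf_greater:
  assumes M: "weak_conv_m M std_normal_distribution" and G: "weak_conv_m G std_normal_distribution"
    and distM: "\<And>n. real_distribution (M n)" and distG: "\<And>n. real_distribution (G n)"
    and p: "p \<le> 1" "\<forall>\<^sub>F n in sequentially. p \<le> cdf (G n) (x n)" and v: "0 < v" "v < p"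
  shows "\<forall>\<^sub>F n in sequentially. v < cdf (M n) (x n)"
proof -
  interpret S: real_distribution std_normal_distribution
    by (simp add: real_distribution_def real_distribution_axioms_def prob_space_normal_density)
  let ?\<Phi> = "cdf std_normal_distribution"
  have cont: "isCont ?\<Phi> z" for z using S.isCont_cdf[of z] std_normal_no_atoms by simp
  define w where "w = (v + p) / 2"
  have w: "v < w" "w < p" "0 < w" "w < 1" using v p by (auto simp: w_def)
  obtain a where a: "?\<Phi> a < w"
    using order_tendstoD(2)[OF S.cdf_lim_at_bot w(3)] by (meson eventually_at_bot_linorder order_refl)
  obtain b where b: "w < ?\<Phi> b"
    using order_tendstoD(1)[OF S.cdf_lim_at_top_prob w(4)] by (meson eventually_at_top_linorder order_refl)
  have "a \<le> b"
  proof (rule ccontr)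
    assume "\<not> a \<le> b"
    then have "?\<Phi> b \<le> ?\<Phi> a" by (intro S.cdf_nondecreasing) simp
    then show False using a b by simp
  qed
  then obtain z where z: "?\<Phi> z = w"
    using IVT[of ?\<Phi> a w b] a b cont by (auto simp: less_imp_le)
  have Mz: "(\<lambda>n. cdf (M n) z) \<longlonglongrightarrow> w" and Gz: "(\<lambda>n. cdf (G n) z) \<longlonglongrightarrow> w"
    using M G cont[of z] z unfolding weak_conv_m_def weak_conv_def by auto
  have "\<forall>\<^sub>F n in sequentially. v < cdf (M n) z" by (rule order_tendstoD(1)[OF Mz w(1)])
  moreover have "\<forall>\<^sub>F n in sequentially. cdf (G n) z < p" by (rule order_tendstoD(2)[OF Gz w(2)])
  ultimately show ?thesis using p(2)
  proof eventually_elim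
    case (elim n)
    interpret Mn: real_distribution "M n" by (rule distM)
    interpret Gn: real_distribution "G n" by (rule distG)
    have "z \<le> x n"
    proof (rule ccontr)
      assume "\<not> z \<le> x n"
      then have "cdf (G n) (x n) \<le> cdf (G n) z" by (intro Gn.cdf_nondecreasing) simp
      then show False using elim by simp
    qed
    then have "cdf (M n) z \<le> cdf (M n) (x n)" by (rule Mn.cdf_nondecreasing)
    then show ?case using elim by simp
  qed
qed

theorem theorem4:
  fixes N Q H N0 :: "nat \<Rightarrow> nat"
    and Nq :: "nat \<Rightarrow> nat \<Rightarrow> nat"
    and Y :: "nat \<Rightarrow> nat \<Rightarrow> nat \<Rightarrow> real"
    and F :: "nat \<Rightarrow> real mat"
    and c_lo c_hi \<sigma>F c c' \<Delta> \<nu> S_lo :: real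
  assumes N_to_inf: "filterlim N at_top sequentially"
    and sizes_sum: "\<And>n. (\<Sum>q<Q n. Nq n q) = N n"
    and sizes_ge2: "\<And>n q. q < Q n \<Longrightarrow> Nq n q \<ge> 2"
    and near_unif_consts: "0 < c_lo" "c_lo \<le> c_hi"
    and near_unif_N0: "\<And>n. N0 n > 0"
    and near_unif: "\<And>n q. q < Q n \<Longrightarrow>
           c_lo * real (N0 n) \<le> real (Nq n q) \<and> real (Nq n q) \<le> c_hi * real (N0 n)"
    and F_dim: "\<And>n. F n \<in> carrier_mat (Q n) (H n)"
    and V_nonsing: "\<And>n. invertible_mat (Vgamma (N n) (Q n) (Nq n) (Y n) (F n))"
    and cond1: "\<sigma>F \<ge> 1"
       "\<And>n. loewner_le (transpose_mat (F n) * Dmat (N n) (Q n) (Nq n) (Y n) * F n)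
                        ((\<sigma>F\<^sup>2) \<cdot>\<^sub>m Vgamma (N n) (Q n) (Nq n) (Y n) (F n))"
    and cond2: "c > 0" "c' > 0"
       "\<And>n q h. q < Q n \<Longrightarrow> h < H n \<Longrightarrow> \<bar>F n $$ (q,h)\<bar> \<le> c / real (Q n)"
       "\<And>n k. eigenvalue (transpose_mat (F n) * F n) k \<Longrightarrow> k \<ge> c' / real (Q n)"
    and cond3: "\<And>n q. q < Q n \<Longrightarrow>
       (\<Sum>i<N n. (Y n i q - Ybar (N n) (Y n) q) ^ 4) / real (N n) \<le> \<Delta> ^ 4"
    and cond4: "S_lo > 0"
       "\<And>n i q. i < N n \<Longrightarrow> q < Q n \<Longrightarrow> \<bar>Y n i q - Ybar (N n) (Y n) q\<bar> \<le> \<nu>"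
       "\<And>n q. q < Q n \<Longrightarrow> Scov (N n) (Y n) q q \<ge> S_lo"
  shows
    "(\<forall>H0 Winf. (\<forall>n. H n = H0) \<longrightarrow> Winf \<in> carrier_mat H0 H0 \<longrightarrow>
        (\<forall>i<H0. \<forall>j<H0. (\<lambda>n. Wmat (N n) (Q n) (Nq n) (Y n) (F n) $$ (i,j)) \<longlonglongrightarrow> Winf $$ (i,j)) \<longrightarrow>
          weak_conv_m
             (\<lambda>n. distr (measure_pmf (CR (N n) (Q n) (Nq n))) borel (That (N n) (Q n) (Nq n) (Y n) (F n)))
             (gauss_quad_law H0 Winf)
        \<and> (\<forall>x. measure (gauss_quad_law H0 Winf) {x<..} \<le> measure (chisq H0) {x<..})
        \<and> (\<forall>\<alpha>. 0 < \<alpha> \<and> \<alpha> < 1 \<longrightarrow>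
             (\<exists>l. (\<lambda>n. measure_pmf.prob (CR (N n) (Q n) (Nq n))
                        {z. That (N n) (Q n) (Nq n) (Y n) (F n) z \<le> chisq_upper_quantile H0 \<alpha>}) \<longlonglongrightarrow> l
                  \<and> l \<ge> 1 - \<alpha>)))
   \<and> (filterlim H at_top sequentially \<longrightarrow>
        (\<lambda>n. real (H n) powr (19/4) / sqrt (real (N n))) \<longlonglongrightarrow> 0 \<longrightarrow>
          weak_conv_m
             (\<lambda>n. distr (measure_pmf (CR (N n) (Q n) (Nq n))) borel
                (\<lambda>z. (That (N n) (Q n) (Nq n) (Y n) (F n) z - mtrace (Wmat (N n) (Q n) (Nq n) (Y n) (F n)))
                     / sqrt (2 * mtrace (Wmat (N n) (Q n) (Nq n) (Y n) (F n) * Wmat (N n) (Q n) (Nq n) (Y n) (F n)))))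
             std_normal_distribution
        \<and> (\<forall>\<alpha>. 0 < \<alpha> \<and> \<alpha> < 1 \<longrightarrow>
             Liminf sequentially (\<lambda>n. ereal (measure_pmf.prob (CR (N n) (Q n) (Nq n))
                        {z. That (N n) (Q n) (Nq n) (Y n) (F n) z \<le> chisq_upper_quantile (H n) \<alpha>}))
               \<ge> ereal (1 - \<alpha>)))"
proof -
  \<comment> \<open>Same value as the constant of the locale, named outside it so that the estimates
    below visibly do not vary with \<open>n\<close>.\<close>
  define \<kappa> where "\<kappa> = c\<^sup>2 * \<sigma>F\<^sup>2 * c_hi\<^sup>2 * \<nu>\<^sup>2 / (c' * S_lo * c_lo\<^sup>2)"
  have \<kappa>: "0 \<le> \<kappa>" using cond2 cond4(1) by (simp add: \<kappa>_def)
  define T where "T n = That (N n) (Q n) (Nq n) (Y n) (F n)" for n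
  define P where "P n = CR (N n) (Q n) (Nq n)" for n
  define W where "W n = Wmat (N n) (Q n) (Nq n) (Y n) (F n)" for n
  define m where "m n = mtrace (W n)" for n
  define s where "s n = sqrt (2 * mtrace (W n * W n))" for n
  define L where "L n = distr (measure_pmf (P n)) borel (T n)" for n
  define Ls where "Ls n = distr (measure_pmf (P n)) borel (\<lambda>z. (T n z - m n) / s n)" for n
  define Gs where "Gs n = distr (gauss_quad_law (H n) (W n)) borel (\<lambda>x. (x - m n) / s n)" for n
  define K where "K h b = 256 * sqrt \<kappa> ^ 3 * h ^ 3 * (4 + 2 * h\<^sup>2 + 64 * \<kappa> * h\<^sup>2) / sqrt b" for h b :: real
  have real_distr_P: "real_distribution (distr (measure_pmf (P n)) borel f)" for n f
    by (rule prob_space.real_distribution_distr[OF prob_space_measure_pmf]) simp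
  have real_distr_G: "real_distribution (gauss_quad_law h w)" for h w
    by (rule gauss_space.real_distribution_gauss)
  have real_distr_Gs: "real_distribution (Gs n)" for n
  proof -
    interpret real_distribution "gauss_quad_law (H n) (W n)" by (rule real_distr_G)
    show ?thesis unfolding Gs_def by (rule real_distribution_distr) simp
  qed
  \<comment> \<open>The diagonalizing data depend on \<open>n\<close> and are obtained anew inside
    each estimate; only bounds in \<open>H n\<close>, \<open>N n\<close> and the constants leave
    it.\<close>
  define diag where "diag n = (\<lambda>\<beta> B l. diagonalized_design (N n) (Q n) (Nq n) (H n) (N0 n) (Y n) (F n) c_lo c_hi \<sigma>F c c' \<nu> S_lo \<beta> B l)" for n
  have ex: "\<exists>\<beta> B l. diag n \<beta> B l" if N: "2 \<le> N n" for n
  proof -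
    interpret design "N n" "Q n" "Nq n" "H n" "N0 n" "Y n" "F n" c_lo c_hi \<sigma>F c c' \<nu> S_lo
      by unfold_locales
        (use N sizes_sum sizes_ge2 near_unif_consts near_unif_N0 near_unif F_dim cond1 cond2 cond4 in auto)
    show ?thesis unfolding diag_def by (rule diagonalized_design_exists)
  qed
  \<comment> \<open>An \<open>n\<close> without treatment levels has \<open>N n = 0\<close>; since
    \<open>N n\<close> tends to infinity, such \<open>n\<close> are eventually excluded.\<close>
  have N_ge: "\<forall>\<^sub>F n in sequentially. 2 \<le> N n"
    using N_to_inf by (simp add: filterlim_at_top)
  have N_real: "filterlim (\<lambda>n. real (N n)) at_top sequentially"
    by (rule filterlim_compose[OF filterlim_real_sequentially N_to_inf])
  have invN: "(\<lambda>n. 1 / real (N n)) \<longlonglongrightarrow> 0"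
    by (rule tendsto_divide_0[OF tendsto_const filterlim_at_top_imp_at_infinity[OF N_real]])
  have invsN: "(\<lambda>n. 1 / sqrt (real (N n))) \<longlonglongrightarrow> 0"
    by (rule tendsto_divide_0[OF tendsto_const filterlim_at_top_imp_at_infinity[OF filterlim_compose[OF sqrt_at_top N_real]]])

  have close: "cmod (char (L n) t - char (gauss_quad_law (H n) (W n)) t)
      \<le> 2 * \<bar>t\<bar> * \<epsilon> * real (H n) + 128 * \<kappa>\<^sup>2 * (real (H n)) ^ 4 / (real (N n) * \<epsilon>\<^sup>2)
        + sqrt (4 * real (H n) * (K (real (H n)) (real (N n)) * (\<bar>t\<bar> + t\<^sup>2)) * (1 + 2 * \<bar>t\<bar>) ^ H n * \<bar>t\<bar>)"
    if N: "2 \<le> N n" and st: "4 * sqrt \<kappa> * real (H n) / sqrt (real (N n)) \<le> 1" and \<epsilon>: "0 < \<epsilon>" "\<epsilon> \<le> 1 / 2" for n \<epsilon> t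
  proof -
    obtain \<beta> B l where "diag n \<beta> B l" using ex[OF N] by blast
    then interpret D: diagonalized_design "N n" "Q n" "Nq n" "H n" "N0 n" "Y n" "F n" c_lo c_hi \<sigma>F c c' \<nu> S_lo \<beta> B l
      unfolding diag_def .
    have k: "D.\<kappa> = \<kappa>" by (simp add: D.\<kappa>_def \<kappa>_def)
    have "D.L.step \<le> 1" unfolding D.step_eq k by (rule st)
    from D.char_T_close_gauss[OF this \<epsilon>, of t] show ?thesis
      unfolding D.K_eq k L_def T_def P_def W_def K_def .
  qed
  have standardized: "cmod (char (Ls n) t - of_real (exp (- (t\<^sup>2) / 2)))
      \<le> 2 * \<bar>t\<bar> * \<sigma>F\<^sup>2 * \<eta> + (128 * \<kappa>\<^sup>2 * (real (H n)) ^ 5 / (real (N n) * \<eta>\<^sup>2)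
        + \<bar>t\<bar> * (4 * t\<^sup>2 * \<sigma>F ^ 6 / sqrt (real (H n))
          + (1 + 2 * \<bar>t\<bar> * \<sigma>F\<^sup>2) * (\<bar>t\<bar> + t\<^sup>2 * \<sigma>F\<^sup>2) * \<sigma>F ^ 4 * (K (real (H n)) (real (N n)) / real (H n))))"
    and gauss_standardized: "cmod (char (Gs n) t - of_real (exp (- (t\<^sup>2) / 2))) \<le> \<bar>t\<bar> * (4 * t\<^sup>2 * \<sigma>F ^ 6 / sqrt (real (H n)))"
    and quantile: "\<And>\<alpha>. 0 < \<alpha> \<Longrightarrow> \<alpha> < 1 \<Longrightarrow> 1 - \<alpha> \<le> cdf (Gs n) ((chisq_upper_quantile (H n) \<alpha> - m n) / s n)"
    and s_pos: "0 < s n"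
    if N: "2 \<le> N n" and H: "0 < H n" and st: "4 * sqrt \<kappa> * real (H n) / sqrt (real (N n)) \<le> 1" and \<eta>: "0 < \<eta>" "\<eta> \<le> 1 / 2" for n \<eta> t
  proof -
    obtain \<beta> B l where "diag n \<beta> B l" using ex[OF N] by blast
    then interpret D: diagonalized_design "N n" "Q n" "Nq n" "H n" "N0 n" "Y n" "F n" c_lo c_hi \<sigma>F c c' \<nu> S_lo \<beta> B l
      unfolding diag_def .
    have k: "D.\<kappa> = \<kappa>" by (simp add: D.\<kappa>_def \<kappa>_def)
    have K: "D.K = K (real (H n)) (real (N n))" unfolding D.K_eq k K_def ..
    have ms: "D.m = m n" "D.s = s n" by (simp_all add: D.m_def D.s_def m_def s_def W_def)
    show sp: "0 < s n" using D.s_pos[OF H] by (simp add: ms)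
    have step: "D.L.step \<le> 1" unfolding D.step_eq k by (rule st)
    have h: "1 \<le> sqrt (real (H n))" "0 < sqrt (real (H n))" using H by auto
    \<comment> \<open>A relative error \<open>\<epsilon>\<close> of a quantity with mean of order
      \<open>H\<close>, divided by a spread of order \<open>sqrt H\<close>, amounts to
      \<open>\<epsilon> * sqrt H\<close>; hence the scaling of the threshold.\<close>
    define \<epsilon> where "\<epsilon> = \<eta> / sqrt (real (H n))"
    have \<epsilon>: "0 < \<epsilon>" "\<epsilon> \<le> 1 / 2"
    proof -
      show "0 < \<epsilon>" using \<eta> h by (simp add: \<epsilon>_def)
      have "\<epsilon> \<le> \<eta> / 1" unfolding \<epsilon>_def using h \<eta> by (intro divide_left_mono) auto
      then show "\<epsilon> \<le> 1 / 2" using \<eta> by simp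
    qed
    have e1: "2 * \<bar>t\<bar> / s n * \<epsilon> * real (H n) \<le> 2 * \<bar>t\<bar> * \<sigma>F\<^sup>2 * \<eta>"
    proof -
      have "\<epsilon> * real (H n) = \<eta> * sqrt (real (H n))"
        unfolding \<epsilon>_def using h by (simp add: field_simps)
      then have "2 * \<bar>t\<bar> / s n * \<epsilon> * real (H n) = 2 * \<bar>t\<bar> * \<eta> * (sqrt (real (H n)) / s n)" by simp
      also have "\<dots> \<le> 2 * \<bar>t\<bar> * \<eta> * \<sigma>F\<^sup>2"
        using D.s_lower \<eta> sp unfolding ms by (intro mult_left_mono) (auto simp: divide_le_eq)
      finally show ?thesis by (simp add: ac_simps)
    qed
    have e2: "128 * \<kappa>\<^sup>2 * (real (H n)) ^ 4 / (real (N n) * \<epsilon>\<^sup>2) = 128 * \<kappa>\<^sup>2 * (real (H n)) ^ 5 / (real (N n) * \<eta>\<^sup>2)"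
      unfolding \<epsilon>_def using H by (simp add: power_divide numeral_eq_Suc)
    have e3: "D.clt_error k' t \<le> \<bar>t\<bar> * (4 * t\<^sup>2 * \<sigma>F ^ 6 / sqrt (real (H n)) + (1 + 2 * \<bar>t\<bar> * \<sigma>F\<^sup>2) * (\<bar>t\<bar> + t\<^sup>2 * \<sigma>F\<^sup>2) * \<sigma>F ^ 4 * (k' / real (H n)))"
      if "0 \<le> k'" for k'
      by (rule D.clt_error_le[OF H that])
    have K0: "0 \<le> K (real (H n)) (real (N n))" using \<kappa> by (simp add: K_def)
    show "cmod (char (Ls n) t - of_real (exp (- (t\<^sup>2) / 2)))
      \<le> 2 * \<bar>t\<bar> * \<sigma>F\<^sup>2 * \<eta> + (128 * \<kappa>\<^sup>2 * (real (H n)) ^ 5 / (real (N n) * \<eta>\<^sup>2)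
        + \<bar>t\<bar> * (4 * t\<^sup>2 * \<sigma>F ^ 6 / sqrt (real (H n))
          + (1 + 2 * \<bar>t\<bar> * \<sigma>F\<^sup>2) * (\<bar>t\<bar> + t\<^sup>2 * \<sigma>F\<^sup>2) * \<sigma>F ^ 4 * (K (real (H n)) (real (N n)) / real (H n))))"
      using D.char_T_standardized[OF step \<epsilon> H, of t] e1 e3[OF K0]
      unfolding K k ms e2 Ls_def T_def P_def by linarith
    show "cmod (char (Gs n) t - of_real (exp (- (t\<^sup>2) / 2))) \<le> \<bar>t\<bar> * (4 * t\<^sup>2 * \<sigma>F ^ 6 / sqrt (real (H n)))"
      using D.char_gauss_standardized[OF H, of t] e3[of 0] unfolding ms Gs_def W_def by simp
    show "1 - \<alpha> \<le> cdf (Gs n) ((chisq_upper_quantile (H n) \<alpha> - m n) / s n)" if "0 < \<alpha>" "\<alpha> < 1" for \<alpha>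
    proof -
      interpret Gl: real_distribution "gauss_quad_law (H n) (W n)" by (rule real_distr_G)
      have "cdf (Gs n) ((chisq_upper_quantile (H n) \<alpha> - m n) / s n) = measure (gauss_quad_law (H n) (W n)) {x \<in> space (gauss_quad_law (H n) (W n)). x \<le> chisq_upper_quantile (H n) \<alpha>}"
        unfolding Gs_def by (rule cdf_standardized[OF sp]) simp
      also have "\<dots> = cdf (gauss_quad_law (H n) (W n)) (chisq_upper_quantile (H n) \<alpha>)"
        by (simp add: cdf_def atMost_def)
      finally show ?thesis using D.gauss_cdf_at_quantile[OF that] unfolding W_def by simp
    qed
  qed

  \<comment> \<open>The laws of the forms of \<open>W n\<close> are an intermediate: the
    randomization law is close to them, and they converge because \<open>W n\<close> does.\<close>
  have fixed: "weak_conv_m L (gauss_quad_law H0 Winf)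
        \<and> (\<forall>x. measure (gauss_quad_law H0 Winf) {x<..} \<le> measure (chisq H0) {x<..})
        \<and> (\<forall>\<alpha>. 0 < \<alpha> \<and> \<alpha> < 1 \<longrightarrow> (\<exists>l. (\<lambda>n. measure_pmf.prob (P n) {z. T n z \<le> chisq_upper_quantile H0 \<alpha>}) \<longlonglongrightarrow> l \<and> l \<ge> 1 - \<alpha>))"
    if H0: "\<And>n. H n = H0" and conv: "\<And>i j. i < H0 \<Longrightarrow> j < H0 \<Longrightarrow> (\<lambda>n. W n $$ (i,j)) \<longlonglongrightarrow> Winf $$ (i,j)" for H0 Winf
  proof -
    interpret G: gauss_space H0 .
    have form_conv: "(\<lambda>n. form H0 (W n) \<xi> \<xi>) \<longlonglongrightarrow> form H0 Winf \<xi> \<xi>" for \<xi>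
      unfolding form_def by (intro tendsto_sum tendsto_mult tendsto_const conv) auto
    have form_le: "form H0 Winf \<xi> \<xi> \<le> (\<Sum>i<H0. (\<xi> i)\<^sup>2)" for \<xi>
    proof (rule tendsto_upperbound[OF form_conv])
      show "\<forall>\<^sub>F n in sequentially. form H0 (W n) \<xi> \<xi> \<le> (\<Sum>i<H0. (\<xi> i)\<^sup>2)"
        using N_ge
      proof eventually_elim
        case (elim n)
        obtain \<beta> B l where "diag n \<beta> B l" using ex[OF elim] by blast
        then interpret D: diagonalized_design "N n" "Q n" "Nq n" "H n" "N0 n" "Y n" "F n" c_lo c_hi \<sigma>F c c' \<nu> S_lo \<beta> B l
          unfolding diag_def .
        show ?case using D.form_W_le[of \<xi>] unfolding H0 W_def .
      qed
    qed simp
    have st: "\<forall>\<^sub>F n in sequentially. 4 * sqrt \<kappa> * real (H n) / sqrt (real (N n)) \<le> 1"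
    proof -
      have "(\<lambda>n. 4 * sqrt \<kappa> * real H0 * (1 / sqrt (real (N n)))) \<longlonglongrightarrow> 0"
        by (rule tendsto_mult_right_zero[OF invsN])
      then have "\<forall>\<^sub>F n in sequentially. 4 * sqrt \<kappa> * real H0 * (1 / sqrt (real (N n))) < 1"
        by (rule order_tendstoD(2)) simp
      then show ?thesis by eventually_elim (simp add: H0)
    qed
    have char_conv: "(\<lambda>n. char (L n) t) \<longlonglongrightarrow> char (gauss_quad_law H0 Winf) t" for t
    proof -
      have "(\<lambda>n. char (L n) t - char (gauss_quad_law H0 (W n)) t) \<longlonglongrightarrow> 0"
      proof (rule tendsto_zero_two_scale[where C = "2 * \<bar>t\<bar> * real H0"])
        fix \<epsilon> :: real assume \<epsilon>: "0 < \<epsilon>" "\<epsilon> \<le> 1 / 2"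
        define k0 where "k0 = 256 * sqrt \<kappa> ^ 3 * (real H0) ^ 3 * (4 + 2 * (real H0)\<^sup>2 + 64 * \<kappa> * (real H0)\<^sup>2)"
        define a1 a2 where "a1 = 128 * \<kappa>\<^sup>2 * (real H0) ^ 4 / \<epsilon>\<^sup>2"
          and "a2 = 4 * real H0 * (k0 * (\<bar>t\<bar> + t\<^sup>2)) * (1 + 2 * \<bar>t\<bar>) ^ H0 * \<bar>t\<bar>"
        define e where "e n = a1 * (1 / real (N n)) + sqrt (a2 * (1 / sqrt (real (N n))))" for n
        have "(\<lambda>n. sqrt (a2 * (1 / sqrt (real (N n))))) \<longlonglongrightarrow> sqrt 0"
          by (intro tendsto_real_sqrt tendsto_mult_right_zero invsN)
        then have "e \<longlonglongrightarrow> 0"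
          unfolding e_def[abs_def] by (intro tendsto_add_zero tendsto_mult_right_zero invN) simp
        moreover have "\<forall>\<^sub>F n in sequentially. norm (char (L n) t - char (gauss_quad_law H0 (W n)) t) \<le> 2 * \<bar>t\<bar> * real H0 * \<epsilon> + e n"
          using N_ge st
        proof eventually_elim
          case (elim n)
          have x1: "128 * \<kappa>\<^sup>2 * (real H0) ^ 4 / (real (N n) * \<epsilon>\<^sup>2) = a1 * (1 / real (N n))" by (simp add: a1_def)
          have x2: "4 * real H0 * (K (real H0) (real (N n)) * (\<bar>t\<bar> + t\<^sup>2)) * (1 + 2 * \<bar>t\<bar>) ^ H0 * \<bar>t\<bar> = a2 * (1 / sqrt (real (N n)))"
            by (simp add: a2_def K_def k0_def)
          show ?case using close[OF elim \<epsilon>, of t] unfolding H0 x1 x2 e_def by (simp add: ac_simps)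
        qed
        ultimately show "\<exists>e. e \<longlonglongrightarrow> 0 \<and> (\<forall>\<^sub>F n in sequentially. norm (char (L n) t - char (gauss_quad_law H0 (W n)) t) \<le> 2 * \<bar>t\<bar> * real H0 * \<epsilon> + e n)"
          by blast
      qed
      \<comment> \<open>All these laws live on one Gaussian space, so entrywise convergence of
        \<open>W n\<close> gives pointwise convergence of the forms, and dominated convergence
        applies.\<close>
      moreover have "(\<lambda>n. char (gauss_quad_law H0 (W n)) t) \<longlonglongrightarrow> char (gauss_quad_law H0 Winf) t"
        unfolding G.char_gauss
      proof (rule integral_dominated_convergence[where w = "\<lambda>_. 1"])
        show "AE \<xi> in G.G. (\<lambda>n. iexp (t * form H0 (W n) \<xi> \<xi>)) \<longlonglongrightarrow> iexp (t * form H0 Winf \<xi> \<xi>)"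
          by (intro AE_I2 tendsto_intros form_conv)
        show "AE \<xi> in G.G. norm (iexp (t * form H0 (W n) \<xi> \<xi>)) \<le> 1" for n
          by (rule AE_I2) (simp only: norm_exp_i_times order_refl)
      qed auto
      ultimately have "(\<lambda>n. (char (L n) t - char (gauss_quad_law H0 (W n)) t) + char (gauss_quad_law H0 (W n)) t) \<longlonglongrightarrow> 0 + char (gauss_quad_law H0 Winf) t"
        by (rule tendsto_add)
      then show ?thesis by simp
    qed
    have weak: "weak_conv_m L (gauss_quad_law H0 Winf)"
      by (rule levy_continuity[OF _ real_distr_G char_conv]) (simp add: L_def real_distr_P)
    have dom: "measure (gauss_quad_law H0 Winf) {x<..} \<le> measure (chisq H0) {x<..}" for x
      by (rule G.gauss_tail_le[OF form_le])
    have "\<exists>l. (\<lambda>n. measure_pmf.prob (P n) {z. T n z \<le> chisq_upper_quantile H0 \<alpha>}) \<longlonglongrightarrow> l \<and> l \<ge> 1 - \<alpha>"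
      if \<alpha>: "0 < \<alpha>" "\<alpha> < 1" for \<alpha>
    \<comment> \<open>For \<open>H0 = 0\<close> the limit law has an atom at the quantile, so weak
      convergence does not yield the probabilities and they are computed directly.\<close>
    proof (cases "H0 = 0")
      case True
      have "\<forall>\<^sub>F n in sequentially. measure_pmf.prob (P n) {z. T n z \<le> chisq_upper_quantile H0 \<alpha>} = 1"
        using N_ge
      proof eventually_elim
        case (elim n)
        obtain \<beta> B l where "diag n \<beta> B l" using ex[OF elim] by blast
        then interpret D: diagonalized_design "N n" "Q n" "Nq n" "H n" "N0 n" "Y n" "F n" c_lo c_hi \<sigma>F c c' \<nu> S_lo \<beta> B l
          unfolding diag_def .
        have "T n z \<le> chisq_upper_quantile H0 \<alpha>" if "z \<in> set_pmf (P n)" for z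
        proof -
          have "z \<in> D.\<Omega>" using that by (simp add: P_def CR_def)
          then have "T n z = 0" unfolding T_def by (rule D.That_zero[OF trans[OF H0 True]])
          then show ?thesis using G.chisq_quantile(1)[OF \<alpha>] by simp
        qed
        then show ?case by (intro measure_pmf.prob_eq_1[THEN iffD2]) (auto intro!: AE_pmfI)
      qed
      then have "(\<lambda>n. measure_pmf.prob (P n) {z. T n z \<le> chisq_upper_quantile H0 \<alpha>}) \<longlonglongrightarrow> 1"
        by (rule tendsto_eventually)
      then show ?thesis using \<alpha> by (intro exI[of _ 1]) auto
    next
      case False
      then have H0p: "0 < H0" by simp
      let ?q = "chisq_upper_quantile H0 \<alpha>"
      interpret C: real_distribution "chisq H0" by (rule G.real_distribution_chisq)
      interpret Gl: real_distribution "gauss_quad_law H0 Winf" by (rule real_distr_G)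
      have "1 \<le> \<sigma>F\<^sup>2 * Winf $$ (0,0)"
      proof (rule tendsto_lowerbound[OF tendsto_mult_left[OF conv[OF H0p H0p]]])
        show "\<forall>\<^sub>F n in sequentially. 1 \<le> \<sigma>F\<^sup>2 * W n $$ (0,0)"
          using N_ge
        proof eventually_elim
          case (elim n)
          obtain \<beta> B l where "diag n \<beta> B l" using ex[OF elim] by blast
          then interpret D: diagonalized_design "N n" "Q n" "Nq n" "H n" "N0 n" "Y n" "F n" c_lo c_hi \<sigma>F c c' \<nu> S_lo \<beta> B l
            unfolding diag_def .
          show ?case using D.W00 H0p unfolding H0 W_def by simp
        qed
      qed simp
      then have W00: "Winf $$ (0,0) \<noteq> 0" by auto
      \<comment> \<open>Continuity at the quantile turns weak convergence into convergence of the
        coverage probability, so that the limit exists.\<close>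
      have "isCont (cdf (gauss_quad_law H0 Winf)) ?q"
        unfolding Gl.isCont_cdf by (rule G.gauss_no_atoms[OF H0p W00])
      then have "(\<lambda>n. cdf (L n) ?q) \<longlonglongrightarrow> cdf (gauss_quad_law H0 Winf) ?q"
        using weak unfolding weak_conv_m_def weak_conv_def by blast
      moreover have "cdf (L n) ?q = measure_pmf.prob (P n) {z. T n z \<le> ?q}" for n
        unfolding L_def cdf_def by (subst measure_distr) (auto simp: vimage_def)
      moreover have "1 - \<alpha> \<le> cdf (gauss_quad_law H0 Winf) ?q"
        using dom[of ?q] G.chisq_quantile(2)[OF \<alpha>] unfolding C.tail_eq Gl.tail_eq by simp
      ultimately show ?thesis by auto
    qed
    then show ?thesis using weak dom by blast
  qed

  \<comment> \<open>Both the randomization law and the law of the Gaussian form are standardized,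
    because the bound at the chi-square quantile is first known for the latter only.\<close>
  have growing: "weak_conv_m Ls std_normal_distribution
      \<and> (\<forall>\<alpha>. 0 < \<alpha> \<and> \<alpha> < 1 \<longrightarrow>
           Liminf sequentially (\<lambda>n. ereal (measure_pmf.prob (P n) {z. T n z \<le> chisq_upper_quantile (H n) \<alpha>})) \<ge> ereal (1 - \<alpha>))"
    if H_inf: "filterlim H at_top sequentially" and rate: "(\<lambda>n. real (H n) powr (19/4) / sqrt (real (N n))) \<longlonglongrightarrow> 0"
  proof -
    define r where "r n = real (H n) powr (19/4) / sqrt (real (N n))" for n
    have r: "r \<longlonglongrightarrow> 0" using rate unfolding r_def .
    have H_ge: "\<forall>\<^sub>F n in sequentially. 0 < H n"
    proof -
      have "\<forall>\<^sub>F n in sequentially. 1 \<le> H n" using H_inf unfolding filterlim_at_top by blast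
      then show ?thesis by eventually_elim simp
    qed
    have H_real: "filterlim (\<lambda>n. real (H n)) at_top sequentially"
      by (rule filterlim_compose[OF filterlim_real_sequentially H_inf])
    have invsH: "(\<lambda>n. 1 / sqrt (real (H n))) \<longlonglongrightarrow> 0"
      by (rule tendsto_divide_0[OF tendsto_const filterlim_at_top_imp_at_infinity[OF filterlim_compose[OF sqrt_at_top H_real]]])
    \<comment> \<open>Reduces the errors that involve \<open>N n\<close> to the assumed rate:
      \<open>j = 1\<close> for the size of a jump, \<open>j = 4\<close> for the Stein error and,
      squared, for the error of \<open>Vhat\<close>.\<close>
    have pow_le: "real (H n) ^ j / sqrt (real (N n)) \<le> r n" if "0 < H n" "j \<le> 4" for n j
    proof -
      have "real (H n) ^ j \<le> real (H n) ^ 4" using that by (intro power_increasing) auto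
      also have "\<dots> = real (H n) powr 4" using that by simp
      also have "\<dots> \<le> real (H n) powr (19/4)" using that by (intro powr_mono) auto
      finally show ?thesis unfolding r_def by (intro divide_right_mono) auto
    qed
    have st: "\<forall>\<^sub>F n in sequentially. 4 * sqrt \<kappa> * real (H n) / sqrt (real (N n)) \<le> 1"
    proof -
      have "(\<lambda>n. 4 * sqrt \<kappa> * r n) \<longlonglongrightarrow> 0" by (rule tendsto_mult_right_zero[OF r])
      then have "\<forall>\<^sub>F n in sequentially. 4 * sqrt \<kappa> * r n < 1" by (rule order_tendstoD(2)) simp
      then show ?thesis using H_ge
      proof eventually_elim
        case (elim n)
        have "4 * sqrt \<kappa> * (real (H n) ^ 1 / sqrt (real (N n))) \<le> 4 * sqrt \<kappa> * r n"
          using pow_le[OF elim(2), of 1] \<kappa> by (intro mult_left_mono) auto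
        then show ?case using elim by simp
      qed
    qed
    have Ls_char: "(\<lambda>n. char (Ls n) t) \<longlonglongrightarrow> char std_normal_distribution t" for t
    proof -
      define c1 where "c1 = (1 + 2 * \<bar>t\<bar> * \<sigma>F\<^sup>2) * (\<bar>t\<bar> + t\<^sup>2 * \<sigma>F\<^sup>2) * \<sigma>F ^ 4"
      define c2 where "c2 = 256 * sqrt \<kappa> ^ 3 * (6 + 64 * \<kappa>)"
      have c: "0 \<le> c1" "0 \<le> c2" using \<kappa> by (auto simp: c1_def c2_def)
      have "(\<lambda>n. char (Ls n) t - of_real (exp (- (t\<^sup>2) / 2))) \<longlonglongrightarrow> 0"
      proof (rule tendsto_zero_two_scale[where C = "2 * \<bar>t\<bar> * \<sigma>F\<^sup>2"])
        fix \<eta> :: real assume \<eta>: "0 < \<eta>" "\<eta> \<le> 1 / 2"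
        define e where "e n = 128 * \<kappa>\<^sup>2 / \<eta>\<^sup>2 * (r n)\<^sup>2 + \<bar>t\<bar> * (4 * t\<^sup>2 * \<sigma>F ^ 6 * (1 / sqrt (real (H n))) + c1 * (c2 * r n))" for n
        have "(\<lambda>n. (r n)\<^sup>2) \<longlonglongrightarrow> 0" using tendsto_power[OF r, of 2] by simp
        then have "e \<longlonglongrightarrow> 0"
          unfolding e_def[abs_def] by (intro tendsto_add_zero tendsto_mult_right_zero invsH r)
        moreover have "\<forall>\<^sub>F n in sequentially. norm (char (Ls n) t - of_real (exp (- (t\<^sup>2) / 2))) \<le> 2 * \<bar>t\<bar> * \<sigma>F\<^sup>2 * \<eta> + e n"
          using N_ge H_ge st
        proof eventually_elim
          case (elim n)
          let ?h = "real (H n)"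
          have h: "1 \<le> ?h" using elim(2) by simp
          have x1: "128 * \<kappa>\<^sup>2 * ?h ^ 5 / (real (N n) * \<eta>\<^sup>2) \<le> 128 * \<kappa>\<^sup>2 / \<eta>\<^sup>2 * (r n)\<^sup>2"
          proof -
            have "?h ^ 5 \<le> ?h ^ 8" using h by (intro power_increasing) auto
            then have "?h ^ 5 / real (N n) \<le> ?h ^ 8 / real (N n)" by (intro divide_right_mono) auto
            also have "\<dots> = (?h ^ 4 / sqrt (real (N n)))\<^sup>2" by (simp add: power_divide power_mult[symmetric])
            also have "\<dots> \<le> (r n)\<^sup>2" using pow_le[OF elim(2), of 4] by (intro power_mono) auto
            finally have "128 * \<kappa>\<^sup>2 / \<eta>\<^sup>2 * (?h ^ 5 / real (N n)) \<le> 128 * \<kappa>\<^sup>2 / \<eta>\<^sup>2 * (r n)\<^sup>2" by (intro mult_left_mono) auto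
            then show ?thesis by (simp add: ac_simps)
          qed
          have x2: "K ?h (real (N n)) / ?h \<le> c2 * r n"
          proof -
            have h2: "1 \<le> ?h\<^sup>2" using h by (simp add: one_le_power)
            have "4 + 2 * ?h\<^sup>2 + 64 * \<kappa> * ?h\<^sup>2 \<le> (6 + 64 * \<kappa>) * ?h\<^sup>2" using h2 by (simp add: algebra_simps)
            then have "256 * sqrt \<kappa> ^ 3 * ?h\<^sup>2 * (4 + 2 * ?h\<^sup>2 + 64 * \<kappa> * ?h\<^sup>2) \<le> 256 * sqrt \<kappa> ^ 3 * ?h\<^sup>2 * ((6 + 64 * \<kappa>) * ?h\<^sup>2)"
              using \<kappa> by (intro mult_left_mono) auto
            also have "\<dots> = c2 * (?h\<^sup>2 * ?h\<^sup>2)" by (simp add: c2_def)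
            also have "?h\<^sup>2 * ?h\<^sup>2 = ?h ^ 4" by (simp flip: power_add)
            finally have "256 * sqrt \<kappa> ^ 3 * ?h\<^sup>2 * (4 + 2 * ?h\<^sup>2 + 64 * \<kappa> * ?h\<^sup>2) / sqrt (real (N n)) \<le> c2 * ?h ^ 4 / sqrt (real (N n))"
              by (intro divide_right_mono) auto
            moreover have "K ?h (real (N n)) / ?h = 256 * sqrt \<kappa> ^ 3 * ?h\<^sup>2 * (4 + 2 * ?h\<^sup>2 + 64 * \<kappa> * ?h\<^sup>2) / sqrt (real (N n))"
              unfolding K_def using h by (simp add: power3_eq_cube power2_eq_square)
            moreover have "c2 * (?h ^ 4 / sqrt (real (N n))) \<le> c2 * r n" using pow_le[OF elim(2), of 4] c by (intro mult_left_mono) auto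
            ultimately show ?thesis by simp
          qed
          have x3: "\<bar>t\<bar> * (4 * t\<^sup>2 * \<sigma>F ^ 6 / sqrt ?h + c1 * (K ?h (real (N n)) / ?h)) \<le> \<bar>t\<bar> * (4 * t\<^sup>2 * \<sigma>F ^ 6 * (1 / sqrt ?h) + c1 * (c2 * r n))"
            using x2 c by (intro mult_left_mono add_mono) auto
          show ?case using standardized[OF elim(1,2,3) \<eta>, of t] x1 x3 unfolding c1_def[symmetric] e_def by linarith
        qed
        ultimately show "\<exists>e. e \<longlonglongrightarrow> 0 \<and> (\<forall>\<^sub>F n in sequentially. norm (char (Ls n) t - of_real (exp (- (t\<^sup>2) / 2))) \<le> 2 * \<bar>t\<bar> * \<sigma>F\<^sup>2 * \<eta> + e n)"
          by blast
      qed
      then show ?thesis unfolding char_std_normal_distribution by (simp add: LIM_zero_iff)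
    qed
    have Gs_char: "(\<lambda>n. char (Gs n) t) \<longlonglongrightarrow> char std_normal_distribution t" for t
    proof -
      have "(\<lambda>n. char (Gs n) t - of_real (exp (- (t\<^sup>2) / 2))) \<longlonglongrightarrow> 0"
      proof (rule Lim_null_comparison)
        show "\<forall>\<^sub>F n in sequentially. norm (char (Gs n) t - of_real (exp (- (t\<^sup>2) / 2))) \<le> \<bar>t\<bar> * (4 * t\<^sup>2 * \<sigma>F ^ 6 * (1 / sqrt (real (H n))))"
          using N_ge H_ge st
        proof eventually_elim
          case (elim n)
          show ?case using gauss_standardized[OF elim(1,2,3), of "1/2" t] by simp
        qed
        show "(\<lambda>n. \<bar>t\<bar> * (4 * t\<^sup>2 * \<sigma>F ^ 6 * (1 / sqrt (real (H n))))) \<longlonglongrightarrow> 0"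
          by (intro tendsto_mult_right_zero invsH)
      qed
      then show ?thesis unfolding char_std_normal_distribution by (simp add: LIM_zero_iff)
    qed
    have real_distr_std: "real_distribution std_normal_distribution"
      by (simp add: real_distribution_def real_distribution_axioms_def prob_space_normal_density)
    have wL: "weak_conv_m Ls std_normal_distribution"
      by (rule levy_continuity[OF _ real_distr_std Ls_char]) (simp add: Ls_def real_distr_P)
    have wG: "weak_conv_m Gs std_normal_distribution"
      by (rule levy_continuity[OF real_distr_Gs real_distr_std Gs_char])
    have "Liminf sequentially (\<lambda>n. ereal (measure_pmf.prob (P n) {z. T n z \<le> chisq_upper_quantile (H n) \<alpha>})) \<ge> ereal (1 - \<alpha>)"
      if \<alpha>: "0 < \<alpha>" "\<alpha> < 1" for \<alpha>
    proof -
      define x where "x n = (chisq_upper_quantile (H n) \<alpha> - m n) / s n" for n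
      have cdfL: "\<forall>\<^sub>F n in sequentially. cdf (Ls n) (x n) = measure_pmf.prob (P n) {z. T n z \<le> chisq_upper_quantile (H n) \<alpha>}"
        using N_ge H_ge st
      proof eventually_elim
        case (elim n)
        have "0 < s n" by (rule s_pos[OF elim(1,2,3), of "1/2"]) auto
        from cdf_standardized[OF this, of "T n" "measure_pmf (P n)" "m n" "chisq_upper_quantile (H n) \<alpha>"]
        show ?case unfolding Ls_def x_def by simp
      qed
      have cdfG: "\<forall>\<^sub>F n in sequentially. 1 - \<alpha> \<le> cdf (Gs n) (x n)"
        using N_ge H_ge st
      proof eventually_elim
        case (elim n)
        show ?case unfolding x_def by (rule quantile[OF elim(1,2,3), of "1/2"]) (use \<alpha> in auto)
      qed
      show ?thesis
        unfolding le_Liminf_iff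
      proof (intro allI impI)
        fix y :: ereal assume y: "y < ereal (1 - \<alpha>)"
        \<comment> \<open>\<open>y\<close> may be negative or minus infinity, whereas
          \<open>eventually_cdf_greater\<close> asks for a positive level: \<open>w\<close> is a
          real upper bound of \<open>y\<close>, cut off at zero, and \<open>v\<close> lies strictly
          between \<open>w\<close> and \<open>1 - \<alpha>\<close>.\<close>
        define w where "w = max 0 (real_of_ereal y)"
        have yw: "y \<le> ereal w" using y by (cases y) (auto simp: w_def)
        have w: "w < 1 - \<alpha>" using y \<alpha> by (cases y) (auto simp: w_def)
        define v where "v = (w + (1 - \<alpha>)) / 2"
        have v: "0 < v" "v < 1 - \<alpha>" "w < v" using w \<alpha> by (auto simp: v_def w_def max_def)
        have "\<forall>\<^sub>F n in sequentially. v < cdf (Ls n) (x n)"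
          by (rule eventually_cdf_greater[OF wL wG _ real_distr_Gs _ cdfG v(1,2)]) (use \<alpha> in \<open>auto simp: Ls_def real_distr_P\<close>)
        with cdfL show "\<forall>\<^sub>F n in sequentially. y < ereal (measure_pmf.prob (P n) {z. T n z \<le> chisq_upper_quantile (H n) \<alpha>})"
        proof eventually_elim
          case (elim n)
          have "y \<le> ereal w" by (rule yw)
          also have "ereal w < ereal (measure_pmf.prob (P n) {z. T n z \<le> chisq_upper_quantile (H n) \<alpha>})"
            using elim v by simp
          finally show ?case .
        qed
      qed
    qed
    then show ?thesis using wL by blast
  qed
  show ?thesis
    using fixed growing unfolding L_def[abs_def] Ls_def[abs_def] P_def T_def m_def s_def W_def by blast
qed

end
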